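(* Let $k$ be a field of characteristic zero and let $(A,x)$ be a pair consisting either of a discrete valuation ring $A$ with uniformizing parameter $x$ and residue field $k$, or of the polynomial ring $A=k[x]$ and its variable $x$. The category $\overrightarrow{\mathfrak{D}}_{(A,x)}$ of relative Danielewski-Fieseler surfaces with base $(A,x)$ is equivalent to the category $\mathcal{T}_{(A,x)}$ of $(A,x)$-labelled rooted trees.
   Context: Let $X=\mathrm{Spec}(A)$, $x_0=\mathrm{div}(x)\in X$, $X_*=X\setminus\{x_0\}=\mathrm{Spec}(A_x)$. Danielewski-Fieseler surfaces. A Danielewski-Fieseler surface (DFS) with base $(A,x)$ is an integral affine $X$-scheme $\pi:S\to X$ of finite type such that $S|_{X_*}$ is isomorphic to the trivial line bundle $\mathbb{A}^1_{X_*}$ and the scheme-theoretic fiber $\pi^{-1}(x_0)$ is nonempty and reduced, consisting of a disjoint union of curves isomorphic to $\mathbb{A}^1_k$. A morphism of DFS's is a birational $X$-morphism $\beta:S'\to S$ restricting to an $X_*$-isomorphism $S'|_{X_*}\to S|_{X_*}$. A relative DFS with base $(A,x)$ is a morphism of DFS's $\psi:S\to\mathbb{A}^1_X$; a morphism of relative DFS's from $(\psi':S'\to\mathbb{A}^1_X)$ to $(\psi:S\to\mathbb{A}^1_X)$ is a morphism of DFS's $\beta:S'\to S$ such that $\psi'=\psi\circ\beta$. These form the category $\overrightarrow{\mathfrak{D}}_{(A,x)}$. Trees. A (rooted) tree $\Gamma$ is a nonempty finite poset with a unique minimal element $e_0$ (the root) such that $(\downarrow e)_\Gamma=\{e'\in\Gamma: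 e'\le e\}$ is a chain for every $e\in\Gamma$. An element $e$ is at level $m$ if $\mathrm{Card}((\downarrow e)_\Gamma)=m+1$. Leaves are the maximal elements; $L(\Gamma)$ is the set of leaves. A maximal subtree of $\Gamma$ is a subset of the form $(\uparrow e)_\Gamma=\{e'\in\Gamma:e'\ge e\}$. The first common ancestor of $e,e'\in\Gamma\setminus\{e_0\}$ is the maximal element of the chain $((\downarrow e)_\Gamma\setminus\{e\})\cap((\downarrow e')_\Gamma\setminus\{e'\})$. A morphism of trees is an order-preserving map $\tau:\Gamma'\to\Gamma$ such that (a) the image of a maximal chain of $\Gamma'$ is a maximal chain of $\Gamma$; (b) for every $e'\in\Gamma'$, $\tau^{-1}(\tau(e'))$ is either $\{e'\}$ or a maximal subtree of $\Gamma'$. In particular leaves map to leaves. Labelled trees. An $(A,x)$-labelled tree is a pair $\gamma=(\Gamma,\sigma)$ of a tree $\Gamma$ with leaves $e_1,\ldots,e_n$ at levels $m_1,\ldots,m_n$ and a cochain $\sigma=(\sigma_i)_{i=1,\ldots,n}\in A^n$ such that for all $i\ne j$, $\sigma_j-\sigma_i\in x^{d_{ij}}A\setminus x^{d_{ij}+1}A$, where $d_{ij}<\min(m_i,m_j)$ is the level of the first common ancestor of $e_i$ and $e_j$. A morphism of $(A,x)$-labelled trees $(\Gamma',\sigma')\to(\Gamma,\sigma)$ is a morphism of trees $\tau:\Gamma'\to\Gamma$ such that, whenever the leaf $e_{j(i)}$ (at level $m_{j(i)}$) of $\Gamma$ is the image of the leaf $e'_i$ of $\Gamma'$, one has $\sigma'_i-\sigma_{j(i)}\in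 x^{m_{j(i)}}A$. These form the category $\mathcal{T}_{(A,x)}$. *)

theory Defs
  imports
    "HOL-Algebra.UnivPoly"
    "HOL-Algebra.RingHom"
    "HOL-Algebra.Generated_Rings"
    "HOL-Algebra.Ring_Divisibility"
    "HOL-Library.FuncSet"
    "HOL-Library.Equipollence"
begin

section \<open>Categories\<close>

text \<open>Hom-sets are indexed by their source and target, so the same morphism value may occur in
  several hom-sets; \<open>Comp C X Y Z g f\<close> is the composite of \<open>f : X \<rightarrow> Y\<close> and \<open>g : Y \<rightarrow> Z\<close>.\<close>

record ('o, 'm) cat =
  Obj :: "'o set"
  Hom :: "'o \<Rightarrow> 'o \<Rightarrow> 'm set"
  Idn :: "'o \<Rightarrow> 'm"
  Comp :: "'o \<Rightarrow> 'o \<Rightarrow> 'o \<Rightarrow> 'm \<Rightarrow> 'm \<Rightarrow> 'm"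

locale category =
  fixes C :: "('o, 'm) cat"
  assumes Idn_closed: "X \<in> Obj C \<Longrightarrow> Idn C X \<in> Hom C X X"
    and Comp_closed: "\<lbrakk>X \<in> Obj C; Y \<in> Obj C; Z \<in> Obj C; f \<in> Hom C X Y; g \<in> Hom C Y Z\<rbrakk>
      \<Longrightarrow> Comp C X Y Z g f \<in> Hom C X Z"
    and Comp_Idn_right: "\<lbrakk>X \<in> Obj C; Y \<in> Obj C; f \<in> Hom C X Y\<rbrakk> \<Longrightarrow> Comp C X X Y f (Idn C X) = f"
    and Comp_Idn_left: "\<lbrakk>X \<in> Obj C; Y \<in> Obj C; f \<in> Hom C X Y\<rbrakk> \<Longrightarrow> Comp C X Y Y (Idn C Y) f = f"
    and Comp_assoc: "\<lbrakk>W \<in> Obj C; X \<in> Obj C; Y \<in> Obj C; Z \<in> Obj C;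
        f \<in> Hom C W X; g \<in> Hom C X Y; h \<in> Hom C Y Z\<rbrakk>
      \<Longrightarrow> Comp C W Y Z h (Comp C W X Y g f) = Comp C W X Z (Comp C X Y Z h g) f"

text \<open>A functor is given by its action \<open>Fo\<close> on objects and \<open>Fm X Y\<close> on \<open>Hom C X Y\<close>.\<close>

definition is_functor ::
  "('o, 'm) cat \<Rightarrow> ('p, 'n) cat \<Rightarrow> ('o \<Rightarrow> 'p) \<Rightarrow> ('o \<Rightarrow> 'o \<Rightarrow> 'm \<Rightarrow> 'n) \<Rightarrow> bool" where
  "is_functor C D Fo Fm \<longleftrightarrow>
     (\<forall>X\<in>Obj C. Fo X \<in> Obj D) \<and>
     (\<forall>X\<in>Obj C. \<forall>Y\<in>Obj C. \<forall>f\<in>Hom C X Y. Fm X Y f \<in> Hom D (Fo X) (Fo Y)) \<and>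
     (\<forall>X\<in>Obj C. Fm X X (Idn C X) = Idn D (Fo X)) \<and>
     (\<forall>X\<in>Obj C. \<forall>Y\<in>Obj C. \<forall>Z\<in>Obj C. \<forall>f\<in>Hom C X Y. \<forall>g\<in>Hom C Y Z.
        Fm X Z (Comp C X Y Z g f) = Comp D (Fo X) (Fo Y) (Fo Z) (Fm Y Z g) (Fm X Y f))"

definition is_iso :: "('o, 'm) cat \<Rightarrow> 'o \<Rightarrow> 'o \<Rightarrow> 'm \<Rightarrow> bool" where
  "is_iso C X Y f \<longleftrightarrow> f \<in> Hom C X Y \<and>
     (\<exists>g\<in>Hom C Y X. Comp C X Y X g f = Idn C X \<and> Comp C Y X Y f g = Idn C Y)"

definition is_nat_iso ::
  "('o, 'm) cat \<Rightarrow> ('p, 'n) cat \<Rightarrow> ('o \<Rightarrow> 'p) \<Rightarrow> ('o \<Rightarrow> 'o \<Rightarrow> 'm \<Rightarrow> 'n) \<Rightarrow>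
   ('o \<Rightarrow> 'p) \<Rightarrow> ('o \<Rightarrow> 'o \<Rightarrow> 'm \<Rightarrow> 'n) \<Rightarrow> ('o \<Rightarrow> 'n) \<Rightarrow> bool" where
  "is_nat_iso C D Fo Fm Go Gm \<eta> \<longleftrightarrow>
     (\<forall>X\<in>Obj C. is_iso D (Fo X) (Go X) (\<eta> X)) \<and>
     (\<forall>X\<in>Obj C. \<forall>Y\<in>Obj C. \<forall>f\<in>Hom C X Y.
        Comp D (Fo X) (Fo Y) (Go Y) (\<eta> Y) (Fm X Y f) =
        Comp D (Fo X) (Go X) (Go Y) (Gm X Y f) (\<eta> X))"

definition equivalent_categories :: "('o, 'm) cat \<Rightarrow> ('p, 'n) cat \<Rightarrow> bool" where
  "equivalent_categories C D \<longleftrightarrow> category C \<and> category D \<and>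
     (\<exists>Fo Fm Go Gm \<eta> \<epsilon>.
        is_functor C D Fo Fm \<and> is_functor D C Go Gm \<and>
        is_nat_iso C C (\<lambda>X. X) (\<lambda>X Y f. f) (Go \<circ> Fo) (\<lambda>X Y f. Gm (Fo X) (Fo Y) (Fm X Y f)) \<eta> \<and>
        is_nat_iso D D (Fo \<circ> Go) (\<lambda>X Y f. Fm (Go X) (Go Y) (Gm X Y f)) (\<lambda>X. X) (\<lambda>X Y f. f) \<epsilon>)"


section \<open>Localization, quotients and products of commutative rings\<close>

definition frac_rel :: "('a, 'm) ring_scheme \<Rightarrow> 'a set \<Rightarrow> (('a \<times> 'a) \<times> ('a \<times> 'a)) set" where
  "frac_rel R M = {((a, u), (b, v)). a \<in> carrier R \<and> u \<in> M \<and> b \<in> carrier R \<and> v \<in> M \<and>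
     (\<exists>w\<in>M. w \<otimes>\<^bsub>R\<^esub> (a \<otimes>\<^bsub>R\<^esub> v) = w \<otimes>\<^bsub>R\<^esub> (b \<otimes>\<^bsub>R\<^esub> u))}"

text \<open>\<open>mk_frac R M a u\<close> is the fraction \<open>a/u\<close>, and \<open>frac_ring R M\<close> is \<open>M\<inverse>R\<close> for a
  multiplicatively closed subset \<open>M\<close> containing 1.\<close>

definition mk_frac :: "('a, 'm) ring_scheme \<Rightarrow> 'a set \<Rightarrow> 'a \<Rightarrow> 'a \<Rightarrow> ('a \<times> 'a) set" where
  "mk_frac R M a u = frac_rel R M `` {(a, u)}"

definition frac_ring :: "('a, 'm) ring_scheme \<Rightarrow> 'a set \<Rightarrow> ('a \<times> 'a) set ring" where
  "frac_ring R M =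
     \<lparr>carrier = (carrier R \<times> M) // frac_rel R M,
      monoid.mult = (\<lambda>p q. \<Union>(a, u)\<in>p. \<Union>(b, v)\<in>q. mk_frac R M (a \<otimes>\<^bsub>R\<^esub> b) (u \<otimes>\<^bsub>R\<^esub> v)),
      one = mk_frac R M \<one>\<^bsub>R\<^esub> \<one>\<^bsub>R\<^esub>,
      zero = mk_frac R M \<zero>\<^bsub>R\<^esub> \<one>\<^bsub>R\<^esub>,
      add = (\<lambda>p q. \<Union>(a, u)\<in>p. \<Union>(b, v)\<in>q.
               mk_frac R M ((a \<otimes>\<^bsub>R\<^esub> v) \<oplus>\<^bsub>R\<^esub> (b \<otimes>\<^bsub>R\<^esub> u)) (u \<otimes>\<^bsub>R\<^esub> v))\<rparr>"

text \<open>The map \<open>a/u \<mapsto> h(a)/h(u)\<close> into \<open>N\<inverse>S\<close> induced by \<open>h : R \<rightarrow> S\<close> with \<open>h(M) \<subseteq> N\<close>; it is applied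
  to fractions of \<open>R\<close>.\<close>

definition frac_map ::
  "('b, 'n) ring_scheme \<Rightarrow> 'b set \<Rightarrow> ('a \<Rightarrow> 'b) \<Rightarrow> ('a \<times> 'a) set \<Rightarrow> ('b \<times> 'b) set" where
  "frac_map S N h p = (\<Union>(a, u)\<in>p. mk_frac S N (h a) (h u))"

definition powers :: "('a, 'm) ring_scheme \<Rightarrow> 'a \<Rightarrow> 'a set" where
  "powers R f = {f [^]\<^bsub>R\<^esub> n |n::nat. True}"

definition loc :: "('a, 'm) ring_scheme \<Rightarrow> 'a \<Rightarrow> ('a \<times> 'a) set ring" where
  "loc R f = frac_ring R (powers R f)"

definition loc_map ::
  "('a, 'm) ring_scheme \<Rightarrow> 'a \<Rightarrow> ('b, 'n) ring_scheme \<Rightarrow> ('a \<Rightarrow> 'b) \<Rightarrow> ('a \<times> 'a) set \<Rightarrow> ('b \<times> 'b) set"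
  where "loc_map R f S h = frac_map S (powers S (h f)) h"

definition nonzeros :: "('a, 'm) ring_scheme \<Rightarrow> 'a set" where
  "nonzeros R = carrier R - {\<zero>\<^bsub>R\<^esub>}"

definition function_field :: "('a, 'm) ring_scheme \<Rightarrow> ('a \<times> 'a) set ring" where
  "function_field R = frac_ring R (nonzeros R)"

definition prod_ring :: "'i set \<Rightarrow> ('i \<Rightarrow> ('b, 'n) ring_scheme) \<Rightarrow> ('i \<Rightarrow> 'b) ring" where
  "prod_ring I R =
     \<lparr>carrier = (\<Pi>\<^sub>E i\<in>I. carrier (R i)),
      monoid.mult = (\<lambda>f g. \<lambda>i\<in>I. f i \<otimes>\<^bsub>R i\<^esub> g i),
      one = (\<lambda>i\<in>I. \<one>\<^bsub>R i\<^esub>),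
      zero = (\<lambda>i\<in>I. \<zero>\<^bsub>R i\<^esub>),
      add = (\<lambda>f g. \<lambda>i\<in>I. f i \<oplus>\<^bsub>R i\<^esub> g i)\<rparr>"

definition reduced :: "('a, 'm) ring_scheme \<Rightarrow> bool" where
  "reduced R \<longleftrightarrow> (\<forall>f\<in>carrier R. \<forall>n::nat. f [^]\<^bsub>R\<^esub> n = \<zero>\<^bsub>R\<^esub> \<longrightarrow> f = \<zero>\<^bsub>R\<^esub>)"


section \<open>The base\<close>

definition char_zero :: "('k, 'p) ring_scheme \<Rightarrow> bool" where
  "char_zero k \<longleftrightarrow> (\<forall>n::nat. n > 0 \<longrightarrow> [n] \<cdot>\<^bsub>k\<^esub> \<one>\<^bsub>k\<^esub> \<noteq> \<zero>\<^bsub>k\<^esub>)"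

text \<open>A discrete valuation ring is a local principal ideal domain that is not a field, and a
  uniformizing parameter is a generator of its maximal ideal.\<close>

definition discrete_valuation_ring :: "('a, 'm) ring_scheme \<Rightarrow> bool" where
  "discrete_valuation_ring A \<longleftrightarrow> principal_domain A \<and> \<not> field A \<and> (\<exists>!M. maximalideal M A)"

definition uniformizer :: "('a, 'm) ring_scheme \<Rightarrow> 'a \<Rightarrow> bool" where
  "uniformizer A x \<longleftrightarrow> x \<in> carrier A \<and> maximalideal (PIdl\<^bsub>A\<^esub> x) A"

definition residue_ring_at :: "('a, 'm) ring_scheme \<Rightarrow> 'a \<Rightarrow> 'a set ring" where
  "residue_ring_at A x = A Quot (PIdl\<^bsub>A\<^esub> x)"

definition base_pair :: "('k, 'p) ring_scheme \<Rightarrow> ('a, 'm) ring_scheme \<Rightarrow> 'a \<Rightarrow> bool" where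
  "base_pair k A x \<longleftrightarrow>
     (discrete_valuation_ring A \<and> uniformizer A x \<and> ring_iso (residue_ring_at A x) k \<noteq> {}) \<or>
     (cring A \<and> (\<exists>\<phi>\<in>ring_iso (UP k) A. \<phi> (monom (UP k) \<one>\<^bsub>k\<^esub> 1) = x))"


section \<open>Danielewski-Fieseler surfaces\<close>

text \<open>
  Affine schemes over \<open>X = Spec A\<close> are handled through the (contravariant) dictionary with
  commutative \<open>A\<close>-algebras. An affine \<open>X\<close>-scheme \<open>S = Spec B\<close> is given by its coordinate ring
  \<open>B\<close> and the structure map \<open>s : A \<rightarrow> B\<close>, and an \<open>X\<close>-morphism \<open>Spec B' \<rightarrow> Spec B\<close> by its comorphism
  \<open>B \<rightarrow> B'\<close>. Then
    \<^item> \<open>S\<close> restricted to \<open>X\<^sub>* = Spec A\<^sub>x\<close> is \<open>Spec B\<^sub>s\<^sub>(\<^sub>x\<^sub>)\<close>,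
    \<^item> the scheme-theoretic fibre over \<open>x\<^sub>0\<close> is \<open>Spec (B/s(x)B)\<close>, over \<open>x\<^sub>0 = Spec (A/xA)\<close>,
    \<^item> the affine line over \<open>Spec R\<close> is \<open>Spec R[t]\<close>, where \<open>R[t]\<close> is \<open>UP R\<close>,
    \<^item> a finite disjoint union of affine schemes is the spectrum of the product ring.
\<close>

definition alg_hom ::
  "('r, 'l) ring_scheme \<Rightarrow> ('b, 'm) ring_scheme \<Rightarrow> ('r \<Rightarrow> 'b) \<Rightarrow> ('c, 'n) ring_scheme \<Rightarrow> ('r \<Rightarrow> 'c) \<Rightarrow>
   ('b \<Rightarrow> 'c) set" where
  "alg_hom R B s C t = {\<phi> \<in> ring_hom B C. \<forall>a\<in>carrier R. \<phi> (s a) = t a}"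

definition alg_iso ::
  "('r, 'l) ring_scheme \<Rightarrow> ('b, 'm) ring_scheme \<Rightarrow> ('r \<Rightarrow> 'b) \<Rightarrow> ('c, 'n) ring_scheme \<Rightarrow> ('r \<Rightarrow> 'c) \<Rightarrow>
   ('b \<Rightarrow> 'c) set" where
  "alg_iso R B s C t = ring_iso B C \<inter> alg_hom R B s C t"

definition const_poly :: "('r, 'l) ring_scheme \<Rightarrow> 'r \<Rightarrow> nat \<Rightarrow> 'r" where
  "const_poly R = (\<lambda>a\<in>carrier R. monom (UP R) a 0)"

definition integral_affine_finite_type ::
  "('a, 'l) ring_scheme \<Rightarrow> ('b, 'm) ring_scheme \<Rightarrow> ('a \<Rightarrow> 'b) \<Rightarrow> bool" where
  "integral_affine_finite_type A B s \<longleftrightarrow> domain B \<and> s \<in> ring_hom A B \<and>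
     (\<exists>T. finite T \<and> T \<subseteq> carrier B \<and> generate_ring B (s ` carrier A \<union> T) = carrier B)"

definition fibre_ring :: "('b, 'm) ring_scheme \<Rightarrow> 'b \<Rightarrow> 'b set ring" where
  "fibre_ring B b = B Quot (PIdl\<^bsub>B\<^esub> b)"

text \<open>The structure map \<open>A/xA \<rightarrow> B/s(x)B\<close> of the fibre; it sends the coset \<open>a + xA\<close> to
  \<open>s(a + xA) + s(x)B = s(a) + s(x)B\<close>.\<close>

definition fibre_str :: "('b, 'm) ring_scheme \<Rightarrow> ('a \<Rightarrow> 'b) \<Rightarrow> 'a \<Rightarrow> 'a set \<Rightarrow> 'b set" where
  "fibre_str B s x c = (s ` c) <+>\<^bsub>B\<^esub> (PIdl\<^bsub>B\<^esub> (s x))"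

definition dfs :: "('a, 'l) ring_scheme \<Rightarrow> 'a \<Rightarrow> ('b, 'm) ring_scheme \<Rightarrow> ('a \<Rightarrow> 'b) \<Rightarrow> bool" where
  "dfs A x B s \<longleftrightarrow>
     integral_affine_finite_type A B s \<and>
     alg_iso (loc A x) (UP (loc A x)) (const_poly (loc A x)) (loc B (s x)) (loc_map A x B s) \<noteq> {} \<and>
     carrier (fibre_ring B (s x)) \<noteq> {\<zero>\<^bsub>fibre_ring B (s x)\<^esub>} \<and>
     reduced (fibre_ring B (s x)) \<and>
     (\<exists>n::nat.
        let \<kappa> = residue_ring_at A x in
        alg_iso \<kappa> (fibre_ring B (s x)) (fibre_str B s x)
          (prod_ring {..<n} (\<lambda>i. UP \<kappa>)) (\<lambda>c. \<lambda>i\<in>{..<n}. const_poly \<kappa> c) \<noteq> {})"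

text \<open>Birationality of \<open>Spec B' \<rightarrow> Spec B\<close>, for domains \<open>B\<close>, \<open>B'\<close>: the morphism is dominant and
  induces an isomorphism of function fields.\<close>

definition birational :: "('b, 'm) ring_scheme \<Rightarrow> ('c, 'n) ring_scheme \<Rightarrow> ('b \<Rightarrow> 'c) \<Rightarrow> bool" where
  "birational B B' \<phi> \<longleftrightarrow> inj_on \<phi> (carrier B) \<and>
     frac_map B' (nonzeros B') \<phi> \<in> ring_iso (function_field B) (function_field B')"

text \<open>\<open>dfs_mor A x B' s' B s \<phi>\<close>: the map \<open>\<phi> : B \<rightarrow> B'\<close> is the comorphism of a morphism of
  Danielewski-Fieseler surfaces from \<open>Spec B'\<close> to \<open>Spec B\<close>.\<close>

definition dfs_mor ::
  "('a, 'l) ring_scheme \<Rightarrow> 'a \<Rightarrow> ('c, 'n) ring_scheme \<Rightarrow> ('a \<Rightarrow> 'c) \<Rightarrow>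
   ('b, 'm) ring_scheme \<Rightarrow> ('a \<Rightarrow> 'b) \<Rightarrow> ('b \<Rightarrow> 'c) \<Rightarrow> bool" where
  "dfs_mor A x B' s' B s \<phi> \<longleftrightarrow>
     \<phi> \<in> alg_hom A B s B' s' \<and>
     birational B B' \<phi> \<and>
     loc_map B (s x) B' \<phi> \<in>
       alg_iso (loc A x) (loc B (s x)) (loc_map A x B s) (loc B' (s' x)) (loc_map A x B' s')"

text \<open>A relative surface \<open>\<psi> : S \<rightarrow> A\<^sup>1\<^sub>X\<close> consists of \<open>S\<close> (coordinate ring and structure map)
  and the comorphism \<open>A[t] \<rightarrow> B\<close> of \<open>\<psi>\<close>.\<close>

record ('a, 'b) rel_surface =
  coord_ring :: "'b ring"
  str_map :: "'a \<Rightarrow> 'b"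
  comorphism :: "(nat \<Rightarrow> 'a) \<Rightarrow> 'b"

definition rel_dfs :: "('a, 'l) ring_scheme \<Rightarrow> 'a \<Rightarrow> ('a, 'b) rel_surface \<Rightarrow> bool" where
  "rel_dfs A x S \<longleftrightarrow>
     dfs A x (coord_ring S) (str_map S) \<and>
     dfs_mor A x (coord_ring S) (str_map S) (UP A) (const_poly A) (comorphism S)"

text \<open>In \<open>rel_dfs_cat\<close> a morphism \<open>S' \<rightarrow> S\<close> is represented by its comorphism, a map
  \<open>coord_ring S \<rightarrow> coord_ring S'\<close> made extensional, so that it is determined by its values on the
  carrier. Composition is therefore in the reversed order on comorphisms.\<close>

definition rel_dfs_cat ::
  "('a, 'l) ring_scheme \<Rightarrow> 'a \<Rightarrow> (('a, 'b) rel_surface, 'b \<Rightarrow> 'b) cat" where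
  "rel_dfs_cat A x =
     \<lparr>Obj = {S. rel_dfs A x S},
      Hom = (\<lambda>S' S. {\<phi> \<in> extensional (carrier (coord_ring S)).
               dfs_mor A x (coord_ring S') (str_map S') (coord_ring S) (str_map S) \<phi> \<and>
               (\<forall>p\<in>carrier (UP A). comorphism S' p = \<phi> (comorphism S p))}),
      Idn = (\<lambda>S. \<lambda>b\<in>carrier (coord_ring S). b),
      Comp = (\<lambda>S'' S' S \<beta> \<beta>'. compose (carrier (coord_ring S)) \<beta>' \<beta>)\<rparr>"


section \<open>Labelled trees\<close>

text \<open>A poset is given by its reflexive order relation \<open>r\<close>, where \<open>(e, e') \<in> r\<close> means \<open>e \<le> e'\<close>; its
  set of elements is \<open>Field r\<close>.\<close>

definition down :: "'v rel \<Rightarrow> 'v \<Rightarrow> 'v set" where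
  "down r e = {e'. (e', e) \<in> r}"

definition up_set :: "'v rel \<Rightarrow> 'v \<Rightarrow> 'v set" where
  "up_set r e = {e'. (e, e') \<in> r}"

definition rooted_tree :: "'v rel \<Rightarrow> bool" where
  "rooted_tree r \<longleftrightarrow> Partial_order r \<and> Field r \<noteq> {} \<and> finite (Field r) \<and>
     (\<exists>!e. e \<in> Field r \<and> (\<forall>e'\<in>Field r. (e', e) \<in> r \<longrightarrow> e' = e)) \<and>
     (\<forall>e\<in>Field r. down r e \<in> Chains r)"

definition level :: "'v rel \<Rightarrow> 'v \<Rightarrow> nat" where
  "level r e = card (down r e) - 1"

definition leaves :: "'v rel \<Rightarrow> 'v set" where
  "leaves r = {e \<in> Field r. \<forall>e'\<in>Field r. (e, e') \<in> r \<longrightarrow> e' = e}"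

definition maximal_subtree :: "'v rel \<Rightarrow> 'v set \<Rightarrow> bool" where
  "maximal_subtree r T \<longleftrightarrow> (\<exists>e\<in>Field r. T = up_set r e)"

definition maximal_chain :: "'v rel \<Rightarrow> 'v set \<Rightarrow> bool" where
  "maximal_chain r C \<longleftrightarrow> C \<in> Chains r \<and> (\<forall>C'\<in>Chains r. C \<subseteq> C' \<longrightarrow> C' = C)"

definition first_common_ancestor :: "'v rel \<Rightarrow> 'v \<Rightarrow> 'v \<Rightarrow> 'v" where
  "first_common_ancestor r e e' =
     (let C = (down r e - {e}) \<inter> (down r e' - {e'})
      in THE a. a \<in> C \<and> (\<forall>b\<in>C. (a, b) \<in> r \<longrightarrow> b = a))"

definition tree_mor :: "'v rel \<Rightarrow> 'v rel \<Rightarrow> ('v \<Rightarrow> 'v) \<Rightarrow> bool" where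
  "tree_mor r' r \<tau> \<longleftrightarrow>
     \<tau> \<in> Field r' \<rightarrow> Field r \<and>
     (\<forall>(e, e')\<in>r'. (\<tau> e, \<tau> e') \<in> r) \<and>
     (\<forall>C. maximal_chain r' C \<longrightarrow> maximal_chain r (\<tau> ` C)) \<and>
     (\<forall>e'\<in>Field r'. let T = {f \<in> Field r'. \<tau> f = \<tau> e'} in T = {e'} \<or> maximal_subtree r' T)"

text \<open>The cochain of a labelled tree is indexed by the leaves themselves rather than by an
  enumeration of them.\<close>

definition labelled_tree ::
  "('a, 'l) ring_scheme \<Rightarrow> 'a \<Rightarrow> 'v rel \<times> ('v \<Rightarrow> 'a) \<Rightarrow> bool" where
  "labelled_tree A x = (\<lambda>(r, \<sigma>). rooted_tree r \<and> \<sigma> \<in> leaves r \<rightarrow>\<^sub>E carrier A \<and>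
     (\<forall>e\<in>leaves r. \<forall>e'\<in>leaves r. e \<noteq> e' \<longrightarrow>
        (let d = level r (first_common_ancestor r e e') in
         \<sigma> e' \<ominus>\<^bsub>A\<^esub> \<sigma> e \<in> PIdl\<^bsub>A\<^esub> (x [^]\<^bsub>A\<^esub> d) - PIdl\<^bsub>A\<^esub> (x [^]\<^bsub>A\<^esub> (d + 1)))))"

definition labelled_tree_mor ::
  "('a, 'l) ring_scheme \<Rightarrow> 'a \<Rightarrow> 'v rel \<times> ('v \<Rightarrow> 'a) \<Rightarrow> 'v rel \<times> ('v \<Rightarrow> 'a) \<Rightarrow> ('v \<Rightarrow> 'v) \<Rightarrow> bool" where
  "labelled_tree_mor A x = (\<lambda>(r', \<sigma>') (r, \<sigma>) \<tau>. tree_mor r' r \<tau> \<and>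
     (\<forall>e'\<in>leaves r'. \<forall>e\<in>leaves r. \<tau> e' = e \<longrightarrow>
        \<sigma>' e' \<ominus>\<^bsub>A\<^esub> \<sigma> e \<in> PIdl\<^bsub>A\<^esub> (x [^]\<^bsub>A\<^esub> level r e)))"

definition labelled_tree_cat ::
  "('a, 'l) ring_scheme \<Rightarrow> 'a \<Rightarrow> ('v rel \<times> ('v \<Rightarrow> 'a), 'v \<Rightarrow> 'v) cat" where
  "labelled_tree_cat A x =
     \<lparr>Obj = {\<gamma>. labelled_tree A x \<gamma>},
      Hom = (\<lambda>\<gamma>' \<gamma>. {\<tau> \<in> extensional (Field (fst \<gamma>')). labelled_tree_mor A x \<gamma>' \<gamma> \<tau>}),
      Idn = (\<lambda>\<gamma>. \<lambda>e\<in>Field (fst \<gamma>). e),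
      Comp = (\<lambda>\<gamma>'' \<gamma>' \<gamma> \<tau> \<tau>'. compose (Field (fst \<gamma>'')) \<tau> \<tau>')\<rparr>"

end

theory Submission
  imports Defs "HOL-Algebra.Weak_Morphisms"
begin

text \<open>
  Both categories are thin. Outside the special fibre a surface over the affine line is the line
  itself, so a relative surface is a ring \<open>B\<close> between \<open>A[t]\<close> and \<open>A\<^sub>x[t]\<close>, and a morphism is an inclusion
  of such rings. A component of the special fibre amounts to a disc \<open>\<sigma> + x\<^sup>mA\<close>, recorded as the pair
  \<open>(\<sigma>, m)\<close>, with generic point the valuation \<open>f \<mapsto> ord\<^sub>x f(\<sigma> + x\<^sup>mT)\<close> of \<open>A[t]\<close>; and \<open>B\<close> consists
  of the fractions \<open>f/x\<^sup>n\<close> with \<open>n \<le> ord\<^sub>x f(\<sigma> + x\<^sup>mT)\<close> for all its discs. Hence there is a morphism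
  \<open>S' \<rightarrow> S\<close> exactly when every disc of \<open>S'\<close> lies in a disc of \<open>S\<close>, and the disc families that occur are
  the finite families of pairwise disjoint discs. On the other side, a leaf of level \<open>m\<close> with label
  \<open>\<sigma>\<close> is the disc \<open>(\<sigma>, m)\<close>, and the nodes below it are the discs \<open>(\<sigma>, l)\<close> with \<open>l \<le> m\<close>; the same
  criterion governs morphisms of labelled trees.
\<close>

section \<open>Polynomials in Horner form and divisibility\<close>

text \<open>All comparisons are phrased as divisibility of \<open>\<psi> f\<close> by powers of the
  image of \<open>x\<close>, for \<open>f\<close> in A[t]. Since denominators are powers of
  \<open>x\<close>, these relations determine the ring over the line, its homomorphisms and its
  fibre. The hard direction is that a component of the fibre is a disc. Inverting a lift of the
  idempotent of that component leaves a single line as fibre, and there t is approximated by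
  elements of \<open>A\<close> as closely as possible. A best approximation \<open>\<sigma>\<close>,
  of order \<open>m\<close>, exists because a lift of the fibre coordinate has bounded denominator.
  Then (t - \<open>\<sigma>\<close>)/x^m is nonconstant on the component, and nonconstancy alone
  makes its substitution injective modulo \<open>x\<close>, so that orders are preserved.
  Conversely, a family of disjoint discs has to yield a ring of finite type with the right fibre;
  the tool is a product of powers of linear factors that peaks on one disc. As objects live in fixed
  types, this ring is realised inside A[T] through one of its charts and then moved along an
  injection, while the nodes of trees receive names in an infinite type.\<close>

definition pvar :: "('a, 'l) ring_scheme \<Rightarrow> nat \<Rightarrow> 'a" where
  "pvar R = monom (UP R) \<one>\<^bsub>R\<^esub> 1"

context cring
begin

interpretation UP: UP_cring R "UP R"
  by (unfold_locales)

lemma pvar_closed [simp]: "pvar R \<in> carrier (UP R)"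
  by (simp add: pvar_def)

lemma const_poly_eq: "a \<in> carrier R \<Longrightarrow> const_poly R a = monom (UP R) a 0"
  by (simp add: const_poly_def)

lemma const_poly_closed [simp]: "a \<in> carrier R \<Longrightarrow> const_poly R a \<in> carrier (UP R)"
  by (simp add: const_poly_eq)

lemma const_poly_hom: "const_poly R \<in> ring_hom R (UP R)"
proof -
  have "monom (UP R) (a \<otimes> b) 0 = monom (UP R) a 0 \<otimes>\<^bsub>UP R\<^esub> monom (UP R) b 0"
    if "a \<in> carrier R" "b \<in> carrier R" for a b
    using UP.monom_mult[OF that, of 0 0] by simp
  then show ?thesis
    by (auto intro!: ring_hom_memI simp: const_poly_eq)
qed

lemma const_poly_inj: "inj_on (const_poly R) (carrier R)"
  by (rule inj_onI) (metis UP.coeff_monom const_poly_eq)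

lemma const_poly_zero: "const_poly R \<zero> = \<zero>\<^bsub>UP R\<^esub>"
  by (simp add: const_poly_eq)

lemma const_poly_eq_zero_iff: "a \<in> carrier R \<Longrightarrow> const_poly R a = \<zero>\<^bsub>UP R\<^esub> \<longleftrightarrow> a = \<zero>"
  using const_poly_inj const_poly_zero inj_onD zero_closed by metis

lemma coeff_horner_0:
  assumes "g \<in> carrier (UP R)" "a \<in> carrier R"
  shows "coeff (UP R) (pvar R \<otimes>\<^bsub>UP R\<^esub> g \<oplus>\<^bsub>UP R\<^esub> const_poly R a) 0 = a"
  using assms by (simp add: const_poly_eq pvar_def)

lemma coeff_horner_Suc:
  assumes "g \<in> carrier (UP R)" "a \<in> carrier R"
  shows "coeff (UP R) (pvar R \<otimes>\<^bsub>UP R\<^esub> g \<oplus>\<^bsub>UP R\<^esub> const_poly R a) (Suc i) = coeff (UP R) g i"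
  using assms UP.coeff_monom_mult[of "\<one>" g 1 i]
  by (simp add: const_poly_eq pvar_def)

lemma horner_inject:
  assumes "g \<in> carrier (UP R)" "a \<in> carrier R" "h \<in> carrier (UP R)" "b \<in> carrier R"
    and "pvar R \<otimes>\<^bsub>UP R\<^esub> g \<oplus>\<^bsub>UP R\<^esub> const_poly R a = pvar R \<otimes>\<^bsub>UP R\<^esub> h \<oplus>\<^bsub>UP R\<^esub> const_poly R b"
  shows "g = h" "a = b"
proof -
  show "a = b" using assms coeff_horner_0 by metis
  show "g = h" by (rule UP.up_eqI) (use assms coeff_horner_Suc in metis)+
qed

lemma horner_eq_zero:
  assumes "g \<in> carrier (UP R)" "a \<in> carrier R"
    and "pvar R \<otimes>\<^bsub>UP R\<^esub> g \<oplus>\<^bsub>UP R\<^esub> const_poly R a = \<zero>\<^bsub>UP R\<^esub>"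
  shows "g = \<zero>\<^bsub>UP R\<^esub>" "a = \<zero>"
proof -
  have *: "\<zero>\<^bsub>UP R\<^esub> = pvar R \<otimes>\<^bsub>UP R\<^esub> \<zero>\<^bsub>UP R\<^esub> \<oplus>\<^bsub>UP R\<^esub> const_poly R \<zero>"
    by (simp add: const_poly_eq)
  show "g = \<zero>\<^bsub>UP R\<^esub>" "a = \<zero>"
    using horner_inject[OF assms(1,2) UP.UP_zero_closed zero_closed] assms(3) * by auto
qed

lemma coeff_bound_ex:
  "f \<in> carrier (UP R) \<Longrightarrow> \<exists>n. bound \<zero> n (coeff (UP R) f)"
  by (auto simp: UP_def)

lemma horner_decomp:
  assumes f: "f \<in> carrier (UP R)" and n: "bound \<zero> n (coeff (UP R) f)"
  shows "\<exists>g\<in>carrier (UP R). bound \<zero> (n - 1) (coeff (UP R) g) \<and>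
           f = pvar R \<otimes>\<^bsub>UP R\<^esub> g \<oplus>\<^bsub>UP R\<^esub> const_poly R (coeff (UP R) f 0)"
proof -
  let ?g = "\<lambda>i. coeff (UP R) f (Suc i)"
  have b: "bound \<zero> (n - 1) ?g"
    by (rule bound.intro) (use n in \<open>auto simp: bound_def\<close>)
  have g: "?g \<in> carrier (UP R)"
    using f b by (auto simp: UP_def[of R] intro!: mem_upI)
  have c: "coeff (UP R) ?g i = coeff (UP R) f (Suc i)" for i
    using g by (simp add: UP_def)
  show ?thesis
  proof (rule bexI[OF _ g], rule conjI)
    show "bound \<zero> (n - 1) (coeff (UP R) ?g)"
      using b by (simp add: bound_def c)
    show "f = pvar R \<otimes>\<^bsub>UP R\<^esub> ?g \<oplus>\<^bsub>UP R\<^esub> const_poly R (coeff (UP R) f 0)" (is "_ = ?h")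
    proof (rule UP.up_eqI)
      fix i
      show "coeff (UP R) f i = coeff (UP R) ?h i"
        using coeff_horner_0[OF g] coeff_horner_Suc[OF g] UP.coeff_closed[OF f]
        by (cases i) (simp_all only: c)
    qed (use f g in auto)
  qed
qed

text \<open>Splitting off the constant coefficient and dividing the rest by the variable lowers a
  bound for the degree by one. Substitutions are easily computed on this form, so it is the
  induction rule for polynomials throughout.\<close>

lemma UP_horner_induct [consumes 1, case_names const horner]:
  assumes f: "f \<in> carrier (UP R)"
    and const: "\<And>a. a \<in> carrier R \<Longrightarrow> Q (const_poly R a)"
    and horner: "\<And>g a. \<lbrakk>g \<in> carrier (UP R); a \<in> carrier R; Q g\<rbrakk>
      \<Longrightarrow> Q (pvar R \<otimes>\<^bsub>UP R\<^esub> g \<oplus>\<^bsub>UP R\<^esub> const_poly R a)"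
  shows "Q f"
proof -
  obtain n where n: "bound \<zero> n (coeff (UP R) f)"
    using f coeff_bound_ex by blast
  show ?thesis
    using f n
  proof (induction n arbitrary: f)
    case 0
    have "f = const_poly R (coeff (UP R) f 0)"
      using 0 by (intro UP.up_eqI) (auto simp: const_poly_eq bound_def)
    then show ?case using const 0 by (metis UP.coeff_closed)
  next
    case (Suc n)
    then show ?case using horner_decomp[OF Suc.prems] horner
      by (metis UP.coeff_closed diff_Suc_1)
  qed
qed

text \<open>Uniqueness half of the universal property of a polynomial ring. Identities between
  composites of substitutions are checked through it, on constants and on the variable.\<close>

lemma UP_hom_eqI:
  assumes S: "cring S" and hs: "\<Phi> \<in> ring_hom (UP R) S" "\<Psi> \<in> ring_hom (UP R) S"
    and c: "\<And>a. a \<in> carrier R \<Longrightarrow> \<Phi> (const_poly R a) = \<Psi> (const_poly R a)"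
    and X: "\<Phi> (pvar R) = \<Psi> (pvar R)" and f: "f \<in> carrier (UP R)"
  shows "\<Phi> f = \<Psi> f"
  using f
proof (induction rule: UP_horner_induct)
  case (horner g a)
  then show ?case using ring_hom_mult[OF hs(1)] ring_hom_mult[OF hs(2)]
      ring_hom_add[OF hs(1)] ring_hom_add[OF hs(2)] c X by simp
qed (rule c)

lemma UP_pre_univ:
  assumes "cring S" "h \<in> ring_hom R S"
  shows "UP_pre_univ_prop R S h"
  using assms by (intro UP_pre_univ_propI is_cring)

lemma eval_hom:
  assumes "cring S" "h \<in> ring_hom R S" "s \<in> carrier S"
  shows "eval R S h s \<in> ring_hom (UP R) S"
  using UP_pre_univ_prop.eval_ring_hom[OF UP_pre_univ[OF assms(1,2)] assms(3)] .

lemma eval_const_poly: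
  assumes "cring S" "h \<in> ring_hom R S" "s \<in> carrier S" "a \<in> carrier R"
  shows "eval R S h s (const_poly R a) = h a"
  using UP_pre_univ_prop.eval_const[OF UP_pre_univ[OF assms(1,2)] assms(3,4)] assms(4)
  by (simp add: const_poly_eq)

lemma eval_pvar:
  assumes "cring S" "h \<in> ring_hom R S" "s \<in> carrier S"
  shows "eval R S h s (pvar R) = s"
  using UP_pre_univ_prop.eval_monom1[OF UP_pre_univ[OF assms(1,2)] assms(3)]
  by (simp add: pvar_def)

text \<open>Multiplication by a constant respects the Horner form, and this form is unique, so
  divisibility by a constant can be tested on the two parts separately.\<close>

lemma const_divides_horner:
  assumes b: "b \<in> carrier R" and g: "g \<in> carrier (UP R)" and a: "a \<in> carrier R"
  shows "const_poly R b divides\<^bsub>UP R\<^esub> (pvar R \<otimes>\<^bsub>UP R\<^esub> g \<oplus>\<^bsub>UP R\<^esub> const_poly R a) \<longleftrightarrow>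
    b divides a \<and> const_poly R b divides\<^bsub>UP R\<^esub> g"
proof
  assume "const_poly R b divides\<^bsub>UP R\<^esub> (pvar R \<otimes>\<^bsub>UP R\<^esub> g \<oplus>\<^bsub>UP R\<^esub> const_poly R a)"
  then obtain q where q: "q \<in> carrier (UP R)"
    "pvar R \<otimes>\<^bsub>UP R\<^esub> g \<oplus>\<^bsub>UP R\<^esub> const_poly R a = const_poly R b \<otimes>\<^bsub>UP R\<^esub> q"
    by (auto simp: factor_def)
  obtain n where "bound \<zero> n (coeff (UP R) q)" using q coeff_bound_ex by blast
  from horner_decomp[OF q(1) this] obtain h c
    where h: "h \<in> carrier (UP R)" "c \<in> carrier R" "q = pvar R \<otimes>\<^bsub>UP R\<^esub> h \<oplus>\<^bsub>UP R\<^esub> const_poly R c"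
    using q(1) by (metis UP.coeff_closed)
  have "const_poly R b \<otimes>\<^bsub>UP R\<^esub> q = pvar R \<otimes>\<^bsub>UP R\<^esub> (const_poly R b \<otimes>\<^bsub>UP R\<^esub> h) \<oplus>\<^bsub>UP R\<^esub> const_poly R (b \<otimes> c)"
    using h b ring_hom_mult[OF const_poly_hom]
    by (simp add: UP.P.r_distr UP.P.m_lcomm)
  then have "g = const_poly R b \<otimes>\<^bsub>UP R\<^esub> h" "a = b \<otimes> c"
    using horner_inject[of g a "const_poly R b \<otimes>\<^bsub>UP R\<^esub> h" "b \<otimes> c"] q(2) g a b h by auto
  then show "b divides a \<and> const_poly R b divides\<^bsub>UP R\<^esub> g"
    using h by (auto simp: factor_def)
next
  assume "b divides a \<and> const_poly R b divides\<^bsub>UP R\<^esub> g"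
  then obtain c h where "c \<in> carrier R" "a = b \<otimes> c" "h \<in> carrier (UP R)" "g = const_poly R b \<otimes>\<^bsub>UP R\<^esub> h"
    by (auto simp: factor_def)
  then show "const_poly R b divides\<^bsub>UP R\<^esub> (pvar R \<otimes>\<^bsub>UP R\<^esub> g \<oplus>\<^bsub>UP R\<^esub> const_poly R a)"
    using b ring_hom_mult[OF const_poly_hom]
    by (intro dividesI[of "pvar R \<otimes>\<^bsub>UP R\<^esub> h \<oplus>\<^bsub>UP R\<^esub> const_poly R c"])
       (simp_all add: UP.P.r_distr UP.P.m_lcomm)
qed

lemma const_divides_const:
  assumes b: "b \<in> carrier R" and a: "a \<in> carrier R"
  shows "const_poly R b divides\<^bsub>UP R\<^esub> const_poly R a \<longleftrightarrow> b divides a"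
proof -
  have "const_poly R a = pvar R \<otimes>\<^bsub>UP R\<^esub> \<zero>\<^bsub>UP R\<^esub> \<oplus>\<^bsub>UP R\<^esub> const_poly R a"
    using a by simp
  moreover have "const_poly R b divides\<^bsub>UP R\<^esub> \<zero>\<^bsub>UP R\<^esub>"
    using b by (simp add: UP.P.divides_zero)
  ultimately show ?thesis
    using const_divides_horner[OF b UP.UP_zero_closed a] by metis
qed

end

section \<open>Substitution into polynomials over a domain\<close>

context "domain"
begin

interpretation UP: UP_domain R "UP R"
  by (unfold_locales)

lemma domain_UP: "domain (UP R)"
  by (rule UP.UP_domain)

text \<open>By degrees: if the image of \<open>g\<close> were nonzero, its product with the
  nonconstant \<open>v\<close> would have positive degree, while the equation makes it the negative
  of a constant. It will be used over the residue field, for nonconstant functions on a component of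
  the fibre.\<close>

lemma eval_nonconst_inj:
  assumes v: "v \<in> carrier (UP R)" and nc: "v \<notin> const_poly R ` carrier R"
    and f: "f \<in> carrier (UP R)" and 0: "eval R (UP R) (const_poly R) v f = \<zero>\<^bsub>UP R\<^esub>"
  shows "f = \<zero>\<^bsub>UP R\<^esub>"
  using f 0
proof (induction rule: UP_horner_induct)
  case (const a)
  then show ?case
    by (simp add: eval_const_poly[OF UP.P.is_cring const_poly_hom v])
next
  case (horner g a)
  let ?E = "eval R (UP R) (const_poly R) v"
  have E: "?E \<in> ring_hom (UP R) (UP R)"
    by (rule eval_hom[OF UP.P.is_cring const_poly_hom v])
  have Eg: "?E g \<in> carrier (UP R)" using ring_hom_closed[OF E horner(1)] .
  have eq: "v \<otimes>\<^bsub>UP R\<^esub> ?E g \<oplus>\<^bsub>UP R\<^esub> const_poly R a = \<zero>\<^bsub>UP R\<^esub>"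
    using horner.prems horner.hyps ring_hom_add[OF E] ring_hom_mult[OF E] v
    by (simp add: eval_const_poly[OF UP.P.is_cring const_poly_hom v]
        eval_pvar[OF UP.P.is_cring const_poly_hom v])
  have Eg0: "?E g = \<zero>\<^bsub>UP R\<^esub>"
  proof (rule ccontr)
    assume ne: "?E g \<noteq> \<zero>\<^bsub>UP R\<^esub>"
    have dv: "deg R v \<noteq> 0"
    proof
      assume "deg R v = 0"
      then have "v = monom (UP R) (coeff (UP R) v 0) 0"
        using UP.deg_zero_impl_monom[OF v] by simp
      then have "v = const_poly R (coeff (UP R) v 0)" using v by (simp add: const_poly_eq)
      then show False using nc v by auto
    qed
    then have "v \<noteq> \<zero>\<^bsub>UP R\<^esub>" by auto
    then have "deg R (v \<otimes>\<^bsub>UP R\<^esub> ?E g) = deg R v + deg R (?E g)"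
      using UP.deg_mult v Eg ne by simp
    moreover have "v \<otimes>\<^bsub>UP R\<^esub> ?E g = \<ominus>\<^bsub>UP R\<^esub> const_poly R a"
      using eq v Eg horner by (simp add: UP.P.minus_equality)
    then have "deg R (v \<otimes>\<^bsub>UP R\<^esub> ?E g) = 0"
      using horner by (simp add: const_poly_eq)
    ultimately show False using dv by simp
  qed
  then have g0: "g = \<zero>\<^bsub>UP R\<^esub>" using horner.IH by simp
  have "const_poly R a = \<zero>\<^bsub>UP R\<^esub>" using eq Eg0 v horner by simp
  then show ?case using g0 by simp
qed

end

section \<open>Divisibility by powers in commutative rings and in domains\<close>

context cring
begin

lemma pow_divides_mono:
  assumes "y \<in> carrier R" "b \<in> carrier R" "y [^] (n::nat) divides b" "m \<le> n"
  shows "y [^] m divides b"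
proof -
  obtain c where "c \<in> carrier R" "b = y [^] n \<otimes> c" using assms by (auto simp: factor_def)
  moreover have "y [^] n = y [^] m \<otimes> y [^] (n - m)"
    using assms nat_pow_mult[OF assms(1), of m "n - m"] by simp
  ultimately show ?thesis using assms by (intro dividesI[of "y [^] (n - m) \<otimes> c"]) (simp_all add: m_assoc)
qed

lemma pow_Suc_divides_imp:
  assumes "y \<in> carrier R" "b \<in> carrier R" "y [^] (Suc n) divides b"
  shows "y divides b"
  using pow_divides_mono[OF assms, of 1] assms(1) by (simp add: numeral_One del: One_nat_def)

lemma divides_add:
  assumes "y \<in> carrier R" "y divides a" "y divides b"
  shows "y divides (a \<oplus> b)"
proof -
  obtain c d where "c \<in> carrier R" "a = y \<otimes> c" "d \<in> carrier R" "b = y \<otimes> d"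
    using assms by (auto simp: factor_def)
  then show ?thesis using assms(1) by (intro dividesI[of "c \<oplus> d"]) (simp_all add: r_distr)
qed

lemma divides_a_inv:
  assumes "y \<in> carrier R" "y divides a"
  shows "y divides (\<ominus> a)"
proof -
  obtain c where "c \<in> carrier R" "a = y \<otimes> c" using assms by (auto simp: factor_def)
  then show ?thesis using assms by (intro dividesI[of "\<ominus> c"]) (simp_all add: r_minus)
qed

lemma divides_minus:
  assumes "y \<in> carrier R" "y divides a" "y divides b"
  shows "y divides (a \<ominus> b)"
  unfolding a_minus_def using assms by (intro divides_add divides_a_inv)

lemma divides_add_cancel:
  assumes "y \<in> carrier R" "y divides a" "a \<in> carrier R" "b \<in> carrier R"
  shows "y divides (a \<oplus> b) \<longleftrightarrow> y divides b"
proof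
  assume "y divides (a \<oplus> b)"
  moreover have "b = (a \<oplus> b) \<ominus> a" using assms by algebra
  ultimately show "y divides b" using divides_minus[OF assms(1) _ assms(2)] by metis
qed (use assms divides_add in blast)

lemma divides_mult_right:
  assumes "y \<in> carrier R" "y divides a" "a \<in> carrier R" "b \<in> carrier R"
  shows "y divides (a \<otimes> b)" "y divides (b \<otimes> a)"
proof -
  show "y divides (a \<otimes> b)" using assms divides_prod_r by simp
  then show "y divides (b \<otimes> a)" using assms m_comm by simp
qed

lemma hom_divides:
  assumes "h \<in> ring_hom R S" "y \<in> carrier R" "y divides a"
  shows "h y divides\<^bsub>S\<^esub> h a"
proof -
  obtain c where "c \<in> carrier R" "a = y \<otimes> c" using assms by (auto simp: factor_def)
  then show ?thesis using assms by (intro dividesI[of "h c"]) (simp_all add: ring_hom_mult ring_hom_closed)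
qed

lemma pow_divides_mult:
  assumes "y \<in> carrier R" "a \<in> carrier R" "b \<in> carrier R"
    "y [^] (n::nat) divides a" "y [^] (m::nat) divides b"
  shows "y [^] (n + m) divides (a \<otimes> b)"
proof -
  obtain c d where "c \<in> carrier R" "a = y [^] n \<otimes> c" "d \<in> carrier R" "b = y [^] m \<otimes> d"
    using assms by (auto simp: factor_def)
  then show ?thesis using assms(1)
    by (intro dividesI[of "c \<otimes> d"]) (simp_all add: nat_pow_mult[symmetric] m_ac)
qed

lemma pow_divides_pow:
  assumes "y \<in> carrier R" "a \<in> carrier R" "y [^] (n::nat) divides a"
  shows "y [^] (n * k) divides (a [^] (k::nat))"
proof (induction k)
  case (Suc k)
  then show ?case using pow_divides_mult[OF assms(1) _ assms(2) Suc assms(3)] assms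
    by (simp add: algebra_simps)
qed (use assms in simp)

lemma ring_hom_minus:
  assumes "cring S" "h \<in> ring_hom R S" "a \<in> carrier R" "b \<in> carrier R"
  shows "h (a \<ominus> b) = h a \<ominus>\<^bsub>S\<^esub> h b"
proof -
  interpret h: ring_hom_cring R S h
    using assms by (intro ring_hom_cringI is_cring)
  show ?thesis using assms by (simp add: a_minus_def)
qed

lemma ring_hom_nat_pow:
  assumes "cring S" "h \<in> ring_hom R S" "a \<in> carrier R"
  shows "h (a [^] (n::nat)) = h a [^]\<^bsub>S\<^esub> n"
proof -
  interpret h: ring_hom_cring R S h
    using assms by (intro ring_hom_cringI is_cring)
  show ?thesis using assms by simp
qed

lemma ring_hom_zero':
  assumes "cring S" "h \<in> ring_hom R S"
  shows "h \<zero> = \<zero>\<^bsub>S\<^esub>"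
proof -
  interpret h: ring_hom_cring R S h
    using assms by (intro ring_hom_cringI is_cring)
  show ?thesis by simp
qed

end

context "domain"
begin

lemma nat_pow_nonzero: "y \<in> carrier R \<Longrightarrow> y \<noteq> \<zero> \<Longrightarrow> y [^] (n::nat) \<noteq> \<zero>"
  by (induction n) (auto simp: integral_iff)

lemma divides_cancel:
  assumes "a \<in> carrier R" "a \<noteq> \<zero>" "b \<in> carrier R" "c \<in> carrier R"
  shows "(a \<otimes> b) divides (a \<otimes> c) \<longleftrightarrow> b divides c"
  using assms by (auto simp: factor_def m_assoc m_lcancel)

lemma pow_divides_cancel:
  assumes "y \<in> carrier R" "y \<noteq> \<zero>" "b \<in> carrier R"
  shows "y [^] (n + m :: nat) divides (y [^] n \<otimes> b) \<longleftrightarrow> y [^] m divides b"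
  using assms divides_cancel[of "y [^] n" "y [^] m" b] nat_pow_nonzero
  by (simp add: nat_pow_mult[symmetric])

lemma pow_Suc_divides_cancel:
  assumes "y \<in> carrier R" "y \<noteq> \<zero>" "b \<in> carrier R"
  shows "y [^] (Suc m) divides (y \<otimes> b) \<longleftrightarrow> y [^] m divides b"
proof -
  have "y [^] (Suc m) = y \<otimes> y [^] m" using assms nat_pow_Suc2 by simp
  then show ?thesis using assms divides_cancel[of y "y [^] m" b] by simp
qed

end

section \<open>The base and its polynomial ring\<close>

text \<open>The properties shared by the two kinds of base pair. Maximality of the ideal makes the
  residue ring a field, so polynomials over it form a domain whose nonzero constants are
  invertible.\<close>

locale base_ring = "domain" A for A (structure) +
  fixes x
  assumes x_closed [simp]: "x \<in> carrier A"
    and x_nonzero [simp]: "x \<noteq> \<zero>"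
    and x_max: "maximalideal (PIdl x) A"
begin

abbreviation P where "P \<equiv> UP A"
abbreviation \<iota> where "\<iota> \<equiv> const_poly A"
abbreviation X where "X \<equiv> pvar A"
abbreviation \<kappa> where "\<kappa> \<equiv> residue_ring_at A x"
abbreviation Q where "Q \<equiv> UP \<kappa>"
abbreviation \<pi> where "\<pi> \<equiv> (+>) (PIdl x)"

text \<open>Reduction of coefficients modulo \<open>x\<close>, that is, restriction of functions
  from the affine line over the base to its special fibre.\<close>

definition red where "red = eval A Q (const_poly \<kappa> \<circ> \<pi>) (pvar \<kappa>)"

text \<open>The substitution t = \<open>\<sigma>\<close> + x^m T, which parametrises the disc with
  centre \<open>\<sigma>\<close> and exponent \<open>m\<close>. Divisibility of the result by the
  n-th power of \<open>\<iota> x\<close> says that the valuation of the disc is at least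
  \<open>n\<close>; the valuation is used only in this form.\<close>

definition theta where "theta \<sigma> m = eval A P \<iota> (\<iota> \<sigma> \<oplus>\<^bsub>P\<^esub> (\<iota> x [^]\<^bsub>P\<^esub> (m::nat)) \<otimes>\<^bsub>P\<^esub> X)"

lemma field_\<kappa>: "field \<kappa>"
  unfolding residue_ring_at_def using maximalideal.quotient_is_field[OF x_max is_cring] .

sublocale \<kappa>: field \<kappa> by (rule field_\<kappa>)
sublocale P: "domain" P by (rule domain_UP)
sublocale Q: "domain" Q by (rule \<kappa>.domain_UP)

lemma \<pi>_hom: "\<pi> \<in> ring_hom A \<kappa>"
  unfolding residue_ring_at_def using ideal.rcos_ring_hom x_max maximalideal.axioms(1) by blast

lemma \<pi>_surj: "c \<in> carrier \<kappa> \<Longrightarrow> \<exists>a\<in>carrier A. c = \<pi> a"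
  by (auto simp: residue_ring_at_def FactRing_def A_RCOSETS_def')

lemma PIdl_iff: "a \<in> carrier A \<Longrightarrow> b \<in> PIdl a \<longleftrightarrow> a divides b"
  by (auto simp: cgenideal_def factor_def m_comm)

lemma \<pi>_zero_iff:
  assumes "a \<in> carrier A"
  shows "\<pi> a = \<zero>\<^bsub>\<kappa>\<^esub> \<longleftrightarrow> x divides a"
proof -
  interpret I: ideal "PIdl x" A using x_max by (rule maximalideal.axioms)
  have "\<zero>\<^bsub>\<kappa>\<^esub> = PIdl x" by (simp add: residue_ring_at_def FactRing_def)
  moreover have "a \<in> PIdl x \<Longrightarrow> PIdl x +> a = PIdl x" by (rule I.a_rcos_const)
  moreover have "a \<in> PIdl x +> a" using assms by (rule I.a_rcos_self)
  ultimately show ?thesis using PIdl_iff[OF x_closed] by metis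
qed

lemma \<iota>_hom: "\<iota> \<in> ring_hom A P" by (rule const_poly_hom)
lemma const_\<kappa>_hom: "const_poly \<kappa> \<in> ring_hom \<kappa> Q" by (rule \<kappa>.const_poly_hom)

lemma c\<pi>_hom: "const_poly \<kappa> \<circ> \<pi> \<in> ring_hom A Q"
  using \<pi>_hom const_\<kappa>_hom by (rule ring_hom_trans)

lemma red_hom: "red \<in> ring_hom P Q"
  unfolding red_def by (rule eval_hom[OF Q.is_cring c\<pi>_hom \<kappa>.pvar_closed])

lemma red_const: "a \<in> carrier A \<Longrightarrow> red (\<iota> a) = const_poly \<kappa> (\<pi> a)"
  unfolding red_def using eval_const_poly[OF Q.is_cring c\<pi>_hom \<kappa>.pvar_closed] by simp

lemma red_var: "red X = pvar \<kappa>"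
  unfolding red_def using eval_pvar[OF Q.is_cring c\<pi>_hom \<kappa>.pvar_closed] by simp

lemma \<iota>_x_closed [simp]: "\<iota> x \<in> carrier P" by simp

lemma \<iota>_x_nonzero [simp]: "\<iota> x \<noteq> \<zero>\<^bsub>P\<^esub>"
  by (simp add: const_poly_eq_zero_iff)

lemma red_surj: "q \<in> carrier Q \<Longrightarrow> \<exists>f\<in>carrier P. red f = q"
proof (induction rule: \<kappa>.UP_horner_induct)
  case (const c)
  then obtain a where "a \<in> carrier A" "c = \<pi> a" using \<pi>_surj by blast
  then show ?case using red_const by (intro bexI[of _ "\<iota> a"]) auto
next
  case (horner g c)
  then obtain a f where "a \<in> carrier A" "c = \<pi> a" "f \<in> carrier P" "red f = g" using \<pi>_surj by blast
  then show ?case using red_const red_var ring_hom_add[OF red_hom] ring_hom_mult[OF red_hom]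
    by (intro bexI[of _ "X \<otimes>\<^bsub>P\<^esub> f \<oplus>\<^bsub>P\<^esub> \<iota> a"]) auto
qed

text \<open>Both conditions are tested coefficient by coefficient: a Horner form vanishes modulo
  \<open>x\<close> exactly if both its parts do.\<close>

lemma red_zero_iff: "f \<in> carrier P \<Longrightarrow> red f = \<zero>\<^bsub>Q\<^esub> \<longleftrightarrow> \<iota> x divides\<^bsub>P\<^esub> f"
proof (induction rule: UP_horner_induct)
  case (const a)
  have "const_poly \<kappa> (\<pi> a) = \<zero>\<^bsub>Q\<^esub> \<longleftrightarrow> \<pi> a = \<zero>\<^bsub>\<kappa>\<^esub>"
    using const ring_hom_closed[OF \<pi>_hom] \<kappa>.const_poly_eq_zero_iff by simp
  then show ?case using const red_const const_divides_const \<pi>_zero_iff by simp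
next
  case (horner g a)
  have *: "red (X \<otimes>\<^bsub>P\<^esub> g \<oplus>\<^bsub>P\<^esub> \<iota> a) = pvar \<kappa> \<otimes>\<^bsub>Q\<^esub> red g \<oplus>\<^bsub>Q\<^esub> const_poly \<kappa> (\<pi> a)"
    using horner ring_hom_add[OF red_hom] ring_hom_mult[OF red_hom] red_const red_var by simp
  have c: "red g \<in> carrier Q" "\<pi> a \<in> carrier \<kappa>"
    using horner ring_hom_closed[OF red_hom] ring_hom_closed[OF \<pi>_hom] by auto
  have "red (X \<otimes>\<^bsub>P\<^esub> g \<oplus>\<^bsub>P\<^esub> \<iota> a) = \<zero>\<^bsub>Q\<^esub> \<longleftrightarrow> red g = \<zero>\<^bsub>Q\<^esub> \<and> \<pi> a = \<zero>\<^bsub>\<kappa>\<^esub>"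
  proof
    assume "red (X \<otimes>\<^bsub>P\<^esub> g \<oplus>\<^bsub>P\<^esub> \<iota> a) = \<zero>\<^bsub>Q\<^esub>"
    then show "red g = \<zero>\<^bsub>Q\<^esub> \<and> \<pi> a = \<zero>\<^bsub>\<kappa>\<^esub>" using \<kappa>.horner_eq_zero[OF c] by (simp add: *)
  next
    assume "red g = \<zero>\<^bsub>Q\<^esub> \<and> \<pi> a = \<zero>\<^bsub>\<kappa>\<^esub>"
    then show "red (X \<otimes>\<^bsub>P\<^esub> g \<oplus>\<^bsub>P\<^esub> \<iota> a) = \<zero>\<^bsub>Q\<^esub>" by (simp add: * \<kappa>.const_poly_zero)
  qed
  then show ?case using horner const_divides_horner \<pi>_zero_iff by auto
qed

lemma theta_arg_closed: "\<sigma> \<in> carrier A \<Longrightarrow> \<iota> \<sigma> \<oplus>\<^bsub>P\<^esub> (\<iota> x [^]\<^bsub>P\<^esub> (m::nat)) \<otimes>\<^bsub>P\<^esub> X \<in> carrier P"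
  by simp

lemma theta_hom: "\<sigma> \<in> carrier A \<Longrightarrow> theta \<sigma> m \<in> ring_hom P P"
  unfolding theta_def by (rule eval_hom[OF P.is_cring \<iota>_hom theta_arg_closed])

lemma theta_closed [simp]: "\<sigma> \<in> carrier A \<Longrightarrow> f \<in> carrier P \<Longrightarrow> theta \<sigma> m f \<in> carrier P"
  using ring_hom_closed[OF theta_hom] .

lemma theta_const [simp]: "\<sigma> \<in> carrier A \<Longrightarrow> a \<in> carrier A \<Longrightarrow> theta \<sigma> m (\<iota> a) = \<iota> a"
  unfolding theta_def by (rule eval_const_poly[OF P.is_cring \<iota>_hom theta_arg_closed])

lemma theta_var: "\<sigma> \<in> carrier A \<Longrightarrow> theta \<sigma> m X = \<iota> \<sigma> \<oplus>\<^bsub>P\<^esub> (\<iota> x [^]\<^bsub>P\<^esub> m) \<otimes>\<^bsub>P\<^esub> X"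
  unfolding theta_def by (rule eval_pvar[OF P.is_cring \<iota>_hom theta_arg_closed])

lemma theta_linear:
  assumes "\<sigma> \<in> carrier A" "a \<in> carrier A"
  shows "theta \<sigma> m (X \<ominus>\<^bsub>P\<^esub> \<iota> a) = \<iota> (\<sigma> \<ominus> a) \<oplus>\<^bsub>P\<^esub> (\<iota> x [^]\<^bsub>P\<^esub> m) \<otimes>\<^bsub>P\<^esub> X"
proof -
  have "theta \<sigma> m (X \<ominus>\<^bsub>P\<^esub> \<iota> a) = (\<iota> \<sigma> \<oplus>\<^bsub>P\<^esub> (\<iota> x [^]\<^bsub>P\<^esub> m) \<otimes>\<^bsub>P\<^esub> X) \<ominus>\<^bsub>P\<^esub> \<iota> a"
    using P.ring_hom_minus[OF P.is_cring theta_hom] assms theta_var theta_const by simp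
  also have "\<dots> = (\<iota> \<sigma> \<ominus>\<^bsub>P\<^esub> \<iota> a) \<oplus>\<^bsub>P\<^esub> (\<iota> x [^]\<^bsub>P\<^esub> m) \<otimes>\<^bsub>P\<^esub> X"
    using assms P.m_closed[of "\<iota> x [^]\<^bsub>P\<^esub> m" X] by (simp add: P.minus_eq P.a_ac)
  finally show ?thesis using ring_hom_minus[OF P.is_cring \<iota>_hom] assms by simp
qed

text \<open>Division by the monic polynomial t - \<open>\<sigma>\<close> leaves a constant
  remainder, the value at \<open>\<sigma>\<close>; Horner induction carries out the
  division.\<close>

lemma taylor:
  assumes "\<sigma> \<in> carrier A" "f \<in> carrier P"
  shows "\<exists>h\<in>carrier P. \<exists>a\<in>carrier A. f = (X \<ominus>\<^bsub>P\<^esub> \<iota> \<sigma>) \<otimes>\<^bsub>P\<^esub> h \<oplus>\<^bsub>P\<^esub> \<iota> a"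
  using assms(2)
proof (induction rule: UP_horner_induct)
  case (const a)
  have "\<iota> a = (X \<ominus>\<^bsub>P\<^esub> \<iota> \<sigma>) \<otimes>\<^bsub>P\<^esub> \<zero>\<^bsub>P\<^esub> \<oplus>\<^bsub>P\<^esub> \<iota> a"
    using assms(1) const by simp
  then show ?case using const P.zero_closed by blast
next
  case (horner g b)
  then obtain h a where ha: "h \<in> carrier P" "a \<in> carrier A" "g = (X \<ominus>\<^bsub>P\<^esub> \<iota> \<sigma>) \<otimes>\<^bsub>P\<^esub> h \<oplus>\<^bsub>P\<^esub> \<iota> a" by blast
  have "\<iota> (a \<otimes> \<sigma> \<oplus> b) = \<iota> a \<otimes>\<^bsub>P\<^esub> \<iota> \<sigma> \<oplus>\<^bsub>P\<^esub> \<iota> b"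
    using assms ha horner ring_hom_add[OF \<iota>_hom] ring_hom_mult[OF \<iota>_hom] by simp
  moreover have "\<iota> a \<in> carrier P" "\<iota> \<sigma> \<in> carrier P" "\<iota> b \<in> carrier P" "X \<in> carrier P"
    using assms ha horner by auto
  then have "X \<otimes>\<^bsub>P\<^esub> ((X \<ominus>\<^bsub>P\<^esub> \<iota> \<sigma>) \<otimes>\<^bsub>P\<^esub> h \<oplus>\<^bsub>P\<^esub> \<iota> a) \<oplus>\<^bsub>P\<^esub> \<iota> b =
      (X \<ominus>\<^bsub>P\<^esub> \<iota> \<sigma>) \<otimes>\<^bsub>P\<^esub> (X \<otimes>\<^bsub>P\<^esub> h \<oplus>\<^bsub>P\<^esub> \<iota> a) \<oplus>\<^bsub>P\<^esub> (\<iota> a \<otimes>\<^bsub>P\<^esub> \<iota> \<sigma> \<oplus>\<^bsub>P\<^esub> \<iota> b)"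
    using ha(1) by algebra
  ultimately have "X \<otimes>\<^bsub>P\<^esub> g \<oplus>\<^bsub>P\<^esub> \<iota> b = (X \<ominus>\<^bsub>P\<^esub> \<iota> \<sigma>) \<otimes>\<^bsub>P\<^esub> (X \<otimes>\<^bsub>P\<^esub> h \<oplus>\<^bsub>P\<^esub> \<iota> a) \<oplus>\<^bsub>P\<^esub> \<iota> (a \<otimes> \<sigma> \<oplus> b)"
    unfolding ha(3) by simp
  moreover have "X \<otimes>\<^bsub>P\<^esub> h \<oplus>\<^bsub>P\<^esub> \<iota> a \<in> carrier P" "a \<otimes> \<sigma> \<oplus> b \<in> carrier A"
    using ha horner(2) assms(1) by auto
  ultimately show ?case by blast
qed

text \<open>\<open>C\<close> stands for a ring whose special fibre is one affine line,
  \<open>\<rho>\<close> being restriction to it; the order along this line is to be recognised as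
  the valuation of a disc. Take the largest \<open>m\<close> for which t agrees with some
  \<open>\<sigma>\<close> from \<open>A\<close> modulo y^m. Then u = (t -
  \<open>\<sigma>\<close>)/y^m is nonconstant on the fibre, so T = u maps A[T] to \<open>C\<close>
  preserving orders, and after the substitution of the disc this map is \<open>\<psi>\<close>. The
  data \<open>w0\<close>, \<open>f0\<close>, \<open>N\<close> bound \<open>m\<close>.\<close>

lemma chart:
  assumes C: "domain C" and \<psi>: "\<psi> \<in> ring_hom P C" and \<rho>: "\<rho> \<in> ring_hom C Q"
    and y: "y = \<psi> (\<iota> x)" "y \<noteq> \<zero>\<^bsub>C\<^esub>"
    and ker: "\<And>c. c \<in> carrier C \<Longrightarrow> \<rho> c = \<zero>\<^bsub>Q\<^esub> \<longleftrightarrow> y divides\<^bsub>C\<^esub> c"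
    and \<rho>\<psi>: "\<And>a. a \<in> carrier A \<Longrightarrow> \<rho> (\<psi> (\<iota> a)) = const_poly \<kappa> (\<pi> a)"
    and w0: "w0 \<in> carrier C" "\<rho> w0 = pvar \<kappa>" "f0 \<in> carrier P" "y [^]\<^bsub>C\<^esub> (N::nat) \<otimes>\<^bsub>C\<^esub> w0 = \<psi> f0"
  shows "\<exists>\<sigma>\<in>carrier A. \<exists>m. \<forall>f\<in>carrier P. \<forall>n::nat.
     y [^]\<^bsub>C\<^esub> n divides\<^bsub>C\<^esub> \<psi> f \<longleftrightarrow> \<iota> x [^]\<^bsub>P\<^esub> n divides\<^bsub>P\<^esub> theta \<sigma> m f"
proof -
  interpret C: "domain" C by fact
  define h where "h = \<psi> \<circ> \<iota>"
  have h: "h \<in> ring_hom A C" unfolding h_def using \<iota>_hom \<psi> by (rule ring_hom_trans)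
  have hc: "h a \<in> carrier C" if "a \<in> carrier A" for a using ring_hom_closed[OF h that] .
  have yc: "y \<in> carrier C" using y ring_hom_closed[OF \<psi> \<iota>_x_closed] by simp
  have hx: "h x = y" by (simp add: h_def y)
  have \<rho>h: "\<rho> (h a) = const_poly \<kappa> (\<pi> a)" if "a \<in> carrier A" for a
    using \<rho>\<psi>[OF that] by (simp add: h_def)
  let ?t = "\<psi> X"
  have tc: "?t \<in> carrier C" using ring_hom_closed[OF \<psi> pvar_closed] .
  \<comment> \<open>\<open>h\<close> reflects powers of \<open>x\<close>: the restriction of
    \<open>h a\<close> to the fibre is the constant \<open>\<pi> a\<close>, which vanishes only if
    \<open>x\<close> divides \<open>a\<close>, and then one factor can be removed on both
    sides.\<close>
  have pow_A: "x [^] n divides a" if "a \<in> carrier A" "y [^]\<^bsub>C\<^esub> n divides\<^bsub>C\<^esub> h a" for a and n :: nat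
    using that
  proof (induction n arbitrary: a)
    case 0
    then show ?case by (auto simp: factor_def)
  next
    case (Suc n)
    have "y divides\<^bsub>C\<^esub> h a"
      by (rule C.pow_Suc_divides_imp[OF yc _ Suc.prems(2)]) (use Suc.prems hc in simp)
    then have "\<rho> (h a) = \<zero>\<^bsub>Q\<^esub>" using ker hc Suc by simp
    then have "\<pi> a = \<zero>\<^bsub>\<kappa>\<^esub>"
      using \<rho>h \<kappa>.const_poly_eq_zero_iff ring_hom_closed[OF \<pi>_hom] Suc by simp
    then obtain b where b: "b \<in> carrier A" "a = x \<otimes> b"
      using \<pi>_zero_iff Suc by (auto simp: factor_def)
    then have "h a = y \<otimes>\<^bsub>C\<^esub> h b" using ring_hom_mult[OF h] hx by simp
    then have "y [^]\<^bsub>C\<^esub> n divides\<^bsub>C\<^esub> h b"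
      using C.pow_Suc_divides_cancel[OF yc y(2) hc] Suc.prems b by simp
    then have "x [^] n divides b" using Suc.IH b by simp
    then show ?case using pow_Suc_divides_cancel[OF x_closed x_nonzero] b by simp
  qed
  define T where "T m \<longleftrightarrow> (\<exists>\<sigma>\<in>carrier A. y [^]\<^bsub>C\<^esub> m divides\<^bsub>C\<^esub> (?t \<ominus>\<^bsub>C\<^esub> h \<sigma>))" for m :: nat
  have T0: "T 0"
    unfolding T_def using tc hc by (intro bexI[of _ \<zero>]) (auto simp: factor_def)
  \<comment> \<open>If t agreed with \<open>\<sigma>\<close> to order N + 1, expanding
    \<open>f0\<close> at \<open>\<sigma>\<close> would make y^N \<open>w0\<close> equal to a
    constant from \<open>A\<close> modulo y^(N+1). Cancelling y^N makes \<open>w0\<close> constant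
    on the fibre, where it is the coordinate.\<close>
  have noT: "\<not> T (Suc N)"
  proof
    assume "T (Suc N)"
    then obtain \<sigma> c where \<sigma>: "\<sigma> \<in> carrier A" "c \<in> carrier C" "?t \<ominus>\<^bsub>C\<^esub> h \<sigma> = y [^]\<^bsub>C\<^esub> Suc N \<otimes>\<^bsub>C\<^esub> c"
      unfolding T_def factor_def by blast
    obtain g a where g: "g \<in> carrier P" "a \<in> carrier A" "f0 = (X \<ominus>\<^bsub>P\<^esub> \<iota> \<sigma>) \<otimes>\<^bsub>P\<^esub> g \<oplus>\<^bsub>P\<^esub> \<iota> a"
      using taylor[OF \<sigma>(1) w0(3)] by blast
    have gc: "\<psi> g \<in> carrier C" using ring_hom_closed[OF \<psi> g(1)] .
    have "\<psi> f0 = (?t \<ominus>\<^bsub>C\<^esub> h \<sigma>) \<otimes>\<^bsub>C\<^esub> \<psi> g \<oplus>\<^bsub>C\<^esub> h a"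
      using g \<sigma> ring_hom_add[OF \<psi>] ring_hom_mult[OF \<psi>] P.ring_hom_minus[OF C.is_cring \<psi>]
      by (simp add: h_def)
    also have "\<dots> = (y [^]\<^bsub>C\<^esub> N \<otimes>\<^bsub>C\<^esub> y \<otimes>\<^bsub>C\<^esub> c) \<otimes>\<^bsub>C\<^esub> \<psi> g \<oplus>\<^bsub>C\<^esub> h a"
      using \<sigma> by simp
    finally have eq: "y [^]\<^bsub>C\<^esub> N \<otimes>\<^bsub>C\<^esub> w0 = (y [^]\<^bsub>C\<^esub> N \<otimes>\<^bsub>C\<^esub> y \<otimes>\<^bsub>C\<^esub> c) \<otimes>\<^bsub>C\<^esub> \<psi> g \<oplus>\<^bsub>C\<^esub> h a"
      using w0 by simp
    have yN: "y [^]\<^bsub>C\<^esub> N \<in> carrier C" using yc by simp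
    have ha: "h a = y [^]\<^bsub>C\<^esub> N \<otimes>\<^bsub>C\<^esub> (w0 \<ominus>\<^bsub>C\<^esub> y \<otimes>\<^bsub>C\<^esub> (c \<otimes>\<^bsub>C\<^esub> \<psi> g))"
    proof -
      have "h a = ((y [^]\<^bsub>C\<^esub> N \<otimes>\<^bsub>C\<^esub> y \<otimes>\<^bsub>C\<^esub> c) \<otimes>\<^bsub>C\<^esub> \<psi> g \<oplus>\<^bsub>C\<^esub> h a) \<ominus>\<^bsub>C\<^esub> (y [^]\<^bsub>C\<^esub> N \<otimes>\<^bsub>C\<^esub> y \<otimes>\<^bsub>C\<^esub> c) \<otimes>\<^bsub>C\<^esub> \<psi> g"
        using yN yc \<sigma>(2) gc hc[OF g(2)] by algebra
      also have "\<dots> = y [^]\<^bsub>C\<^esub> N \<otimes>\<^bsub>C\<^esub> w0 \<ominus>\<^bsub>C\<^esub> (y [^]\<^bsub>C\<^esub> N \<otimes>\<^bsub>C\<^esub> y \<otimes>\<^bsub>C\<^esub> c) \<otimes>\<^bsub>C\<^esub> \<psi> g"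
        using eq by simp
      also have "\<dots> = y [^]\<^bsub>C\<^esub> N \<otimes>\<^bsub>C\<^esub> (w0 \<ominus>\<^bsub>C\<^esub> y \<otimes>\<^bsub>C\<^esub> (c \<otimes>\<^bsub>C\<^esub> \<psi> g))"
        using yN yc \<sigma>(2) gc w0(1) by algebra
      finally show ?thesis .
    qed
    then have "y [^]\<^bsub>C\<^esub> N divides\<^bsub>C\<^esub> h a"
      using w0 yc \<sigma> gc by (intro dividesI) auto
    then obtain b where b: "b \<in> carrier A" "a = x [^] N \<otimes> b"
      using pow_A[OF g(2)] by (auto simp: factor_def)
    have "h a = y [^]\<^bsub>C\<^esub> N \<otimes>\<^bsub>C\<^esub> h b"
      using b ring_hom_mult[OF h] ring_hom_nat_pow[OF C.is_cring h] hx by simp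
    then have "w0 \<ominus>\<^bsub>C\<^esub> y \<otimes>\<^bsub>C\<^esub> (c \<otimes>\<^bsub>C\<^esub> \<psi> g) = h b"
      using ha C.m_lcancel[OF C.nat_pow_nonzero[OF yc y(2)] yN] w0 yc \<sigma> gc hc b by simp
    moreover have "w0 \<ominus>\<^bsub>C\<^esub> (w0 \<ominus>\<^bsub>C\<^esub> y \<otimes>\<^bsub>C\<^esub> (c \<otimes>\<^bsub>C\<^esub> \<psi> g)) = y \<otimes>\<^bsub>C\<^esub> (c \<otimes>\<^bsub>C\<^esub> \<psi> g)"
      using w0(1) yc \<sigma>(2) gc by algebra
    ultimately have "w0 \<ominus>\<^bsub>C\<^esub> h b = y \<otimes>\<^bsub>C\<^esub> (c \<otimes>\<^bsub>C\<^esub> \<psi> g)" by simp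
    then have "y divides\<^bsub>C\<^esub> (w0 \<ominus>\<^bsub>C\<^esub> h b)" using \<sigma> gc by (intro dividesI) auto
    then have "\<rho> (w0 \<ominus>\<^bsub>C\<^esub> h b) = \<zero>\<^bsub>Q\<^esub>" using ker w0 hc b by simp
    then have "pvar \<kappa> \<ominus>\<^bsub>Q\<^esub> const_poly \<kappa> (\<pi> b) = \<zero>\<^bsub>Q\<^esub>"
      using C.ring_hom_minus[OF Q.is_cring \<rho>] w0 hc b \<rho>h by simp
    then have "pvar \<kappa> = const_poly \<kappa> (\<pi> b)"
      using ring_hom_closed[OF \<pi>_hom] b by (simp add: Q.r_right_minus_eq)
    then have "pvar \<kappa> \<otimes>\<^bsub>Q\<^esub> \<one>\<^bsub>Q\<^esub> \<oplus>\<^bsub>Q\<^esub> const_poly \<kappa> \<zero>\<^bsub>\<kappa>\<^esub> = pvar \<kappa> \<otimes>\<^bsub>Q\<^esub> \<zero>\<^bsub>Q\<^esub> \<oplus>\<^bsub>Q\<^esub> const_poly \<kappa> (\<pi> b)"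
      using ring_hom_closed[OF \<pi>_hom] b by (simp add: \<kappa>.const_poly_zero)
    then have "\<one>\<^bsub>Q\<^esub> = \<zero>\<^bsub>Q\<^esub>"
      using \<kappa>.horner_inject(1)[OF Q.one_closed \<kappa>.zero_closed Q.zero_closed] ring_hom_closed[OF \<pi>_hom] b by blast
    then show False by simp
  qed
  have bound: "m \<le> N" if "T m" for m
  proof (rule ccontr)
    assume "\<not> m \<le> N"
    then have "Suc N \<le> m" by simp
    from that obtain \<sigma> where s: "\<sigma> \<in> carrier A" "y [^]\<^bsub>C\<^esub> m divides\<^bsub>C\<^esub> (?t \<ominus>\<^bsub>C\<^esub> h \<sigma>)" unfolding T_def by (elim bexE)
    have "y [^]\<^bsub>C\<^esub> Suc N divides\<^bsub>C\<^esub> (?t \<ominus>\<^bsub>C\<^esub> h \<sigma>)"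
      by (rule C.pow_divides_mono[OF yc C.minus_closed[OF tc hc[OF s(1)]] s(2) \<open>Suc N \<le> m\<close>])
    then show False using noT s(1) unfolding T_def by blast
  qed
  define m where "m = (GREATEST m. T m)"
  have Tm: "T m" unfolding m_def using T0 bound by (rule GreatestI_nat)
  have notTSm: "\<not> T (Suc m)"
    using Greatest_le_nat[of T "Suc m" N] bound unfolding m_def by fastforce
  obtain \<sigma> u where \<sigma>: "\<sigma> \<in> carrier A" and u: "u \<in> carrier C" "?t \<ominus>\<^bsub>C\<^esub> h \<sigma> = y [^]\<^bsub>C\<^esub> m \<otimes>\<^bsub>C\<^esub> u"
    using Tm unfolding T_def factor_def by blast
  \<comment> \<open>A constant value of \<open>u\<close> on the fibre lifts to some \<open>a\<close>
    in \<open>A\<close>; then \<open>\<sigma>\<close> + x^m a approximates t better, against the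
    choice of \<open>m\<close>.\<close>
  have nonconst: "\<rho> u \<notin> const_poly \<kappa> ` carrier \<kappa>"
  proof
    assume "\<rho> u \<in> const_poly \<kappa> ` carrier \<kappa>"
    then obtain a where a: "a \<in> carrier A" "\<rho> u = \<rho> (h a)" using \<pi>_surj \<rho>h by auto
    then have "\<rho> (u \<ominus>\<^bsub>C\<^esub> h a) = \<zero>\<^bsub>Q\<^esub>"
      using C.ring_hom_minus[OF Q.is_cring \<rho>] u hc ring_hom_closed[OF \<rho>] by simp
    then obtain v where v: "v \<in> carrier C" "u \<ominus>\<^bsub>C\<^esub> h a = y \<otimes>\<^bsub>C\<^esub> v"
      using ker u hc a by (auto simp: factor_def)
    have ym: "y [^]\<^bsub>C\<^esub> m \<in> carrier C" using yc by simp
    have "?t \<ominus>\<^bsub>C\<^esub> h (\<sigma> \<oplus> x [^] m \<otimes> a) = ?t \<ominus>\<^bsub>C\<^esub> (h \<sigma> \<oplus>\<^bsub>C\<^esub> y [^]\<^bsub>C\<^esub> m \<otimes>\<^bsub>C\<^esub> h a)"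
      using \<sigma> a ring_hom_add[OF h] ring_hom_mult[OF h] ring_hom_nat_pow[OF C.is_cring h] hx by simp
    also have "\<dots> = (?t \<ominus>\<^bsub>C\<^esub> h \<sigma>) \<ominus>\<^bsub>C\<^esub> y [^]\<^bsub>C\<^esub> m \<otimes>\<^bsub>C\<^esub> h a"
      using tc hc[OF \<sigma>] hc[OF a(1)] ym by algebra
    also have "\<dots> = y [^]\<^bsub>C\<^esub> m \<otimes>\<^bsub>C\<^esub> (u \<ominus>\<^bsub>C\<^esub> h a)"
      unfolding u(2) using u(1) hc[OF a(1)] ym by algebra
    also have "\<dots> = y [^]\<^bsub>C\<^esub> Suc m \<otimes>\<^bsub>C\<^esub> v" using v yc by (simp add: C.m_assoc)
    finally have "T (Suc m)" unfolding T_def using v \<sigma> a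
      by (intro bexI[of _ "\<sigma> \<oplus> x [^] m \<otimes> a"] dividesI) auto
    then show False using notTSm by simp
  qed
  define E where "E = eval A C h u"
  have E: "E \<in> ring_hom P C" unfolding E_def by (rule eval_hom[OF C.is_cring h u(1)])
  have Ec: "E (\<iota> a) = h a" if "a \<in> carrier A" for a
    unfolding E_def using eval_const_poly[OF C.is_cring h u(1) that] .
  have EX: "E X = u" unfolding E_def by (rule eval_pvar[OF C.is_cring h u(1)])
  \<comment> \<open>\<open>\<sigma>\<close> + x^m u is t again, so the substitution of the disc
    followed by T = u is \<open>\<psi>\<close>.\<close>
  have Etheta: "E (theta \<sigma> m f) = \<psi> f" if f: "f \<in> carrier P" for f
  proof -
    have "(E \<circ> theta \<sigma> m) f = \<psi> f"
    proof (rule UP_hom_eqI[OF C.is_cring ring_hom_trans[OF theta_hom[OF \<sigma>] E] \<psi> _ _ f])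
      fix a assume "a \<in> carrier A"
      then show "(E \<circ> theta \<sigma> m) (\<iota> a) = \<psi> (\<iota> a)" using \<sigma> Ec by (simp add: h_def)
    next
      have "(E \<circ> theta \<sigma> m) X = h \<sigma> \<oplus>\<^bsub>C\<^esub> y [^]\<^bsub>C\<^esub> m \<otimes>\<^bsub>C\<^esub> u"
        using \<sigma> Ec EX hx ring_hom_add[OF E] ring_hom_mult[OF E] P.ring_hom_nat_pow[OF C.is_cring E]
        by (simp add: theta_var)
      also have "\<dots> = h \<sigma> \<oplus>\<^bsub>C\<^esub> (?t \<ominus>\<^bsub>C\<^esub> h \<sigma>)" using u by simp
      also have "\<dots> = ?t" using tc hc[OF \<sigma>] by algebra
      finally show "(E \<circ> theta \<sigma> m) X = \<psi> X" .
    qed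
    then show ?thesis by simp
  qed
  let ?F = "eval \<kappa> Q (const_poly \<kappa>) (\<rho> u)"
  have \<rho>u: "\<rho> u \<in> carrier Q" using ring_hom_closed[OF \<rho> u(1)] .
  have F: "?F \<in> ring_hom Q Q" by (rule \<kappa>.eval_hom[OF Q.is_cring const_\<kappa>_hom \<rho>u])
  \<comment> \<open>On the fibre, T = u becomes the substitution of the nonconstant polynomial
    \<open>\<rho> u\<close>, which is injective.\<close>
  have \<rho>E: "\<rho> (E g) = ?F (red g)" if g: "g \<in> carrier P" for g
  proof -
    have "(\<rho> \<circ> E) g = (?F \<circ> red) g"
    proof (rule UP_hom_eqI[OF Q.is_cring ring_hom_trans[OF E \<rho>] ring_hom_trans[OF red_hom F] _ _ g])
      fix a assume a: "a \<in> carrier A"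
      have "?F (red (\<iota> a)) = ?F (const_poly \<kappa> (\<pi> a))" by (simp only: red_const[OF a])
      also have "\<dots> = const_poly \<kappa> (\<pi> a)"
        by (rule \<kappa>.eval_const_poly[OF Q.is_cring const_\<kappa>_hom \<rho>u ring_hom_closed[OF \<pi>_hom a]])
      also have "\<dots> = \<rho> (E (\<iota> a))" by (simp only: Ec[OF a] \<rho>h[OF a])
      finally show "(\<rho> \<circ> E) (\<iota> a) = (?F \<circ> red) (\<iota> a)" by (simp only: o_apply)
    next
      show "(\<rho> \<circ> E) X = (?F \<circ> red) X"
        by (simp only: o_apply EX red_var \<kappa>.eval_pvar[OF Q.is_cring const_\<kappa>_hom \<rho>u])
    qed
    then show ?thesis by (simp only: o_apply)
  qed
  \<comment> \<open>A factor y of \<open>E g\<close> forces \<open>red g\<close> to vanish by this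
    injectivity, so \<open>x\<close> can be split off from \<open>g\<close>, and the induction
    continues with the quotient.\<close>
  have div_back: "\<iota> x [^]\<^bsub>P\<^esub> n divides\<^bsub>P\<^esub> g" if "g \<in> carrier P" "y [^]\<^bsub>C\<^esub> n divides\<^bsub>C\<^esub> E g" for g and n :: nat
    using that
  proof (induction n arbitrary: g)
    case 0
    then show ?case by (auto simp: factor_def)
  next
    case (Suc n)
    have Eg: "E g \<in> carrier C" using ring_hom_closed[OF E Suc.prems(1)] .
    have "y divides\<^bsub>C\<^esub> E g" by (rule C.pow_Suc_divides_imp[OF yc Eg Suc.prems(2)])
    then have "\<rho> (E g) = \<zero>\<^bsub>Q\<^esub>" using ker[OF Eg] by (rule iffD2[rotated])
    then have "?F (red g) = \<zero>\<^bsub>Q\<^esub>" by (simp only: \<rho>E[OF Suc.prems(1)])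
    then have "red g = \<zero>\<^bsub>Q\<^esub>"
      by (rule \<kappa>.eval_nonconst_inj[OF \<rho>u nonconst ring_hom_closed[OF red_hom Suc.prems(1)]])
    then have "\<iota> x divides\<^bsub>P\<^esub> g" using red_zero_iff[OF Suc.prems(1)] by blast
    then obtain g' where g': "g' \<in> carrier P" "g = \<iota> x \<otimes>\<^bsub>P\<^esub> g'"
      unfolding factor_def by blast
    have "E g = y \<otimes>\<^bsub>C\<^esub> E g'" using g' ring_hom_mult[OF E] Ec hx by simp
    then have "y [^]\<^bsub>C\<^esub> n divides\<^bsub>C\<^esub> E g'"
      using C.pow_Suc_divides_cancel[OF yc y(2)] ring_hom_closed[OF E g'(1)] Suc.prems by simp
    then have "\<iota> x [^]\<^bsub>P\<^esub> n divides\<^bsub>P\<^esub> g'" using Suc.IH g' by simp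
    then show ?case using P.pow_Suc_divides_cancel[OF \<iota>_x_closed \<iota>_x_nonzero] g' by simp
  qed
  have div_fwd: "y [^]\<^bsub>C\<^esub> n divides\<^bsub>C\<^esub> E g" if "g \<in> carrier P" "\<iota> x [^]\<^bsub>P\<^esub> n divides\<^bsub>P\<^esub> g" for g and n :: nat
  proof -
    have "E (\<iota> x [^]\<^bsub>P\<^esub> n) divides\<^bsub>C\<^esub> E g"
      by (rule P.hom_divides[OF E _ that(2)]) simp
    then show ?thesis
      by (simp only: P.ring_hom_nat_pow[OF C.is_cring E \<iota>_x_closed] Ec[OF x_closed] hx)
  qed
  show ?thesis
  proof (intro bexI[OF _ \<sigma>] exI[of _ m] ballI allI)
    fix f n assume f: "f \<in> carrier P"
    have "theta \<sigma> m f \<in> carrier P" by (rule theta_closed[OF \<sigma> f])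
    then show "y [^]\<^bsub>C\<^esub> (n::nat) divides\<^bsub>C\<^esub> \<psi> f \<longleftrightarrow> \<iota> x [^]\<^bsub>P\<^esub> n divides\<^bsub>P\<^esub> theta \<sigma> m f"
      using div_back[of "theta \<sigma> m f" n] div_fwd[of "theta \<sigma> m f" n] unfolding Etheta[OF f] by blast
  qed
qed

end

section \<open>Rings of fractions\<close>

text \<open>In a domain the auxiliary multiplier \<open>w\<close> of \<open>frac_rel\<close> cancels
  once zero is excluded from the denominators, so equality of fractions becomes plain cross
  multiplication.\<close>

locale fractions = "domain" R for R (structure) +
  fixes M
  assumes M_subset: "M \<subseteq> carrier R" and M_one [simp]: "\<one> \<in> M"
    and M_mult [simp]: "\<lbrakk>u \<in> M; v \<in> M\<rbrakk> \<Longrightarrow> u \<otimes> v \<in> M" and M_zero: "\<zero> \<notin> M"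
begin

abbreviation F where "F \<equiv> frac_ring R M"
abbreviation frac where "frac \<equiv> mk_frac R M"

lemma M_closed [simp]: "u \<in> M \<Longrightarrow> u \<in> carrier R"
  using M_subset by blast

lemma M_nonzero: "u \<in> M \<Longrightarrow> u \<noteq> \<zero>"
  using M_zero by blast

lemma frac_rel_iff:
  "((a, u), (b, v)) \<in> frac_rel R M \<longleftrightarrow>
    a \<in> carrier R \<and> u \<in> M \<and> b \<in> carrier R \<and> v \<in> M \<and> a \<otimes> v = b \<otimes> u"
proof -
  have "w \<otimes> (a \<otimes> v) = w \<otimes> (b \<otimes> u) \<longleftrightarrow> a \<otimes> v = b \<otimes> u"
    if "a \<in> carrier R" "u \<in> M" "b \<in> carrier R" "v \<in> M" "w \<in> M" for w
    using that M_nonzero by (simp add: m_lcancel)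
  then show ?thesis unfolding frac_rel_def using M_one by auto
qed

lemma equiv_frac_rel: "equiv (carrier R \<times> M) (frac_rel R M)"
proof (rule equivI)
  show "frac_rel R M \<subseteq> (carrier R \<times> M) \<times> (carrier R \<times> M)"
    by (auto simp: frac_rel_iff)
  show "refl_on (carrier R \<times> M) (frac_rel R M)"
    by (auto simp: refl_on_def frac_rel_iff)
  show "sym (frac_rel R M)"
    by (auto simp: sym_def frac_rel_iff)
  show "trans (frac_rel R M)"
  proof (rule transI)
    fix p q r assume pq: "(p, q) \<in> frac_rel R M" "(q, r) \<in> frac_rel R M"
    obtain a u b v c w where e: "p = (a, u)" "q = (b, v)" "r = (c, w)" by (metis prod.exhaust)
    note h = pq[unfolded e frac_rel_iff]
    have c: "a \<in> carrier R" "u \<in> carrier R" "b \<in> carrier R" "v \<in> carrier R" "c \<in> carrier R" "w \<in> carrier R"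
      using h by auto
    have "v \<otimes> (a \<otimes> w) = (a \<otimes> v) \<otimes> w" using c by (simp add: m_ac)
    also have "\<dots> = (b \<otimes> u) \<otimes> w" using h by simp
    also have "\<dots> = (b \<otimes> w) \<otimes> u" using c by (simp add: m_ac)
    also have "\<dots> = (c \<otimes> v) \<otimes> u" using h by simp
    also have "\<dots> = v \<otimes> (c \<otimes> u)" using c by (simp add: m_ac)
    finally have "a \<otimes> w = c \<otimes> u" using h M_nonzero by (simp add: m_lcancel)
    then show "(p, r) \<in> frac_rel R M" using h by (simp add: e frac_rel_iff)
  qed
qed

lemma frac_eq_iff:
  assumes "a \<in> carrier R" "u \<in> M" "b \<in> carrier R" "v \<in> M"
  shows "frac a u = frac b v \<longleftrightarrow> a \<otimes> v = b \<otimes> u"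
  using eq_equiv_class_iff[OF equiv_frac_rel, of "(a, u)" "(b, v)"] assms
  by (simp add: mk_frac_def frac_rel_iff)

lemma frac_closed [simp]: "a \<in> carrier R \<Longrightarrow> u \<in> M \<Longrightarrow> frac a u \<in> carrier F"
  by (auto simp: frac_ring_def mk_frac_def intro: quotientI)

lemma frac_cases:
  assumes "p \<in> carrier F"
  obtains a u where "a \<in> carrier R" "u \<in> M" "p = frac a u"
  using assms by (auto simp: frac_ring_def mk_frac_def elim!: quotientE)

lemma mem_frac:
  assumes "a \<in> carrier R" "u \<in> M"
  shows "(b, v) \<in> frac a u \<longleftrightarrow> b \<in> carrier R \<and> v \<in> M \<and> frac b v = frac a u"
proof -
  have "(b, v) \<in> frac a u \<longleftrightarrow> b \<in> carrier R \<and> v \<in> M \<and> a \<otimes> v = b \<otimes> u"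
    by (simp add: mk_frac_def frac_rel_iff assms)
  moreover have "\<lbrakk>b \<in> carrier R; v \<in> M\<rbrakk> \<Longrightarrow> frac b v = frac a u \<longleftrightarrow> b \<otimes> u = a \<otimes> v"
    by (rule frac_eq_iff[OF _ _ assms])
  ultimately show ?thesis by metis
qed

text \<open>The operations of \<open>frac_ring\<close> are unions over all representatives of a
  class. A union of equal sets is that set, so independence of the representative lets a single one
  compute the operation.\<close>

lemma UN_frac:
  assumes "a \<in> carrier R" "u \<in> M"
    and "\<And>b v. \<lbrakk>b \<in> carrier R; v \<in> M; frac b v = frac a u\<rbrakk> \<Longrightarrow> g b v = g a u"
  shows "(\<Union>(b, v)\<in>frac a u. g b v) = g a u"
proof (rule SUP_eq_const)
  show "frac a u \<noteq> {}" using assms(1,2) mem_frac[of a u a u] by blast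
  fix p assume "p \<in> frac a u"
  then show "(case p of (b, v) \<Rightarrow> g b v) = g a u"
    using assms(3) mem_frac[OF assms(1,2)] by (cases p) simp
qed

lemma frac_mult [simp]:
  assumes "a \<in> carrier R" "u \<in> M" "b \<in> carrier R" "v \<in> M"
  shows "frac a u \<otimes>\<^bsub>F\<^esub> frac b v = frac (a \<otimes> b) (u \<otimes> v)"
proof -
  have *: "frac (a' \<otimes> b') (u' \<otimes> v') = frac (a \<otimes> b) (u \<otimes> v)"
    if "a' \<in> carrier R" "u' \<in> M" "frac a' u' = frac a u" "b' \<in> carrier R" "v' \<in> M" "frac b' v' = frac b v"
      "a \<in> carrier R" "u \<in> M" "b \<in> carrier R" "v \<in> M"
    for a u a' u' b v b' v'
  proof -
    have e: "a' \<otimes> u = a \<otimes> u'" "b' \<otimes> v = b \<otimes> v'" using that frac_eq_iff by auto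
    have "(a' \<otimes> b') \<otimes> (u \<otimes> v) = (a' \<otimes> u) \<otimes> (b' \<otimes> v)" using that by (simp add: m_ac)
    also have "\<dots> = (a \<otimes> b) \<otimes> (u' \<otimes> v')" unfolding e using that by (simp add: m_ac)
    finally show ?thesis using that frac_eq_iff by simp
  qed
  have "frac a u \<otimes>\<^bsub>F\<^esub> frac b v = (\<Union>(a, u)\<in>frac a u. \<Union>(b, v)\<in>frac b v. frac (a \<otimes> b) (u \<otimes> v))"
    by (simp add: frac_ring_def)
  also have "\<dots> = (\<Union>(b, v)\<in>frac b v. frac (a \<otimes> b) (u \<otimes> v))"
  proof (rule UN_frac[OF assms(1,2)])
    fix a' u' assume a': "a' \<in> carrier R" "u' \<in> M" "frac a' u' = frac a u"
    have "(\<Union>(b, v)\<in>frac b v. frac (c \<otimes> b) (w \<otimes> v)) = frac (c \<otimes> b) (w \<otimes> v)"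
      if "c \<in> carrier R" "w \<in> M" for c w
      by (rule UN_frac[OF assms(3,4)]) (rule *[OF that refl _ _ _ that assms(3,4)])
    then show "(\<Union>(b, v)\<in>frac b v. frac (a' \<otimes> b) (u' \<otimes> v)) = (\<Union>(b, v)\<in>frac b v. frac (a \<otimes> b) (u \<otimes> v))"
      using a' assms *[OF a' assms(3,4) refl assms] by simp
  qed
  also have "\<dots> = frac (a \<otimes> b) (u \<otimes> v)"
    by (rule UN_frac[OF assms(3,4)]) (rule *[OF assms(1,2) refl _ _ _ assms])
  finally show ?thesis .
qed

lemma frac_add [simp]:
  assumes "a \<in> carrier R" "u \<in> M" "b \<in> carrier R" "v \<in> M"
  shows "frac a u \<oplus>\<^bsub>F\<^esub> frac b v = frac (a \<otimes> v \<oplus> b \<otimes> u) (u \<otimes> v)"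
proof -
  have *: "frac (a' \<otimes> v' \<oplus> b' \<otimes> u') (u' \<otimes> v') = frac (a \<otimes> v \<oplus> b \<otimes> u) (u \<otimes> v)"
    if "a' \<in> carrier R" "u' \<in> M" "frac a' u' = frac a u" "b' \<in> carrier R" "v' \<in> M" "frac b' v' = frac b v"
      "a \<in> carrier R" "u \<in> M" "b \<in> carrier R" "v \<in> M"
    for a u a' u' b v b' v'
  proof -
    have e: "a' \<otimes> u = a \<otimes> u'" "b' \<otimes> v = b \<otimes> v'" using that frac_eq_iff by auto
    have "(a' \<otimes> v' \<oplus> b' \<otimes> u') \<otimes> (u \<otimes> v) = (a' \<otimes> u) \<otimes> (v' \<otimes> v) \<oplus> (b' \<otimes> v) \<otimes> (u' \<otimes> u)"
      using that by (simp add: l_distr r_distr m_ac a_ac)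
    also have "\<dots> = (a \<otimes> v \<oplus> b \<otimes> u) \<otimes> (u' \<otimes> v')"
      unfolding e using that by (simp add: l_distr r_distr m_ac a_ac)
    finally show ?thesis using that frac_eq_iff by simp
  qed
  have "frac a u \<oplus>\<^bsub>F\<^esub> frac b v = (\<Union>(a, u)\<in>frac a u. \<Union>(b, v)\<in>frac b v. frac (a \<otimes> v \<oplus> b \<otimes> u) (u \<otimes> v))"
    by (simp add: frac_ring_def)
  also have "\<dots> = (\<Union>(b, v)\<in>frac b v. frac (a \<otimes> v \<oplus> b \<otimes> u) (u \<otimes> v))"
  proof (rule UN_frac[OF assms(1,2)])
    fix a' u' assume a': "a' \<in> carrier R" "u' \<in> M" "frac a' u' = frac a u"
    have "(\<Union>(b, v)\<in>frac b v. frac (c \<otimes> v \<oplus> b \<otimes> w) (w \<otimes> v)) = frac (c \<otimes> v \<oplus> b \<otimes> w) (w \<otimes> v)"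
      if "c \<in> carrier R" "w \<in> M" for c w
      by (rule UN_frac[OF assms(3,4)]) (rule *[OF that refl _ _ _ that assms(3,4)])
    then show "(\<Union>(b, v)\<in>frac b v. frac (a' \<otimes> v \<oplus> b \<otimes> u') (u' \<otimes> v)) =
        (\<Union>(b, v)\<in>frac b v. frac (a \<otimes> v \<oplus> b \<otimes> u) (u \<otimes> v))"
      using a' assms *[OF a' assms(3,4) refl assms] by simp
  qed
  also have "\<dots> = frac (a \<otimes> v \<oplus> b \<otimes> u) (u \<otimes> v)"
    by (rule UN_frac[OF assms(3,4)]) (rule *[OF assms(1,2) refl _ _ _ assms])
  finally show ?thesis .
qed

lemma frac_one: "\<one>\<^bsub>F\<^esub> = frac \<one> \<one>" by (simp add: frac_ring_def)
lemma frac_zero: "\<zero>\<^bsub>F\<^esub> = frac \<zero> \<one>" by (simp add: frac_ring_def)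

lemma frac_eq_zero_iff:
  assumes "a \<in> carrier R" "u \<in> M"
  shows "frac a u = \<zero>\<^bsub>F\<^esub> \<longleftrightarrow> a = \<zero>"
  using assms frac_eq_iff[of a u \<zero> \<one>] by (simp add: frac_zero)

lemma frac_cring: "cring F"
proof (rule cringI)
  show "abelian_group F"
  proof (rule abelian_groupI)
    fix p q assume "p \<in> carrier F" "q \<in> carrier F"
    then obtain a u b v where h: "a \<in> carrier R" "u \<in> M" "p = frac a u" "b \<in> carrier R" "v \<in> M" "q = frac b v"
      by (elim frac_cases) blast
    then show "p \<oplus>\<^bsub>F\<^esub> q \<in> carrier F" by simp
    show "p \<oplus>\<^bsub>F\<^esub> q = q \<oplus>\<^bsub>F\<^esub> p" using h by (simp add: a_comm m_comm)
    fix r assume "r \<in> carrier F"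
    then obtain c w where r: "c \<in> carrier R" "w \<in> M" "r = frac c w" by (elim frac_cases) blast
    show "p \<oplus>\<^bsub>F\<^esub> q \<oplus>\<^bsub>F\<^esub> r = p \<oplus>\<^bsub>F\<^esub> (q \<oplus>\<^bsub>F\<^esub> r)"
      using h r by (simp add: l_distr r_distr m_ac a_ac)
  next
    show "\<zero>\<^bsub>F\<^esub> \<in> carrier F" by (simp add: frac_zero)
  next
    fix p assume "p \<in> carrier F"
    then obtain a u where h: "a \<in> carrier R" "u \<in> M" "p = frac a u" by (elim frac_cases) blast
    show "\<zero>\<^bsub>F\<^esub> \<oplus>\<^bsub>F\<^esub> p = p" using h by (simp add: frac_zero)
    have "frac (\<ominus> a) u \<oplus>\<^bsub>F\<^esub> p = \<zero>\<^bsub>F\<^esub>"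
      using h by (simp add: l_minus l_neg frac_eq_zero_iff)
    then show "\<exists>q\<in>carrier F. q \<oplus>\<^bsub>F\<^esub> p = \<zero>\<^bsub>F\<^esub>" by (rule bexI) (simp add: h)
  qed
  show "comm_monoid F"
  proof (rule comm_monoidI)
    fix p q assume "p \<in> carrier F" "q \<in> carrier F"
    then obtain a u b v where h: "a \<in> carrier R" "u \<in> M" "p = frac a u" "b \<in> carrier R" "v \<in> M" "q = frac b v"
      by (elim frac_cases) blast
    then show "p \<otimes>\<^bsub>F\<^esub> q \<in> carrier F" by simp
    show "p \<otimes>\<^bsub>F\<^esub> q = q \<otimes>\<^bsub>F\<^esub> p" using h by (simp add: m_comm)
    fix r assume "r \<in> carrier F"
    then obtain c w where r: "c \<in> carrier R" "w \<in> M" "r = frac c w" by (elim frac_cases) blast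
    show "p \<otimes>\<^bsub>F\<^esub> q \<otimes>\<^bsub>F\<^esub> r = p \<otimes>\<^bsub>F\<^esub> (q \<otimes>\<^bsub>F\<^esub> r)"
      using h r by (simp add: m_assoc)
  next
    show "\<one>\<^bsub>F\<^esub> \<in> carrier F" by (simp add: frac_one)
  next
    fix p assume "p \<in> carrier F"
    then obtain a u where h: "a \<in> carrier R" "u \<in> M" "p = frac a u" by (elim frac_cases) blast
    show "\<one>\<^bsub>F\<^esub> \<otimes>\<^bsub>F\<^esub> p = p" using h by (simp add: frac_one)
  qed
  fix p q r assume "p \<in> carrier F" "q \<in> carrier F" "r \<in> carrier F"
  then obtain a u b v c w where h: "a \<in> carrier R" "u \<in> M" "p = frac a u" "b \<in> carrier R" "v \<in> M" "q = frac b v"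
     "c \<in> carrier R" "w \<in> M" "r = frac c w"
    by (elim frac_cases) blast
  then show "(p \<oplus>\<^bsub>F\<^esub> q) \<otimes>\<^bsub>F\<^esub> r = p \<otimes>\<^bsub>F\<^esub> r \<oplus>\<^bsub>F\<^esub> q \<otimes>\<^bsub>F\<^esub> r"
    by (simp add: frac_eq_iff l_distr r_distr m_ac)
qed

lemma frac_domain: "domain F"
proof -
  interpret F: cring F by (rule frac_cring)
  show ?thesis
  proof (rule domain.intro[OF frac_cring], unfold_locales)
    show "\<one>\<^bsub>F\<^esub> \<noteq> \<zero>\<^bsub>F\<^esub>" by (simp add: frac_one frac_eq_zero_iff)
    fix p q assume h: "p \<otimes>\<^bsub>F\<^esub> q = \<zero>\<^bsub>F\<^esub>" "p \<in> carrier F" "q \<in> carrier F"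
    from h(2,3) obtain a u b v where "a \<in> carrier R" "u \<in> M" "p = frac a u" "b \<in> carrier R" "v \<in> M" "q = frac b v"
      by (elim frac_cases) blast
    then show "p = \<zero>\<^bsub>F\<^esub> \<or> q = \<zero>\<^bsub>F\<^esub>" using h(1) by (simp add: frac_eq_zero_iff integral_iff)
  qed
qed

lemma frac_one_hom: "(\<lambda>a. frac a \<one>) \<in> ring_hom R F"
  by (rule ring_hom_memI) (simp_all add: frac_one)

end

lemma (in "domain") fractions_powers:
  assumes "f \<in> carrier R" "f \<noteq> \<zero>"
  shows "fractions R (powers R f)"
proof (unfold_locales)
  show "\<one> \<in> powers R f" unfolding powers_def using nat_pow_0 by (metis (mono_tags, lifting) mem_Collect_eq)
  fix u v assume "u \<in> powers R f" "v \<in> powers R f"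
  then obtain m n :: nat where "u = f [^] m" "v = f [^] n" by (auto simp: powers_def)
  then show "u \<otimes> v \<in> powers R f" using nat_pow_mult[OF assms(1), of m n] by (auto simp: powers_def)
next
  show "\<zero> \<notin> powers R f" using nat_pow_nonzero[OF assms] unfolding powers_def by force
qed (use assms in \<open>auto simp: powers_def\<close>)

lemma (in "domain") fractions_nonzeros: "fractions R (nonzeros R)"
  by unfold_locales (auto simp: nonzeros_def integral_iff)

locale fractions_hom = R: fractions R M + S: fractions S N
  for R (structure) and M and S (structure) and N +
  fixes h
  assumes hom: "h \<in> ring_hom R S" and h_M: "h ` M \<subseteq> N"
begin

lemma hM [simp]: "u \<in> M \<Longrightarrow> h u \<in> N" using h_M by blast
lemma hR [simp]: "a \<in> carrier R \<Longrightarrow> h a \<in> carrier S" using ring_hom_closed[OF hom] .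

lemma frac_map_frac:
  assumes "a \<in> carrier R" "u \<in> M"
  shows "frac_map S N h (mk_frac R M a u) = mk_frac S N (h a) (h u)"
  unfolding frac_map_def
proof (rule R.UN_frac[OF assms])
  fix b v assume h: "b \<in> carrier R" "v \<in> M" "mk_frac R M b v = mk_frac R M a u"
  then have "h (b \<otimes>\<^bsub>R\<^esub> u) = h (a \<otimes>\<^bsub>R\<^esub> v)" using R.frac_eq_iff assms by simp
  then show "mk_frac S N (h b) (h v) = mk_frac S N (h a) (h u)"
    using h assms by (simp add: S.frac_eq_iff ring_hom_mult[OF hom])
qed

lemma frac_map_hom: "frac_map S N h \<in> ring_hom (frac_ring R M) (frac_ring S N)"
proof (rule ring_hom_memI)
  fix p assume "p \<in> carrier (frac_ring R M)"
  then show "frac_map S N h p \<in> carrier (frac_ring S N)"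
    by (auto elim!: R.frac_cases simp: frac_map_frac)
next
  fix p q assume "p \<in> carrier (frac_ring R M)" "q \<in> carrier (frac_ring R M)"
  then obtain a u b v where h: "a \<in> carrier R" "u \<in> M" "p = mk_frac R M a u"
      "b \<in> carrier R" "v \<in> M" "q = mk_frac R M b v"
    by (elim R.frac_cases) blast
  then show "frac_map S N h (p \<otimes>\<^bsub>frac_ring R M\<^esub> q) = frac_map S N h p \<otimes>\<^bsub>frac_ring S N\<^esub> frac_map S N h q"
    by (simp add: frac_map_frac ring_hom_mult[OF hom])
  show "frac_map S N h (p \<oplus>\<^bsub>frac_ring R M\<^esub> q) = frac_map S N h p \<oplus>\<^bsub>frac_ring S N\<^esub> frac_map S N h q"
    using h by (simp add: frac_map_frac ring_hom_mult[OF hom] ring_hom_add[OF hom])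
next
  show "frac_map S N h \<one>\<^bsub>frac_ring R M\<^esub> = \<one>\<^bsub>frac_ring S N\<^esub>"
    by (simp add: R.frac_one S.frac_one frac_map_frac ring_hom_one[OF hom])
qed

lemma frac_map_iso:
  assumes inj: "inj_on h (carrier R)"
    and surj: "\<And>b v. \<lbrakk>b \<in> carrier S; v \<in> N\<rbrakk> \<Longrightarrow> \<exists>a\<in>carrier R. \<exists>u\<in>M. b \<otimes>\<^bsub>S\<^esub> h u = h a \<otimes>\<^bsub>S\<^esub> v"
  shows "frac_map S N h \<in> ring_iso (frac_ring R M) (frac_ring S N)"
proof -
  have "inj_on (frac_map S N h) (carrier (frac_ring R M))"
  proof (rule inj_onI)
    fix p q assume pq: "p \<in> carrier (frac_ring R M)" "q \<in> carrier (frac_ring R M)"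
      "frac_map S N h p = frac_map S N h q"
    from pq(1,2) obtain a u b v where h: "a \<in> carrier R" "u \<in> M" "p = mk_frac R M a u"
        "b \<in> carrier R" "v \<in> M" "q = mk_frac R M b v"
      by (elim R.frac_cases) blast
    then have "h (a \<otimes>\<^bsub>R\<^esub> v) = h (b \<otimes>\<^bsub>R\<^esub> u)"
      using pq(3) by (simp add: frac_map_frac S.frac_eq_iff ring_hom_mult[OF hom])
    then have "a \<otimes>\<^bsub>R\<^esub> v = b \<otimes>\<^bsub>R\<^esub> u"
      using h by (intro inj_onD[OF inj]) simp_all
    then show "p = q" using h R.frac_eq_iff by simp
  qed
  moreover have "carrier (frac_ring S N) \<subseteq> frac_map S N h ` carrier (frac_ring R M)"
  proof
    fix q assume "q \<in> carrier (frac_ring S N)"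
    then obtain b v where q: "b \<in> carrier S" "v \<in> N" "q = mk_frac S N b v" by (elim S.frac_cases) blast
    obtain a u where a: "a \<in> carrier R" "u \<in> M" "b \<otimes>\<^bsub>S\<^esub> h u = h a \<otimes>\<^bsub>S\<^esub> v" using surj q by blast
    then have "q = frac_map S N h (mk_frac R M a u)"
      using q by (simp add: frac_map_frac S.frac_eq_iff)
    then show "q \<in> frac_map S N h ` carrier (frac_ring R M)" by (rule image_eqI) (simp add: a)
  qed
  ultimately show ?thesis
    unfolding ring_iso_def bij_betw_def
    by (intro CollectI conjI equalityI image_subsetI frac_map_hom ring_hom_closed[OF frac_map_hom])
qed

end

section \<open>Domains over the affine line\<close>

context base_ring
begin

lemma loc_map_frac:
  assumes "domain B" "s \<in> ring_hom A B" "s x \<noteq> \<zero>\<^bsub>B\<^esub>" "a \<in> carrier A" "u \<in> powers A x"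
  shows "loc_map A x B s (mk_frac A (powers A x) a u) = mk_frac B (powers B (s x)) (s a) (s u)"
    and "s u \<in> powers B (s x)"
proof -
  interpret B: "domain" B by fact
  interpret FA: fractions A "powers A x" by (rule fractions_powers) auto
  interpret FB: fractions B "powers B (s x)"
    by (rule B.fractions_powers[OF ring_hom_closed[OF assms(2) x_closed] assms(3)])
  have M: "s ` powers A x \<subseteq> powers B (s x)"
    using ring_hom_nat_pow[OF B.is_cring assms(2) x_closed] by (auto simp: powers_def)
  interpret H: fractions_hom A "powers A x" B "powers B (s x)" s
    by unfold_locales (rule assms(2), rule M)
  show "loc_map A x B s (mk_frac A (powers A x) a u) = mk_frac B (powers B (s x)) (s a) (s u)"
    unfolding loc_map_def by (rule H.frac_map_frac[OF assms(4,5)])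
  show "s u \<in> powers B (s x)" by (rule H.hM[OF assms(5)])
qed

text \<open>Inverting the image of \<open>x\<close> turns an injection into an isomorphism exactly
  when each element of \<open>B'\<close> enters the image after multiplication by a power of it, and
  such a map also identifies the fraction fields. So birationality and the isomorphism over the
  punctured base become conditions on elements.\<close>

lemma dfs_mor_iff:
  assumes "domain B" "domain B'" and s: "s \<in> ring_hom A B" and s': "s' \<in> ring_hom A B'"
    and nz: "s x \<noteq> \<zero>\<^bsub>B\<^esub>" "s' x \<noteq> \<zero>\<^bsub>B'\<^esub>"
  shows "dfs_mor A x B' s' B s \<phi> \<longleftrightarrow>
    \<phi> \<in> ring_hom B B' \<and> (\<forall>a\<in>carrier A. \<phi> (s a) = s' a) \<and> inj_on \<phi> (carrier B) \<and>
    (\<forall>b'\<in>carrier B'. \<exists>n::nat. \<exists>b\<in>carrier B. s' x [^]\<^bsub>B'\<^esub> n \<otimes>\<^bsub>B'\<^esub> b' = \<phi> b)"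
    (is "?L \<longleftrightarrow> ?R")
proof -
  interpret B: "domain" B by fact
  interpret B': "domain" B' by fact
  let ?y = "s x" and ?y' = "s' x"
  have y: "?y \<in> carrier B" "?y' \<in> carrier B'"
    using ring_hom_closed[OF s x_closed] ring_hom_closed[OF s' x_closed] by auto
  interpret FA: fractions A "powers A x" by (rule fractions_powers) auto
  interpret FB: fractions B "powers B ?y" by (rule B.fractions_powers[OF y(1) nz(1)])
  interpret FB': fractions B' "powers B' ?y'" by (rule B'.fractions_powers[OF y(2) nz(2)])
  interpret NB: fractions B "nonzeros B" by (rule B.fractions_nonzeros)
  interpret NB': fractions B' "nonzeros B'" by (rule B'.fractions_nonzeros)
  show ?thesis
  proof
    assume L: ?L
    then have \<phi>: "\<phi> \<in> ring_hom B B'" and \<phi>s: "\<forall>a\<in>carrier A. \<phi> (s a) = s' a" and inj: "inj_on \<phi> (carrier B)"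
      and iso: "loc_map B ?y B' \<phi> \<in> ring_iso (loc B ?y) (loc B' ?y')"
      by (auto simp: dfs_mor_def alg_hom_def alg_iso_def birational_def)
    have \<phi>y: "\<phi> ?y = ?y'" using \<phi>s by simp
    have M: "\<phi> ` powers B ?y \<subseteq> powers B' ?y'"
      using B.ring_hom_nat_pow[OF B'.is_cring \<phi> y(1)] \<phi>y by (auto simp: powers_def)
    interpret H: fractions_hom B "powers B ?y" B' "powers B' ?y'" \<phi>
      by unfold_locales (rule \<phi>, rule M)
    have "\<exists>n::nat. \<exists>b\<in>carrier B. ?y' [^]\<^bsub>B'\<^esub> n \<otimes>\<^bsub>B'\<^esub> b' = \<phi> b" if b': "b' \<in> carrier B'" for b'
    proof -
      have "mk_frac B' (powers B' ?y') b' \<one>\<^bsub>B'\<^esub> \<in> carrier (loc B' ?y')"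
        unfolding loc_def by (rule FB'.frac_closed[OF b' FB'.M_one])
      then have "mk_frac B' (powers B' ?y') b' \<one>\<^bsub>B'\<^esub> \<in> loc_map B ?y B' \<phi> ` carrier (loc B ?y)"
        using iso by (simp add: ring_iso_def bij_betw_def)
      then obtain p where p: "p \<in> carrier (loc B ?y)"
        "mk_frac B' (powers B' ?y') b' \<one>\<^bsub>B'\<^esub> = loc_map B ?y B' \<phi> p" by (rule imageE)
      obtain b u where b: "b \<in> carrier B" "u \<in> powers B ?y" "p = mk_frac B (powers B ?y) b u"
        by (rule FB.frac_cases[OF p(1)[unfolded loc_def]])
      obtain n :: nat where n: "u = ?y [^]\<^bsub>B\<^esub> n" using b(2) by (auto simp: powers_def)
      have "mk_frac B' (powers B' ?y') b' \<one>\<^bsub>B'\<^esub> = mk_frac B' (powers B' ?y') (\<phi> b) (\<phi> u)"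
        unfolding p(2) b(3) loc_map_def \<phi>y by (rule H.frac_map_frac[OF b(1,2)])
      then have "b' \<otimes>\<^bsub>B'\<^esub> \<phi> u = \<phi> b \<otimes>\<^bsub>B'\<^esub> \<one>\<^bsub>B'\<^esub>"
        by (rule iffD1[OF FB'.frac_eq_iff[OF b' FB'.M_one H.hR[OF b(1)] H.hM[OF b(2)]]])
      then have "?y' [^]\<^bsub>B'\<^esub> n \<otimes>\<^bsub>B'\<^esub> b' = \<phi> b"
        using b b' y H.hR[OF b(1)]
        by (simp add: n B.ring_hom_nat_pow[OF B'.is_cring \<phi> y(1)] \<phi>y B'.m_comm)
      then show ?thesis using b(1) by metis
    qed
    then show ?R using \<phi> \<phi>s inj by metis
  next
    assume R: ?R
    then have \<phi>: "\<phi> \<in> ring_hom B B'" and \<phi>s: "\<And>a. a \<in> carrier A \<Longrightarrow> \<phi> (s a) = s' a"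
      and inj: "inj_on \<phi> (carrier B)"
      and den: "\<And>b'. b' \<in> carrier B' \<Longrightarrow> \<exists>n::nat. \<exists>b\<in>carrier B. ?y' [^]\<^bsub>B'\<^esub> n \<otimes>\<^bsub>B'\<^esub> b' = \<phi> b"
      by auto
    have \<phi>c: "\<phi> b \<in> carrier B'" if "b \<in> carrier B" for b using ring_hom_closed[OF \<phi> that] .
    have \<phi>y: "\<phi> ?y = ?y'" using \<phi>s by simp
    have M: "\<phi> ` powers B ?y \<subseteq> powers B' ?y'"
      using B.ring_hom_nat_pow[OF B'.is_cring \<phi> y(1)] \<phi>y by (auto simp: powers_def)
    have \<phi>0: "\<phi> \<zero>\<^bsub>B\<^esub> = \<zero>\<^bsub>B'\<^esub>" by (rule B.ring_hom_zero'[OF B'.is_cring \<phi>])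
    have \<phi>nz: "\<phi> b \<noteq> \<zero>\<^bsub>B'\<^esub>" if "b \<in> carrier B" "b \<noteq> \<zero>\<^bsub>B\<^esub>" for b
      using inj_onD[OF inj, of b "\<zero>\<^bsub>B\<^esub>"] that \<phi>0 by auto
    have N: "\<phi> ` nonzeros B \<subseteq> nonzeros B'"
      using \<phi>c \<phi>nz by (auto simp: nonzeros_def)
    interpret H: fractions_hom B "powers B ?y" B' "powers B' ?y'" \<phi>
      by unfold_locales (rule \<phi>, rule M)
    interpret K: fractions_hom B "nonzeros B" B' "nonzeros B'" \<phi>
      by unfold_locales (rule \<phi>, rule N)
    have "frac_map B' (powers B' ?y') \<phi> \<in> ring_iso (frac_ring B (powers B ?y)) (frac_ring B' (powers B' ?y'))"
    proof (rule H.frac_map_iso[OF inj])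
      fix b' v assume b': "b' \<in> carrier B'" "v \<in> powers B' ?y'"
      then obtain m :: nat where m: "v = ?y' [^]\<^bsub>B'\<^esub> m" by (auto simp: powers_def)
      obtain n :: nat and b where b: "b \<in> carrier B" "?y' [^]\<^bsub>B'\<^esub> n \<otimes>\<^bsub>B'\<^esub> b' = \<phi> b" using den[OF b'(1)] by auto
      have u: "?y [^]\<^bsub>B\<^esub> (n + m) \<in> powers B ?y" unfolding powers_def by blast
      have "b' \<otimes>\<^bsub>B'\<^esub> \<phi> (?y [^]\<^bsub>B\<^esub> (n + m)) = (?y' [^]\<^bsub>B'\<^esub> n \<otimes>\<^bsub>B'\<^esub> b') \<otimes>\<^bsub>B'\<^esub> ?y' [^]\<^bsub>B'\<^esub> m"
        using b'(1) y by (simp add: B.ring_hom_nat_pow[OF B'.is_cring \<phi> y(1)] \<phi>y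
            B'.nat_pow_mult[symmetric] B'.m_ac)
      also have "\<dots> = \<phi> b \<otimes>\<^bsub>B'\<^esub> v" by (simp only: b m)
      finally show "\<exists>a\<in>carrier B. \<exists>u\<in>powers B ?y. b' \<otimes>\<^bsub>B'\<^esub> \<phi> u = \<phi> a \<otimes>\<^bsub>B'\<^esub> v"
        using b(1) u by metis
    qed
    then have L1: "loc_map B ?y B' \<phi> \<in> ring_iso (loc B ?y) (loc B' ?y')"
      by (simp only: loc_map_def loc_def \<phi>y)
    \<comment> \<open>With y and y' the images of \<open>x\<close>, b' is \<open>\<phi> b\<close> /
      y'^n and v is \<open>\<phi> c\<close> / y'^m, so b'/v is the image of (b y^m)/(c y^n).\<close>
    have "frac_map B' (nonzeros B') \<phi> \<in> ring_iso (frac_ring B (nonzeros B)) (frac_ring B' (nonzeros B'))"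
    proof (rule K.frac_map_iso[OF inj])
      fix b' v assume b': "b' \<in> carrier B'" "v \<in> nonzeros B'"
      then have v: "v \<in> carrier B'" "v \<noteq> \<zero>\<^bsub>B'\<^esub>" by (auto simp: nonzeros_def)
      obtain n :: nat and b where b: "b \<in> carrier B" "?y' [^]\<^bsub>B'\<^esub> n \<otimes>\<^bsub>B'\<^esub> b' = \<phi> b" using den[OF b'(1)] by auto
      obtain m :: nat and c where c: "c \<in> carrier B" "?y' [^]\<^bsub>B'\<^esub> m \<otimes>\<^bsub>B'\<^esub> v = \<phi> c" using den[OF v(1)] by auto
      have ym: "?y' [^]\<^bsub>B'\<^esub> k \<in> carrier B'" for k :: nat using y by simp
      have yk: "?y [^]\<^bsub>B\<^esub> k \<in> carrier B" "?y [^]\<^bsub>B\<^esub> k \<noteq> \<zero>\<^bsub>B\<^esub>" for k :: nat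
        using y B.nat_pow_nonzero nz by auto
      have \<phi>yk: "\<phi> (?y [^]\<^bsub>B\<^esub> k) = ?y' [^]\<^bsub>B'\<^esub> k" for k :: nat
        by (simp only: B.ring_hom_nat_pow[OF B'.is_cring \<phi> y(1)] \<phi>y)
      have "c \<noteq> \<zero>\<^bsub>B\<^esub>"
      proof
        assume "c = \<zero>\<^bsub>B\<^esub>"
        then have "?y' [^]\<^bsub>B'\<^esub> m \<otimes>\<^bsub>B'\<^esub> v = \<zero>\<^bsub>B'\<^esub>" using c \<phi>0 by simp
        then show False using B'.integral[OF _ ym v(1)] v B'.nat_pow_nonzero[OF y(2) nz(2)] by metis
      qed
      then have u: "c \<otimes>\<^bsub>B\<^esub> ?y [^]\<^bsub>B\<^esub> n \<in> nonzeros B"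
        using c yk by (simp add: nonzeros_def B.integral_iff)
      have "b' \<otimes>\<^bsub>B'\<^esub> \<phi> (c \<otimes>\<^bsub>B\<^esub> ?y [^]\<^bsub>B\<^esub> n) = b' \<otimes>\<^bsub>B'\<^esub> ((?y' [^]\<^bsub>B'\<^esub> m \<otimes>\<^bsub>B'\<^esub> v) \<otimes>\<^bsub>B'\<^esub> ?y' [^]\<^bsub>B'\<^esub> n)"
        using c(1) yk(1) by (simp only: ring_hom_mult[OF \<phi>] \<phi>yk c(2))
      also have "\<dots> = (?y' [^]\<^bsub>B'\<^esub> n \<otimes>\<^bsub>B'\<^esub> b') \<otimes>\<^bsub>B'\<^esub> ?y' [^]\<^bsub>B'\<^esub> m \<otimes>\<^bsub>B'\<^esub> v"
        using b'(1) v(1) ym by (simp add: B'.m_ac)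
      also have "\<dots> = \<phi> (b \<otimes>\<^bsub>B\<^esub> ?y [^]\<^bsub>B\<^esub> m) \<otimes>\<^bsub>B'\<^esub> v"
        using b(1) yk(1) by (simp only: ring_hom_mult[OF \<phi>] \<phi>yk b(2))
      finally show "\<exists>a\<in>carrier B. \<exists>u\<in>nonzeros B. b' \<otimes>\<^bsub>B'\<^esub> \<phi> u = \<phi> a \<otimes>\<^bsub>B'\<^esub> v"
        using b(1) u B.m_closed[OF b(1) yk(1)] by metis
    qed
    then have L2: "birational B B' \<phi>"
      unfolding birational_def function_field_def using inj by simp
    have L3: "\<forall>p\<in>carrier (loc A x). loc_map B ?y B' \<phi> (loc_map A x B s p) = loc_map A x B' s' p"
    proof
      fix p assume "p \<in> carrier (loc A x)"
      then have p: "p \<in> carrier (frac_ring A (powers A x))" by (simp only: loc_def)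
      obtain a u where a: "a \<in> carrier A" "u \<in> powers A x" "p = mk_frac A (powers A x) a u"
        by (rule FA.frac_cases[OF p])
      have "loc_map B ?y B' \<phi> (loc_map A x B s p) = loc_map B ?y B' \<phi> (mk_frac B (powers B ?y) (s a) (s u))"
        unfolding a(3) by (simp only: loc_map_frac(1)[OF assms(1) s nz(1) a(1,2)])
      also have "\<dots> = mk_frac B' (powers B' ?y') (\<phi> (s a)) (\<phi> (s u))"
        unfolding loc_map_def \<phi>y
        by (rule H.frac_map_frac[OF ring_hom_closed[OF s a(1)] loc_map_frac(2)[OF assms(1) s nz(1) a(1,2)]])
      also have "\<dots> = mk_frac B' (powers B' ?y') (s' a) (s' u)"
        by (simp only: \<phi>s[OF a(1)] \<phi>s[OF FA.M_closed[OF a(2)]])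
      also have "\<dots> = loc_map A x B' s' p"
        unfolding a(3) by (simp only: loc_map_frac(1)[OF assms(2) s' nz(2) a(1,2)])
      finally show "loc_map B ?y B' \<phi> (loc_map A x B s p) = loc_map A x B' s' p" .
    qed
    have "loc_map B ?y B' \<phi> \<in> ring_hom (loc B ?y) (loc B' ?y')" using L1 by (simp add: ring_iso_def)
    then show ?L unfolding dfs_mor_def alg_iso_def alg_hom_def using \<phi> \<phi>s L1 L2 L3 by simp
  qed
qed

end

text \<open>A ring between A[t] and A_x[t], given abstractly: \<open>\<psi>\<close> embeds A[t], and
  some power of \<open>x\<close> clears the denominator of each element.\<close>

locale over_line = base_ring A x + B: "domain" B
  for A (structure) and x and B +
  fixes \<psi>
  assumes \<psi>_hom: "\<psi> \<in> ring_hom (UP A) B" and \<psi>_inj: "inj_on \<psi> (carrier (UP A))"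
    and denominators: "b \<in> carrier B \<Longrightarrow> \<exists>n::nat. \<exists>f\<in>carrier (UP A). \<psi> (const_poly A x) [^]\<^bsub>B\<^esub> n \<otimes>\<^bsub>B\<^esub> b = \<psi> f"
begin

abbreviation y where "y \<equiv> \<psi> (\<iota> x)"

lemma \<psi>_closed [simp]: "f \<in> carrier P \<Longrightarrow> \<psi> f \<in> carrier B" by (rule ring_hom_closed[OF \<psi>_hom])
lemma \<psi>_zero_iff: "f \<in> carrier P \<Longrightarrow> \<psi> f = \<zero>\<^bsub>B\<^esub> \<longleftrightarrow> f = \<zero>\<^bsub>P\<^esub>"
  using inj_onD[OF \<psi>_inj, of f "\<zero>\<^bsub>P\<^esub>"] P.ring_hom_zero'[OF B.is_cring \<psi>_hom] by auto
lemma y_closed: "y \<in> carrier B" by simp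
lemma y_nonzero: "y \<noteq> \<zero>\<^bsub>B\<^esub>" using \<psi>_zero_iff[OF \<iota>_x_closed] by simp
lemma \<psi>_pow: "\<psi> (\<iota> x [^]\<^bsub>P\<^esub> (n::nat)) = y [^]\<^bsub>B\<^esub> n"
  by (rule P.ring_hom_nat_pow[OF B.is_cring \<psi>_hom \<iota>_x_closed])

text \<open>An element of \<open>B\<close> is a fraction \<open>\<psi> f\<close> / y^n where y^n
  divides \<open>\<psi> f\<close>. The hypothesis allows the same fraction to be formed in
  \<open>B'\<close>, and sending one to the other is the extension; \<open>G\<close> is the graph of
  this map.\<close>

lemma extend:
  assumes "domain B'" and \<psi>': "\<psi>' \<in> ring_hom P B'" and nz: "\<psi>' (\<iota> x) \<noteq> \<zero>\<^bsub>B'\<^esub>"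
    and le: "\<And>f n. \<lbrakk>f \<in> carrier P; y [^]\<^bsub>B\<^esub> (n::nat) divides\<^bsub>B\<^esub> \<psi> f\<rbrakk> \<Longrightarrow> \<psi>' (\<iota> x) [^]\<^bsub>B'\<^esub> n divides\<^bsub>B'\<^esub> \<psi>' f"
  shows "\<exists>\<phi>\<in>ring_hom B B'. \<forall>f\<in>carrier P. \<phi> (\<psi> f) = \<psi>' f"
proof -
  interpret B': "domain" B' by fact
  let ?y' = "\<psi>' (\<iota> x)"
  have y': "?y' \<in> carrier B'" by (rule ring_hom_closed[OF \<psi>' \<iota>_x_closed])
  have \<psi>'_pow: "\<psi>' (\<iota> x [^]\<^bsub>P\<^esub> (n::nat)) = ?y' [^]\<^bsub>B'\<^esub> n" for n
    by (rule P.ring_hom_nat_pow[OF B'.is_cring \<psi>' \<iota>_x_closed])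
  have yn: "y [^]\<^bsub>B\<^esub> (n::nat) \<in> carrier B" "?y' [^]\<^bsub>B'\<^esub> n \<in> carrier B'" "\<iota> x [^]\<^bsub>P\<^esub> n \<in> carrier P" for n
    using y' by auto
  have \<psi>'c: "\<psi>' f \<in> carrier B'" if "f \<in> carrier P" for f by (rule ring_hom_closed[OF \<psi>' that])
  define G where "G b b' \<longleftrightarrow> b \<in> carrier B \<and> b' \<in> carrier B' \<and>
    (\<exists>n::nat. \<exists>f\<in>carrier P. y [^]\<^bsub>B\<^esub> n \<otimes>\<^bsub>B\<^esub> b = \<psi> f \<and> ?y' [^]\<^bsub>B'\<^esub> n \<otimes>\<^bsub>B'\<^esub> b' = \<psi>' f)" for b b'
  have GI: "G b b'" if "b \<in> carrier B" "b' \<in> carrier B'" "f \<in> carrier P" "y [^]\<^bsub>B\<^esub> n \<otimes>\<^bsub>B\<^esub> b = \<psi> f"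
      "?y' [^]\<^bsub>B'\<^esub> n \<otimes>\<^bsub>B'\<^esub> b' = \<psi>' f" for b b' f and n :: nat
    unfolding G_def using that by metis
  have total: "\<exists>b'. G b b'" if b: "b \<in> carrier B" for b
  proof -
    obtain n :: nat and f where f: "f \<in> carrier P" "y [^]\<^bsub>B\<^esub> n \<otimes>\<^bsub>B\<^esub> b = \<psi> f" using denominators[OF b] by metis
    then have "y [^]\<^bsub>B\<^esub> n divides\<^bsub>B\<^esub> \<psi> f" using b by (metis dividesI)
    then obtain b' where "b' \<in> carrier B'" "\<psi>' f = ?y' [^]\<^bsub>B'\<^esub> n \<otimes>\<^bsub>B'\<^esub> b'" using le[OF f(1)] unfolding factor_def by metis
    then show ?thesis using GI[OF b _ f] by metis
  qed
  \<comment> \<open>Two fractions for the same \<open>b\<close> are compared by cross multiplication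
    in A[t], where \<open>\<psi>\<close> is injective; the equation is then carried to
    \<open>B'\<close>, and the powers of the image of \<open>x\<close> cancel.\<close>
  have unique: "b1 = b2" if 1: "G b b1" and 2: "G b b2" for b b1 b2
  proof -
    from 1 obtain n :: nat and f where f: "f \<in> carrier P" "y [^]\<^bsub>B\<^esub> n \<otimes>\<^bsub>B\<^esub> b = \<psi> f" "?y' [^]\<^bsub>B'\<^esub> n \<otimes>\<^bsub>B'\<^esub> b1 = \<psi>' f"
      unfolding G_def by metis
    from 2 obtain m :: nat and g where g: "g \<in> carrier P" "y [^]\<^bsub>B\<^esub> m \<otimes>\<^bsub>B\<^esub> b = \<psi> g" "?y' [^]\<^bsub>B'\<^esub> m \<otimes>\<^bsub>B'\<^esub> b2 = \<psi>' g"
      unfolding G_def by metis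
    have b: "b \<in> carrier B" "b1 \<in> carrier B'" "b2 \<in> carrier B'" using 1 2 by (auto simp: G_def)
    have "\<psi> (\<iota> x [^]\<^bsub>P\<^esub> m \<otimes>\<^bsub>P\<^esub> f) = y [^]\<^bsub>B\<^esub> m \<otimes>\<^bsub>B\<^esub> (y [^]\<^bsub>B\<^esub> n \<otimes>\<^bsub>B\<^esub> b)"
      by (simp only: ring_hom_mult[OF \<psi>_hom yn(3) f(1)] \<psi>_pow f(2))
    also have "\<dots> = y [^]\<^bsub>B\<^esub> n \<otimes>\<^bsub>B\<^esub> (y [^]\<^bsub>B\<^esub> m \<otimes>\<^bsub>B\<^esub> b)" using yn(1) b(1) by (rule B.m_lcomm[rotated]) (rule yn)
    also have "\<dots> = \<psi> (\<iota> x [^]\<^bsub>P\<^esub> n \<otimes>\<^bsub>P\<^esub> g)"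
      by (simp only: ring_hom_mult[OF \<psi>_hom yn(3) g(1)] \<psi>_pow g(2))
    finally have "\<iota> x [^]\<^bsub>P\<^esub> m \<otimes>\<^bsub>P\<^esub> f = \<iota> x [^]\<^bsub>P\<^esub> n \<otimes>\<^bsub>P\<^esub> g"
      by (rule inj_onD[OF \<psi>_inj]) (use f g in simp_all)
    then have "\<psi>' (\<iota> x [^]\<^bsub>P\<^esub> m \<otimes>\<^bsub>P\<^esub> f) = \<psi>' (\<iota> x [^]\<^bsub>P\<^esub> n \<otimes>\<^bsub>P\<^esub> g)" by simp
    then have "?y' [^]\<^bsub>B'\<^esub> m \<otimes>\<^bsub>B'\<^esub> (?y' [^]\<^bsub>B'\<^esub> n \<otimes>\<^bsub>B'\<^esub> b1) = ?y' [^]\<^bsub>B'\<^esub> n \<otimes>\<^bsub>B'\<^esub> (?y' [^]\<^bsub>B'\<^esub> m \<otimes>\<^bsub>B'\<^esub> b2)"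
      by (simp only: ring_hom_mult[OF \<psi>' yn(3) f(1)] ring_hom_mult[OF \<psi>' yn(3) g(1)] \<psi>'_pow f(3) g(3))
    also have "\<dots> = ?y' [^]\<^bsub>B'\<^esub> m \<otimes>\<^bsub>B'\<^esub> (?y' [^]\<^bsub>B'\<^esub> n \<otimes>\<^bsub>B'\<^esub> b2)" using yn(2) b by (simp add: B'.m_lcomm)
    finally show ?thesis
      using B'.m_lcancel[OF B'.nat_pow_nonzero[OF y' nz] yn(2)] b yn(2) by simp
  qed
  define \<phi> where "\<phi> b = (SOME b'. G b b')" for b
  have G\<phi>: "G b (\<phi> b)" if "b \<in> carrier B" for b
    unfolding \<phi>_def using total[OF that] by (rule someI_ex)
  have \<phi>I: "\<phi> b = b'" if "G b b'" for b b'
    using unique[OF G\<phi> that] that unfolding G_def by blast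
  have G\<psi>: "G (\<psi> f) (\<psi>' f)" if "f \<in> carrier P" for f
    using that \<psi>'c by (intro GI[of _ _ f 0]) simp_all
  have Gmult: "G (b \<otimes>\<^bsub>B\<^esub> c) (b' \<otimes>\<^bsub>B'\<^esub> c')" and Gadd: "G (b \<oplus>\<^bsub>B\<^esub> c) (b' \<oplus>\<^bsub>B'\<^esub> c')"
    if 1: "G b b'" and 2: "G c c'" for b b' c c'
  proof -
    from 1 obtain n :: nat and f where f: "f \<in> carrier P" "y [^]\<^bsub>B\<^esub> n \<otimes>\<^bsub>B\<^esub> b = \<psi> f" "?y' [^]\<^bsub>B'\<^esub> n \<otimes>\<^bsub>B'\<^esub> b' = \<psi>' f"
      unfolding G_def by metis
    from 2 obtain m :: nat and g where g: "g \<in> carrier P" "y [^]\<^bsub>B\<^esub> m \<otimes>\<^bsub>B\<^esub> c = \<psi> g" "?y' [^]\<^bsub>B'\<^esub> m \<otimes>\<^bsub>B'\<^esub> c' = \<psi>' g"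
      unfolding G_def by metis
    have b: "b \<in> carrier B" "b' \<in> carrier B'" "c \<in> carrier B" "c' \<in> carrier B'" using 1 2 by (auto simp: G_def)
    show "G (b \<otimes>\<^bsub>B\<^esub> c) (b' \<otimes>\<^bsub>B'\<^esub> c')"
    proof (rule GI[of _ _ "f \<otimes>\<^bsub>P\<^esub> g" "n + m"])
      have "y [^]\<^bsub>B\<^esub> (n + m) \<otimes>\<^bsub>B\<^esub> (b \<otimes>\<^bsub>B\<^esub> c) = (y [^]\<^bsub>B\<^esub> n \<otimes>\<^bsub>B\<^esub> b) \<otimes>\<^bsub>B\<^esub> (y [^]\<^bsub>B\<^esub> m \<otimes>\<^bsub>B\<^esub> c)"
        using b yn(1) by (simp add: B.nat_pow_mult[symmetric] B.m_ac)
      then show "y [^]\<^bsub>B\<^esub> (n + m) \<otimes>\<^bsub>B\<^esub> (b \<otimes>\<^bsub>B\<^esub> c) = \<psi> (f \<otimes>\<^bsub>P\<^esub> g)"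
        by (simp only: f(2) g(2) ring_hom_mult[OF \<psi>_hom f(1) g(1)])
      have "?y' [^]\<^bsub>B'\<^esub> (n + m) \<otimes>\<^bsub>B'\<^esub> (b' \<otimes>\<^bsub>B'\<^esub> c') = (?y' [^]\<^bsub>B'\<^esub> n \<otimes>\<^bsub>B'\<^esub> b') \<otimes>\<^bsub>B'\<^esub> (?y' [^]\<^bsub>B'\<^esub> m \<otimes>\<^bsub>B'\<^esub> c')"
        using b yn(2) y' by (simp add: B'.nat_pow_mult[symmetric] B'.m_ac)
      then show "?y' [^]\<^bsub>B'\<^esub> (n + m) \<otimes>\<^bsub>B'\<^esub> (b' \<otimes>\<^bsub>B'\<^esub> c') = \<psi>' (f \<otimes>\<^bsub>P\<^esub> g)"
        by (simp only: f(3) g(3) ring_hom_mult[OF \<psi>' f(1) g(1)])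
    qed (use b f g in simp_all)
    show "G (b \<oplus>\<^bsub>B\<^esub> c) (b' \<oplus>\<^bsub>B'\<^esub> c')"
    proof (rule GI[of _ _ "\<iota> x [^]\<^bsub>P\<^esub> m \<otimes>\<^bsub>P\<^esub> f \<oplus>\<^bsub>P\<^esub> \<iota> x [^]\<^bsub>P\<^esub> n \<otimes>\<^bsub>P\<^esub> g" "n + m"])
      have "y [^]\<^bsub>B\<^esub> (n + m) \<otimes>\<^bsub>B\<^esub> (b \<oplus>\<^bsub>B\<^esub> c) =
          y [^]\<^bsub>B\<^esub> m \<otimes>\<^bsub>B\<^esub> (y [^]\<^bsub>B\<^esub> n \<otimes>\<^bsub>B\<^esub> b) \<oplus>\<^bsub>B\<^esub> y [^]\<^bsub>B\<^esub> n \<otimes>\<^bsub>B\<^esub> (y [^]\<^bsub>B\<^esub> m \<otimes>\<^bsub>B\<^esub> c)"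
        using b yn(1) by (simp add: B.nat_pow_mult[symmetric] B.r_distr B.l_distr B.m_ac)
      then show "y [^]\<^bsub>B\<^esub> (n + m) \<otimes>\<^bsub>B\<^esub> (b \<oplus>\<^bsub>B\<^esub> c) = \<psi> (\<iota> x [^]\<^bsub>P\<^esub> m \<otimes>\<^bsub>P\<^esub> f \<oplus>\<^bsub>P\<^esub> \<iota> x [^]\<^bsub>P\<^esub> n \<otimes>\<^bsub>P\<^esub> g)"
        using f(1) g(1) yn(3)
        by (simp only: f(2) g(2) \<psi>_pow ring_hom_mult[OF \<psi>_hom] ring_hom_add[OF \<psi>_hom] P.m_closed)
      have "?y' [^]\<^bsub>B'\<^esub> (n + m) \<otimes>\<^bsub>B'\<^esub> (b' \<oplus>\<^bsub>B'\<^esub> c') =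
          ?y' [^]\<^bsub>B'\<^esub> m \<otimes>\<^bsub>B'\<^esub> (?y' [^]\<^bsub>B'\<^esub> n \<otimes>\<^bsub>B'\<^esub> b') \<oplus>\<^bsub>B'\<^esub> ?y' [^]\<^bsub>B'\<^esub> n \<otimes>\<^bsub>B'\<^esub> (?y' [^]\<^bsub>B'\<^esub> m \<otimes>\<^bsub>B'\<^esub> c')"
        using b yn(2) y' by (simp add: B'.nat_pow_mult[symmetric] B'.r_distr B'.l_distr B'.m_ac)
      then show "?y' [^]\<^bsub>B'\<^esub> (n + m) \<otimes>\<^bsub>B'\<^esub> (b' \<oplus>\<^bsub>B'\<^esub> c') = \<psi>' (\<iota> x [^]\<^bsub>P\<^esub> m \<otimes>\<^bsub>P\<^esub> f \<oplus>\<^bsub>P\<^esub> \<iota> x [^]\<^bsub>P\<^esub> n \<otimes>\<^bsub>P\<^esub> g)"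
        using f(1) g(1) yn(3)
        by (simp only: f(3) g(3) \<psi>'_pow ring_hom_mult[OF \<psi>'] ring_hom_add[OF \<psi>'] P.m_closed)
    qed (use b f g in simp_all)
  qed
  have "\<phi> \<in> ring_hom B B'"
  proof (rule ring_hom_memI)
    fix b assume b: "b \<in> carrier B"
    show "\<phi> b \<in> carrier B'" using G\<phi>[OF b] unfolding G_def by blast
    fix c assume c: "c \<in> carrier B"
    show "\<phi> (b \<otimes>\<^bsub>B\<^esub> c) = \<phi> b \<otimes>\<^bsub>B'\<^esub> \<phi> c" by (rule \<phi>I[OF Gmult[OF G\<phi>[OF b] G\<phi>[OF c]]])
    show "\<phi> (b \<oplus>\<^bsub>B\<^esub> c) = \<phi> b \<oplus>\<^bsub>B'\<^esub> \<phi> c" by (rule \<phi>I[OF Gadd[OF G\<phi>[OF b] G\<phi>[OF c]]])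
  next
    show "\<phi> \<one>\<^bsub>B\<^esub> = \<one>\<^bsub>B'\<^esub>"
      using \<phi>I[OF G\<psi>[OF P.one_closed]] ring_hom_one[OF \<psi>_hom] ring_hom_one[OF \<psi>'] by simp
  qed
  then show ?thesis using \<phi>I[OF G\<psi>] by blast
qed

end

section \<open>Families of discs\<close>

context base_ring
begin

text \<open>Disjointness of discs in the form of the condition on labels: the centres agree modulo
  x^d but not modulo x^(d+1), with \<open>d\<close> below both exponents. This \<open>d\<close>
  becomes the level of the first common ancestor.\<close>

definition separated where
  "separated p q \<longleftrightarrow> (\<exists>d < min (snd p) (snd q). x [^] d divides (fst q \<ominus> fst p) \<and>
     \<not> x [^] (Suc d) divides (fst q \<ominus> fst p))"

definition disc_family :: "('a \<times> nat) set \<Rightarrow> bool" where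
  "disc_family \<Delta> \<longleftrightarrow> finite \<Delta> \<and> \<Delta> \<noteq> {} \<and> fst ` \<Delta> \<subseteq> carrier A \<and>
     (\<forall>p\<in>\<Delta>. \<forall>q\<in>\<Delta>. p \<noteq> q \<longrightarrow> separated p q)"

text \<open>Inclusion of the disc \<open>p\<close>, as a set of elements of \<open>A\<close>, in the
  disc \<open>q\<close>; a larger exponent means a smaller disc.\<close>

definition disc_within where
  "disc_within p q \<longleftrightarrow> snd q \<le> snd p \<and> x [^] (snd q :: nat) divides (fst p \<ominus> fst q)"

lemma minus_swap_divides:
  assumes "\<sigma> \<in> carrier A" "\<tau> \<in> carrier A" "b \<in> carrier A" "b divides (\<sigma> \<ominus> \<tau>)"
  shows "b divides (\<tau> \<ominus> \<sigma>)"
proof -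
  have "\<tau> \<ominus> \<sigma> = \<ominus> (\<sigma> \<ominus> \<tau>)" using assms(1,2) by algebra
  then show ?thesis using divides_a_inv[OF assms(3,4)] by simp
qed

text \<open>Like ultrametric balls, two discs are nested or disjoint. With \<open>?k\<close> the
  smaller exponent, both sides say that the power \<open>?k\<close> of \<open>x\<close> does not
  divide the difference of the centres; the separating exponent is one less than the least power
  that fails.\<close>

lemma separated_iff_not_within:
  assumes "fst p \<in> carrier A" "fst q \<in> carrier A"
  shows "separated p q \<longleftrightarrow> \<not> disc_within p q \<and> \<not> disc_within q p"
proof -
  let ?k = "min (snd p) (snd q)" and ?\<delta> = "fst q \<ominus> fst p"
  have \<delta>: "?\<delta> \<in> carrier A" using assms by simp
  have "disc_within p q \<or> disc_within q p \<longleftrightarrow> x [^] ?k divides ?\<delta>"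
  proof -
    have sw: "x [^] k divides (fst p \<ominus> fst q) \<longleftrightarrow> x [^] k divides ?\<delta>" for k :: nat
      by (rule iffI) (erule minus_swap_divides[rotated -1], use assms in simp_all)+
    have "disc_within p q \<longleftrightarrow> snd q \<le> snd p \<and> x [^] snd q divides ?\<delta>"
      by (simp only: disc_within_def sw)
    moreover have "disc_within q p \<longleftrightarrow> snd p \<le> snd q \<and> x [^] snd p divides ?\<delta>"
      by (simp only: disc_within_def)
    ultimately show ?thesis by (metis le_antisym linear min_def)
  qed
  moreover have "separated p q \<longleftrightarrow> \<not> x [^] ?k divides ?\<delta>"
  proof
    assume "separated p q"
    then obtain d where d: "d < ?k" "\<not> x [^] (Suc d) divides ?\<delta>" unfolding separated_def by metis
    then show "\<not> x [^] ?k divides ?\<delta>" using pow_divides_mono[OF x_closed \<delta>, of ?k "Suc d"] by auto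
  next
    assume n: "\<not> x [^] ?k divides ?\<delta>"
    define l where "l = (LEAST l. \<not> x [^] (l::nat) divides ?\<delta>)"
    have l: "\<not> x [^] l divides ?\<delta>" unfolding l_def by (rule LeastI[of "\<lambda>l. \<not> x [^] (l::nat) divides ?\<delta>", OF n])
    have lk: "l \<le> ?k" unfolding l_def by (rule Least_le[of "\<lambda>l. \<not> x [^] (l::nat) divides ?\<delta>", OF n])
    have "l \<noteq> 0"
    proof
      assume "l = 0"
      moreover have "x [^] (0::nat) divides ?\<delta>" using \<delta> by (intro dividesI[of ?\<delta>]) simp_all
      ultimately show False using l by metis
    qed
    then obtain d where d: "l = Suc d" by (cases l) auto
    have "x [^] d divides ?\<delta>"
      using not_less_Least[of d "\<lambda>l. \<not> x [^] (l::nat) divides ?\<delta>"] d unfolding l_def[symmetric] by auto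
    then show "separated p q" unfolding separated_def using l lk d by (intro exI[of _ d]) auto
  qed
  ultimately show ?thesis by blast
qed

text \<open>With \<open>\<sigma>'\<close> = \<open>\<sigma>\<close> + x^m c, the substitution of the
  smaller disc is that of the larger one followed by T = c + x^(m'-m) T, and a substitution keeps
  divisibility by powers of \<open>x\<close>. So valuations can only grow on a smaller disc.\<close>

lemma theta_within:
  assumes \<sigma>: "\<sigma> \<in> carrier A" "\<sigma>' \<in> carrier A" and w: "disc_within (\<sigma>', m') (\<sigma>, m)"
    and f: "f \<in> carrier P" and d: "\<iota> x [^]\<^bsub>P\<^esub> (n::nat) divides\<^bsub>P\<^esub> theta \<sigma> m f"
  shows "\<iota> x [^]\<^bsub>P\<^esub> n divides\<^bsub>P\<^esub> theta \<sigma>' m' f"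
proof -
  obtain c where c: "c \<in> carrier A" "\<sigma>' \<ominus> \<sigma> = x [^] m \<otimes> c" and mm: "m \<le> m'"
    using w unfolding disc_within_def factor_def by auto
  have \<sigma>': "\<sigma>' = \<sigma> \<oplus> x [^] m \<otimes> c"
  proof -
    have "\<sigma>' = \<sigma> \<oplus> (\<sigma>' \<ominus> \<sigma>)" using \<sigma> by algebra
    then show ?thesis by (simp only: c(2))
  qed
  let ?E = "theta c (m' - m)"
  have E: "?E \<in> ring_hom P P" by (rule theta_hom[OF c(1)])
  have xm: "\<iota> x [^]\<^bsub>P\<^esub> k \<in> carrier P" for k :: nat by simp
  have Ex: "?E (\<iota> x [^]\<^bsub>P\<^esub> k) = \<iota> x [^]\<^bsub>P\<^esub> k" for k :: nat
    by (simp only: P.ring_hom_nat_pow[OF P.is_cring E \<iota>_x_closed] theta_const[OF c(1) x_closed])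
  have "(?E \<circ> theta \<sigma> m) f = theta \<sigma>' m' f"
  proof (rule UP_hom_eqI[OF P.is_cring ring_hom_trans[OF theta_hom[OF \<sigma>(1)] E] theta_hom[OF \<sigma>(2)] _ _ f])
    fix a assume "a \<in> carrier A"
    then show "(?E \<circ> theta \<sigma> m) (\<iota> a) = theta \<sigma>' m' (\<iota> a)" using \<sigma> c by simp
  next
    have "?E (\<iota> \<sigma> \<oplus>\<^bsub>P\<^esub> \<iota> x [^]\<^bsub>P\<^esub> m \<otimes>\<^bsub>P\<^esub> X) = \<iota> \<sigma> \<oplus>\<^bsub>P\<^esub> \<iota> x [^]\<^bsub>P\<^esub> m \<otimes>\<^bsub>P\<^esub> (\<iota> c \<oplus>\<^bsub>P\<^esub> \<iota> x [^]\<^bsub>P\<^esub> (m' - m) \<otimes>\<^bsub>P\<^esub> X)"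
      using \<sigma> xm by (simp only: ring_hom_add[OF E] ring_hom_mult[OF E] Ex theta_const[OF c(1)] theta_var[OF c(1)]
          const_poly_closed pvar_closed P.m_closed)
    also have "\<dots> = (\<iota> \<sigma> \<oplus>\<^bsub>P\<^esub> \<iota> x [^]\<^bsub>P\<^esub> m \<otimes>\<^bsub>P\<^esub> \<iota> c) \<oplus>\<^bsub>P\<^esub> (\<iota> x [^]\<^bsub>P\<^esub> m \<otimes>\<^bsub>P\<^esub> \<iota> x [^]\<^bsub>P\<^esub> (m' - m)) \<otimes>\<^bsub>P\<^esub> X"
      using \<sigma>(1) c(1) by (simp add: P.r_distr P.m_assoc P.a_assoc)
    also have "\<iota> x [^]\<^bsub>P\<^esub> m \<otimes>\<^bsub>P\<^esub> \<iota> x [^]\<^bsub>P\<^esub> (m' - m) = \<iota> x [^]\<^bsub>P\<^esub> m'"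
      using mm by (simp add: P.nat_pow_mult)
    also have "\<iota> \<sigma> \<oplus>\<^bsub>P\<^esub> \<iota> x [^]\<^bsub>P\<^esub> m \<otimes>\<^bsub>P\<^esub> \<iota> c = \<iota> \<sigma>'"
      unfolding \<sigma>' using \<sigma>(1) c(1)
      by (simp add: ring_hom_add[OF \<iota>_hom] ring_hom_mult[OF \<iota>_hom] ring_hom_nat_pow[OF P.is_cring \<iota>_hom])
    finally show "(?E \<circ> theta \<sigma> m) X = theta \<sigma>' m' X"
      by (simp only: o_apply theta_var[OF \<sigma>(1)] theta_var[OF \<sigma>(2)])
  qed
  moreover have "?E (\<iota> x [^]\<^bsub>P\<^esub> n) divides\<^bsub>P\<^esub> ?E (theta \<sigma> m f)"
    by (rule P.hom_divides[OF E xm d])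
  ultimately show ?thesis by (simp only: o_apply Ex)
qed

end

section \<open>From the special fibre of a surface to its discs\<close>

context over_line
begin

text \<open>Asked only for elements of A[t]; as denominators are powers of \<open>x\<close>, this
  settles divisibility by powers of y in all of \<open>B\<close>.\<close>

definition describes where
  "describes \<Delta> \<longleftrightarrow> (\<forall>f\<in>carrier P. \<forall>n::nat. y [^]\<^bsub>B\<^esub> n divides\<^bsub>B\<^esub> \<psi> f \<longleftrightarrow>
     (\<forall>(\<sigma>, m)\<in>\<Delta>. \<iota> x [^]\<^bsub>P\<^esub> n divides\<^bsub>P\<^esub> theta \<sigma> m f))"

text \<open>The isomorphism of the fibre with \<open>n\<close> disjoint lines, unwound into
  coordinate maps on \<open>B\<close>: together they have kernel generated by y, they are jointly
  surjective, and they are compatible with constants from \<open>A\<close>. Quotient and product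
  rings are thereby postponed until the definition of a surface has to be met.\<close>

definition fibre_charts :: "nat \<Rightarrow> (nat \<Rightarrow> 'c \<Rightarrow> nat \<Rightarrow> 'a set) \<Rightarrow> bool" where
  "fibre_charts n \<rho> \<longleftrightarrow> (\<forall>i<n. \<rho> i \<in> ring_hom B Q) \<and>
     (\<forall>i<n. \<forall>a\<in>carrier A. \<rho> i (\<psi> (\<iota> a)) = const_poly \<kappa> (\<pi> a)) \<and>
     (\<forall>b\<in>carrier B. (\<forall>i<n. \<rho> i b = \<zero>\<^bsub>Q\<^esub>) \<longrightarrow> y divides\<^bsub>B\<^esub> b) \<and>
     (\<forall>g. (\<forall>i<n. g i \<in> carrier Q) \<longrightarrow> (\<exists>b\<in>carrier B. \<forall>i<n. \<rho> i b = g i))"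

context
  fixes n :: nat and \<rho>
  assumes fc: "fibre_charts n \<rho>"
begin

lemma \<rho>_hom: "i < n \<Longrightarrow> \<rho> i \<in> ring_hom B Q"
  using fc unfolding fibre_charts_def by blast

lemma \<rho>_const: "i < n \<Longrightarrow> a \<in> carrier A \<Longrightarrow> \<rho> i (\<psi> (\<iota> a)) = const_poly \<kappa> (\<pi> a)"
  using fc unfolding fibre_charts_def by blast

lemma \<rho>_kernel: "b \<in> carrier B \<Longrightarrow> (\<And>i. i < n \<Longrightarrow> \<rho> i b = \<zero>\<^bsub>Q\<^esub>) \<Longrightarrow> y divides\<^bsub>B\<^esub> b"
  using fc unfolding fibre_charts_def by blast

lemma \<rho>_surj: "(\<And>i. i < n \<Longrightarrow> g i \<in> carrier Q) \<Longrightarrow> \<exists>b\<in>carrier B. \<forall>i<n. \<rho> i b = g i"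
  using fc unfolding fibre_charts_def by blast

lemma \<rho>_y: "i < n \<Longrightarrow> \<rho> i y = \<zero>\<^bsub>Q\<^esub>"
  using \<rho>_const[OF _ x_closed] \<pi>_zero_iff[OF x_closed] \<kappa>.const_poly_zero by simp

lemma \<rho>_divides: "i < n \<Longrightarrow> b \<in> carrier B \<Longrightarrow> y divides\<^bsub>B\<^esub> b \<Longrightarrow> \<rho> i b = \<zero>\<^bsub>Q\<^esub>"
proof -
  assume i: "i < n" and "y divides\<^bsub>B\<^esub> b"
  then obtain c where c: "c \<in> carrier B" "b = y \<otimes>\<^bsub>B\<^esub> c" unfolding factor_def by metis
  show ?thesis using ring_hom_closed[OF \<rho>_hom[OF i] c(1)]
    by (simp add: c(2) ring_hom_mult[OF \<rho>_hom[OF i] y_closed c(1)] \<rho>_y[OF i])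
qed

text \<open>\<open>e\<close> is idempotent only modulo y: it is 1 on one component of the fibre and
  0 on the others. Inverting it removes these others.\<close>

lemma idempotent_lift:
  assumes i: "i < n"
  obtains e where "e \<in> carrier B" "\<rho> i e = \<one>\<^bsub>Q\<^esub>" "\<And>j. j < n \<Longrightarrow> j \<noteq> i \<Longrightarrow> \<rho> j e = \<zero>\<^bsub>Q\<^esub>"
proof -
  have "\<exists>b\<in>carrier B. \<forall>j<n. \<rho> j b = (if j = i then \<one>\<^bsub>Q\<^esub> else \<zero>\<^bsub>Q\<^esub>)"
    by (rule \<rho>_surj) simp
  then obtain e where e: "e \<in> carrier B" "\<forall>j<n. \<rho> j e = (if j = i then \<one>\<^bsub>Q\<^esub> else \<zero>\<^bsub>Q\<^esub>)"
    by (elim bexE)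
  show ?thesis by (rule that[OF e(1)]) (use e(2) i in auto)
qed

text \<open>After inverting \<open>e\<close> the fibre is the single line \<open>i\<close>, so
  \<open>chart\<close> applies. Divisibility in the localisation means divisibility in
  \<open>B\<close> after multiplication by a power of \<open>e\<close>.\<close>

lemma local_chart:
  assumes i: "i < n" and e: "e \<in> carrier B" "\<rho> i e = \<one>\<^bsub>Q\<^esub>" "\<And>j. j < n \<Longrightarrow> j \<noteq> i \<Longrightarrow> \<rho> j e = \<zero>\<^bsub>Q\<^esub>"
  shows "\<exists>\<sigma>\<in>carrier A. \<exists>m. \<forall>f\<in>carrier P. \<forall>l::nat.
     (\<exists>k::nat. y [^]\<^bsub>B\<^esub> l divides\<^bsub>B\<^esub> (e [^]\<^bsub>B\<^esub> k \<otimes>\<^bsub>B\<^esub> \<psi> f)) \<longleftrightarrow> \<iota> x [^]\<^bsub>P\<^esub> l divides\<^bsub>P\<^esub> theta \<sigma> m f"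
proof -
  note r = \<rho>_hom[OF i]
  have e0: "e \<noteq> \<zero>\<^bsub>B\<^esub>" using e(2) B.ring_hom_zero'[OF Q.is_cring r] by auto
  let ?M = "powers B e"
  interpret F: fractions B ?M by (rule B.fractions_powers[OF e(1) e0])
  interpret C: "domain" "frac_ring B ?M" by (rule F.frac_domain)
  let ?C = "frac_ring B ?M" and ?fr = "mk_frac B ?M"
  have \<rho>M: "\<rho> i u = \<one>\<^bsub>Q\<^esub>" if u: "u \<in> ?M" for u
  proof -
    obtain k :: nat where "u = e [^]\<^bsub>B\<^esub> k" using u by (auto simp: powers_def)
    then show ?thesis by (simp add: B.ring_hom_nat_pow[OF Q.is_cring r e(1)] e(2))
  qed
  define j where "j b = ?fr b \<one>\<^bsub>B\<^esub>" for b
  have j: "j \<in> ring_hom B ?C" unfolding j_def by (rule F.frac_one_hom)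
  \<comment> \<open>The denominators are powers of \<open>e\<close> and restrict to 1, so a fraction
    restricts like the numerator of any representative; \<open>SOME\<close> picks one.\<close>
  define \<rho>' where "\<rho>' p = \<rho> i (fst (SOME z. z \<in> p \<and> snd z \<in> carrier B))" for p
  have \<rho>': "\<rho>' (?fr b u) = \<rho> i b" if b: "b \<in> carrier B" "u \<in> ?M" for b u
  proof -
    have "(b, u) \<in> ?fr b u" using F.mem_frac[OF b, of b u] b by blast
    moreover have "snd (b, u) \<in> carrier B" using F.M_closed[OF b(2)] by simp
    ultimately have "\<exists>z. z \<in> ?fr b u \<and> snd z \<in> carrier B" by metis
    then have "(SOME z. z \<in> ?fr b u \<and> snd z \<in> carrier B) \<in> ?fr b u" by (rule someI2_ex) (rule conjunct1)
    then obtain c v where cv: "(SOME z. z \<in> ?fr b u \<and> snd z \<in> carrier B) = (c, v)" "(c, v) \<in> ?fr b u"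
      by (metis prod.exhaust)
    then have c: "c \<in> carrier B" "v \<in> ?M" "?fr c v = ?fr b u" using F.mem_frac[OF b] by blast+
    then have "c \<otimes>\<^bsub>B\<^esub> u = b \<otimes>\<^bsub>B\<^esub> v" using F.frac_eq_iff[OF c(1,2) b] by blast
    then have "\<rho> i c \<otimes>\<^bsub>Q\<^esub> \<rho> i u = \<rho> i b \<otimes>\<^bsub>Q\<^esub> \<rho> i v"
      using ring_hom_mult[OF r c(1) F.M_closed[OF b(2)]] ring_hom_mult[OF r b(1) F.M_closed[OF c(2)]] by simp
    then have "\<rho> i c = \<rho> i b"
      using ring_hom_closed[OF r c(1)] ring_hom_closed[OF r b(1)] by (simp add: \<rho>M[OF b(2)] \<rho>M[OF c(2)])
    then show ?thesis by (simp add: \<rho>'_def cv(1))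
  qed
  have \<rho>'j: "\<rho>' (j b) = \<rho> i b" if "b \<in> carrier B" for b
    unfolding j_def by (rule \<rho>'[OF that F.M_one])
  have \<rho>'_hom: "\<rho>' \<in> ring_hom ?C Q"
  proof (rule ring_hom_memI)
    fix p assume p: "p \<in> carrier ?C"
    obtain b u where b: "b \<in> carrier B" "u \<in> ?M" "p = ?fr b u" by (rule F.frac_cases[OF p])
    show "\<rho>' p \<in> carrier Q" unfolding b(3) \<rho>'[OF b(1,2)] by (rule ring_hom_closed[OF r b(1)])
    fix q assume q: "q \<in> carrier ?C"
    obtain c v where c: "c \<in> carrier B" "v \<in> ?M" "q = ?fr c v" by (rule F.frac_cases[OF q])
    have u: "u \<in> carrier B" "v \<in> carrier B" using F.M_closed b c by auto
    show "\<rho>' (p \<otimes>\<^bsub>?C\<^esub> q) = \<rho>' p \<otimes>\<^bsub>Q\<^esub> \<rho>' q"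
      unfolding b(3) c(3) F.frac_mult[OF b(1,2) c(1,2)] \<rho>'[OF b(1,2)] \<rho>'[OF c(1,2)]
        \<rho>'[OF B.m_closed[OF b(1) c(1)] F.M_mult[OF b(2) c(2)]]
      by (rule ring_hom_mult[OF r b(1) c(1)])
    have "\<rho>' (p \<oplus>\<^bsub>?C\<^esub> q) = \<rho> i (b \<otimes>\<^bsub>B\<^esub> v \<oplus>\<^bsub>B\<^esub> c \<otimes>\<^bsub>B\<^esub> u)"
      unfolding b(3) c(3) F.frac_add[OF b(1,2) c(1,2)]
      by (rule \<rho>') (use b c u in simp_all)
    also have "\<dots> = \<rho> i b \<oplus>\<^bsub>Q\<^esub> \<rho> i c"
      using b(1) c(1) u ring_hom_closed[OF r]
      by (simp add: ring_hom_add[OF r] ring_hom_mult[OF r] \<rho>M[OF b(2)] \<rho>M[OF c(2)])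
    finally show "\<rho>' (p \<oplus>\<^bsub>?C\<^esub> q) = \<rho>' p \<oplus>\<^bsub>Q\<^esub> \<rho>' q"
      unfolding b(3) c(3) \<rho>'[OF b(1,2)] \<rho>'[OF c(1,2)] .
  next
    show "\<rho>' \<one>\<^bsub>?C\<^esub> = \<one>\<^bsub>Q\<^esub>" unfolding F.frac_one \<rho>'[OF B.one_closed F.M_one] by (rule ring_hom_one[OF r])
  qed
  have ker: "\<rho>' p = \<zero>\<^bsub>Q\<^esub> \<longleftrightarrow> j y divides\<^bsub>?C\<^esub> p" if p: "p \<in> carrier ?C" for p
  proof
    obtain b u where b: "b \<in> carrier B" "u \<in> ?M" "p = ?fr b u" by (rule F.frac_cases[OF p])
    have u: "u \<in> carrier B" using F.M_closed b by auto
    have eM: "e \<in> ?M" unfolding powers_def using B.nat_pow_eone[OF e(1)] by (metis (mono_tags) mem_Collect_eq)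
    assume "\<rho>' p = \<zero>\<^bsub>Q\<^esub>"
    then have \<rho>b: "\<rho> i b = \<zero>\<^bsub>Q\<^esub>" using \<rho>'[OF b(1,2)] b(3) by simp
    \<comment> \<open>\<open>b\<close> vanishes on component \<open>i\<close> and \<open>e\<close>
      on all others, so their product vanishes on the whole fibre.\<close>
    have "y divides\<^bsub>B\<^esub> (e \<otimes>\<^bsub>B\<^esub> b)"
    proof (rule \<rho>_kernel)
      fix k assume k: "k < n"
      show "\<rho> k (e \<otimes>\<^bsub>B\<^esub> b) = \<zero>\<^bsub>Q\<^esub>"
        using ring_hom_mult[OF \<rho>_hom[OF k] e(1) b(1)] ring_hom_closed[OF \<rho>_hom[OF k] b(1)]
          \<rho>b e(3)[OF k] ring_hom_closed[OF \<rho>_hom[OF k] e(1)] by (cases "k = i") simp_all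
    qed (use e b in simp)
    then obtain c where c: "c \<in> carrier B" "e \<otimes>\<^bsub>B\<^esub> b = y \<otimes>\<^bsub>B\<^esub> c" unfolding factor_def by metis
    have "p = j y \<otimes>\<^bsub>?C\<^esub> ?fr c (e \<otimes>\<^bsub>B\<^esub> u)"
    proof -
      have "j y \<otimes>\<^bsub>?C\<^esub> ?fr c (e \<otimes>\<^bsub>B\<^esub> u) = ?fr (y \<otimes>\<^bsub>B\<^esub> c) (\<one>\<^bsub>B\<^esub> \<otimes>\<^bsub>B\<^esub> (e \<otimes>\<^bsub>B\<^esub> u))"
        unfolding j_def by (rule F.frac_mult[OF y_closed F.M_one c(1) F.M_mult[OF eM b(2)]])
      also have "\<dots> = ?fr (e \<otimes>\<^bsub>B\<^esub> b) (e \<otimes>\<^bsub>B\<^esub> u)" using e u by (simp add: c(2))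
      also have "\<dots> = ?fr b u"
        using F.frac_eq_iff[OF B.m_closed[OF e(1) b(1)] F.M_mult[OF eM b(2)] b(1,2)] e(1) b(1) u
        by (simp add: B.m_ac)
      finally show ?thesis using b(3) by simp
    qed
    then show "j y divides\<^bsub>?C\<^esub> p"
      by (rule dividesI[rotated]) (rule F.frac_closed[OF c(1) F.M_mult[OF eM b(2)]])
  next
    assume "j y divides\<^bsub>?C\<^esub> p"
    then obtain q where q: "q \<in> carrier ?C" "p = j y \<otimes>\<^bsub>?C\<^esub> q" unfolding factor_def by metis
    show "\<rho>' p = \<zero>\<^bsub>Q\<^esub>"
      using ring_hom_closed[OF \<rho>'_hom q(1)]
      by (simp add: q(2) ring_hom_mult[OF \<rho>'_hom ring_hom_closed[OF j y_closed] q(1)] \<rho>'j[OF y_closed] \<rho>_y[OF i])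
  qed
  have j\<psi>: "j \<circ> \<psi> \<in> ring_hom P ?C" using \<psi>_hom j by (rule ring_hom_trans)
  have jy: "j y \<noteq> \<zero>\<^bsub>?C\<^esub>"
    unfolding j_def using F.frac_eq_zero_iff[OF y_closed F.M_one] y_nonzero by simp
  \<comment> \<open>Any lift of the coordinate of the line can serve as \<open>w0\<close>; the
    exponent of its denominator is the bound \<open>N\<close> that \<open>chart\<close> asks
    for.\<close>
  have "\<exists>b\<in>carrier B. \<forall>j<n. \<rho> j b = pvar \<kappa>" by (rule \<rho>_surj) simp
  then obtain w0 where w0: "w0 \<in> carrier B" "\<rho> i w0 = pvar \<kappa>" using i by metis
  obtain N :: nat and f0 where f0: "f0 \<in> carrier P" "y [^]\<^bsub>B\<^esub> N \<otimes>\<^bsub>B\<^esub> w0 = \<psi> f0"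
    using denominators[OF w0(1)] by metis
  have jpow: "j (y [^]\<^bsub>B\<^esub> k) = j y [^]\<^bsub>?C\<^esub> k" for k :: nat
    by (rule B.ring_hom_nat_pow[OF C.is_cring j y_closed])
  have "\<exists>\<sigma>\<in>carrier A. \<exists>m. \<forall>f\<in>carrier P. \<forall>l::nat.
     j y [^]\<^bsub>?C\<^esub> l divides\<^bsub>?C\<^esub> (j \<circ> \<psi>) f \<longleftrightarrow> \<iota> x [^]\<^bsub>P\<^esub> l divides\<^bsub>P\<^esub> theta \<sigma> m f"
  proof (rule chart[OF C.domain_axioms j\<psi> \<rho>'_hom _ jy ker])
    show "j y = (j \<circ> \<psi>) (\<iota> x)" by simp
    show "\<rho>' ((j \<circ> \<psi>) (\<iota> a)) = const_poly \<kappa> (\<pi> a)" if "a \<in> carrier A" for a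
      using \<rho>'j[of "\<psi> (\<iota> a)"] \<rho>_const[OF i that] that by simp
    show "j w0 \<in> carrier ?C" by (rule ring_hom_closed[OF j w0(1)])
    show "\<rho>' (j w0) = pvar \<kappa>" using \<rho>'j[OF w0(1)] w0(2) by simp
    show "f0 \<in> carrier P" by (rule f0(1))
    show "j y [^]\<^bsub>?C\<^esub> N \<otimes>\<^bsub>?C\<^esub> j w0 = (j \<circ> \<psi>) f0"
      using ring_hom_mult[OF j _ w0(1), of "y [^]\<^bsub>B\<^esub> N"] by (simp add: jpow f0(2)[symmetric])
  qed
  moreover have "j y [^]\<^bsub>?C\<^esub> l divides\<^bsub>?C\<^esub> j b \<longleftrightarrow> (\<exists>k::nat. y [^]\<^bsub>B\<^esub> l divides\<^bsub>B\<^esub> (e [^]\<^bsub>B\<^esub> k \<otimes>\<^bsub>B\<^esub> b))"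
    if b: "b \<in> carrier B" for b and l :: nat
  proof
    have yl: "y [^]\<^bsub>B\<^esub> l \<in> carrier B" by simp
    assume "j y [^]\<^bsub>?C\<^esub> l divides\<^bsub>?C\<^esub> j b"
    then obtain q where q: "q \<in> carrier ?C" "j b = j (y [^]\<^bsub>B\<^esub> l) \<otimes>\<^bsub>?C\<^esub> q" unfolding factor_def jpow by metis
    obtain c u where c: "c \<in> carrier B" "u \<in> ?M" "q = ?fr c u" by (rule F.frac_cases[OF q(1)])
    obtain k :: nat where k: "u = e [^]\<^bsub>B\<^esub> k" using c(2) by (auto simp: powers_def)
    have "?fr b \<one>\<^bsub>B\<^esub> = ?fr (y [^]\<^bsub>B\<^esub> l \<otimes>\<^bsub>B\<^esub> c) (\<one>\<^bsub>B\<^esub> \<otimes>\<^bsub>B\<^esub> u)"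
      using q(2) unfolding j_def c(3) F.frac_mult[OF yl F.M_one c(1,2)] .
    then have "b \<otimes>\<^bsub>B\<^esub> (\<one>\<^bsub>B\<^esub> \<otimes>\<^bsub>B\<^esub> u) = (y [^]\<^bsub>B\<^esub> l \<otimes>\<^bsub>B\<^esub> c) \<otimes>\<^bsub>B\<^esub> \<one>\<^bsub>B\<^esub>"
      by (rule iffD1[OF F.frac_eq_iff[OF b F.M_one B.m_closed[OF yl c(1)] F.M_mult[OF F.M_one c(2)]]])
    then have "e [^]\<^bsub>B\<^esub> k \<otimes>\<^bsub>B\<^esub> b = y [^]\<^bsub>B\<^esub> l \<otimes>\<^bsub>B\<^esub> c"
      using b c(1) yl e(1) by (simp add: k B.m_comm)
    then show "\<exists>k::nat. y [^]\<^bsub>B\<^esub> l divides\<^bsub>B\<^esub> (e [^]\<^bsub>B\<^esub> k \<otimes>\<^bsub>B\<^esub> b)" using c(1) by (metis dividesI)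
  next
    have yl: "y [^]\<^bsub>B\<^esub> l \<in> carrier B" by simp
    assume "\<exists>k::nat. y [^]\<^bsub>B\<^esub> l divides\<^bsub>B\<^esub> (e [^]\<^bsub>B\<^esub> k \<otimes>\<^bsub>B\<^esub> b)"
    then obtain k :: nat and c where c: "c \<in> carrier B" "e [^]\<^bsub>B\<^esub> k \<otimes>\<^bsub>B\<^esub> b = y [^]\<^bsub>B\<^esub> l \<otimes>\<^bsub>B\<^esub> c"
      unfolding factor_def by metis
    have u: "e [^]\<^bsub>B\<^esub> k \<in> ?M" unfolding powers_def by blast
    have "j (y [^]\<^bsub>B\<^esub> l) \<otimes>\<^bsub>?C\<^esub> ?fr c (e [^]\<^bsub>B\<^esub> k) = ?fr (y [^]\<^bsub>B\<^esub> l \<otimes>\<^bsub>B\<^esub> c) (\<one>\<^bsub>B\<^esub> \<otimes>\<^bsub>B\<^esub> e [^]\<^bsub>B\<^esub> k)"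
      unfolding j_def by (rule F.frac_mult[OF yl F.M_one c(1) u])
    also have "\<dots> = ?fr b \<one>\<^bsub>B\<^esub>"
      by (rule iffD2[OF F.frac_eq_iff[OF B.m_closed[OF yl c(1)] F.M_mult[OF F.M_one u] b F.M_one]])
         (use b e(1) in \<open>simp add: c(2)[symmetric] B.m_comm\<close>)
    finally have "j b = j y [^]\<^bsub>?C\<^esub> l \<otimes>\<^bsub>?C\<^esub> ?fr c (e [^]\<^bsub>B\<^esub> k)" by (simp only: j_def[of b] jpow)
    then show "j y [^]\<^bsub>?C\<^esub> l divides\<^bsub>?C\<^esub> j b"
      by (rule dividesI[rotated]) (rule F.frac_closed[OF c(1) u])
  qed
  ultimately show ?thesis by (simp only: o_apply \<psi>_closed cong: ball_cong)
qed

end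

text \<open>The charts cover the fibre. Once b = y^l c by induction, y divides a power of
  \<open>e i\<close> times \<open>c\<close>, and as \<open>e i\<close> is 1 on component
  \<open>i\<close>, \<open>c\<close> vanishes there. Vanishing on all components yields one more
  factor y.\<close>

lemma y_pow_divides_charts:
  assumes fc: "fibre_charts n \<rho>"
    and e: "\<And>i. i < n \<Longrightarrow> e i \<in> carrier B" "\<And>i. i < n \<Longrightarrow> \<rho> i (e i) = \<one>\<^bsub>Q\<^esub>"
    and b: "b \<in> carrier B"
    and d: "\<And>i. i < n \<Longrightarrow> \<exists>k::nat. y [^]\<^bsub>B\<^esub> l divides\<^bsub>B\<^esub> (e i [^]\<^bsub>B\<^esub> k \<otimes>\<^bsub>B\<^esub> b)"
  shows "y [^]\<^bsub>B\<^esub> (l::nat) divides\<^bsub>B\<^esub> b"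
  using d
proof (induction l)
  case 0
  then show ?case using b by (intro dividesI[of b]) simp_all
next
  case (Suc l)
  have ek: "e i [^]\<^bsub>B\<^esub> (k::nat) \<in> carrier B" if "i < n" for i k using e(1)[OF that] by simp
  have "\<exists>k::nat. y [^]\<^bsub>B\<^esub> l divides\<^bsub>B\<^esub> (e i [^]\<^bsub>B\<^esub> k \<otimes>\<^bsub>B\<^esub> b)" if i: "i < n" for i
  proof -
    obtain k :: nat where k: "y [^]\<^bsub>B\<^esub> Suc l divides\<^bsub>B\<^esub> (e i [^]\<^bsub>B\<^esub> k \<otimes>\<^bsub>B\<^esub> b)" using Suc.prems[OF i] by metis
    have "y [^]\<^bsub>B\<^esub> l divides\<^bsub>B\<^esub> (e i [^]\<^bsub>B\<^esub> k \<otimes>\<^bsub>B\<^esub> b)"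
      by (rule B.pow_divides_mono[OF y_closed B.m_closed[OF ek[OF i] b] k]) simp
    then show ?thesis by (rule exI)
  qed
  then obtain c where c: "c \<in> carrier B" "b = y [^]\<^bsub>B\<^esub> l \<otimes>\<^bsub>B\<^esub> c"
    using Suc.IH unfolding factor_def by metis
  have yl: "y [^]\<^bsub>B\<^esub> l \<in> carrier B" by simp
  have "y divides\<^bsub>B\<^esub> c"
  proof (rule \<rho>_kernel[OF fc c(1)])
    fix i assume i: "i < n"
    note r = \<rho>_hom[OF fc i]
    obtain k :: nat where k: "y [^]\<^bsub>B\<^esub> Suc l divides\<^bsub>B\<^esub> (e i [^]\<^bsub>B\<^esub> k \<otimes>\<^bsub>B\<^esub> b)" using Suc.prems[OF i] by metis
    have "e i [^]\<^bsub>B\<^esub> k \<otimes>\<^bsub>B\<^esub> b = y [^]\<^bsub>B\<^esub> l \<otimes>\<^bsub>B\<^esub> (e i [^]\<^bsub>B\<^esub> k \<otimes>\<^bsub>B\<^esub> c)"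
      unfolding c(2) using ek[OF i] yl c(1) by (simp add: B.m_lcomm)
    then have "y [^]\<^bsub>B\<^esub> (l + 1) divides\<^bsub>B\<^esub> (y [^]\<^bsub>B\<^esub> l \<otimes>\<^bsub>B\<^esub> (e i [^]\<^bsub>B\<^esub> k \<otimes>\<^bsub>B\<^esub> c))" using k by simp
    then have "y [^]\<^bsub>B\<^esub> (1::nat) divides\<^bsub>B\<^esub> (e i [^]\<^bsub>B\<^esub> k \<otimes>\<^bsub>B\<^esub> c)"
      by (rule iffD1[OF B.pow_divides_cancel[OF y_closed y_nonzero B.m_closed[OF ek[OF i] c(1)]]])
    then have "y divides\<^bsub>B\<^esub> (e i [^]\<^bsub>B\<^esub> k \<otimes>\<^bsub>B\<^esub> c)" by (simp only: B.nat_pow_eone[OF y_closed])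
    then have "\<rho> i (e i [^]\<^bsub>B\<^esub> k \<otimes>\<^bsub>B\<^esub> c) = \<zero>\<^bsub>Q\<^esub>"
      by (rule \<rho>_divides[OF fc i B.m_closed[OF ek[OF i] c(1)]])
    then show "\<rho> i c = \<zero>\<^bsub>Q\<^esub>"
      using ring_hom_closed[OF r c(1)]
      by (simp add: ring_hom_mult[OF r ek[OF i] c(1)] B.ring_hom_nat_pow[OF Q.is_cring r e(1)[OF i]] e(2)[OF i])
  qed
  then have "y [^]\<^bsub>B\<^esub> (1::nat) divides\<^bsub>B\<^esub> c" by (simp only: B.nat_pow_eone[OF y_closed])
  then have "y [^]\<^bsub>B\<^esub> (l + 1) divides\<^bsub>B\<^esub> (y [^]\<^bsub>B\<^esub> l \<otimes>\<^bsub>B\<^esub> c)"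
    by (rule iffD2[OF B.pow_divides_cancel[OF y_closed y_nonzero c(1)]])
  then show ?case by (simp add: c(2))
qed

text \<open>Each component gives a disc by \<open>local_chart\<close>, and since the charts cover
  the fibre, the local criteria combine into one for \<open>B\<close>. Distinct components have
  separated discs because the lifted idempotents tell them apart.\<close>

lemma describes_ex:
  assumes fc: "fibre_charts n \<rho>" and n: "n > 0"
  shows "\<exists>\<Delta>. disc_family \<Delta> \<and> describes \<Delta>"
proof -
  have "\<exists>e. e \<in> carrier B \<and> \<rho> i e = \<one>\<^bsub>Q\<^esub> \<and> (\<forall>j<n. j \<noteq> i \<longrightarrow> \<rho> j e = \<zero>\<^bsub>Q\<^esub>)" if "i < n" for i
    using idempotent_lift[OF fc that] by metis
  then obtain e where e: "\<And>i. i < n \<Longrightarrow> e i \<in> carrier B" "\<And>i. i < n \<Longrightarrow> \<rho> i (e i) = \<one>\<^bsub>Q\<^esub>"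
      "\<And>i j. i < n \<Longrightarrow> j < n \<Longrightarrow> j \<noteq> i \<Longrightarrow> \<rho> j (e i) = \<zero>\<^bsub>Q\<^esub>"
    by metis
  have "\<exists>\<sigma> m. \<sigma> \<in> carrier A \<and> (\<forall>f\<in>carrier P. \<forall>l::nat.
     (\<exists>k::nat. y [^]\<^bsub>B\<^esub> l divides\<^bsub>B\<^esub> (e i [^]\<^bsub>B\<^esub> k \<otimes>\<^bsub>B\<^esub> \<psi> f)) \<longleftrightarrow> \<iota> x [^]\<^bsub>P\<^esub> l divides\<^bsub>P\<^esub> theta \<sigma> m f)" if i: "i < n" for i
    using local_chart[OF fc i e(1)[OF i] e(2)[OF i] e(3)[OF i]] by metis
  then obtain \<sigma> m where \<sigma>: "\<And>i. i < n \<Longrightarrow> \<sigma> i \<in> carrier A"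
    and ch: "\<And>i f l. i < n \<Longrightarrow> f \<in> carrier P \<Longrightarrow> (\<exists>k::nat. y [^]\<^bsub>B\<^esub> (l::nat) divides\<^bsub>B\<^esub> (e i [^]\<^bsub>B\<^esub> k \<otimes>\<^bsub>B\<^esub> \<psi> f)) \<longleftrightarrow>
        \<iota> x [^]\<^bsub>P\<^esub> l divides\<^bsub>P\<^esub> theta (\<sigma> i) (m i) f"
    by metis
  have ek: "e i [^]\<^bsub>B\<^esub> (k::nat) \<in> carrier B" if "i < n" for i k using e(1)[OF that] by simp
  \<comment> \<open>Write \<open>e i\<close> as \<open>\<psi> f\<close> / y^M. Since
    \<open>e j\<close> times \<open>e i\<close> vanishes on the whole fibre, \<open>f\<close> has
    order at least M + 1 on disc \<open>j\<close>, hence on disc \<open>i\<close> if that lies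
    inside. Then y divides a power of \<open>e i\<close>, although this power is 1 on component
    \<open>i\<close>.\<close>
  have nested: False
    if i: "i < n" and j: "j < n" and ij: "i \<noteq> j" and w: "disc_within (\<sigma> i, m i) (\<sigma> j, m j)" for i j
  proof -
    note r = \<rho>_hom[OF fc i]
    obtain M :: nat and f where f: "f \<in> carrier P" "y [^]\<^bsub>B\<^esub> M \<otimes>\<^bsub>B\<^esub> e i = \<psi> f"
      using denominators[OF e(1)[OF i]] by metis
    have ee: "e j \<otimes>\<^bsub>B\<^esub> e i \<in> carrier B" using e(1) i j by simp
    have yM: "y [^]\<^bsub>B\<^esub> M \<in> carrier B" by simp
    have "y divides\<^bsub>B\<^esub> (e j \<otimes>\<^bsub>B\<^esub> e i)"
    proof (rule \<rho>_kernel[OF fc ee])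
      fix k assume k: "k < n"
      note r = \<rho>_hom[OF fc k]
      have "\<rho> k (e j) = \<zero>\<^bsub>Q\<^esub> \<or> \<rho> k (e i) = \<zero>\<^bsub>Q\<^esub>" using e(3) i j k ij by metis
      then show "\<rho> k (e j \<otimes>\<^bsub>B\<^esub> e i) = \<zero>\<^bsub>Q\<^esub>"
        using ring_hom_closed[OF r e(1)[OF i]] ring_hom_closed[OF r e(1)[OF j]]
        by (auto simp: ring_hom_mult[OF r e(1)[OF j] e(1)[OF i]])
    qed
    then have "y [^]\<^bsub>B\<^esub> (1::nat) divides\<^bsub>B\<^esub> (e j \<otimes>\<^bsub>B\<^esub> e i)" by (simp only: B.nat_pow_eone[OF y_closed])
    then have "y [^]\<^bsub>B\<^esub> (M + 1) divides\<^bsub>B\<^esub> (y [^]\<^bsub>B\<^esub> M \<otimes>\<^bsub>B\<^esub> (e j \<otimes>\<^bsub>B\<^esub> e i))"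
      by (rule iffD2[OF B.pow_divides_cancel[OF y_closed y_nonzero ee]])
    moreover have "y [^]\<^bsub>B\<^esub> M \<otimes>\<^bsub>B\<^esub> (e j \<otimes>\<^bsub>B\<^esub> e i) = e j [^]\<^bsub>B\<^esub> (1::nat) \<otimes>\<^bsub>B\<^esub> \<psi> f"
      using yM e(1)[OF i] e(1)[OF j] by (simp add: f(2)[symmetric] B.m_lcomm)
    ultimately have "\<exists>k::nat. y [^]\<^bsub>B\<^esub> (M + 1) divides\<^bsub>B\<^esub> (e j [^]\<^bsub>B\<^esub> k \<otimes>\<^bsub>B\<^esub> \<psi> f)" by metis
    then have "\<iota> x [^]\<^bsub>P\<^esub> (M + 1) divides\<^bsub>P\<^esub> theta (\<sigma> j) (m j) f" by (simp only: ch[OF j f(1)])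
    then have "\<iota> x [^]\<^bsub>P\<^esub> (M + 1) divides\<^bsub>P\<^esub> theta (\<sigma> i) (m i) f"
      by (rule theta_within[OF \<sigma>[OF j] \<sigma>[OF i] w f(1)])
    then obtain k :: nat where k: "y [^]\<^bsub>B\<^esub> (M + 1) divides\<^bsub>B\<^esub> (e i [^]\<^bsub>B\<^esub> k \<otimes>\<^bsub>B\<^esub> \<psi> f)"
      using ch[OF i f(1)] by metis
    have "e i [^]\<^bsub>B\<^esub> k \<otimes>\<^bsub>B\<^esub> \<psi> f = y [^]\<^bsub>B\<^esub> M \<otimes>\<^bsub>B\<^esub> e i [^]\<^bsub>B\<^esub> Suc k"
      using yM e(1)[OF i] ek[OF i] by (simp add: f(2)[symmetric] B.m_ac)
    then have "y [^]\<^bsub>B\<^esub> (M + 1) divides\<^bsub>B\<^esub> (y [^]\<^bsub>B\<^esub> M \<otimes>\<^bsub>B\<^esub> e i [^]\<^bsub>B\<^esub> Suc k)" using k by simp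
    then have "y [^]\<^bsub>B\<^esub> (1::nat) divides\<^bsub>B\<^esub> (e i [^]\<^bsub>B\<^esub> Suc k)"
      by (rule iffD1[OF B.pow_divides_cancel[OF y_closed y_nonzero ek[OF i]]])
    then have "\<rho> i (e i [^]\<^bsub>B\<^esub> Suc k) = \<zero>\<^bsub>Q\<^esub>"
      using \<rho>_divides[OF fc i ek[OF i]] by (simp only: B.nat_pow_eone[OF y_closed])
    then have "\<one>\<^bsub>Q\<^esub> [^]\<^bsub>Q\<^esub> Suc k = \<zero>\<^bsub>Q\<^esub>"
      by (simp only: B.ring_hom_nat_pow[OF Q.is_cring r e(1)[OF i]] e(2)[OF i])
    then show False by simp
  qed
  define \<Delta> where "\<Delta> = (\<lambda>i. (\<sigma> i, m i)) ` {..<n}"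
  have "disc_family \<Delta>"
    unfolding disc_family_def
  proof (intro conjI ballI impI)
    show "finite \<Delta>" "\<Delta> \<noteq> {}" "fst ` \<Delta> \<subseteq> carrier A" using n \<sigma> by (auto simp: \<Delta>_def)
    fix p q assume "p \<in> \<Delta>" "q \<in> \<Delta>" and pq: "p \<noteq> q"
    then obtain i j where ij: "i < n" "p = (\<sigma> i, m i)" "j < n" "q = (\<sigma> j, m j)" by (auto simp: \<Delta>_def)
    then have "i \<noteq> j" using pq by auto
    then have "\<not> disc_within p q \<and> \<not> disc_within q p" using nested ij by metis
    then show "separated p q" using separated_iff_not_within[of p q] \<sigma> ij by simp
  qed
  moreover have "describes \<Delta>"
    unfolding describes_def
  proof (intro ballI allI)
    fix f and l :: nat assume f: "f \<in> carrier P"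
    have "y [^]\<^bsub>B\<^esub> l divides\<^bsub>B\<^esub> \<psi> f \<longleftrightarrow> (\<forall>i<n. \<exists>k::nat. y [^]\<^bsub>B\<^esub> l divides\<^bsub>B\<^esub> (e i [^]\<^bsub>B\<^esub> k \<otimes>\<^bsub>B\<^esub> \<psi> f))"
    proof
      assume d: "y [^]\<^bsub>B\<^esub> l divides\<^bsub>B\<^esub> \<psi> f"
      show "\<forall>i<n. \<exists>k::nat. y [^]\<^bsub>B\<^esub> l divides\<^bsub>B\<^esub> (e i [^]\<^bsub>B\<^esub> k \<otimes>\<^bsub>B\<^esub> \<psi> f)"
      proof (intro allI impI exI)
        fix i assume i: "i < n"
        show "y [^]\<^bsub>B\<^esub> l divides\<^bsub>B\<^esub> (e i [^]\<^bsub>B\<^esub> (0::nat) \<otimes>\<^bsub>B\<^esub> \<psi> f)" using d f by simp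
      qed
    qed (rule y_pow_divides_charts[OF fc e(1,2) \<psi>_closed[OF f]], simp_all)
    also have "\<dots> \<longleftrightarrow> (\<forall>i<n. \<iota> x [^]\<^bsub>P\<^esub> l divides\<^bsub>P\<^esub> theta (\<sigma> i) (m i) f)"
      using ch[OF _ f] by metis
    also have "\<dots> \<longleftrightarrow> (\<forall>(\<sigma>, m)\<in>\<Delta>. \<iota> x [^]\<^bsub>P\<^esub> l divides\<^bsub>P\<^esub> theta \<sigma> m f)"
      by (auto simp: \<Delta>_def)
    finally show "y [^]\<^bsub>B\<^esub> l divides\<^bsub>B\<^esub> \<psi> f \<longleftrightarrow> (\<forall>(\<sigma>, m)\<in>\<Delta>. \<iota> x [^]\<^bsub>P\<^esub> l divides\<^bsub>P\<^esub> theta \<sigma> m f)" .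
  qed
  ultimately show ?thesis by metis
qed

end

section \<open>Polynomials that peak on one disc\<close>

context base_ring
begin

abbreviation thd where "thd p \<equiv> theta (fst p) (snd p :: nat)"

lemma theta_linear_divides:
  assumes "\<sigma> \<in> carrier A" "\<tau> \<in> carrier A" "x [^] (d::nat) divides (\<sigma> \<ominus> \<tau>)" "d \<le> m"
  shows "\<iota> x [^]\<^bsub>P\<^esub> d divides\<^bsub>P\<^esub> theta \<sigma> m (X \<ominus>\<^bsub>P\<^esub> \<iota> \<tau>)"
proof -
  have xd: "\<iota> x [^]\<^bsub>P\<^esub> d \<in> carrier P" by simp
  have "\<iota> (x [^] d) divides\<^bsub>P\<^esub> \<iota> (\<sigma> \<ominus> \<tau>)"
    by (rule iffD2[OF const_divides_const]) (use assms in simp_all)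
  then have 1: "\<iota> x [^]\<^bsub>P\<^esub> d divides\<^bsub>P\<^esub> \<iota> (\<sigma> \<ominus> \<tau>)"
    by (simp only: ring_hom_nat_pow[OF P.is_cring \<iota>_hom x_closed])
  have "\<iota> x [^]\<^bsub>P\<^esub> m \<otimes>\<^bsub>P\<^esub> X = \<iota> x [^]\<^bsub>P\<^esub> d \<otimes>\<^bsub>P\<^esub> (\<iota> x [^]\<^bsub>P\<^esub> (m - d) \<otimes>\<^bsub>P\<^esub> X)"
    using assms(4) by (simp add: P.m_assoc[symmetric] P.nat_pow_mult)
  then have "\<iota> x [^]\<^bsub>P\<^esub> d divides\<^bsub>P\<^esub> (\<iota> x [^]\<^bsub>P\<^esub> m \<otimes>\<^bsub>P\<^esub> X)"
    by (rule dividesI[rotated]) simp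
  then show ?thesis unfolding theta_linear[OF assms(1,2)] by (rule P.divides_add[OF xd 1])
qed

text \<open>The polynomial \<open>f\<close> is a product of powers \<open>(X - \<sigma>)\<^sup>r\<close>; adding the factor of a disc farther
  from \<open>q\<close> does not spoil the estimates already obtained on the discs closer to \<open>q\<close>.\<close>

lemma peak:
  assumes q: "fst q \<in> carrier A" and S: "finite S" "fst ` S \<subseteq> carrier A"
    and K: "\<one>\<^bsub>Q\<^esub> \<in> K" "\<And>u v. u \<in> K \<Longrightarrow> v \<in> K \<Longrightarrow> u \<otimes>\<^bsub>Q\<^esub> v \<in> K"
    and d: "\<And>p. p \<in> S \<Longrightarrow> d p < snd p" "\<And>p. p \<in> S \<Longrightarrow> x [^] (d p :: nat) divides (fst q \<ominus> fst p)"
    and u: "\<And>p. p \<in> S \<Longrightarrow> u p \<in> carrier P" "\<And>p. p \<in> S \<Longrightarrow> red (u p) \<in> K"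
       "\<And>p. p \<in> S \<Longrightarrow> thd q (X \<ominus>\<^bsub>P\<^esub> \<iota> (fst p)) = \<iota> x [^]\<^bsub>P\<^esub> d p \<otimes>\<^bsub>P\<^esub> u p"
  shows "\<exists>f\<in>carrier P. \<exists>s::nat. \<exists>g\<in>carrier P. thd q f = \<iota> x [^]\<^bsub>P\<^esub> s \<otimes>\<^bsub>P\<^esub> g \<and> red g \<in> K \<and>
     (\<forall>p\<in>S. \<iota> x [^]\<^bsub>P\<^esub> Suc s divides\<^bsub>P\<^esub> thd p f)"
  using S(1) S(2) d u
\<comment> \<open>The ranking by the negative of \<open>d\<close> inserts last the disc with the
  smallest \<open>d\<close>, which is the one farthest from \<open>q\<close>.\<close>
proof (induction rule: finite_ranking_induct[where f = "\<lambda>p. - int (d p)"])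
  case empty
  have "thd q \<one>\<^bsub>P\<^esub> = \<iota> x [^]\<^bsub>P\<^esub> (0::nat) \<otimes>\<^bsub>P\<^esub> \<one>\<^bsub>P\<^esub>" using ring_hom_one[OF theta_hom[OF q]] by simp
  moreover have "red \<one>\<^bsub>P\<^esub> \<in> K" using ring_hom_one[OF red_hom] K by simp
  ultimately show ?case
    by (intro bexI[OF _ P.one_closed] exI[of _ "0::nat"]) (simp only: ball_empty simp_thms)
next
  case (insert p S)
  have "\<exists>f\<in>carrier P. \<exists>s::nat. \<exists>g\<in>carrier P. thd q f = \<iota> x [^]\<^bsub>P\<^esub> s \<otimes>\<^bsub>P\<^esub> g \<and> red g \<in> K \<and>
     (\<forall>p\<in>S. \<iota> x [^]\<^bsub>P\<^esub> Suc s divides\<^bsub>P\<^esub> thd p f)"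
    by (rule insert.IH) (use insert.prems in simp_all)
  then obtain f s g where f: "f \<in> carrier P" "g \<in> carrier P" "thd q f = \<iota> x [^]\<^bsub>P\<^esub> (s::nat) \<otimes>\<^bsub>P\<^esub> g" "red g \<in> K"
    and fS: "\<And>p. p \<in> S \<Longrightarrow> \<iota> x [^]\<^bsub>P\<^esub> Suc s divides\<^bsub>P\<^esub> thd p f"
    by metis
  have pc: "fst p \<in> carrier A" using insert.prems(1) by simp
  define l where "l = X \<ominus>\<^bsub>P\<^esub> \<iota> (fst p)"
  \<comment> \<open>On \<open>p\<close> itself the linear factor has order at least d + 1 with d =
    \<open>d p\<close>, and nothing is known about the order of \<open>f\<close> there. Since (d +
    1)(s + 1) exceeds s + d(s + 1) by one, the power s + 1 makes up for the old order
    \<open>s\<close> at \<open>q\<close>.\<close>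
  define r where "r = Suc s"
  let ?up = "u p"
  have lc: "l \<in> carrier P" unfolding l_def using pc by simp
  have lr: "l [^]\<^bsub>P\<^esub> r \<in> carrier P" using lc by simp
  have xk: "\<iota> x [^]\<^bsub>P\<^esub> k \<in> carrier P" for k :: nat by simp
  have up: "?up \<in> carrier P" "red ?up \<in> K" "thd q l = \<iota> x [^]\<^bsub>P\<^esub> d p \<otimes>\<^bsub>P\<^esub> ?up"
    unfolding l_def using insert.prems by simp_all
  have redpow: "red (?up [^]\<^bsub>P\<^esub> k) \<in> K" for k :: nat
  proof (induction k)
    case 0
    then show ?case using ring_hom_one[OF red_hom] K by simp
  next
    case (Suc k)
    then show ?case using K(2) up by (simp add: ring_hom_mult[OF red_hom])
  qed
  have th: "thd t (f \<otimes>\<^bsub>P\<^esub> l [^]\<^bsub>P\<^esub> r) = thd t f \<otimes>\<^bsub>P\<^esub> thd t l [^]\<^bsub>P\<^esub> r" if "fst t \<in> carrier A" for t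
    by (simp only: ring_hom_mult[OF theta_hom[OF that] f(1) lr] P.ring_hom_nat_pow[OF P.is_cring theta_hom[OF that] lc])
  have "thd q (f \<otimes>\<^bsub>P\<^esub> l [^]\<^bsub>P\<^esub> r) = (\<iota> x [^]\<^bsub>P\<^esub> s \<otimes>\<^bsub>P\<^esub> g) \<otimes>\<^bsub>P\<^esub> (\<iota> x [^]\<^bsub>P\<^esub> (d p * r) \<otimes>\<^bsub>P\<^esub> ?up [^]\<^bsub>P\<^esub> r)"
    unfolding th[OF q] f(3) up(3) using up(1) by (simp add: P.nat_pow_distrib P.nat_pow_pow)
  also have "\<dots> = \<iota> x [^]\<^bsub>P\<^esub> (s + d p * r) \<otimes>\<^bsub>P\<^esub> (g \<otimes>\<^bsub>P\<^esub> ?up [^]\<^bsub>P\<^esub> r)"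
    using f(2) up(1) xk by (simp add: P.nat_pow_mult[symmetric] P.m_ac)
  finally have 1: "thd q (f \<otimes>\<^bsub>P\<^esub> l [^]\<^bsub>P\<^esub> r) = \<iota> x [^]\<^bsub>P\<^esub> (s + d p * r) \<otimes>\<^bsub>P\<^esub> (g \<otimes>\<^bsub>P\<^esub> ?up [^]\<^bsub>P\<^esub> r)" .
  have "red (g \<otimes>\<^bsub>P\<^esub> ?up [^]\<^bsub>P\<^esub> r) = red g \<otimes>\<^bsub>Q\<^esub> red (?up [^]\<^bsub>P\<^esub> r)"
    using f(2) up(1) by (intro ring_hom_mult[OF red_hom]) simp_all
  then have 2: "red (g \<otimes>\<^bsub>P\<^esub> ?up [^]\<^bsub>P\<^esub> r) \<in> K" using K(2)[OF f(4) redpow] by simp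
  have 3: "\<iota> x [^]\<^bsub>P\<^esub> Suc (s + d p * r) divides\<^bsub>P\<^esub> thd t (f \<otimes>\<^bsub>P\<^esub> l [^]\<^bsub>P\<^esub> r)" if t: "t \<in> insert p S" for t
  proof -
    have tc: "fst t \<in> carrier A" using insert.prems(1) t by auto
    have tf: "thd t f \<in> carrier P" and tl: "thd t l \<in> carrier P" using tc f lc by simp_all
    have tlr: "thd t l [^]\<^bsub>P\<^esub> r \<in> carrier P" using tl by simp
    show ?thesis
    proof (cases "t \<in> S")
      case True
      have dd: "d p \<le> d t" using insert.hyps(2)[OF True] by simp
      have "x [^] d p divides (fst q \<ominus> fst t)"
        by (rule pow_divides_mono[OF x_closed _ insert.prems(3)[OF t] dd]) (use q tc in simp)
      then have a: "x [^] d p divides (fst t \<ominus> fst q)"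
        by (rule minus_swap_divides[OF q tc, rotated]) simp
      have b: "x [^] d p divides (fst q \<ominus> fst p)" by (rule insert.prems(3)) simp
      have "fst t \<ominus> fst p = (fst t \<ominus> fst q) \<oplus> (fst q \<ominus> fst p)" using q tc pc by algebra
      then have "x [^] d p divides (fst t \<ominus> fst p)"
        using divides_add[OF _ a b] by simp
      moreover have "d p \<le> snd t" using insert.prems(2)[OF t] dd by simp
      ultimately have "\<iota> x [^]\<^bsub>P\<^esub> d p divides\<^bsub>P\<^esub> thd t l"
        unfolding l_def by (rule theta_linear_divides[OF tc pc])
      then have "\<iota> x [^]\<^bsub>P\<^esub> (d p * r) divides\<^bsub>P\<^esub> (thd t l [^]\<^bsub>P\<^esub> r)"
        by (rule P.pow_divides_pow[OF \<iota>_x_closed tl])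
      then have "\<iota> x [^]\<^bsub>P\<^esub> (Suc s + d p * r) divides\<^bsub>P\<^esub> (thd t f \<otimes>\<^bsub>P\<^esub> thd t l [^]\<^bsub>P\<^esub> r)"
        by (rule P.pow_divides_mult[OF \<iota>_x_closed tf tlr fS[OF True]])
      then show ?thesis unfolding th[OF tc] by simp
    next
      case False
      then have tp: "t = p" using t by simp
      have "fst t \<ominus> fst p = \<zero>" using tp pc by simp
      then have "x [^] snd t divides (fst t \<ominus> fst p)" by (intro dividesI[of \<zero>]) simp_all
      then have "\<iota> x [^]\<^bsub>P\<^esub> snd t divides\<^bsub>P\<^esub> thd t l"
        unfolding l_def by (rule theta_linear_divides[OF tc pc]) simp
      then have "\<iota> x [^]\<^bsub>P\<^esub> (d p + 1) divides\<^bsub>P\<^esub> thd t l"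
        by (rule P.pow_divides_mono[OF \<iota>_x_closed tl]) (use insert.prems(2)[OF t] tp in simp)
      then have A: "\<iota> x [^]\<^bsub>P\<^esub> ((d p + 1) * r) divides\<^bsub>P\<^esub> (thd t l [^]\<^bsub>P\<^esub> r)"
        by (rule P.pow_divides_pow[OF \<iota>_x_closed tl])
      have "\<iota> x [^]\<^bsub>P\<^esub> (0::nat) divides\<^bsub>P\<^esub> thd t f" using tf by (intro dividesI[of "thd t f"]) simp_all
      then have "\<iota> x [^]\<^bsub>P\<^esub> (0 + (d p + 1) * r) divides\<^bsub>P\<^esub> (thd t f \<otimes>\<^bsub>P\<^esub> thd t l [^]\<^bsub>P\<^esub> r)"
        by (rule P.pow_divides_mult[OF \<iota>_x_closed tf tlr _ A])
      moreover have "0 + (d p + 1) * r = Suc (s + d p * r)" by (simp add: r_def)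
      ultimately show ?thesis unfolding th[OF tc] by simp
    qed
  qed
  have "f \<otimes>\<^bsub>P\<^esub> l [^]\<^bsub>P\<^esub> r \<in> carrier P" "g \<otimes>\<^bsub>P\<^esub> ?up [^]\<^bsub>P\<^esub> r \<in> carrier P"
    using f lr up(1) by simp_all
  then show ?case using 1 2 3 by metis
qed

lemma theta_linear_factor:
  assumes "\<sigma> \<in> carrier A" "\<tau> \<in> carrier A" "c \<in> carrier A" "\<sigma> \<ominus> \<tau> = x [^] (d::nat) \<otimes> c" "d \<le> m"
  shows "theta \<sigma> m (X \<ominus>\<^bsub>P\<^esub> \<iota> \<tau>) = \<iota> x [^]\<^bsub>P\<^esub> d \<otimes>\<^bsub>P\<^esub> (X \<otimes>\<^bsub>P\<^esub> \<iota> x [^]\<^bsub>P\<^esub> (m - d) \<oplus>\<^bsub>P\<^esub> \<iota> c)"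
proof -
  have "\<iota> x [^]\<^bsub>P\<^esub> m = \<iota> x [^]\<^bsub>P\<^esub> d \<otimes>\<^bsub>P\<^esub> \<iota> x [^]\<^bsub>P\<^esub> (m - d)" using assms(5) by (simp add: P.nat_pow_mult)
  then show ?thesis unfolding theta_linear[OF assms(1,2)] assms(4)
    using assms(3) by (simp add: ring_hom_mult[OF \<iota>_hom] ring_hom_nat_pow[OF P.is_cring \<iota>_hom] P.r_distr P.a_comm P.m_ac)
qed

lemma x_not_divides_one: "\<not> x divides \<one>"
proof
  assume "x divides \<one>"
  then have "\<pi> \<one> = \<zero>\<^bsub>\<kappa>\<^esub>" using \<pi>_zero_iff by simp
  then show False using ring_hom_one[OF \<pi>_hom] by simp
qed

text \<open>Let \<open>d\<close> be the smaller of the exponent of \<open>q\<close> and the order of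
  the difference of centres; then t - \<open>fst p\<close> becomes x^d u on \<open>q\<close>. If
  \<open>q\<close> is not inside \<open>p\<close>, then \<open>d\<close> is below the exponent of
  \<open>p\<close>, which is the order of t - \<open>fst p\<close> on \<open>p\<close>. Maximality
  of \<open>d\<close> keeps \<open>u\<close> nonzero modulo \<open>x\<close>, so \<open>peak\<close>
  applies with the nonzero polynomials as \<open>K\<close>.\<close>

lemma disc_not_within_peak:
  assumes q: "fst q \<in> carrier A" and S: "finite S" "fst ` S \<subseteq> carrier A"
    and nw: "\<And>p. p \<in> S \<Longrightarrow> \<not> disc_within q p"
  shows "\<exists>f\<in>carrier P. \<exists>s::nat. \<not> \<iota> x [^]\<^bsub>P\<^esub> Suc s divides\<^bsub>P\<^esub> thd q f \<and>
     (\<forall>p\<in>S. \<iota> x [^]\<^bsub>P\<^esub> Suc s divides\<^bsub>P\<^esub> thd p f)"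
proof -
  have "\<exists>d u. d < snd p \<and> x [^] (d::nat) divides (fst q \<ominus> fst p) \<and> u \<in> carrier P \<and> red u \<in> carrier Q - {\<zero>\<^bsub>Q\<^esub>} \<and>
      thd q (X \<ominus>\<^bsub>P\<^esub> \<iota> (fst p)) = \<iota> x [^]\<^bsub>P\<^esub> d \<otimes>\<^bsub>P\<^esub> u" if p: "p \<in> S" for p
  proof -
    have pc: "fst p \<in> carrier A" using S p by auto
    let ?\<delta> = "fst q \<ominus> fst p" and ?T = "\<lambda>k. k \<le> snd q \<and> x [^] (k::nat) divides (fst q \<ominus> fst p)"
    have \<delta>: "?\<delta> \<in> carrier A" using q pc by simp
    define d where "d = (GREATEST k. ?T k)"
    have T0: "?T 0" using \<delta> by (intro conjI dividesI[of ?\<delta>]) simp_all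
    have Td: "?T d" unfolding d_def by (rule GreatestI_nat[of ?T 0 "snd q", OF T0]) simp
    have max: "k \<le> d" if "?T k" for k unfolding d_def by (rule Greatest_le_nat[of ?T k "snd q", OF that]) simp
    obtain c where c: "c \<in> carrier A" "?\<delta> = x [^] d \<otimes> c" using Td unfolding factor_def by metis
    have dm: "d < snd p"
    proof (rule ccontr)
      assume "\<not> d < snd p"
      then have le: "snd p \<le> d" by simp
      have "x [^] snd p divides ?\<delta>" by (rule pow_divides_mono[OF x_closed \<delta> conjunct2[OF Td] le])
      then have "disc_within q p" unfolding disc_within_def using le Td by simp
      then show False using nw p by simp
    qed
    let ?u = "X \<otimes>\<^bsub>P\<^esub> \<iota> x [^]\<^bsub>P\<^esub> (snd q - d) \<oplus>\<^bsub>P\<^esub> \<iota> c"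
    have uc: "?u \<in> carrier P" using c by simp
    \<comment> \<open>If \<open>d\<close> is the exponent of \<open>q\<close>, the coefficient of
      the variable in \<open>?u\<close> is 1. Otherwise a factor \<open>x\<close> in
      \<open>c\<close> would allow d + 1 in place of \<open>d\<close>.\<close>
    have "\<not> \<iota> x divides\<^bsub>P\<^esub> ?u"
    proof
      assume "\<iota> x divides\<^bsub>P\<^esub> ?u"
      then have xc: "x divides c" and xx: "\<iota> x divides\<^bsub>P\<^esub> (\<iota> x [^]\<^bsub>P\<^esub> (snd q - d))"
        using const_divides_horner[OF x_closed _ c(1), of "\<iota> x [^]\<^bsub>P\<^esub> (snd q - d)"] by simp_all
      show False
      proof (cases "d = snd q")
        case True
        then have "\<iota> x divides\<^bsub>P\<^esub> \<iota> \<one>" using xx ring_hom_one[OF \<iota>_hom] by simp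
        then show False using x_not_divides_one const_divides_const[OF x_closed one_closed] by simp
      next
        case False
        obtain c' where "c' \<in> carrier A" "c = x \<otimes> c'" using xc unfolding factor_def by metis
        then have "x [^] Suc d divides ?\<delta>" using c by (intro dividesI[of c']) (simp_all add: m_assoc)
        then have "?T (Suc d)" using Td False by simp
        then show False using max by fastforce
      qed
    qed
    then have "red ?u \<in> carrier Q - {\<zero>\<^bsub>Q\<^esub>}" using red_zero_iff[OF uc] ring_hom_closed[OF red_hom uc] by simp
    then show ?thesis using dm Td uc theta_linear_factor[OF q pc c] by metis
  qed
  then obtain d u where du: "\<And>p. p \<in> S \<Longrightarrow> d p < snd p" "\<And>p. p \<in> S \<Longrightarrow> x [^] (d p ::nat) divides (fst q \<ominus> fst p)"
    "\<And>p. p \<in> S \<Longrightarrow> u p \<in> carrier P" "\<And>p. p \<in> S \<Longrightarrow> red (u p) \<in> carrier Q - {\<zero>\<^bsub>Q\<^esub>}"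
    "\<And>p. p \<in> S \<Longrightarrow> thd q (X \<ominus>\<^bsub>P\<^esub> \<iota> (fst p)) = \<iota> x [^]\<^bsub>P\<^esub> d p \<otimes>\<^bsub>P\<^esub> u p"
    by metis
  have "\<exists>f\<in>carrier P. \<exists>s::nat. \<exists>g\<in>carrier P. thd q f = \<iota> x [^]\<^bsub>P\<^esub> s \<otimes>\<^bsub>P\<^esub> g \<and> red g \<in> carrier Q - {\<zero>\<^bsub>Q\<^esub>} \<and>
     (\<forall>p\<in>S. \<iota> x [^]\<^bsub>P\<^esub> Suc s divides\<^bsub>P\<^esub> thd p f)"
    by (rule peak[OF q S _ _ du]) (simp_all add: Q.integral_iff)
  then obtain f s g where f: "f \<in> carrier P" "g \<in> carrier P" "thd q f = \<iota> x [^]\<^bsub>P\<^esub> (s::nat) \<otimes>\<^bsub>P\<^esub> g" "red g \<noteq> \<zero>\<^bsub>Q\<^esub>"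
    "\<forall>p\<in>S. \<iota> x [^]\<^bsub>P\<^esub> Suc s divides\<^bsub>P\<^esub> thd p f" by (metis Diff_iff singletonI)
  have "\<not> \<iota> x [^]\<^bsub>P\<^esub> Suc s divides\<^bsub>P\<^esub> thd q f"
  proof
    assume "\<iota> x [^]\<^bsub>P\<^esub> Suc s divides\<^bsub>P\<^esub> thd q f"
    then have "\<iota> x [^]\<^bsub>P\<^esub> (s + 1) divides\<^bsub>P\<^esub> (\<iota> x [^]\<^bsub>P\<^esub> s \<otimes>\<^bsub>P\<^esub> g)" by (simp only: f(3) Suc_eq_plus1)
    then have "\<iota> x [^]\<^bsub>P\<^esub> (1::nat) divides\<^bsub>P\<^esub> g"
      by (rule iffD1[OF P.pow_divides_cancel[OF \<iota>_x_closed \<iota>_x_nonzero f(2)]])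
    then have "\<iota> x divides\<^bsub>P\<^esub> g" by (simp only: P.nat_pow_eone[OF \<iota>_x_closed])
    then show False using red_zero_iff[OF f(2)] f(4) by simp
  qed
  then show ?thesis using f by metis
qed

text \<open>For separated discs \<open>d\<close> is also below the exponent of \<open>q\<close>, so
  the variable disappears from \<open>u\<close> modulo \<open>x\<close> and a nonzero constant
  remains: \<open>peak\<close> applies with the nonzero constants as \<open>K\<close>. The constant
  is scaled to 1, so that the quotient by x^s will be 1 on one component and 0 on the
  others.\<close>

lemma disc_family_peak:
  assumes \<Delta>: "disc_family \<Delta>" and q: "q \<in> \<Delta>"
  shows "\<exists>f\<in>carrier P. \<exists>s::nat. \<exists>g\<in>carrier P. thd q f = \<iota> x [^]\<^bsub>P\<^esub> s \<otimes>\<^bsub>P\<^esub> g \<and> red g = \<one>\<^bsub>Q\<^esub> \<and>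
     (\<forall>p\<in>\<Delta> - {q}. \<iota> x [^]\<^bsub>P\<^esub> Suc s divides\<^bsub>P\<^esub> thd p f)"
proof -
  have carr: "fst p \<in> carrier A" if "p \<in> \<Delta>" for p using \<Delta> that unfolding disc_family_def by auto
  let ?K = "const_poly \<kappa> ` (carrier \<kappa> - {\<zero>\<^bsub>\<kappa>\<^esub>})"
  have "\<exists>d u. d < snd p \<and> x [^] (d::nat) divides (fst q \<ominus> fst p) \<and> u \<in> carrier P \<and> red u \<in> ?K \<and>
      thd q (X \<ominus>\<^bsub>P\<^esub> \<iota> (fst p)) = \<iota> x [^]\<^bsub>P\<^esub> d \<otimes>\<^bsub>P\<^esub> u" if p: "p \<in> \<Delta> - {q}" for p
  proof -
    have pc: "fst p \<in> carrier A" using p carr by simp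
    have "separated p q" using \<Delta> p q unfolding disc_family_def by simp
    then obtain d where d: "d < snd p" "d < snd q" "x [^] d divides (fst q \<ominus> fst p)"
      "\<not> x [^] Suc d divides (fst q \<ominus> fst p)" unfolding separated_def by auto
    obtain c where c: "c \<in> carrier A" "fst q \<ominus> fst p = x [^] d \<otimes> c" using d unfolding factor_def by metis
    have nc: "\<not> x divides c"
    proof
      assume "x divides c"
      then obtain c' where "c' \<in> carrier A" "c = x \<otimes> c'" unfolding factor_def by metis
      then have "x [^] Suc d divides (fst q \<ominus> fst p)" using c by (intro dividesI[of c']) (simp_all add: m_assoc)
      then show False using d by simp
    qed
    let ?u = "X \<otimes>\<^bsub>P\<^esub> \<iota> x [^]\<^bsub>P\<^esub> (snd q - d) \<oplus>\<^bsub>P\<^esub> \<iota> c"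
    have uc: "?u \<in> carrier P" using c by simp
    obtain k where k: "snd q - d = Suc k" using d by (metis Suc_diff_Suc)
    have "red (\<iota> x) = \<zero>\<^bsub>Q\<^esub>" using \<pi>_zero_iff[OF x_closed] by (simp add: red_const \<kappa>.const_poly_zero)
    moreover have "red (\<iota> x [^]\<^bsub>P\<^esub> k) \<in> carrier Q" "red X \<in> carrier Q"
      by (rule ring_hom_closed[OF red_hom], simp)+
    ultimately have "red (X \<otimes>\<^bsub>P\<^esub> \<iota> x [^]\<^bsub>P\<^esub> (snd q - d)) = \<zero>\<^bsub>Q\<^esub>"
      by (simp add: k ring_hom_mult[OF red_hom])
    then have "red ?u = const_poly \<kappa> (\<pi> c)"
      using c(1) ring_hom_closed[OF \<pi>_hom c(1)] by (simp add: ring_hom_add[OF red_hom] red_const)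
    moreover have "\<pi> c \<in> carrier \<kappa> - {\<zero>\<^bsub>\<kappa>\<^esub>}" using nc \<pi>_zero_iff[OF c(1)] ring_hom_closed[OF \<pi>_hom c(1)] by simp
    ultimately have "red ?u \<in> ?K" by (rule image_eqI)
    moreover have "thd q (X \<ominus>\<^bsub>P\<^esub> \<iota> (fst p)) = \<iota> x [^]\<^bsub>P\<^esub> d \<otimes>\<^bsub>P\<^esub> ?u"
      by (rule theta_linear_factor[OF carr[OF q] pc c]) (use d in simp)
    ultimately show ?thesis using d uc by metis
  qed
  then obtain d u where du: "\<And>p. p \<in> \<Delta> - {q} \<Longrightarrow> d p < snd p" "\<And>p. p \<in> \<Delta> - {q} \<Longrightarrow> x [^] (d p ::nat) divides (fst q \<ominus> fst p)"
    "\<And>p. p \<in> \<Delta> - {q} \<Longrightarrow> u p \<in> carrier P" "\<And>p. p \<in> \<Delta> - {q} \<Longrightarrow> red (u p) \<in> ?K"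
    "\<And>p. p \<in> \<Delta> - {q} \<Longrightarrow> thd q (X \<ominus>\<^bsub>P\<^esub> \<iota> (fst p)) = \<iota> x [^]\<^bsub>P\<^esub> d p \<otimes>\<^bsub>P\<^esub> u p"
    by metis
  have "\<exists>f\<in>carrier P. \<exists>s::nat. \<exists>g\<in>carrier P. thd q f = \<iota> x [^]\<^bsub>P\<^esub> s \<otimes>\<^bsub>P\<^esub> g \<and> red g \<in> ?K \<and>
     (\<forall>p\<in>\<Delta> - {q}. \<iota> x [^]\<^bsub>P\<^esub> Suc s divides\<^bsub>P\<^esub> thd p f)"
  proof (rule peak[OF carr[OF q] _ _ _ _ du])
    show "finite (\<Delta> - {q})" "fst ` (\<Delta> - {q}) \<subseteq> carrier A" using \<Delta> unfolding disc_family_def by auto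
    show "\<one>\<^bsub>Q\<^esub> \<in> ?K" using ring_hom_one[OF const_\<kappa>_hom] by (intro image_eqI[of _ _ "\<one>\<^bsub>\<kappa>\<^esub>"]) simp_all
    fix a b assume ab: "a \<in> ?K" "b \<in> ?K"
    obtain a' where "a = const_poly \<kappa> a'" "a' \<in> carrier \<kappa> - {\<zero>\<^bsub>\<kappa>\<^esub>}" using ab(1) by (rule imageE)
    moreover obtain b' where "b = const_poly \<kappa> b'" "b' \<in> carrier \<kappa> - {\<zero>\<^bsub>\<kappa>\<^esub>}" using ab(2) by (rule imageE)
    ultimately show "a \<otimes>\<^bsub>Q\<^esub> b \<in> ?K"
      by (intro image_eqI[of _ _ "a' \<otimes>\<^bsub>\<kappa>\<^esub> b'"]) (simp_all add: ring_hom_mult[OF const_\<kappa>_hom] \<kappa>.integral_iff)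
  qed
  then obtain f s g where f: "f \<in> carrier P" "g \<in> carrier P" "thd q f = \<iota> x [^]\<^bsub>P\<^esub> (s::nat) \<otimes>\<^bsub>P\<^esub> g" "red g \<in> ?K"
    "\<And>p. p \<in> \<Delta> - {q} \<Longrightarrow> \<iota> x [^]\<^bsub>P\<^esub> Suc s divides\<^bsub>P\<^esub> thd p f" by metis
  obtain k where k': "red g = const_poly \<kappa> k" "k \<in> carrier \<kappa> - {\<zero>\<^bsub>\<kappa>\<^esub>}" using f(4) by (rule imageE)
  then have k: "k \<in> carrier \<kappa>" "k \<noteq> \<zero>\<^bsub>\<kappa>\<^esub>" "red g = const_poly \<kappa> k" by simp_all
  have ku: "k \<in> Units \<kappa>" using k \<kappa>.field_Units by simp
  obtain a where a: "a \<in> carrier A" "inv\<^bsub>\<kappa>\<^esub> k = \<pi> a" using \<pi>_surj \<kappa>.Units_inv_closed[OF ku] by metis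
  have fa: "f \<otimes>\<^bsub>P\<^esub> \<iota> a \<in> carrier P" "g \<otimes>\<^bsub>P\<^esub> \<iota> a \<in> carrier P" using f a by simp_all
  have th: "thd t (f \<otimes>\<^bsub>P\<^esub> \<iota> a) = thd t f \<otimes>\<^bsub>P\<^esub> \<iota> a" if "t \<in> \<Delta>" for t
    using carr[OF that] f(1) a(1) by (simp add: ring_hom_mult[OF theta_hom])
  have "thd q (f \<otimes>\<^bsub>P\<^esub> \<iota> a) = \<iota> x [^]\<^bsub>P\<^esub> s \<otimes>\<^bsub>P\<^esub> (g \<otimes>\<^bsub>P\<^esub> \<iota> a)"
    unfolding th[OF q] f(3) using f(2) a(1) by (simp add: P.m_assoc)
  moreover have "red (g \<otimes>\<^bsub>P\<^esub> \<iota> a) = \<one>\<^bsub>Q\<^esub>"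
  proof -
    have "red (g \<otimes>\<^bsub>P\<^esub> \<iota> a) = const_poly \<kappa> k \<otimes>\<^bsub>Q\<^esub> const_poly \<kappa> (inv\<^bsub>\<kappa>\<^esub> k)"
      using f(2) a(1) by (simp add: ring_hom_mult[OF red_hom] k(3) red_const a(2))
    also have "\<dots> = const_poly \<kappa> (k \<otimes>\<^bsub>\<kappa>\<^esub> inv\<^bsub>\<kappa>\<^esub> k)"
      by (rule ring_hom_mult[OF const_\<kappa>_hom k(1) \<kappa>.Units_inv_closed[OF ku], symmetric])
    also have "\<dots> = \<one>\<^bsub>Q\<^esub>" by (simp only: \<kappa>.Units_r_inv[OF ku] ring_hom_one[OF const_\<kappa>_hom])
    finally show ?thesis .
  qed
  moreover have "\<iota> x [^]\<^bsub>P\<^esub> Suc s divides\<^bsub>P\<^esub> thd p (f \<otimes>\<^bsub>P\<^esub> \<iota> a)" if p: "p \<in> \<Delta> - {q}" for p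
  proof -
    have pd: "p \<in> \<Delta>" using p by simp
    show ?thesis unfolding th[OF pd]
      by (rule P.divides_mult_right(1)[OF _ f(5)[OF p]]) (use carr[OF pd] f(1) a(1) in simp_all)
  qed
  ultimately show ?thesis using fa by metis
qed

text \<open>Converse to \<open>theta_within\<close>: if \<open>q\<close> lay in none of the discs, a
  polynomial of smaller order on \<open>q\<close> than on all of them would contradict the
  inequality of valuations.\<close>

lemma within_if_divides:
  assumes \<Delta>: "disc_family \<Delta>" and q: "fst q \<in> carrier A"
    and le: "\<And>f n. f \<in> carrier P \<Longrightarrow> (\<And>p. p \<in> \<Delta> \<Longrightarrow> \<iota> x [^]\<^bsub>P\<^esub> (n::nat) divides\<^bsub>P\<^esub> thd p f) \<Longrightarrow>
       \<iota> x [^]\<^bsub>P\<^esub> n divides\<^bsub>P\<^esub> thd q f"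
  shows "\<exists>p\<in>\<Delta>. disc_within q p"
proof (rule ccontr)
  assume "\<not> ?thesis"
  then have "\<exists>f\<in>carrier P. \<exists>s::nat. \<not> \<iota> x [^]\<^bsub>P\<^esub> Suc s divides\<^bsub>P\<^esub> thd q f \<and>
     (\<forall>p\<in>\<Delta>. \<iota> x [^]\<^bsub>P\<^esub> Suc s divides\<^bsub>P\<^esub> thd p f)"
    using \<Delta> unfolding disc_family_def by (intro disc_not_within_peak[OF q]) auto
  then show False using le by metis
qed

lemma theta_scale_inj:
  assumes "f \<in> carrier P" "theta \<zero> m f = \<zero>\<^bsub>P\<^esub>"
  shows "f = \<zero>\<^bsub>P\<^esub>"
  using assms
proof (induction rule: UP_horner_induct)
  case (const a)
  then show ?case by simp
next
  case (horner g a)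
  have tg: "theta \<zero> m g \<in> carrier P" using horner by simp
  have "theta \<zero> m (X \<otimes>\<^bsub>P\<^esub> g \<oplus>\<^bsub>P\<^esub> \<iota> a) = X \<otimes>\<^bsub>P\<^esub> (\<iota> x [^]\<^bsub>P\<^esub> m \<otimes>\<^bsub>P\<^esub> theta \<zero> m g) \<oplus>\<^bsub>P\<^esub> \<iota> a"
    using horner tg by (simp add: ring_hom_add[OF theta_hom] ring_hom_mult[OF theta_hom] theta_var
        const_poly_zero P.m_ac)
  then have *: "X \<otimes>\<^bsub>P\<^esub> (\<iota> x [^]\<^bsub>P\<^esub> m \<otimes>\<^bsub>P\<^esub> theta \<zero> m g) \<oplus>\<^bsub>P\<^esub> \<iota> a = \<zero>\<^bsub>P\<^esub>" using horner.prems by simp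
  have "\<iota> x [^]\<^bsub>P\<^esub> m \<otimes>\<^bsub>P\<^esub> theta \<zero> m g = \<zero>\<^bsub>P\<^esub>" and a: "a = \<zero>"
    by (rule horner_eq_zero[OF _ horner.hyps(2) *], use tg in simp)+
  then have "theta \<zero> m g = \<zero>\<^bsub>P\<^esub>"
    using P.integral[OF _ _ tg, of "\<iota> x [^]\<^bsub>P\<^esub> m"] P.nat_pow_nonzero[OF \<iota>_x_closed \<iota>_x_nonzero, of m] by auto
  then have "g = \<zero>\<^bsub>P\<^esub>" by (rule horner.IH)
  then show ?case using a by (simp add: const_poly_zero)
qed

text \<open>The substitution of a disc is a translation, undone by the translation with
  \<open>\<ominus> \<sigma>\<close>, followed by the scaling T = x^m T, which is injective because
  \<open>x\<close> is nonzero in a domain.\<close>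

lemma theta_zero_iff:
  assumes \<sigma>: "\<sigma> \<in> carrier A" and f: "f \<in> carrier P"
  shows "theta \<sigma> m f = \<zero>\<^bsub>P\<^esub> \<longleftrightarrow> f = \<zero>\<^bsub>P\<^esub>"
proof
  assume 0: "theta \<sigma> m f = \<zero>\<^bsub>P\<^esub>"
  have m\<sigma>: "\<ominus> \<sigma> \<in> carrier A" using \<sigma> by simp
  have "(theta \<zero> m \<circ> theta \<sigma> 0) f = theta \<sigma> m f"
    by (rule UP_hom_eqI[OF P.is_cring ring_hom_trans[OF theta_hom[OF \<sigma>] theta_hom[OF zero_closed]] theta_hom[OF \<sigma>] _ _ f])
       (use \<sigma> in \<open>simp_all add: theta_var ring_hom_add[OF theta_hom] const_poly_zero\<close>)
  then have "theta \<zero> m (theta \<sigma> 0 f) = \<zero>\<^bsub>P\<^esub>" using 0 by simp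
  then have *: "theta \<sigma> 0 f = \<zero>\<^bsub>P\<^esub>" by (rule theta_scale_inj[OF theta_closed[OF \<sigma> f]])
  have "(theta (\<ominus> \<sigma>) 0 \<circ> theta \<sigma> 0) f = id f"
  proof (rule UP_hom_eqI[OF P.is_cring ring_hom_trans[OF theta_hom[OF \<sigma>] theta_hom[OF m\<sigma>]] _ _ _ f])
    show "id \<in> ring_hom P P" by (rule ring_hom_memI) simp_all
    have "\<iota> \<sigma> \<oplus>\<^bsub>P\<^esub> (\<iota> (\<ominus> \<sigma>) \<oplus>\<^bsub>P\<^esub> X) = \<iota> (\<sigma> \<oplus> \<ominus> \<sigma>) \<oplus>\<^bsub>P\<^esub> X"
      using \<sigma> by (simp add: ring_hom_add[OF \<iota>_hom] P.a_assoc)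
    then show "(theta (\<ominus> \<sigma>) 0 \<circ> theta \<sigma> 0) X = id X"
      using \<sigma> by (simp add: theta_var ring_hom_add[OF theta_hom] r_neg const_poly_zero)
  qed (use \<sigma> in simp_all)
  moreover have "theta (\<ominus> \<sigma>) 0 \<zero>\<^bsub>P\<^esub> = \<zero>\<^bsub>P\<^esub>" by (rule P.ring_hom_zero'[OF P.is_cring theta_hom[OF m\<sigma>]])
  ultimately show "f = \<zero>\<^bsub>P\<^esub>" using * by simp
qed (use P.ring_hom_zero'[OF P.is_cring theta_hom[OF \<sigma>]] in simp)

lemma theta_inj: "\<sigma> \<in> carrier A \<Longrightarrow> inj_on (theta \<sigma> m) (carrier P)"
proof (rule inj_onI)
  fix f g assume \<sigma>: "\<sigma> \<in> carrier A" and h: "f \<in> carrier P" "g \<in> carrier P" "theta \<sigma> m f = theta \<sigma> m g"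
  then have "theta \<sigma> m (f \<ominus>\<^bsub>P\<^esub> g) = \<zero>\<^bsub>P\<^esub>"
    using P.ring_hom_minus[OF P.is_cring theta_hom[OF \<sigma>] h(1,2)] by simp
  then have "f \<ominus>\<^bsub>P\<^esub> g = \<zero>\<^bsub>P\<^esub>" using theta_zero_iff[OF \<sigma>, of "f \<ominus>\<^bsub>P\<^esub> g"] h by simp
  then show "f = g" using h by simp
qed

end

text \<open>A local test for membership in a subring, over a partition of unity. The product of
  \<open>b\<close> with \<open>a i\<close> satisfies the hypothesis with the exponent
  \<open>K i\<close> lowered by one, so induction on the sum of the exponents puts all these
  products into \<open>G\<close>, and their sum is \<open>b\<close>. If some exponent is zero,
  \<open>b\<close> is already there.\<close>

lemma (in cring) subring_local:
  assumes G: "subring G R" and I: "finite I" and a: "\<And>i. i \<in> I \<Longrightarrow> a i \<in> G"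
    and sum: "(\<Oplus>i\<in>I. a i) = \<one>"
    and b: "b \<in> carrier R" and K: "\<And>i. i \<in> I \<Longrightarrow> a i [^] (K i :: nat) \<otimes> b \<in> G"
  shows "b \<in> G"
  using b K
proof (induction "\<Sum>i\<in>I. K i" arbitrary: b K rule: less_induct)
  case less
  have aR: "a i \<in> carrier R" if "i \<in> I" for i using a[OF that] subringE(1)[OF G] by blast
  show ?case
  proof (cases "\<exists>i\<in>I. K i = 0")
    case True
    then obtain i where i: "i \<in> I" "K i = 0" by metis
    have "a i [^] (K i) \<otimes> b \<in> G" by (rule less.prems(2)[OF i(1)])
    then show ?thesis using less.prems(1) i(2) by simp
  next
    case False
    have ab: "a i \<otimes> b \<in> G" if i: "i \<in> I" for i
    proof (rule less.hyps[of "K(i := K i - 1)"])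
      have "(\<Sum>j\<in>I. (K(i := K i - 1)) j) = (\<Sum>j\<in>I - {i}. K j) + (K i - 1)"
        using I i by (simp add: sum.remove[of I i])
      moreover have "(\<Sum>j\<in>I. K j) = (\<Sum>j\<in>I - {i}. K j) + K i" using I i by (simp add: sum.remove[of I i])
      ultimately show "(\<Sum>j\<in>I. (K(i := K i - 1)) j) < (\<Sum>j\<in>I. K j)" using False i by auto
      show "a i \<otimes> b \<in> carrier R" using aR[OF i] less.prems(1) by simp
      fix j assume j: "j \<in> I"
      show "a j [^] ((K(i := K i - 1)) j) \<otimes> (a i \<otimes> b) \<in> G"
      proof (cases "j = i")
        case True
        obtain l where l: "K i = Suc l" using False i by (metis not0_implies_Suc)
        have "a i [^] l \<otimes> (a i \<otimes> b) = a i [^] (K i) \<otimes> b"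
          using aR[OF i] less.prems(1) by (simp add: l m_assoc)
        then show ?thesis using less.prems(2)[OF i] by (simp add: True l)
      next
        case f: False
        have "a j [^] (K j) \<otimes> (a i \<otimes> b) = a i \<otimes> (a j [^] (K j) \<otimes> b)"
          using aR[OF i] aR[OF j] less.prems(1) by (simp add: m_lcomm)
        also have "\<dots> \<in> G" by (rule subringE(6)[OF G a[OF i] less.prems(2)[OF j]])
        finally show ?thesis using f by simp
      qed
    qed
    have "b = (\<Oplus>i\<in>I. a i \<otimes> b)"
      using finsum_ldistr[OF I less.prems(1), of a] sum less.prems(1) aR by simp
    also have "\<dots> \<in> G"
    proof -
      have "(\<Oplus>i\<in>J. a i \<otimes> b) \<in> G" if "finite J" "J \<subseteq> I" for J
        using that
      proof (induction J rule: finite_induct)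
        case empty
        then show ?case using subringE(2)[OF G] by simp
      next
        case (insert j J)
        have "(\<Oplus>i\<in>insert j J. a i \<otimes> b) = a j \<otimes> b \<oplus> (\<Oplus>i\<in>J. a i \<otimes> b)"
          using insert aR less.prems(1) by (intro finsum_insert) auto
        then show ?case using insert ab by (simp add: subringE(7)[OF G])
      qed
      then show ?thesis using I by simp
    qed
    finally show ?thesis .
  qed
qed

section \<open>From discs to the special fibre and to generators\<close>

context over_line
begin

text \<open>The substitution of a disc extended to fractions: f/x^n goes to
  f(\<open>\<sigma>\<close> + x^m T)/x^n, which is again a polynomial as the order of
  \<open>f\<close> on the disc is at least \<open>n\<close>.\<close>

definition charts where
  "charts \<Delta> \<chi> \<longleftrightarrow> (\<forall>p\<in>\<Delta>. \<chi> p \<in> ring_hom B P \<and> (\<forall>f\<in>carrier P. \<chi> p (\<psi> f) = thd p f))"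

context
  fixes \<Delta>
  assumes \<Delta>: "disc_family \<Delta>" and desc: "describes \<Delta>"
begin

lemma \<Delta>_closed: "p \<in> \<Delta> \<Longrightarrow> fst p \<in> carrier A"
  using \<Delta> unfolding disc_family_def by auto

lemma describes_iff:
  "f \<in> carrier P \<Longrightarrow> y [^]\<^bsub>B\<^esub> (n::nat) divides\<^bsub>B\<^esub> \<psi> f \<longleftrightarrow> (\<forall>p\<in>\<Delta>. \<iota> x [^]\<^bsub>P\<^esub> n divides\<^bsub>P\<^esub> thd p f)"
  using desc unfolding describes_def by (simp add: case_prod_beta)

lemma charts_ex: "\<exists>\<chi>. charts \<Delta> \<chi>"
proof -
  have "\<exists>\<phi>\<in>ring_hom B P. \<forall>f\<in>carrier P. \<phi> (\<psi> f) = thd p f" if p: "p \<in> \<Delta>" for p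
  proof (rule extend[OF P.domain_axioms theta_hom[OF \<Delta>_closed[OF p]]])
    have t: "thd p (\<iota> x) = \<iota> x" by (rule theta_const[OF \<Delta>_closed[OF p] x_closed])
    show "thd p (\<iota> x) \<noteq> \<zero>\<^bsub>P\<^esub>" unfolding t by (rule \<iota>_x_nonzero)
    fix f and n :: nat assume "f \<in> carrier P" "y [^]\<^bsub>B\<^esub> n divides\<^bsub>B\<^esub> \<psi> f"
    then show "thd p (\<iota> x) [^]\<^bsub>P\<^esub> n divides\<^bsub>P\<^esub> thd p f" unfolding t using describes_iff p by metis
  qed
  then show ?thesis unfolding charts_def by metis
qed

context
  fixes \<chi>
  assumes ch: "charts \<Delta> \<chi>"
begin

lemma \<chi>: "p \<in> \<Delta> \<Longrightarrow> \<chi> p \<in> ring_hom B P" "p \<in> \<Delta> \<Longrightarrow> f \<in> carrier P \<Longrightarrow> \<chi> p (\<psi> f) = thd p f"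
  using ch unfolding charts_def by simp_all

lemma \<chi>_y: "p \<in> \<Delta> \<Longrightarrow> \<chi> p y = \<iota> x"
  using \<chi>(2)[OF _ \<iota>_x_closed] theta_const[OF \<Delta>_closed x_closed] by simp

lemma \<chi>_closed: "p \<in> \<Delta> \<Longrightarrow> b \<in> carrier B \<Longrightarrow> \<chi> p b \<in> carrier P"
  by (rule ring_hom_closed[OF \<chi>(1)])

lemma \<chi>_y_pow: "p \<in> \<Delta> \<Longrightarrow> \<chi> p (y [^]\<^bsub>B\<^esub> (n::nat)) = \<iota> x [^]\<^bsub>P\<^esub> n"
  using B.ring_hom_nat_pow[OF P.is_cring \<chi>(1) y_closed] \<chi>_y by simp

text \<open>Clearing the denominator y^N of \<open>b\<close> shifts both sides by \<open>N\<close>,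
  which carries the criterion from A[t] to \<open>B\<close>.\<close>

lemma \<chi>_divides:
  assumes b: "b \<in> carrier B"
  shows "y [^]\<^bsub>B\<^esub> (n::nat) divides\<^bsub>B\<^esub> b \<longleftrightarrow> (\<forall>p\<in>\<Delta>. \<iota> x [^]\<^bsub>P\<^esub> n divides\<^bsub>P\<^esub> \<chi> p b)"
proof -
  obtain N :: nat and f where f: "f \<in> carrier P" "y [^]\<^bsub>B\<^esub> N \<otimes>\<^bsub>B\<^esub> b = \<psi> f" using denominators[OF b] by metis
  have yN: "y [^]\<^bsub>B\<^esub> N \<in> carrier B" by simp
  have "y [^]\<^bsub>B\<^esub> n divides\<^bsub>B\<^esub> b \<longleftrightarrow> y [^]\<^bsub>B\<^esub> (N + n) divides\<^bsub>B\<^esub> \<psi> f"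
    unfolding f(2)[symmetric] by (rule B.pow_divides_cancel[OF y_closed y_nonzero b, symmetric])
  also have "\<dots> \<longleftrightarrow> (\<forall>p\<in>\<Delta>. \<iota> x [^]\<^bsub>P\<^esub> (N + n) divides\<^bsub>P\<^esub> thd p f)" by (rule describes_iff[OF f(1)])
  also have "\<dots> \<longleftrightarrow> (\<forall>p\<in>\<Delta>. \<iota> x [^]\<^bsub>P\<^esub> n divides\<^bsub>P\<^esub> \<chi> p b)"
  proof (rule ball_cong[OF refl])
    fix p assume p: "p \<in> \<Delta>"
    have "thd p f = \<iota> x [^]\<^bsub>P\<^esub> N \<otimes>\<^bsub>P\<^esub> \<chi> p b"
      by (simp only: \<chi>(2)[OF p f(1), symmetric] f(2)[symmetric] ring_hom_mult[OF \<chi>(1)[OF p] yN b] \<chi>_y_pow[OF p])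
    then show "\<iota> x [^]\<^bsub>P\<^esub> (N + n) divides\<^bsub>P\<^esub> thd p f \<longleftrightarrow> \<iota> x [^]\<^bsub>P\<^esub> n divides\<^bsub>P\<^esub> \<chi> p b"
      using P.pow_divides_cancel[OF \<iota>_x_closed \<iota>_x_nonzero \<chi>_closed[OF p b]] by simp
  qed
  finally show ?thesis .
qed

lemma \<chi>_inj:
  assumes p: "p \<in> \<Delta>" and b: "b \<in> carrier B" "c \<in> carrier B" "\<chi> p b = \<chi> p c"
  shows "b = c"
proof -
  let ?d = "b \<ominus>\<^bsub>B\<^esub> c"
  have d: "?d \<in> carrier B" using b by simp
  have 0: "\<chi> p ?d = \<zero>\<^bsub>P\<^esub>"
    using B.ring_hom_minus[OF P.is_cring \<chi>(1)[OF p] b(1,2)] b \<chi>_closed[OF p] by simp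
  obtain N :: nat and f where f: "f \<in> carrier P" "y [^]\<^bsub>B\<^esub> N \<otimes>\<^bsub>B\<^esub> ?d = \<psi> f" using denominators[OF d] by metis
  have yN: "y [^]\<^bsub>B\<^esub> N \<in> carrier B" by simp
  have "thd p f = \<zero>\<^bsub>P\<^esub>"
    by (simp only: \<chi>(2)[OF p f(1), symmetric] f(2)[symmetric] ring_hom_mult[OF \<chi>(1)[OF p] yN d] 0 \<chi>_y_pow[OF p])
       simp
  then have "f = \<zero>\<^bsub>P\<^esub>" using theta_zero_iff[OF \<Delta>_closed[OF p] f(1)] by simp
  then have "y [^]\<^bsub>B\<^esub> N \<otimes>\<^bsub>B\<^esub> ?d = \<zero>\<^bsub>B\<^esub>" using f(2) \<psi>_zero_iff[OF P.zero_closed] by simp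
  then have "?d = \<zero>\<^bsub>B\<^esub>" using B.integral[OF _ yN d] B.nat_pow_nonzero[OF y_closed y_nonzero, of N] by auto
  then show ?thesis using b by simp
qed

text \<open>The peak polynomial has order \<open>s\<close> on \<open>p\<close> and a larger one on
  the other discs, so its quotient by y^s lies in \<open>B\<close> and has the required
  restrictions.\<close>

lemma chart_idempotent:
  assumes p: "p \<in> \<Delta>"
  shows "\<exists>e\<in>carrier B. red (\<chi> p e) = \<one>\<^bsub>Q\<^esub> \<and> (\<forall>q\<in>\<Delta> - {p}. \<iota> x divides\<^bsub>P\<^esub> \<chi> q e)"
proof -
  obtain f s g where f: "f \<in> carrier P" "g \<in> carrier P" "thd p f = \<iota> x [^]\<^bsub>P\<^esub> (s::nat) \<otimes>\<^bsub>P\<^esub> g" "red g = \<one>\<^bsub>Q\<^esub>"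
    "\<And>q. q \<in> \<Delta> - {p} \<Longrightarrow> \<iota> x [^]\<^bsub>P\<^esub> Suc s divides\<^bsub>P\<^esub> thd q f"
    using disc_family_peak[OF \<Delta> p] by metis
  have xs: "\<iota> x [^]\<^bsub>P\<^esub> s \<in> carrier P" by simp
  have "y [^]\<^bsub>B\<^esub> s divides\<^bsub>B\<^esub> \<psi> f"
  proof (rule iffD2[OF describes_iff[OF f(1)]], rule ballI)
    fix q assume q: "q \<in> \<Delta>"
    show "\<iota> x [^]\<^bsub>P\<^esub> s divides\<^bsub>P\<^esub> thd q f"
    proof (cases "q = p")
      case True
      show ?thesis unfolding True f(3) by (rule dividesI[OF f(2) refl])
    next
      case False
      have "\<iota> x [^]\<^bsub>P\<^esub> Suc s divides\<^bsub>P\<^esub> thd q f" using f(5) q False by simp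
      then show ?thesis
        by (rule P.pow_divides_mono[OF \<iota>_x_closed theta_closed[OF \<Delta>_closed[OF q] f(1)]]) simp
    qed
  qed
  then obtain e where e: "e \<in> carrier B" "\<psi> f = y [^]\<^bsub>B\<^esub> s \<otimes>\<^bsub>B\<^esub> e" unfolding factor_def by metis
  have ys: "y [^]\<^bsub>B\<^esub> s \<in> carrier B" by simp
  have th: "thd q f = \<iota> x [^]\<^bsub>P\<^esub> s \<otimes>\<^bsub>P\<^esub> \<chi> q e" if q: "q \<in> \<Delta>" for q
    by (simp only: \<chi>(2)[OF q f(1), symmetric] e(2) ring_hom_mult[OF \<chi>(1)[OF q] ys e(1)] \<chi>_y_pow[OF q])
  have "\<chi> p e = g"
    using th[OF p] f(3) P.m_lcancel[OF P.nat_pow_nonzero[OF \<iota>_x_closed \<iota>_x_nonzero, of s] xs \<chi>_closed[OF p e(1)] f(2)] by simp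
  moreover have "\<iota> x divides\<^bsub>P\<^esub> \<chi> q e" if q: "q \<in> \<Delta> - {p}" for q
  proof -
    have qd: "q \<in> \<Delta>" using q by simp
    have "\<iota> x [^]\<^bsub>P\<^esub> (s + 1) divides\<^bsub>P\<^esub> (\<iota> x [^]\<^bsub>P\<^esub> s \<otimes>\<^bsub>P\<^esub> \<chi> q e)"
      using f(5)[OF q] unfolding th[OF qd] Suc_eq_plus1 .
    then have "\<iota> x [^]\<^bsub>P\<^esub> (1::nat) divides\<^bsub>P\<^esub> \<chi> q e"
      by (rule iffD1[OF P.pow_divides_cancel[OF \<iota>_x_closed \<iota>_x_nonzero \<chi>_closed[OF qd e(1)]]])
    then show ?thesis by (simp only: P.nat_pow_eone[OF \<iota>_x_closed])
  qed
  ultimately show ?thesis using e(1) f(4) by metis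
qed

text \<open>The coordinate (t - \<open>\<sigma>\<close>)/x^m of the disc may fail to lie in
  \<open>B\<close> because of the other discs. On these \<open>e\<close> is divisible by
  \<open>x\<close>, so the factor e^m supplies the missing order.\<close>

lemma chart_coordinate:
  assumes p: "p \<in> \<Delta>" and e: "e \<in> carrier B" "\<And>q. q \<in> \<Delta> - {p} \<Longrightarrow> \<iota> x divides\<^bsub>P\<^esub> \<chi> q e"
  shows "\<exists>w\<in>carrier B. \<chi> p w = \<chi> p e [^]\<^bsub>P\<^esub> snd p \<otimes>\<^bsub>P\<^esub> X"
proof -
  let ?l = "X \<ominus>\<^bsub>P\<^esub> \<iota> (fst p)" and ?m = "snd p"
  have l: "?l \<in> carrier P" using \<Delta>_closed[OF p] by simp
  have em: "e [^]\<^bsub>B\<^esub> ?m \<in> carrier B" using e by simp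
  have elB: "e [^]\<^bsub>B\<^esub> ?m \<otimes>\<^bsub>B\<^esub> \<psi> ?l \<in> carrier B" using em l by simp
  have cel: "\<chi> q (e [^]\<^bsub>B\<^esub> ?m \<otimes>\<^bsub>B\<^esub> \<psi> ?l) = \<chi> q e [^]\<^bsub>P\<^esub> ?m \<otimes>\<^bsub>P\<^esub> thd q ?l" if q: "q \<in> \<Delta>" for q
    by (simp only: ring_hom_mult[OF \<chi>(1)[OF q] em \<psi>_closed[OF l]] \<chi>(2)[OF q l]
        B.ring_hom_nat_pow[OF P.is_cring \<chi>(1)[OF q] e(1)])
  have tp: "thd p ?l = \<iota> x [^]\<^bsub>P\<^esub> ?m \<otimes>\<^bsub>P\<^esub> X"
  proof -
    have "fst p \<ominus> fst p = \<zero>" using \<Delta>_closed[OF p] by simp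
    then show ?thesis unfolding theta_linear[OF \<Delta>_closed[OF p] \<Delta>_closed[OF p]] by (simp add: const_poly_zero)
  qed
  have "y [^]\<^bsub>B\<^esub> ?m divides\<^bsub>B\<^esub> (e [^]\<^bsub>B\<^esub> ?m \<otimes>\<^bsub>B\<^esub> \<psi> ?l)"
  proof (rule iffD2[OF \<chi>_divides[OF elB]], rule ballI)
    fix q assume q: "q \<in> \<Delta>"
    have c: "\<chi> q e \<in> carrier P" "\<chi> q e [^]\<^bsub>P\<^esub> ?m \<in> carrier P" "thd q ?l \<in> carrier P" "\<iota> x [^]\<^bsub>P\<^esub> ?m \<in> carrier P"
      using \<chi>_closed[OF q e(1)] l \<Delta>_closed[OF q] by simp_all
    show "\<iota> x [^]\<^bsub>P\<^esub> ?m divides\<^bsub>P\<^esub> \<chi> q (e [^]\<^bsub>B\<^esub> ?m \<otimes>\<^bsub>B\<^esub> \<psi> ?l)"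
      unfolding cel[OF q]
    proof (cases "q = p")
      case True
      have "\<iota> x [^]\<^bsub>P\<^esub> ?m divides\<^bsub>P\<^esub> thd p ?l" unfolding tp by (rule dividesI[OF pvar_closed refl])
      then show "\<iota> x [^]\<^bsub>P\<^esub> ?m divides\<^bsub>P\<^esub> (\<chi> q e [^]\<^bsub>P\<^esub> ?m \<otimes>\<^bsub>P\<^esub> thd q ?l)"
        unfolding True by (intro P.divides_mult_right(2)) (use c True in simp_all)
    next
      case False
      then have "\<iota> x [^]\<^bsub>P\<^esub> (1::nat) divides\<^bsub>P\<^esub> \<chi> q e" using e(2) q by (simp only: P.nat_pow_eone[OF \<iota>_x_closed]) simp
      then have "\<iota> x [^]\<^bsub>P\<^esub> (1 * ?m) divides\<^bsub>P\<^esub> (\<chi> q e [^]\<^bsub>P\<^esub> ?m)"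
        by (rule P.pow_divides_pow[OF \<iota>_x_closed c(1)])
      then show "\<iota> x [^]\<^bsub>P\<^esub> ?m divides\<^bsub>P\<^esub> (\<chi> q e [^]\<^bsub>P\<^esub> ?m \<otimes>\<^bsub>P\<^esub> thd q ?l)"
        by (intro P.divides_mult_right(1)) (use c in simp_all)
    qed
  qed
  then obtain w where w: "w \<in> carrier B" "e [^]\<^bsub>B\<^esub> ?m \<otimes>\<^bsub>B\<^esub> \<psi> ?l = y [^]\<^bsub>B\<^esub> ?m \<otimes>\<^bsub>B\<^esub> w" unfolding factor_def by metis
  have ym: "y [^]\<^bsub>B\<^esub> ?m \<in> carrier B" and xm: "\<iota> x [^]\<^bsub>P\<^esub> ?m \<in> carrier P" by simp_all
  have "\<iota> x [^]\<^bsub>P\<^esub> ?m \<otimes>\<^bsub>P\<^esub> \<chi> p w = \<chi> p e [^]\<^bsub>P\<^esub> ?m \<otimes>\<^bsub>P\<^esub> (\<iota> x [^]\<^bsub>P\<^esub> ?m \<otimes>\<^bsub>P\<^esub> X)"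
    using cel[OF p] unfolding w(2) tp ring_hom_mult[OF \<chi>(1)[OF p] ym w(1)] \<chi>_y_pow[OF p] .
  also have "\<dots> = \<iota> x [^]\<^bsub>P\<^esub> ?m \<otimes>\<^bsub>P\<^esub> (\<chi> p e [^]\<^bsub>P\<^esub> ?m \<otimes>\<^bsub>P\<^esub> X)"
    using \<chi>_closed[OF p e(1)] xm by (simp add: P.m_lcomm)
  finally have "\<chi> p w = \<chi> p e [^]\<^bsub>P\<^esub> ?m \<otimes>\<^bsub>P\<^esub> X"
    using P.m_lcancel[OF P.nat_pow_nonzero[OF \<iota>_x_closed \<iota>_x_nonzero, of ?m] xm \<chi>_closed[OF p w(1)]]
      \<chi>_closed[OF p e(1)] by simp
  then show ?thesis using w(1) by metis
qed

end

end

text \<open>Converse to \<open>describes_ex\<close>: the coordinate maps are the charts followed by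
  reduction modulo \<open>x\<close>. The divisibility criterion for the first power of y gives the
  joint kernel, \<open>chart_idempotent\<close> and \<open>chart_coordinate\<close> give joint
  surjectivity.\<close>

lemma describes_fibre_charts:
  assumes \<Delta>: "disc_family \<Delta>" and desc: "describes \<Delta>"
  shows "\<exists>n>0. \<exists>\<rho>. fibre_charts n \<rho>"
proof -
  obtain \<chi> where ch: "charts \<Delta> \<chi>" using charts_ex[OF \<Delta> desc] by metis
  note \<chi> = \<chi>[OF \<Delta> desc ch] and \<chi>_divides = \<chi>_divides[OF \<Delta> desc ch] and \<chi>_closed = \<chi>_closed[OF \<Delta> desc ch]
  define R where "R p = red \<circ> \<chi> p" for p
  have R: "R p \<in> ring_hom B Q" if "p \<in> \<Delta>" for p
    unfolding R_def by (rule ring_hom_trans[OF \<chi>(1)[OF that] red_hom])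
  have Rc: "R p b \<in> carrier Q" if "p \<in> \<Delta>" "b \<in> carrier B" for p b by (rule ring_hom_closed[OF R[OF that(1)] that(2)])
  have R\<iota>: "R p (\<psi> (\<iota> a)) = const_poly \<kappa> (\<pi> a)" if "p \<in> \<Delta>" "a \<in> carrier A" for p a
    using that \<chi>(2)[OF that(1), of "\<iota> a"] \<Delta>_closed[OF \<Delta> desc] by (simp add: R_def red_const)
  have ker: "y divides\<^bsub>B\<^esub> b" if b: "b \<in> carrier B" and 0: "\<And>p. p \<in> \<Delta> \<Longrightarrow> R p b = \<zero>\<^bsub>Q\<^esub>" for b
  proof -
    have "\<forall>p\<in>\<Delta>. \<iota> x [^]\<^bsub>P\<^esub> (1::nat) divides\<^bsub>P\<^esub> \<chi> p b"
    proof
      fix p assume p: "p \<in> \<Delta>"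
      have "\<iota> x divides\<^bsub>P\<^esub> \<chi> p b" using red_zero_iff[OF \<chi>_closed[OF p b]] 0[OF p] by (simp add: R_def)
      then show "\<iota> x [^]\<^bsub>P\<^esub> (1::nat) divides\<^bsub>P\<^esub> \<chi> p b" by (simp only: P.nat_pow_eone[OF \<iota>_x_closed])
    qed
    then have "y [^]\<^bsub>B\<^esub> (1::nat) divides\<^bsub>B\<^esub> b" by (rule iffD2[OF \<chi>_divides[OF b]])
    then show ?thesis by (simp only: B.nat_pow_eone[OF y_closed])
  qed
  \<comment> \<open>On component \<open>p\<close> the element \<open>w\<close> restricts to the
    variable, because \<open>e\<close> restricts to 1. So a polynomial in \<open>w\<close> restricts
    to any given \<open>g\<close>, and the factor \<open>e\<close> makes it vanish on the other
    components.\<close>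
  have local_surj: "\<exists>b\<in>carrier B. R p b = g \<and> (\<forall>q\<in>\<Delta> - {p}. R q b = \<zero>\<^bsub>Q\<^esub>)" if p: "p \<in> \<Delta>" and g: "g \<in> carrier Q" for p g
  proof -
    obtain e where e: "e \<in> carrier B" "red (\<chi> p e) = \<one>\<^bsub>Q\<^esub>" "\<And>q. q \<in> \<Delta> - {p} \<Longrightarrow> \<iota> x divides\<^bsub>P\<^esub> \<chi> q e"
      using chart_idempotent[OF \<Delta> desc ch p] by metis
    obtain w where w: "w \<in> carrier B" "\<chi> p w = \<chi> p e [^]\<^bsub>P\<^esub> snd p \<otimes>\<^bsub>P\<^esub> X"
      using chart_coordinate[OF \<Delta> desc ch p e(1,3)] by metis
    obtain f where f: "f \<in> carrier P" "red f = g" using red_surj[OF g] by metis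
    have h: "\<psi> \<circ> \<iota> \<in> ring_hom A B" by (rule ring_hom_trans[OF \<iota>_hom \<psi>_hom])
    let ?E = "eval A B (\<psi> \<circ> \<iota>) w"
    have E: "?E \<in> ring_hom P B" by (rule eval_hom[OF B.is_cring h w(1)])
    have Ef: "?E f \<in> carrier B" by (rule ring_hom_closed[OF E f(1)])
    have ce: "\<chi> p e \<in> carrier P" by (rule \<chi>_closed[OF p e(1)])
    have cem: "\<chi> p e [^]\<^bsub>P\<^esub> snd p \<in> carrier P" using ce by simp
    have Rw: "R p w = pvar \<kappa>"
      by (simp add: R_def w(2) ring_hom_mult[OF red_hom cem] P.ring_hom_nat_pow[OF Q.is_cring red_hom ce] e(2) red_var)
    have "(R p \<circ> ?E) f = red f"
    proof (rule UP_hom_eqI[OF Q.is_cring ring_hom_trans[OF E R[OF p]] red_hom _ _ f(1)])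
      fix a assume a: "a \<in> carrier A"
      show "(R p \<circ> ?E) (\<iota> a) = red (\<iota> a)"
        by (simp only: o_apply eval_const_poly[OF B.is_cring h w(1) a] R\<iota>[OF p a] red_const[OF a])
    next
      show "(R p \<circ> ?E) X = red X"
        by (simp only: o_apply eval_pvar[OF B.is_cring h w(1)] Rw red_var)
    qed
    then have RE: "R p (?E f) = g" by (simp only: o_apply f(2))
    have "R p (e \<otimes>\<^bsub>B\<^esub> ?E f) = g"
      using g by (simp add: ring_hom_mult[OF R[OF p] e(1) Ef] RE) (simp add: R_def e(2))
    moreover have "R q (e \<otimes>\<^bsub>B\<^esub> ?E f) = \<zero>\<^bsub>Q\<^esub>" if q: "q \<in> \<Delta> - {p}" for q
    proof -
      have qd: "q \<in> \<Delta>" using q by simp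
      have "R q e = \<zero>\<^bsub>Q\<^esub>" using red_zero_iff[OF \<chi>_closed[OF qd e(1)]] e(3)[OF q] by (simp add: R_def)
      then show ?thesis using Rc[OF qd Ef] by (simp add: ring_hom_mult[OF R[OF qd] e(1) Ef])
    qed
    ultimately show ?thesis using B.m_closed[OF e(1) Ef] by metis
  qed
  have surj: "\<exists>b\<in>carrier B. \<forall>p\<in>\<Delta>. R p b = (if p \<in> S then g p else \<zero>\<^bsub>Q\<^esub>)"
    if g: "\<And>p. p \<in> \<Delta> \<Longrightarrow> g p \<in> carrier Q" and S: "finite S" "S \<subseteq> \<Delta>" for g S
    using S
  proof (induction S rule: finite_induct)
    case empty
    show ?case
      by (rule bexI[OF _ B.zero_closed]) (simp add: B.ring_hom_zero'[OF Q.is_cring R])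
  next
    case (insert p S)
    then obtain b where b: "b \<in> carrier B" "\<forall>q\<in>\<Delta>. R q b = (if q \<in> S then g q else \<zero>\<^bsub>Q\<^esub>)" by auto
    have p: "p \<in> \<Delta>" using insert by simp
    obtain c where c: "c \<in> carrier B" "R p c = g p" "\<forall>q\<in>\<Delta> - {p}. R q c = \<zero>\<^bsub>Q\<^esub>"
      using local_surj[OF p g[OF p]] by metis
    have "R q (b \<oplus>\<^bsub>B\<^esub> c) = (if q \<in> insert p S then g q else \<zero>\<^bsub>Q\<^esub>)" if q: "q \<in> \<Delta>" for q
    proof (cases "q = p")
      case True
      have "R p b = \<zero>\<^bsub>Q\<^esub>" using b(2) p insert.hyps(2) by simp
      then show ?thesis unfolding True using c(2) g[OF p]
        by (simp add: ring_hom_add[OF R[OF p] b(1) c(1)])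
    next
      case False
      have "R q c = \<zero>\<^bsub>Q\<^esub>" using c(3) q False by simp
      then show ?thesis using b(2) q g[OF q] False
        by (simp add: ring_hom_add[OF R[OF q] b(1) c(1)])
    qed
    then show ?case using B.a_closed[OF b(1) c(1)] by metis
  qed
  have fin: "finite \<Delta>" and ne: "\<Delta> \<noteq> {}" using \<Delta> unfolding disc_family_def by auto
  obtain h where h: "bij_betw h {..<card \<Delta>} \<Delta>"
    using ex_bij_betw_nat_finite[OF fin] by (auto simp: atLeast0LessThan)
  have h\<Delta>: "h i \<in> \<Delta>" if "i < card \<Delta>" for i using bij_betwE[OF h] that by simp
  have "fibre_charts (card \<Delta>) (\<lambda>i. R (h i))"
    unfolding fibre_charts_def
  proof (intro conjI allI impI ballI)
    fix i assume i: "i < card \<Delta>"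
    show "R (h i) \<in> ring_hom B Q" by (rule R[OF h\<Delta>[OF i]])
  next
    fix i a assume i: "i < card \<Delta>" "a \<in> carrier A"
    show "R (h i) (\<psi> (\<iota> a)) = const_poly \<kappa> (\<pi> a)" by (rule R\<iota>[OF h\<Delta>[OF i(1)] i(2)])
  next
    fix b assume b: "b \<in> carrier B" "\<forall>i<card \<Delta>. R (h i) b = \<zero>\<^bsub>Q\<^esub>"
    show "y divides\<^bsub>B\<^esub> b"
    proof (rule ker[OF b(1)])
      fix p assume "p \<in> \<Delta>"
      then have "p \<in> h ` {..<card \<Delta>}" using bij_betw_imp_surj_on[OF h] by simp
      then obtain i where "p = h i" "i \<in> {..<card \<Delta>}" by (rule imageE)
      then show "R p b = \<zero>\<^bsub>Q\<^esub>" using b(2) by simp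
    qed
  next
    fix g :: "nat \<Rightarrow> nat \<Rightarrow> 'a set" assume g: "\<forall>i<card \<Delta>. g i \<in> carrier Q"
    define k where "k = the_inv_into {..<card \<Delta>} h"
    have k: "k (h i) = i" if i: "i < card \<Delta>" for i
      unfolding k_def by (rule the_inv_into_f_f[OF bij_betw_imp_inj_on[OF h]]) (use i in simp)
    have "g (k p) \<in> carrier Q" if p: "p \<in> \<Delta>" for p
    proof -
      have "p \<in> h ` {..<card \<Delta>}" using bij_betw_imp_surj_on[OF h] p by simp
      then obtain i where "p = h i" "i \<in> {..<card \<Delta>}" by (rule imageE)
      then show ?thesis using k g by simp
    qed
    from surj[of "\<lambda>p. g (k p)", OF this fin subset_refl]
    obtain b where b: "b \<in> carrier B" "\<forall>p\<in>\<Delta>. R p b = (if p \<in> \<Delta> then g (k p) else \<zero>\<^bsub>Q\<^esub>)" by metis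
    then show "\<exists>b\<in>carrier B. \<forall>i<card \<Delta>. R (h i) b = g i"
      by (intro bexI[OF _ b(1)]) (simp add: h\<Delta> k)
  qed
  moreover have "card \<Delta> > 0" using fin ne by (simp add: card_gt_0_iff)
  ultimately show ?thesis by metis
qed

text \<open>Generators are t, all \<open>e p\<close> and \<open>w p\<close>, and the quotient
  \<open>c\<close> of 1 minus the sum of the \<open>e p\<close> by y. Up to powers of
  \<open>e p\<close>, every element is a polynomial in \<open>w p\<close>; up to a power of y, it
  lies in A[t]. As the \<open>e p\<close> and y c sum to 1, \<open>subring_local\<close>
  applies.\<close>

lemma describes_finite_type:
  assumes \<Delta>: "disc_family \<Delta>" and desc: "describes \<Delta>"
  shows "\<exists>T. finite T \<and> T \<subseteq> carrier B \<and> generate_ring B (\<psi> ` \<iota> ` carrier A \<union> T) = carrier B"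
proof -
  obtain \<chi> where ch: "charts \<Delta> \<chi>" using charts_ex[OF \<Delta> desc] by metis
  note \<chi> = \<chi>[OF \<Delta> desc ch] and \<chi>_divides = \<chi>_divides[OF \<Delta> desc ch] and \<chi>_closed = \<chi>_closed[OF \<Delta> desc ch]
  have fin: "finite \<Delta>" using \<Delta> unfolding disc_family_def by auto
  have "\<exists>e. e \<in> carrier B \<and> red (\<chi> p e) = \<one>\<^bsub>Q\<^esub> \<and> (\<forall>q\<in>\<Delta> - {p}. \<iota> x divides\<^bsub>P\<^esub> \<chi> q e)" if "p \<in> \<Delta>" for p
    using chart_idempotent[OF \<Delta> desc ch that] by metis
  then obtain e where e: "\<And>p. p \<in> \<Delta> \<Longrightarrow> e p \<in> carrier B" "\<And>p. p \<in> \<Delta> \<Longrightarrow> red (\<chi> p (e p)) = \<one>\<^bsub>Q\<^esub>"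
      "\<And>p q. p \<in> \<Delta> \<Longrightarrow> q \<in> \<Delta> - {p} \<Longrightarrow> \<iota> x divides\<^bsub>P\<^esub> \<chi> q (e p)"
    by metis
  have "\<exists>w. w \<in> carrier B \<and> \<chi> p w = \<chi> p (e p) [^]\<^bsub>P\<^esub> snd p \<otimes>\<^bsub>P\<^esub> X" if "p \<in> \<Delta>" for p
    using chart_coordinate[OF \<Delta> desc ch that e(1)[OF that] e(3)[OF that]] by metis
  then obtain w where w: "\<And>p. p \<in> \<Delta> \<Longrightarrow> w p \<in> carrier B"
      "\<And>p. p \<in> \<Delta> \<Longrightarrow> \<chi> p (w p) = \<chi> p (e p) [^]\<^bsub>P\<^esub> snd p \<otimes>\<^bsub>P\<^esub> X"
    by metis
  define E where "E = (\<Oplus>\<^bsub>B\<^esub>p\<in>\<Delta>. e p)"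
  have Ec: "E \<in> carrier B" unfolding E_def using e(1) by (intro B.finsum_closed) auto
  have 1: "\<one>\<^bsub>B\<^esub> \<ominus>\<^bsub>B\<^esub> E \<in> carrier B" using Ec by simp
  \<comment> \<open>On each component exactly one \<open>e p\<close> is 1 and the others are 0, so 1
    - \<open>E\<close> vanishes on the whole fibre.\<close>
  have "\<forall>q\<in>\<Delta>. \<iota> x [^]\<^bsub>P\<^esub> (1::nat) divides\<^bsub>P\<^esub> \<chi> q (\<one>\<^bsub>B\<^esub> \<ominus>\<^bsub>B\<^esub> E)"
  proof
    fix q assume q: "q \<in> \<Delta>"
    have Rh: "red \<circ> \<chi> q \<in> ring_hom B Q" by (rule ring_hom_trans[OF \<chi>(1)[OF q] red_hom])
    interpret Rh: ring_hom_cring B Q "red \<circ> \<chi> q"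
      by (rule ring_hom_cringI[OF B.is_cring Q.is_cring Rh])
    have re: "(red \<circ> \<chi> q) (e p) = (if p = q then \<one>\<^bsub>Q\<^esub> else \<zero>\<^bsub>Q\<^esub>)" if p: "p \<in> \<Delta>" for p
      using red_zero_iff[OF \<chi>_closed[OF q e(1)[OF p]]] e(2)[OF q] e(3)[OF p, of q] q by auto
    have "(red \<circ> \<chi> q) E = (\<Oplus>\<^bsub>Q\<^esub>p\<in>\<Delta>. (red \<circ> \<chi> q) (e p))"
      unfolding E_def using Rh.hom_finsum[of e \<Delta>] e(1) by (auto simp: o_def Pi_def)
    also have "\<dots> = (\<Oplus>\<^bsub>Q\<^esub>p\<in>\<Delta>. if q = p then \<one>\<^bsub>Q\<^esub> else \<zero>\<^bsub>Q\<^esub>)"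
      by (rule Q.finsum_cong') (use re in auto)
    also have "\<dots> = \<one>\<^bsub>Q\<^esub>" using Q.finsum_singleton[OF q fin, of "\<lambda>_. \<one>\<^bsub>Q\<^esub>"] by simp
    finally have "red (\<chi> q (\<one>\<^bsub>B\<^esub> \<ominus>\<^bsub>B\<^esub> E)) = \<zero>\<^bsub>Q\<^esub>"
      using B.ring_hom_minus[OF Q.is_cring Rh B.one_closed Ec] ring_hom_one[OF Rh] by simp
    then have "\<iota> x divides\<^bsub>P\<^esub> \<chi> q (\<one>\<^bsub>B\<^esub> \<ominus>\<^bsub>B\<^esub> E)" using red_zero_iff[OF \<chi>_closed[OF q 1]] by simp
    then show "\<iota> x [^]\<^bsub>P\<^esub> (1::nat) divides\<^bsub>P\<^esub> \<chi> q (\<one>\<^bsub>B\<^esub> \<ominus>\<^bsub>B\<^esub> E)" by (simp only: P.nat_pow_eone[OF \<iota>_x_closed])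
  qed
  then have "y [^]\<^bsub>B\<^esub> (1::nat) divides\<^bsub>B\<^esub> (\<one>\<^bsub>B\<^esub> \<ominus>\<^bsub>B\<^esub> E)" by (rule iffD2[OF \<chi>_divides[OF 1]])
  then obtain c where c: "c \<in> carrier B" "\<one>\<^bsub>B\<^esub> \<ominus>\<^bsub>B\<^esub> E = y \<otimes>\<^bsub>B\<^esub> c"
    unfolding B.nat_pow_eone[OF y_closed] factor_def by metis
  define T where "T = insert (\<psi> X) (insert c (e ` \<Delta> \<union> w ` \<Delta>))"
  have T: "finite T" "T \<subseteq> carrier B" unfolding T_def using fin e(1) w(1) c(1) by auto
  let ?S = "\<psi> ` \<iota> ` carrier A \<union> T"
  define G where "G = generate_ring B ?S"
  have S: "?S \<subseteq> carrier B" using T by auto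
  have G: "subring G B" unfolding G_def by (rule B.generate_ring_is_subring[OF S])
  have SG: "b \<in> G" if "b \<in> ?S" for b unfolding G_def using that by (rule generate_ring.incl)
  have inG: "\<psi> X \<in> G" "c \<in> G" "\<And>p. p \<in> \<Delta> \<Longrightarrow> e p \<in> G" "\<And>p. p \<in> \<Delta> \<Longrightarrow> w p \<in> G"
    by (rule SG, simp add: T_def)+
  have \<iota>G: "\<psi> (\<iota> a) \<in> G" if "a \<in> carrier A" for a using SG that by blast
  have Gpow: "g [^]\<^bsub>B\<^esub> (k::nat) \<in> G" if "g \<in> G" for g k
    by (induction k) (use that subringE(3,6)[OF G] in auto)
  have \<psi>G: "\<psi> f \<in> G" if "f \<in> carrier P" for f
    using that
  proof (induction rule: UP_horner_induct)
    case (horner g a)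
    have "\<psi> (X \<otimes>\<^bsub>P\<^esub> g \<oplus>\<^bsub>P\<^esub> \<iota> a) = \<psi> X \<otimes>\<^bsub>B\<^esub> \<psi> g \<oplus>\<^bsub>B\<^esub> \<psi> (\<iota> a)"
      using horner by (simp add: ring_hom_add[OF \<psi>_hom] ring_hom_mult[OF \<psi>_hom])
    then show ?case
      using subringE(7)[OF G subringE(6)[OF G inG(1) horner.IH] \<iota>G[OF horner.hyps(2)]] by simp
  qed (rule \<iota>G)
  have "b \<in> G" if b: "b \<in> carrier B" for b
  proof -
    have local: "\<exists>K::nat. e p [^]\<^bsub>B\<^esub> K \<otimes>\<^bsub>B\<^esub> b \<in> G" if p: "p \<in> \<Delta>" for p
    proof -
      let ?\<epsilon> = "\<chi> p (e p)"
      have \<epsilon>: "?\<epsilon> \<in> carrier P" by (rule \<chi>_closed[OF p e(1)[OF p]])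
      have \<epsilon>k: "?\<epsilon> [^]\<^bsub>P\<^esub> k \<in> carrier P" for k :: nat using \<epsilon> by simp
      have \<chi>e: "\<chi> p (e p [^]\<^bsub>B\<^esub> k) = ?\<epsilon> [^]\<^bsub>P\<^esub> k" for k :: nat
        by (rule B.ring_hom_nat_pow[OF P.is_cring \<chi>(1)[OF p] e(1)[OF p]])
      have ek: "e p [^]\<^bsub>B\<^esub> k \<in> carrier B" for k :: nat using e(1)[OF p] by simp
      \<comment> \<open>In the chart, \<open>w p\<close> is the variable times a power of
        \<open>e p\<close>. Horner induction therefore reaches every polynomial after multiplication
        by a power of \<open>e p\<close>.\<close>
      have "\<exists>K::nat. \<exists>b'\<in>G. \<chi> p b' = ?\<epsilon> [^]\<^bsub>P\<^esub> K \<otimes>\<^bsub>P\<^esub> g" if "g \<in> carrier P" for g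
        using that
      proof (induction rule: UP_horner_induct)
        case (const a)
        have "\<chi> p (\<psi> (\<iota> a)) = \<iota> a"
          using const \<chi>(2)[OF p, of "\<iota> a"] \<Delta>_closed[OF \<Delta> desc p] by simp
        also have "\<dots> = ?\<epsilon> [^]\<^bsub>P\<^esub> (0::nat) \<otimes>\<^bsub>P\<^esub> \<iota> a" using const by simp
        finally show ?case using \<iota>G[OF const] by (intro exI[of _ "0::nat"] bexI[of _ "\<psi> (\<iota> a)"])
      next
        case (horner g a)
        then obtain K :: nat and b' where b': "b' \<in> G" "\<chi> p b' = ?\<epsilon> [^]\<^bsub>P\<^esub> K \<otimes>\<^bsub>P\<^esub> g" by metis
        let ?m = "snd p"
        let ?b = "w p \<otimes>\<^bsub>B\<^esub> b' \<oplus>\<^bsub>B\<^esub> e p [^]\<^bsub>B\<^esub> (?m + K) \<otimes>\<^bsub>B\<^esub> \<psi> (\<iota> a)"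
        have bG: "?b \<in> G"
          by (intro subringE(7)[OF G] subringE(6)[OF G] inG(4)[OF p] b'(1) Gpow inG(3)[OF p] \<iota>G[OF horner.hyps(2)])
        have b'B: "b' \<in> carrier B" using b'(1) subringE(1)[OF G] by blast
        have aP: "\<iota> a \<in> carrier P" using horner by simp
        have cm: "w p \<otimes>\<^bsub>B\<^esub> b' \<in> carrier B" "e p [^]\<^bsub>B\<^esub> (?m + K) \<otimes>\<^bsub>B\<^esub> \<psi> (\<iota> a) \<in> carrier B"
          using w(1)[OF p] b'B ek aP by simp_all
        have "\<chi> p ?b = \<chi> p (w p) \<otimes>\<^bsub>P\<^esub> \<chi> p b' \<oplus>\<^bsub>P\<^esub> ?\<epsilon> [^]\<^bsub>P\<^esub> (?m + K) \<otimes>\<^bsub>P\<^esub> \<chi> p (\<psi> (\<iota> a))"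
          by (simp only: ring_hom_add[OF \<chi>(1)[OF p] cm] ring_hom_mult[OF \<chi>(1)[OF p] w(1)[OF p] b'B]
              ring_hom_mult[OF \<chi>(1)[OF p] ek \<psi>_closed[OF aP]] \<chi>e)
        also have "\<chi> p (\<psi> (\<iota> a)) = \<iota> a"
          using horner \<chi>(2)[OF p, of "\<iota> a"] \<Delta>_closed[OF \<Delta> desc p] by simp
        also have "\<chi> p (w p) \<otimes>\<^bsub>P\<^esub> \<chi> p b' \<oplus>\<^bsub>P\<^esub> ?\<epsilon> [^]\<^bsub>P\<^esub> (?m + K) \<otimes>\<^bsub>P\<^esub> \<iota> a =
            ?\<epsilon> [^]\<^bsub>P\<^esub> (?m + K) \<otimes>\<^bsub>P\<^esub> (X \<otimes>\<^bsub>P\<^esub> g \<oplus>\<^bsub>P\<^esub> \<iota> a)"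
          unfolding w(2)[OF p] b'(2)
          using \<epsilon> \<epsilon>k horner.hyps aP by (simp add: P.nat_pow_mult[symmetric] P.r_distr P.m_ac)
        finally show ?case using bG by metis
      qed
      from this[OF \<chi>_closed[OF p b]]
      obtain K :: nat and b' where b': "b' \<in> G" "\<chi> p b' = ?\<epsilon> [^]\<^bsub>P\<^esub> K \<otimes>\<^bsub>P\<^esub> \<chi> p b" by metis
      have b'B: "b' \<in> carrier B" using b'(1) subringE(1)[OF G] by blast
      have "\<chi> p (e p [^]\<^bsub>B\<^esub> K \<otimes>\<^bsub>B\<^esub> b) = \<chi> p b'"
        by (simp only: ring_hom_mult[OF \<chi>(1)[OF p] ek b] \<chi>e b'(2))
      then have "e p [^]\<^bsub>B\<^esub> K \<otimes>\<^bsub>B\<^esub> b = b'"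
        by (rule \<chi>_inj[OF \<Delta> desc ch p B.m_closed[OF ek b] b'B])
      then show ?thesis using b'(1) by metis
    qed
    then obtain K where K: "\<And>p. p \<in> \<Delta> \<Longrightarrow> e p [^]\<^bsub>B\<^esub> (K p :: nat) \<otimes>\<^bsub>B\<^esub> b \<in> G" by metis
    obtain M :: nat and f where f: "f \<in> carrier P" "y [^]\<^bsub>B\<^esub> M \<otimes>\<^bsub>B\<^esub> b = \<psi> f" using denominators[OF b] by metis
    \<comment> \<open>\<open>None\<close> indexes the summand y c, whose M-th power moves
      \<open>b\<close> into \<open>G\<close> because y^M does; \<open>Some p\<close> indexes
      \<open>e p\<close>.\<close>
    define a where "a i = (case i of None \<Rightarrow> y \<otimes>\<^bsub>B\<^esub> c | Some p \<Rightarrow> e p)" for i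
    define L where "L i = (case i of None \<Rightarrow> M | Some p \<Rightarrow> K p)" for i
    let ?I = "insert None (Some ` \<Delta>)"
    have yG: "y \<in> G" by (rule \<psi>G[OF \<iota>_x_closed])
    have aG: "a i \<in> G" if "i \<in> ?I" for i
      using that by (auto simp: a_def inG intro!: subringE(6)[OF G] yG inG(2))
    show "b \<in> G"
    proof (rule B.subring_local[OF G, of ?I a b L])
      show "finite ?I" using fin by simp
      show "a i \<in> G" if "i \<in> ?I" for i by (rule aG[OF that])
      have aB: "a i \<in> carrier B" if "i \<in> ?I" for i using aG[OF that] subringE(1)[OF G] by blast
      have "(\<Oplus>\<^bsub>B\<^esub>i\<in>?I. a i) = a None \<oplus>\<^bsub>B\<^esub> (\<Oplus>\<^bsub>B\<^esub>i\<in>Some ` \<Delta>. a i)"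
        using fin aB by (intro B.finsum_insert) auto
      also have "(\<Oplus>\<^bsub>B\<^esub>i\<in>Some ` \<Delta>. a i) = (\<Oplus>\<^bsub>B\<^esub>p\<in>\<Delta>. a (Some p))"
        by (rule B.finsum_reindex) (use aB in auto)
      also have "\<dots> = E" by (simp add: a_def E_def)
      also have "a None \<oplus>\<^bsub>B\<^esub> E = (\<one>\<^bsub>B\<^esub> \<ominus>\<^bsub>B\<^esub> E) \<oplus>\<^bsub>B\<^esub> E" by (simp add: a_def c(2))
      also have "\<dots> = \<one>\<^bsub>B\<^esub>" using Ec B.one_closed by algebra
      finally show "(\<Oplus>\<^bsub>B\<^esub>i\<in>?I. a i) = \<one>\<^bsub>B\<^esub>" .
      show "b \<in> carrier B" by (rule b)
      fix i assume i: "i \<in> ?I"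
      show "a i [^]\<^bsub>B\<^esub> L i \<otimes>\<^bsub>B\<^esub> b \<in> G"
      proof (cases i)
        case None
        have "(y \<otimes>\<^bsub>B\<^esub> c) [^]\<^bsub>B\<^esub> M \<otimes>\<^bsub>B\<^esub> b = c [^]\<^bsub>B\<^esub> M \<otimes>\<^bsub>B\<^esub> (y [^]\<^bsub>B\<^esub> M \<otimes>\<^bsub>B\<^esub> b)"
          using c(1) b y_closed by (simp add: B.nat_pow_distrib B.m_ac)
        also have "\<dots> \<in> G" unfolding f(2) by (intro subringE(6)[OF G] Gpow inG(2) \<psi>G[OF f(1)])
        finally show ?thesis by (simp add: None a_def L_def)
      next
        case (Some p)
        then show ?thesis using K i by (auto simp: a_def L_def)
      qed
    qed
  qed
  then have "generate_ring B ?S = carrier B"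
    using subringE(1)[OF G] unfolding G_def by blast
  then show ?thesis using T by metis
qed

end

section \<open>Relative surfaces and disc families\<close>

lemma prod_ring_cring:
  assumes "\<And>i. i \<in> I \<Longrightarrow> cring (R i)"
  shows "cring (prod_ring I R)"
proof -
  have R: "\<And>i. i \<in> I \<Longrightarrow> ring (R i)" using assms cring.axioms(1) by blast
  have c: "\<And>i f. i \<in> I \<Longrightarrow> f \<in> carrier (prod_ring I R) \<Longrightarrow> f i \<in> carrier (R i)"
    by (auto simp: prod_ring_def)
  note m = cring.cring_simprules[OF assms]
  show ?thesis
  proof (rule cringI)
    show "abelian_group (prod_ring I R)"
    proof (rule abelian_groupI)
      fix f assume f: "f \<in> carrier (prod_ring I R)"
      show "\<exists>g\<in>carrier (prod_ring I R). g \<oplus>\<^bsub>prod_ring I R\<^esub> f = \<zero>\<^bsub>prod_ring I R\<^esub>"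
      proof (rule bexI[of _ "\<lambda>i\<in>I. \<ominus>\<^bsub>R i\<^esub> f i"])
        show "(\<lambda>i\<in>I. \<ominus>\<^bsub>R i\<^esub> f i) \<oplus>\<^bsub>prod_ring I R\<^esub> f = \<zero>\<^bsub>prod_ring I R\<^esub>"
          by (auto simp: prod_ring_def fun_eq_iff restrict_def m(9) c[OF _ f])
        show "(\<lambda>i\<in>I. \<ominus>\<^bsub>R i\<^esub> f i) \<in> carrier (prod_ring I R)"
          using c[OF _ f] m(3) by (auto simp: prod_ring_def)
      qed
      show "\<zero>\<^bsub>prod_ring I R\<^esub> \<oplus>\<^bsub>prod_ring I R\<^esub> f = f"
        using f c[OF _ f] m(8) by (auto simp: prod_ring_def intro!: extensionalityI[of _ I] simp: PiE_def)
      fix g assume g: "g \<in> carrier (prod_ring I R)"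
      show "f \<oplus>\<^bsub>prod_ring I R\<^esub> g \<in> carrier (prod_ring I R)"
        using c[OF _ f] c[OF _ g] m(1) by (auto simp: prod_ring_def)
      show "f \<oplus>\<^bsub>prod_ring I R\<^esub> g = g \<oplus>\<^bsub>prod_ring I R\<^esub> f"
        using c[OF _ f] c[OF _ g] m(10) by (auto simp: prod_ring_def fun_eq_iff restrict_def)
      fix h assume h: "h \<in> carrier (prod_ring I R)"
      show "f \<oplus>\<^bsub>prod_ring I R\<^esub> g \<oplus>\<^bsub>prod_ring I R\<^esub> h = f \<oplus>\<^bsub>prod_ring I R\<^esub> (g \<oplus>\<^bsub>prod_ring I R\<^esub> h)"
        using c[OF _ f] c[OF _ g] c[OF _ h] m(7) by (auto simp: prod_ring_def fun_eq_iff restrict_def)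
    next
      show "\<zero>\<^bsub>prod_ring I R\<^esub> \<in> carrier (prod_ring I R)" using m(2) by (auto simp: prod_ring_def)
    qed
    show "comm_monoid (prod_ring I R)"
    proof (rule comm_monoidI)
      show "\<one>\<^bsub>prod_ring I R\<^esub> \<in> carrier (prod_ring I R)" using m(6) by (auto simp: prod_ring_def)
      fix f assume f: "f \<in> carrier (prod_ring I R)"
      show "\<one>\<^bsub>prod_ring I R\<^esub> \<otimes>\<^bsub>prod_ring I R\<^esub> f = f"
        using f c[OF _ f] m(12) by (auto simp: prod_ring_def intro!: extensionalityI[of _ I] simp: PiE_def)
      fix g assume g: "g \<in> carrier (prod_ring I R)"
      show "f \<otimes>\<^bsub>prod_ring I R\<^esub> g \<in> carrier (prod_ring I R)"
        using c[OF _ f] c[OF _ g] m(5) by (auto simp: prod_ring_def)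
      show "f \<otimes>\<^bsub>prod_ring I R\<^esub> g = g \<otimes>\<^bsub>prod_ring I R\<^esub> f"
        using c[OF _ f] c[OF _ g] m(14) by (auto simp: prod_ring_def fun_eq_iff restrict_def)
      fix h assume h: "h \<in> carrier (prod_ring I R)"
      show "f \<otimes>\<^bsub>prod_ring I R\<^esub> g \<otimes>\<^bsub>prod_ring I R\<^esub> h = f \<otimes>\<^bsub>prod_ring I R\<^esub> (g \<otimes>\<^bsub>prod_ring I R\<^esub> h)"
        using c[OF _ f] c[OF _ g] c[OF _ h] m(11) by (auto simp: prod_ring_def fun_eq_iff restrict_def)
    qed
    fix f g h assume f: "f \<in> carrier (prod_ring I R)" and g: "g \<in> carrier (prod_ring I R)"
      and h: "h \<in> carrier (prod_ring I R)"
    show "(f \<oplus>\<^bsub>prod_ring I R\<^esub> g) \<otimes>\<^bsub>prod_ring I R\<^esub> h = f \<otimes>\<^bsub>prod_ring I R\<^esub> h \<oplus>\<^bsub>prod_ring I R\<^esub> g \<otimes>\<^bsub>prod_ring I R\<^esub> h"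
      using c[OF _ f] c[OF _ g] c[OF _ h] m(13) by (auto simp: prod_ring_def fun_eq_iff restrict_def)
  qed
qed

lemma prod_ring_proj_hom: "i \<in> I \<Longrightarrow> (\<lambda>f. f i) \<in> ring_hom (prod_ring I R) (R i)"
  by (rule ring_hom_memI) (auto simp: prod_ring_def)

section \<open>Reading off the coordinate maps of a given relative surface\<close>

context base_ring
begin

text \<open>Elements of the coset of \<open>a\<close> have images that differ from
  \<open>s a\<close> by multiples of \<open>s x\<close>, and the added ideal absorbs these.\<close>

lemma fibre_str_coset:
  assumes "cring B" and s: "s \<in> ring_hom A B" and a: "a \<in> carrier A"
  shows "fibre_str B s x (\<pi> a) = PIdl\<^bsub>B\<^esub> (s x) +>\<^bsub>B\<^esub> s a"
proof -
  interpret B: cring B by fact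
  have sc: "s b \<in> carrier B" if "b \<in> carrier A" for b by (rule ring_hom_closed[OF s that])
  note sx = sc[OF x_closed] and sa = sc[OF a]
  show ?thesis
  proof (intro equalityI subsetI)
    fix b assume "b \<in> fibre_str B s x (\<pi> a)"
    then obtain z w where z: "z \<in> carrier A" "w \<in> carrier B" "b = s (z \<otimes> x \<oplus> a) \<oplus>\<^bsub>B\<^esub> w \<otimes>\<^bsub>B\<^esub> s x"
      unfolding fibre_str_def set_add_def' a_r_coset_def' cgenideal_def by auto
    have "b = (s z \<otimes>\<^bsub>B\<^esub> s x \<oplus>\<^bsub>B\<^esub> s a) \<oplus>\<^bsub>B\<^esub> w \<otimes>\<^bsub>B\<^esub> s x"
      using z(1) a by (simp add: z(3) ring_hom_add[OF s] ring_hom_mult[OF s])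
    also have "\<dots> = (s z \<oplus>\<^bsub>B\<^esub> w) \<otimes>\<^bsub>B\<^esub> s x \<oplus>\<^bsub>B\<^esub> s a"
      using sc[OF z(1)] z(2) sx sa by algebra
    finally have "b = (s z \<oplus>\<^bsub>B\<^esub> w) \<otimes>\<^bsub>B\<^esub> s x \<oplus>\<^bsub>B\<^esub> s a" .
    moreover have "(s z \<oplus>\<^bsub>B\<^esub> w) \<otimes>\<^bsub>B\<^esub> s x \<in> PIdl\<^bsub>B\<^esub> (s x)"
      unfolding cgenideal_def using B.a_closed[OF sc[OF z(1)] z(2)] by blast
    ultimately show "b \<in> PIdl\<^bsub>B\<^esub> (s x) +>\<^bsub>B\<^esub> s a" unfolding a_r_coset_def' by blast
  next
    fix b assume "b \<in> PIdl\<^bsub>B\<^esub> (s x) +>\<^bsub>B\<^esub> s a"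
    then obtain w where w: "w \<in> carrier B" "b = w \<otimes>\<^bsub>B\<^esub> s x \<oplus>\<^bsub>B\<^esub> s a"
      unfolding a_r_coset_def' cgenideal_def by auto
    have "b = s (\<zero> \<otimes> x \<oplus> a) \<oplus>\<^bsub>B\<^esub> w \<otimes>\<^bsub>B\<^esub> s x"
      using w sx sa a by (simp add: B.a_comm)
    moreover have "\<zero> \<otimes> x \<in> PIdl x" unfolding cgenideal_def using zero_closed by blast
    then have "s (\<zero> \<otimes> x \<oplus> a) \<in> s ` (\<pi> a)" unfolding a_r_coset_def' by blast
    moreover have "w \<otimes>\<^bsub>B\<^esub> s x \<in> PIdl\<^bsub>B\<^esub> (s x)" unfolding cgenideal_def using w by blast
    ultimately show "b \<in> fibre_str B s x (\<pi> a)" unfolding fibre_str_def set_add_def' by blast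
  qed
qed

lemma rel_dfs_over_line:
  assumes S: "rel_dfs A x S"
  shows "over_line A x (coord_ring S) (comorphism S)"
    and "str_map S \<in> ring_hom A (coord_ring S)"
    and "a \<in> carrier A \<Longrightarrow> comorphism S (\<iota> a) = str_map S a"
proof -
  let ?B = "coord_ring S" and ?s = "str_map S" and ?\<psi> = "comorphism S"
  have dom: "domain ?B" and s: "?s \<in> ring_hom A ?B"
    using S by (simp_all add: rel_dfs_def dfs_def integral_affine_finite_type_def)
  have mor: "dfs_mor A x ?B ?s P \<iota> ?\<psi>" using S by (simp add: rel_dfs_def)
  then have \<psi>: "?\<psi> \<in> ring_hom P ?B" "\<And>a. a \<in> carrier A \<Longrightarrow> ?\<psi> (\<iota> a) = ?s a" "inj_on ?\<psi> (carrier P)"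
    by (simp_all add: dfs_mor_def alg_hom_def birational_def)
  interpret B: "domain" ?B by (rule dom)
  have nz: "?s x \<noteq> \<zero>\<^bsub>?B\<^esub>"
    using inj_onD[OF \<psi>(3), of "\<iota> x" "\<zero>\<^bsub>P\<^esub>"] P.ring_hom_zero'[OF B.is_cring \<psi>(1)] \<psi>(2)[OF x_closed] by auto
  have den: "\<forall>b'\<in>carrier ?B. \<exists>n::nat. \<exists>b\<in>carrier P. ?s x [^]\<^bsub>?B\<^esub> n \<otimes>\<^bsub>?B\<^esub> b' = ?\<psi> b"
    using mor dfs_mor_iff[OF P.domain_axioms dom \<iota>_hom s \<iota>_x_nonzero nz] by simp
  show "over_line A x ?B ?\<psi>"
    by (intro over_line.intro over_line_axioms.intro base_ring_axioms dom \<psi>(1,3))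
       (use den \<psi>(2)[OF x_closed] in simp)
  show "?s \<in> ring_hom A ?B" by (rule s)
  show "a \<in> carrier A \<Longrightarrow> ?\<psi> (\<iota> a) = ?s a" by (rule \<psi>(2))
qed

text \<open>The coordinate maps are the quotient map, the given isomorphism and the projections
  composed. Their number is positive because the fibre is nonempty: with none of them, y would
  divide everything.\<close>

lemma rel_dfs_fibre_charts:
  assumes S: "rel_dfs A x S"
  shows "\<exists>n>0. \<exists>\<rho>. over_line.fibre_charts A x (coord_ring S) (comorphism S) n \<rho>"
proof -
  let ?B = "coord_ring S" and ?s = "str_map S" and ?\<psi> = "comorphism S"
  interpret L: over_line A x ?B ?\<psi> by (rule rel_dfs_over_line(1)[OF S])
  note s = rel_dfs_over_line(2)[OF S] and s\<psi> = rel_dfs_over_line(3)[OF S]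
  have sx: "?s x = L.y" using s\<psi>[OF x_closed] by simp
  let ?I = "PIdl\<^bsub>?B\<^esub> L.y"
  interpret I: ideal ?I ?B by (rule L.B.cgenideal_ideal[OF L.y_closed])
  have fr: "fibre_ring ?B (?s x) = ?B Quot ?I" by (simp add: fibre_ring_def sx)
  have mem: "b \<in> ?I \<longleftrightarrow> L.y divides\<^bsub>?B\<^esub> b" if "b \<in> carrier ?B" for b
    unfolding cgenideal_def factor_def using L.B.m_comm[OF L.y_closed] by auto
  obtain n :: nat where n: "alg_iso \<kappa> (?B Quot ?I) (fibre_str ?B ?s x)
          (prod_ring {..<n} (\<lambda>i. Q)) (\<lambda>c. \<lambda>i\<in>{..<n}. const_poly \<kappa> c) \<noteq> {}"
    using S unfolding rel_dfs_def dfs_def Let_def fr by blast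
  then obtain \<Phi> where \<Phi>: "\<Phi> \<in> alg_iso \<kappa> (?B Quot ?I) (fibre_str ?B ?s x)
          (prod_ring {..<n} (\<lambda>i. Q)) (\<lambda>c. \<lambda>i\<in>{..<n}. const_poly \<kappa> c)" by blast
  let ?Pr = "prod_ring {..<n} (\<lambda>i. Q)"
  have iso: "\<Phi> \<in> ring_hom (?B Quot ?I) ?Pr" "bij_betw \<Phi> (carrier (?B Quot ?I)) (carrier ?Pr)"
    and \<Phi>s: "\<And>c. c \<in> carrier \<kappa> \<Longrightarrow> \<Phi> (fibre_str ?B ?s x c) = (\<lambda>i\<in>{..<n}. const_poly \<kappa> c)"
    using \<Phi> by (simp_all add: alg_iso_def alg_hom_def ring_iso_def)
  interpret Pr: cring ?Pr by (rule prod_ring_cring) (rule Q.is_cring)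
  interpret FB: cring "?B Quot ?I" by (rule I.quotient_is_cring[OF L.B.is_cring])
  let ?q = "(+>\<^bsub>?B\<^esub>) ?I"
  have q: "?q \<in> ring_hom ?B (?B Quot ?I)" by (rule I.rcos_ring_hom)
  define \<rho> where "\<rho> i = (\<lambda>f. f i) \<circ> (\<Phi> \<circ> ?q)" for i :: nat
  have \<rho>: "\<rho> i b = \<Phi> (?q b) i" for i b by (simp add: \<rho>_def)
  have fc: "L.fibre_charts n \<rho>"
    unfolding L.fibre_charts_def
  proof (intro conjI allI impI ballI)
    fix i assume "i < n"
    then show "\<rho> i \<in> ring_hom ?B Q" unfolding \<rho>_def
      by (intro ring_hom_trans[OF ring_hom_trans[OF q iso(1)] prod_ring_proj_hom]) simp
  next
    fix i a assume i: "i < n" and a: "a \<in> carrier A"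
    have "?q (?\<psi> (\<iota> a)) = fibre_str ?B ?s x (\<pi> a)"
      unfolding fibre_str_coset[OF L.B.is_cring s a] sx s\<psi>[OF a] ..
    then show "\<rho> i (?\<psi> (\<iota> a)) = const_poly \<kappa> (\<pi> a)"
      using i by (simp add: \<rho> \<Phi>s[OF ring_hom_closed[OF \<pi>_hom a]])
  next
    fix b assume b: "b \<in> carrier ?B" "\<forall>i<n. \<rho> i b = \<zero>\<^bsub>Q\<^esub>"
    have qb: "?q b \<in> carrier (?B Quot ?I)" by (rule ring_hom_closed[OF q b(1)])
    have "\<Phi> (?q b) \<in> carrier ?Pr" by (rule ring_hom_closed[OF iso(1) qb])
    then have "\<Phi> (?q b) \<in> extensional {..<n}" by (simp add: prod_ring_def PiE_def)
    then have "\<Phi> (?q b) = (\<lambda>i\<in>{..<n}. \<zero>\<^bsub>Q\<^esub>)"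
      by (rule extensionalityI[OF _ restrict_extensional]) (use b(2) in \<open>simp add: \<rho>\<close>)
    also have "\<dots> = \<zero>\<^bsub>?Pr\<^esub>" by (simp add: prod_ring_def)
    also have "\<dots> = \<Phi> \<zero>\<^bsub>?B Quot ?I\<^esub>" using FB.ring_hom_zero'[OF Pr.is_cring iso(1)] by simp
    finally have "?q b = \<zero>\<^bsub>?B Quot ?I\<^esub>"
      using inj_onD[OF bij_betw_imp_inj_on[OF iso(2)] _ qb FB.zero_closed] by simp
    then have "?q b = ?I" by (simp add: FactRing_def)
    moreover have "b \<in> ?q b" by (rule I.a_rcos_self[OF b(1)])
    ultimately have "b \<in> ?I" by simp
    then show "L.y divides\<^bsub>?B\<^esub> b" using mem[OF b(1)] by simp
  next
    fix g :: "nat \<Rightarrow> nat \<Rightarrow> 'a set" assume g: "\<forall>i<n. g i \<in> carrier Q"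
    have "(\<lambda>i\<in>{..<n}. g i) \<in> carrier ?Pr" using g by (simp add: prod_ring_def)
    then have "(\<lambda>i\<in>{..<n}. g i) \<in> \<Phi> ` carrier (?B Quot ?I)" using bij_betw_imp_surj_on[OF iso(2)] by simp
    then obtain p where p: "(\<lambda>i\<in>{..<n}. g i) = \<Phi> p" "p \<in> carrier (?B Quot ?I)" by (rule imageE)
    obtain b where b: "b \<in> carrier ?B" "p = ?q b"
      using p(2) by (auto simp: FactRing_def A_RCOSETS_def')
    show "\<exists>b\<in>carrier ?B. \<forall>i<n. \<rho> i b = g i"
    proof (rule bexI[OF _ b(1)], intro allI impI)
      fix i assume "i < n"
      then show "\<rho> i b = g i" using fun_cong[OF p(1), of i] by (simp add: \<rho> b(2))
    qed
  qed
  moreover have "n > 0"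
  proof (rule ccontr)
    assume "\<not> n > 0"
    then have "n = 0" by simp
    have all: "b \<in> ?I" if b: "b \<in> carrier ?B" for b
    proof -
      have "L.y divides\<^bsub>?B\<^esub> b" by (rule L.\<rho>_kernel[OF fc b]) (use \<open>n = 0\<close> in simp)
      then show ?thesis using mem[OF b] by simp
    qed
    have "carrier (?B Quot ?I) = {\<zero>\<^bsub>?B Quot ?I\<^esub>}"
    proof (rule equalityI)
      show "carrier (?B Quot ?I) \<subseteq> {\<zero>\<^bsub>?B Quot ?I\<^esub>}"
      proof
        fix p assume "p \<in> carrier (?B Quot ?I)"
        then obtain b where b: "b \<in> carrier ?B" "p = ?q b" by (auto simp: FactRing_def A_RCOSETS_def')
        have "p = ?I" using I.a_rcos_const[OF all[OF b(1)]] by (simp only: b(2))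
        then show "p \<in> {\<zero>\<^bsub>?B Quot ?I\<^esub>}" by (simp add: FactRing_def)
      qed
      show "{\<zero>\<^bsub>?B Quot ?I\<^esub>} \<subseteq> carrier (?B Quot ?I)" using FB.zero_closed by simp
    qed
    then show False using S unfolding rel_dfs_def dfs_def fr by simp
  qed
  ultimately show ?thesis by metis
qed

end

section \<open>From discs back to the definition of a surface\<close>

context over_line
begin

text \<open>Send the variable over A_x to \<open>\<psi> X\<close>. The map is onto because
  denominators of elements of \<open>B\<close> are powers of y, and injective because a power of
  \<open>x\<close> brings a polynomial over A_x into A[t], where \<open>\<psi>\<close> is
  injective.\<close>

lemma loc_iso:
  defines "s \<equiv> \<psi> \<circ> \<iota>"
  shows "alg_iso (loc A x) (UP (loc A x)) (const_poly (loc A x)) (loc B (s x)) (loc_map A x B s) \<noteq> {}"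
proof -
  have s: "s \<in> ring_hom A B" unfolding s_def by (rule ring_hom_trans[OF \<iota>_hom \<psi>_hom])
  have sa: "s a = \<psi> (\<iota> a)" for a by (simp add: s_def)
  have sx: "s x = y" by (simp add: sa)
  interpret FA: fractions A "powers A x" by (rule fractions_powers) auto
  interpret FB: fractions B "powers B y" by (rule B.fractions_powers[OF y_closed y_nonzero])
  have M: "s ` powers A x \<subseteq> powers B y"
    using ring_hom_nat_pow[OF B.is_cring s x_closed] sx by (auto simp: powers_def)
  interpret H: fractions_hom A "powers A x" B "powers B y" s
    by unfold_locales (rule s, rule M)
  let ?L = "frac_ring A (powers A x)" and ?LB = "frac_ring B (powers B y)"
  let ?fa = "mk_frac A (powers A x)" and ?fb = "mk_frac B (powers B y)"
  let ?lm = "frac_map B (powers B y) s"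
  interpret L: "domain" ?L by (rule FA.frac_domain)
  interpret LB: "domain" ?LB by (rule FB.frac_domain)
  interpret LP: "domain" "UP ?L" by (rule L.domain_UP)
  have lm: "?lm \<in> ring_hom ?L ?LB" by (rule H.frac_map_hom)
  have ja: "(\<lambda>a. ?fa a \<one>) \<in> ring_hom A ?L" by (rule FA.frac_one_hom)
  have jb: "(\<lambda>b. ?fb b \<one>\<^bsub>B\<^esub>) \<in> ring_hom B ?LB" by (rule FB.frac_one_hom)
  note cL = L.const_poly_hom
  have tB: "?fb (\<psi> X) \<one>\<^bsub>B\<^esub> \<in> carrier ?LB" by (rule FB.frac_closed[OF \<psi>_closed[OF pvar_closed] FB.M_one])
  define E where "E = eval ?L ?LB ?lm (?fb (\<psi> X) \<one>\<^bsub>B\<^esub>)"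
  have E: "E \<in> ring_hom (UP ?L) ?LB" unfolding E_def by (rule L.eval_hom[OF LB.is_cring lm tB])
  have Ec: "E (const_poly ?L c) = ?lm c" if "c \<in> carrier ?L" for c
    unfolding E_def by (rule L.eval_const_poly[OF LB.is_cring lm tB that])
  have EX: "E (pvar ?L) = ?fb (\<psi> X) \<one>\<^bsub>B\<^esub>"
    unfolding E_def by (rule L.eval_pvar[OF LB.is_cring lm tB])
  define h where "h = const_poly ?L \<circ> (\<lambda>a. ?fa a \<one>)"
  have h: "h \<in> ring_hom A (UP ?L)" unfolding h_def by (rule ring_hom_trans[OF ja cL])
  have ha: "h a = const_poly ?L (?fa a \<one>)" for a by (simp add: h_def)
  define j where "j = eval A (UP ?L) h (pvar ?L)"
  have j: "j \<in> ring_hom P (UP ?L)" unfolding j_def by (rule eval_hom[OF LP.is_cring h L.pvar_closed])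
  have j\<iota>: "j (\<iota> a) = h a" if "a \<in> carrier A" for a
    unfolding j_def by (rule eval_const_poly[OF LP.is_cring h L.pvar_closed that])
  have jX: "j X = pvar ?L" unfolding j_def by (rule eval_pvar[OF LP.is_cring h L.pvar_closed])
  have lmf: "?lm (?fa a u) = ?fb (s a) (s u)" if "a \<in> carrier A" "u \<in> powers A x" for a u
    by (rule H.frac_map_frac[OF that])
  have faL: "?fa a \<one> \<in> carrier ?L" if "a \<in> carrier A" for a by (rule FA.frac_closed[OF that FA.M_one])
  have Ej: "E (j f) = ?fb (\<psi> f) \<one>\<^bsub>B\<^esub>" if f: "f \<in> carrier P" for f
  proof -
    have "(E \<circ> j) f = ((\<lambda>b. ?fb b \<one>\<^bsub>B\<^esub>) \<circ> \<psi>) f"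
    proof (rule UP_hom_eqI[OF LB.is_cring ring_hom_trans[OF j E] ring_hom_trans[OF \<psi>_hom jb] _ _ f])
      fix a assume a: "a \<in> carrier A"
      have "s \<one> = \<one>\<^bsub>B\<^esub>" by (rule ring_hom_one[OF s])
      then show "(E \<circ> j) (\<iota> a) = ((\<lambda>b. ?fb b \<one>\<^bsub>B\<^esub>) \<circ> \<psi>) (\<iota> a)"
        by (simp only: o_apply j\<iota>[OF a] ha Ec[OF faL[OF a]] lmf[OF a FA.M_one] sa)
    next
      show "(E \<circ> j) X = ((\<lambda>b. ?fb b \<one>\<^bsub>B\<^esub>) \<circ> \<psi>) X" by (simp only: o_apply jX EX)
    qed
    then show ?thesis by (simp only: o_apply)
  qed
  have xn: "x [^] (n::nat) \<in> powers A x" "x [^] n \<in> carrier A" for n by (auto simp: powers_def)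
  have yn: "y [^]\<^bsub>B\<^esub> (n::nat) \<in> powers B y" for n by (auto simp: powers_def)
  have sxn: "s (x [^] (n::nat)) = y [^]\<^bsub>B\<^esub> n" for n
    by (simp only: ring_hom_nat_pow[OF B.is_cring s x_closed] sx)
  have surj: "q \<in> E ` carrier (UP ?L)" if q: "q \<in> carrier ?LB" for q
  proof -
    obtain b u where b: "b \<in> carrier B" "u \<in> powers B y" "q = ?fb b u" by (rule FB.frac_cases[OF q])
    obtain k :: nat where k: "u = y [^]\<^bsub>B\<^esub> k" using b(2) by (auto simp: powers_def)
    obtain N :: nat and f where f: "f \<in> carrier P" "y [^]\<^bsub>B\<^esub> N \<otimes>\<^bsub>B\<^esub> b = \<psi> f" using denominators[OF b(1)] by metis
    let ?c = "?fa \<one> (x [^] (N + k))"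
    have c: "?c \<in> carrier ?L" by (rule FA.frac_closed[OF one_closed xn(1)])
    have jf: "j f \<in> carrier (UP ?L)" by (rule ring_hom_closed[OF j f(1)])
    have "E (const_poly ?L ?c \<otimes>\<^bsub>UP ?L\<^esub> j f) = ?lm ?c \<otimes>\<^bsub>?LB\<^esub> ?fb (\<psi> f) \<one>\<^bsub>B\<^esub>"
      by (simp only: ring_hom_mult[OF E L.const_poly_closed[OF c] jf] Ec[OF c] Ej[OF f(1)])
    also have "?lm ?c = ?fb \<one>\<^bsub>B\<^esub> (y [^]\<^bsub>B\<^esub> (N + k))"
      by (simp only: lmf[OF one_closed xn(1)] ring_hom_one[OF s] sxn)
    also have "?fb \<one>\<^bsub>B\<^esub> (y [^]\<^bsub>B\<^esub> (N + k)) \<otimes>\<^bsub>?LB\<^esub> ?fb (\<psi> f) \<one>\<^bsub>B\<^esub> = ?fb (\<one>\<^bsub>B\<^esub> \<otimes>\<^bsub>B\<^esub> \<psi> f) (y [^]\<^bsub>B\<^esub> (N + k) \<otimes>\<^bsub>B\<^esub> \<one>\<^bsub>B\<^esub>)"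
      by (rule FB.frac_mult[OF B.one_closed yn \<psi>_closed[OF f(1)] FB.M_one])
    also have "\<dots> = ?fb b u"
    proof (rule iffD2[OF FB.frac_eq_iff])
      have "(\<one>\<^bsub>B\<^esub> \<otimes>\<^bsub>B\<^esub> \<psi> f) \<otimes>\<^bsub>B\<^esub> u = (y [^]\<^bsub>B\<^esub> N \<otimes>\<^bsub>B\<^esub> b) \<otimes>\<^bsub>B\<^esub> y [^]\<^bsub>B\<^esub> k" using f(1) by (simp add: f(2) k)
      also have "\<dots> = b \<otimes>\<^bsub>B\<^esub> (y [^]\<^bsub>B\<^esub> (N + k) \<otimes>\<^bsub>B\<^esub> \<one>\<^bsub>B\<^esub>)"
        using b(1) y_closed by (simp add: B.nat_pow_mult[symmetric] B.m_ac)
      finally show "(\<one>\<^bsub>B\<^esub> \<otimes>\<^bsub>B\<^esub> \<psi> f) \<otimes>\<^bsub>B\<^esub> u = b \<otimes>\<^bsub>B\<^esub> (y [^]\<^bsub>B\<^esub> (N + k) \<otimes>\<^bsub>B\<^esub> \<one>\<^bsub>B\<^esub>)" .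
    qed (use b f yn FB.M_mult[OF yn FB.M_one] in simp_all)
    finally have "q = E (const_poly ?L ?c \<otimes>\<^bsub>UP ?L\<^esub> j f)" by (simp only: b(3))
    then show ?thesis by (rule image_eqI[where f = E]) (rule LP.m_closed[OF L.const_poly_closed[OF c] jf])
  qed
  \<comment> \<open>A common denominator, found along the Horner form; the exponents for the two
    parts are added.\<close>
  have clear: "\<exists>N::nat. \<exists>f\<in>carrier P. h (x [^] N) \<otimes>\<^bsub>UP ?L\<^esub> p = j f" if "p \<in> carrier (UP ?L)" for p
    using that
  proof (induction rule: L.UP_horner_induct)
    case (const c)
    obtain a u where a: "a \<in> carrier A" "u \<in> powers A x" "c = ?fa a u" by (rule FA.frac_cases[OF const])
    obtain k :: nat where k: "u = x [^] k" using a(2) by (auto simp: powers_def)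
    have "?fa (x [^] k) \<one> \<otimes>\<^bsub>?L\<^esub> ?fa a u = ?fa (x [^] k \<otimes> a) (\<one> \<otimes> u)"
      by (rule FA.frac_mult[OF xn(2) FA.M_one a(1,2)])
    also have "\<dots> = ?fa a \<one>"
      by (rule iffD2[OF FA.frac_eq_iff]) (use a xn k in \<open>simp_all add: m_comm\<close>)
    finally have "?fa (x [^] k) \<one> \<otimes>\<^bsub>?L\<^esub> c = ?fa a \<one>" by (simp only: a(3))
    then have "h (x [^] k) \<otimes>\<^bsub>UP ?L\<^esub> const_poly ?L c = j (\<iota> a)"
      by (simp only: ha j\<iota>[OF a(1)] ring_hom_mult[OF cL faL[OF xn(2)] const, symmetric])
    then show ?case using a(1) const_poly_closed by metis
  next
    case (horner g c)
    obtain N :: nat and f where f: "f \<in> carrier P" "h (x [^] N) \<otimes>\<^bsub>UP ?L\<^esub> g = j f" using horner.IH by metis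
    obtain a u where a: "a \<in> carrier A" "u \<in> powers A x" "c = ?fa a u" by (rule FA.frac_cases[OF horner.hyps(2)])
    obtain k :: nat where k: "u = x [^] k" using a(2) by (auto simp: powers_def)
    have hk: "h (x [^] (n::nat)) \<in> carrier (UP ?L)" for n by (rule ring_hom_closed[OF h xn(2)])
    have hNk: "h (x [^] (N + k)) = h (x [^] N) \<otimes>\<^bsub>UP ?L\<^esub> h (x [^] k)"
      by (simp only: ring_hom_mult[OF h xn(2) xn(2), symmetric] nat_pow_mult[OF x_closed])
    have cc: "const_poly ?L c \<in> carrier (UP ?L)" by (rule L.const_poly_closed[OF horner.hyps(2)])
    have "?fa (x [^] k) \<one> \<otimes>\<^bsub>?L\<^esub> ?fa a u = ?fa (x [^] k \<otimes> a) (\<one> \<otimes> u)"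
      by (rule FA.frac_mult[OF xn(2) FA.M_one a(1,2)])
    also have "\<dots> = ?fa a \<one>"
      by (rule iffD2[OF FA.frac_eq_iff]) (use a xn k in \<open>simp_all add: m_comm\<close>)
    finally have "?fa (x [^] k) \<one> \<otimes>\<^bsub>?L\<^esub> c = ?fa a \<one>" by (simp only: a(3))
    then have ck: "h (x [^] k) \<otimes>\<^bsub>UP ?L\<^esub> const_poly ?L c = h a"
      by (simp only: ha ring_hom_mult[OF cL faL[OF xn(2)] horner.hyps(2), symmetric])
    have "h (x [^] (N + k)) \<otimes>\<^bsub>UP ?L\<^esub> (pvar ?L \<otimes>\<^bsub>UP ?L\<^esub> g \<oplus>\<^bsub>UP ?L\<^esub> const_poly ?L c) =
        pvar ?L \<otimes>\<^bsub>UP ?L\<^esub> (h (x [^] k) \<otimes>\<^bsub>UP ?L\<^esub> (h (x [^] N) \<otimes>\<^bsub>UP ?L\<^esub> g)) \<oplus>\<^bsub>UP ?L\<^esub>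
        h (x [^] N) \<otimes>\<^bsub>UP ?L\<^esub> (h (x [^] k) \<otimes>\<^bsub>UP ?L\<^esub> const_poly ?L c)"
      unfolding hNk using hk cc horner.hyps(1) L.pvar_closed by (simp add: LP.r_distr LP.m_ac)
    also have "\<dots> = pvar ?L \<otimes>\<^bsub>UP ?L\<^esub> (h (x [^] k) \<otimes>\<^bsub>UP ?L\<^esub> j f) \<oplus>\<^bsub>UP ?L\<^esub> h (x [^] N) \<otimes>\<^bsub>UP ?L\<^esub> h a"
      by (simp only: f(2) ck)
    also have "\<dots> = j (X \<otimes>\<^bsub>P\<^esub> (\<iota> (x [^] k) \<otimes>\<^bsub>P\<^esub> f) \<oplus>\<^bsub>P\<^esub> \<iota> (x [^] N) \<otimes>\<^bsub>P\<^esub> \<iota> a)"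
      using f(1) a(1) xn(2) by (simp add: ring_hom_add[OF j] ring_hom_mult[OF j] jX j\<iota>)
    finally have "h (x [^] (N + k)) \<otimes>\<^bsub>UP ?L\<^esub> (pvar ?L \<otimes>\<^bsub>UP ?L\<^esub> g \<oplus>\<^bsub>UP ?L\<^esub> const_poly ?L c) =
        j (X \<otimes>\<^bsub>P\<^esub> (\<iota> (x [^] k) \<otimes>\<^bsub>P\<^esub> f) \<oplus>\<^bsub>P\<^esub> \<iota> (x [^] N) \<otimes>\<^bsub>P\<^esub> \<iota> a)" .
    moreover have "X \<otimes>\<^bsub>P\<^esub> (\<iota> (x [^] k) \<otimes>\<^bsub>P\<^esub> f) \<oplus>\<^bsub>P\<^esub> \<iota> (x [^] N) \<otimes>\<^bsub>P\<^esub> \<iota> a \<in> carrier P"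
      using f(1) a(1) xn(2) by simp
    ultimately show ?case by metis
  qed
  have hnz: "h (x [^] (n::nat)) \<noteq> \<zero>\<^bsub>UP ?L\<^esub>" for n
    unfolding ha L.const_poly_eq_zero_iff[OF faL[OF xn(2)]] FA.frac_eq_zero_iff[OF xn(2) FA.M_one]
    by (rule nat_pow_nonzero[OF x_closed x_nonzero])
  have ker: "p = \<zero>\<^bsub>UP ?L\<^esub>" if p: "p \<in> carrier (UP ?L)" and 0: "E p = \<zero>\<^bsub>?LB\<^esub>" for p
  proof -
    obtain N :: nat and f where f: "f \<in> carrier P" "h (x [^] N) \<otimes>\<^bsub>UP ?L\<^esub> p = j f" using clear[OF p] by metis
    have hN: "h (x [^] N) \<in> carrier (UP ?L)" by (rule ring_hom_closed[OF h xn(2)])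
    have "?fb (\<psi> f) \<one>\<^bsub>B\<^esub> = E (h (x [^] N)) \<otimes>\<^bsub>?LB\<^esub> E p"
      by (simp only: Ej[OF f(1), symmetric] f(2)[symmetric] ring_hom_mult[OF E hN p])
    also have "\<dots> = \<zero>\<^bsub>?LB\<^esub>" unfolding 0 by (rule LB.r_null[OF ring_hom_closed[OF E hN]])
    finally have "\<psi> f = \<zero>\<^bsub>B\<^esub>" using FB.frac_eq_zero_iff[OF \<psi>_closed[OF f(1)] FB.M_one] by simp
    then have "f = \<zero>\<^bsub>P\<^esub>" using \<psi>_zero_iff[OF f(1)] by simp
    then have "h (x [^] N) \<otimes>\<^bsub>UP ?L\<^esub> p = \<zero>\<^bsub>UP ?L\<^esub>" using f(2) P.ring_hom_zero'[OF LP.is_cring j] by simp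
    then show ?thesis using LP.integral[OF _ hN p] hnz by metis
  qed
  have "inj_on E (carrier (UP ?L))"
  proof (rule inj_onI)
    fix p q assume pq: "p \<in> carrier (UP ?L)" "q \<in> carrier (UP ?L)" "E p = E q"
    then have "E (p \<ominus>\<^bsub>UP ?L\<^esub> q) = \<zero>\<^bsub>?LB\<^esub>"
      using LP.ring_hom_minus[OF LB.is_cring E pq(1,2)] ring_hom_closed[OF E pq(2)] by simp
    then have "p \<ominus>\<^bsub>UP ?L\<^esub> q = \<zero>\<^bsub>UP ?L\<^esub>" by (rule ker[OF LP.minus_closed[OF pq(1,2)]])
    then show "p = q" using pq by simp
  qed
  moreover have "E ` carrier (UP ?L) = carrier ?LB"
    using surj ring_hom_closed[OF E] by (intro equalityI subsetI) (auto simp: image_subset_iff)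
  ultimately have "E \<in> ring_iso (UP ?L) ?LB" unfolding ring_iso_def bij_betw_def using E by simp
  then have "E \<in> alg_iso (loc A x) (UP (loc A x)) (const_poly (loc A x)) (loc B (s x)) (loc_map A x B s)"
    unfolding alg_iso_def alg_hom_def loc_def loc_map_def sx using E Ec by simp
  then show ?thesis by blast
qed

text \<open>The first isomorphism theorem for the map to the product whose components are the
  \<open>\<rho> i\<close>.\<close>

lemma fibre_isomorphism:
  assumes fc: "fibre_charts n \<rho>"
  shows "alg_iso \<kappa> (fibre_ring B y) (fibre_str B (\<psi> \<circ> \<iota>) x)
      (prod_ring {..<n} (\<lambda>i. Q)) (\<lambda>c. \<lambda>i\<in>{..<n}. const_poly \<kappa> c) \<noteq> {}"
proof -
  let ?Pr = "prod_ring {..<n} (\<lambda>i. Q)" and ?I = "PIdl\<^bsub>B\<^esub> y"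
  interpret Pr: cring ?Pr by (rule prod_ring_cring) (rule Q.is_cring)
  have s: "\<psi> \<circ> \<iota> \<in> ring_hom A B" by (rule ring_hom_trans[OF \<iota>_hom \<psi>_hom])
  define h where "h b = (\<lambda>i\<in>{..<n}. \<rho> i b)" for b
  have h: "h \<in> ring_hom B ?Pr"
  proof (rule ring_hom_memI)
    fix b c assume b: "b \<in> carrier B" and c: "c \<in> carrier B"
    show "h (b \<otimes>\<^bsub>B\<^esub> c) = h b \<otimes>\<^bsub>?Pr\<^esub> h c"
      by (auto simp: h_def prod_ring_def fun_eq_iff restrict_def ring_hom_mult[OF \<rho>_hom[OF fc] b c])
    show "h (b \<oplus>\<^bsub>B\<^esub> c) = h b \<oplus>\<^bsub>?Pr\<^esub> h c"
      by (auto simp: h_def prod_ring_def fun_eq_iff restrict_def ring_hom_add[OF \<rho>_hom[OF fc] b c])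
  next
    fix b assume b: "b \<in> carrier B"
    show "h b \<in> carrier ?Pr"
      by (simp add: h_def prod_ring_def ring_hom_closed[OF \<rho>_hom[OF fc] b])
  next
    show "h \<one>\<^bsub>B\<^esub> = \<one>\<^bsub>?Pr\<^esub>"
      by (auto simp: h_def prod_ring_def fun_eq_iff restrict_def ring_hom_one[OF \<rho>_hom[OF fc]])
  qed
  interpret h: ring_hom_ring B ?Pr h
    by (rule ring_hom_ringI2[OF B.ring_axioms Pr.ring_axioms h])
  have ker: "a_kernel B ?Pr h = ?I"
  proof (intro equalityI subsetI)
    fix b assume "b \<in> a_kernel B ?Pr h"
    then have b: "b \<in> carrier B" "h b = \<zero>\<^bsub>?Pr\<^esub>" unfolding a_kernel_def' by blast+
    have "y divides\<^bsub>B\<^esub> b"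
    proof (rule \<rho>_kernel[OF fc b(1)])
      fix i assume "i < n"
      then show "\<rho> i b = \<zero>\<^bsub>Q\<^esub>" using fun_cong[OF b(2), of i] by (simp add: h_def prod_ring_def)
    qed
    then obtain c where c: "c \<in> carrier B" "b = y \<otimes>\<^bsub>B\<^esub> c" unfolding factor_def by metis
    show "b \<in> ?I" unfolding cgenideal_def c(2) B.m_comm[OF y_closed c(1)] by (rule CollectI, rule exI[of _ c]) (simp add: c(1))
  next
    fix b assume "b \<in> ?I"
    then obtain c where c: "c \<in> carrier B" "b = c \<otimes>\<^bsub>B\<^esub> y" unfolding cgenideal_def by auto
    then have b: "b \<in> carrier B" by simp
    have d: "y divides\<^bsub>B\<^esub> b" unfolding c(2) B.m_comm[OF c(1) y_closed] by (rule dividesI[OF c(1) refl])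
    have "h b = \<zero>\<^bsub>?Pr\<^esub>"
      by (auto simp: h_def prod_ring_def fun_eq_iff restrict_def \<rho>_divides[OF fc _ b d])
    then show "b \<in> a_kernel B ?Pr h" unfolding a_kernel_def' using b by blast
  qed
  have im: "h ` carrier B = carrier ?Pr"
  proof (intro equalityI subsetI)
    fix g assume "g \<in> carrier ?Pr"
    then have g: "g \<in> extensional {..<n}" "\<And>i. i < n \<Longrightarrow> g i \<in> carrier Q"
      by (auto simp: prod_ring_def PiE_def)
    obtain b where b: "b \<in> carrier B" "\<forall>i<n. \<rho> i b = g i" using \<rho>_surj[OF fc, of g] g(2) by metis
    have "g = h b" unfolding h_def
      by (rule extensionalityI[OF g(1) restrict_extensional]) (use b(2) in simp)
    then show "g \<in> h ` carrier B" by (rule image_eqI) (rule b(1))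
  qed (use ring_hom_closed[OF h] in auto)
  let ?\<Phi> = "\<lambda>Z. the_elem (h ` Z)"
  have iso: "?\<Phi> \<in> ring_iso (fibre_ring B y) ?Pr"
    using h.FactRing_iso_set[OF im] unfolding ker fibre_ring_def .
  have "?\<Phi> (fibre_str B (\<psi> \<circ> \<iota>) x c) = (\<lambda>i\<in>{..<n}. const_poly \<kappa> c)" if c: "c \<in> carrier \<kappa>" for c
  proof -
    obtain a where a: "a \<in> carrier A" "c = \<pi> a" using \<pi>_surj[OF c] by metis
    have sa: "\<psi> (\<iota> a) \<in> carrier B" using a by simp
    have "fibre_str B (\<psi> \<circ> \<iota>) x c = ?I +>\<^bsub>B\<^esub> \<psi> (\<iota> a)"
      unfolding a(2) fibre_str_coset[OF B.is_cring s a(1)] by simp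
    then have "?\<Phi> (fibre_str B (\<psi> \<circ> \<iota>) x c) = h (\<psi> (\<iota> a))"
      using h.the_elem_simp[OF sa] unfolding ker by simp
    also have "\<dots> = (\<lambda>i\<in>{..<n}. const_poly \<kappa> c)"
      by (auto simp: h_def a(2) fun_eq_iff restrict_def \<rho>_const[OF fc _ a(1)])
    finally show ?thesis .
  qed
  then have "?\<Phi> \<in> alg_iso \<kappa> (fibre_ring B y) (fibre_str B (\<psi> \<circ> \<iota>) x) ?Pr (\<lambda>c. \<lambda>i\<in>{..<n}. const_poly \<kappa> c)"
    using iso unfolding alg_iso_def alg_hom_def ring_iso_def by simp
  then show ?thesis by blast
qed

text \<open>A nilpotent element of the fibre vanishes on every component, since polynomials over a
  field form a domain; and 1 does not vanish on component 0.\<close>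

lemma fibre_reduced_nonzero:
  assumes fc: "fibre_charts n \<rho>" and n: "n > 0"
  shows "reduced (fibre_ring B y)" and "carrier (fibre_ring B y) \<noteq> {\<zero>\<^bsub>fibre_ring B y\<^esub>}"
proof -
  let ?I = "PIdl\<^bsub>B\<^esub> y"
  interpret I: ideal ?I B by (rule B.cgenideal_ideal[OF y_closed])
  interpret FB: cring "B Quot ?I" by (rule I.quotient_is_cring[OF B.is_cring])
  let ?q = "(+>\<^bsub>B\<^esub>) ?I"
  have q: "?q \<in> ring_hom B (B Quot ?I)" by (rule I.rcos_ring_hom)
  have mem: "b \<in> ?I \<longleftrightarrow> y divides\<^bsub>B\<^esub> b" if "b \<in> carrier B" for b
    unfolding cgenideal_def factor_def using B.m_comm[OF y_closed] by auto
  have zero: "?q b = \<zero>\<^bsub>B Quot ?I\<^esub> \<longleftrightarrow> y divides\<^bsub>B\<^esub> b" if b: "b \<in> carrier B" for b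
  proof -
    have "?q b = ?I \<longleftrightarrow> b \<in> ?I"
      using I.a_rcos_self[OF b] I.a_rcos_const by metis
    then show ?thesis using mem[OF b] by (simp add: FactRing_def)
  qed
  show "reduced (fibre_ring B y)"
    unfolding reduced_def fibre_ring_def
  proof (intro ballI allI impI)
    fix p and k :: nat assume p: "p \<in> carrier (B Quot ?I)" and 0: "p [^]\<^bsub>B Quot ?I\<^esub> k = \<zero>\<^bsub>B Quot ?I\<^esub>"
    obtain b where b: "b \<in> carrier B" "p = ?q b" using p by (auto simp: FactRing_def A_RCOSETS_def')
    have "?q (b [^]\<^bsub>B\<^esub> k) = \<zero>\<^bsub>B Quot ?I\<^esub>" using 0 unfolding b(2) B.ring_hom_nat_pow[OF FB.is_cring q b(1)] .
    then have d: "y divides\<^bsub>B\<^esub> (b [^]\<^bsub>B\<^esub> k)" using zero[of "b [^]\<^bsub>B\<^esub> k"] b(1) by simp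
    have "y divides\<^bsub>B\<^esub> b"
    proof (rule \<rho>_kernel[OF fc b(1)])
      fix i assume i: "i < n"
      have "\<rho> i b [^]\<^bsub>Q\<^esub> k = \<zero>\<^bsub>Q\<^esub>"
        using \<rho>_divides[OF fc i _ d] b(1) B.ring_hom_nat_pow[OF Q.is_cring \<rho>_hom[OF fc i] b(1)] by simp
      then show "\<rho> i b = \<zero>\<^bsub>Q\<^esub>" using Q.nat_pow_nonzero[OF ring_hom_closed[OF \<rho>_hom[OF fc i] b(1)]] by metis
    qed
    then show "p = \<zero>\<^bsub>B Quot ?I\<^esub>" unfolding b(2) by (rule iffD2[OF zero[OF b(1)]])
  qed
  have "\<rho> 0 \<one>\<^bsub>B\<^esub> \<noteq> \<zero>\<^bsub>Q\<^esub>" using ring_hom_one[OF \<rho>_hom[OF fc n]] by simp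
  then have "\<not> y divides\<^bsub>B\<^esub> \<one>\<^bsub>B\<^esub>" using \<rho>_divides[OF fc n B.one_closed] by metis
  then have "?q \<one>\<^bsub>B\<^esub> \<noteq> \<zero>\<^bsub>B Quot ?I\<^esub>" using zero[OF B.one_closed] by simp
  moreover have "?q \<one>\<^bsub>B\<^esub> \<in> carrier (B Quot ?I)" by (rule ring_hom_closed[OF q B.one_closed])
  ultimately show "carrier (fibre_ring B y) \<noteq> {\<zero>\<^bsub>fibre_ring B y\<^esub>}" unfolding fibre_ring_def by auto
qed

end

context base_ring
begin

lemma rel_dfs_if_describes:
  fixes B :: "'z ring"
  assumes L: "over_line A x B \<psi>" and \<Delta>: "disc_family \<Delta>" and d: "over_line.describes A x B \<psi> \<Delta>"
  shows "rel_dfs A x \<lparr>coord_ring = B, str_map = \<psi> \<circ> \<iota>, comorphism = \<psi>\<rparr>"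
proof -
  interpret over_line A x B \<psi> by (rule L)
  let ?s = "\<psi> \<circ> \<iota>"
  have s: "?s \<in> ring_hom A B" by (rule ring_hom_trans[OF \<iota>_hom \<psi>_hom])
  have sx: "?s x = y" by simp
  obtain n \<rho> where n: "n > 0" and fc: "fibre_charts n \<rho>" using describes_fibre_charts[OF \<Delta> d] by metis
  have ft: "integral_affine_finite_type A B ?s"
    unfolding integral_affine_finite_type_def
    using B.domain_axioms s describes_finite_type[OF \<Delta> d] unfolding image_comp by (intro conjI)
  have "dfs A x B ?s"
    unfolding dfs_def Let_def sx
  proof (intro conjI exI[of _ n])
    show "integral_affine_finite_type A B ?s" by (rule ft)
    show "alg_iso (loc A x) (UP (loc A x)) (const_poly (loc A x)) (loc B y) (loc_map A x B ?s) \<noteq> {}"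
      using loc_iso unfolding sx .
  qed (rule fibre_reduced_nonzero[OF fc n] fibre_isomorphism[OF fc])+
  moreover have "dfs_mor A x B ?s P \<iota> \<psi>"
    unfolding dfs_mor_iff[OF P.domain_axioms B.domain_axioms \<iota>_hom s \<iota>_x_nonzero y_nonzero[folded sx]]
  proof (intro conjI ballI)
    fix b assume "b \<in> carrier B"
    then show "\<exists>n::nat. \<exists>f\<in>carrier P. ?s x [^]\<^bsub>B\<^esub> n \<otimes>\<^bsub>B\<^esub> b = \<psi> f" unfolding sx by (rule denominators)
  qed (simp_all add: \<psi>_hom \<psi>_inj)
  ultimately show ?thesis by (simp add: rel_dfs_def)
qed

end

section \<open>Every disc family comes from a surface\<close>

context base_ring
begin

text \<open>The powers of the nonzero nonunit \<open>x\<close> are distinct. Infinity of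
  \<open>A\<close> is what keeps A[t] from being larger than \<open>A\<close>.\<close>

lemma infinite_carrier: "infinite (carrier A)"
proof -
  have "inj (\<lambda>n::nat. x [^] n)"
  proof (rule linorder_injI)
    fix m n :: nat assume "m < n"
    then obtain k where k: "n = m + Suc k" by (metis add_Suc_right less_imp_Suc_add)
    show "x [^] m \<noteq> x [^] n"
    proof
      assume e: "x [^] m = x [^] n"
      have xm: "x [^] m \<in> carrier A" "x [^] Suc k \<in> carrier A" using x_closed by simp_all
      have "x [^] m \<otimes> \<one> = x [^] n" using e xm by simp
      also have "\<dots> = x [^] m \<otimes> x [^] Suc k" unfolding k by (rule nat_pow_mult[OF x_closed, symmetric])
      finally have "\<one> = x [^] Suc k"
        by (rule iffD1[OF m_lcancel[OF nat_pow_nonzero[OF x_closed x_nonzero] xm(1) one_closed xm(2)]])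
      then have "\<one> = x \<otimes> x [^] k" using nat_pow_Suc2[OF x_closed] by simp
      then have "x divides \<one>" by (rule dividesI[rotated]) simp
      then show False using x_not_divides_one by simp
    qed
  qed
  then have "infinite (range (\<lambda>n::nat. x [^] n))" by (rule range_inj_infinite)
  moreover have "range (\<lambda>n::nat. x [^] n) \<subseteq> carrier A" by auto
  ultimately show ?thesis using finite_subset by metis
qed

text \<open>Polynomials with a given degree bound are, by Horner form, the image of a product of two
  sets no larger than the infinite carrier; A[t] is the countable union of these layers.\<close>

lemma polynomials_lepoll:
  includes cardinal_syntax
  shows "carrier P \<lesssim> carrier A"
proof -
  define S where "S n = {f \<in> carrier P. bound \<zero> n (coeff P f)}" for n
  have Sn: "|S n| \<le>o |carrier A|" for n
  proof (induction n)
    case 0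
    have "S 0 \<subseteq> \<iota> ` carrier A"
    proof
      fix f assume f: "f \<in> S 0"
      interpret UP: UP_ring A P by unfold_locales
      have "f = const_poly A (coeff P f 0)"
        using f by (intro UP.up_eqI) (auto simp: const_poly_eq bound_def S_def)
      then show "f \<in> \<iota> ` carrier A" by (rule image_eqI) (use f in \<open>simp add: S_def\<close>)
    qed
    then have "|S 0| \<le>o |\<iota> ` carrier A|" by (rule card_of_mono1)
    also have "|\<iota> ` carrier A| \<le>o |carrier A|" by (rule card_of_image)
    finally show ?case .
  next
    case (Suc n)
    have "S (Suc n) \<subseteq> (\<lambda>(g, a). X \<otimes>\<^bsub>P\<^esub> g \<oplus>\<^bsub>P\<^esub> \<iota> a) ` (S n \<times> carrier A)"
    proof
      fix f assume f: "f \<in> S (Suc n)"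
      interpret UP: UP_ring A P by unfold_locales
      obtain g where g: "g \<in> carrier P" "bound \<zero> n (coeff P g)" "f = X \<otimes>\<^bsub>P\<^esub> g \<oplus>\<^bsub>P\<^esub> \<iota> (coeff P f 0)"
        using horner_decomp[of f "Suc n"] f unfolding S_def by auto
      have "(g, coeff P f 0) \<in> S n \<times> carrier A" using g f by (simp add: S_def)
      moreover have "f = (\<lambda>(g, a). X \<otimes>\<^bsub>P\<^esub> g \<oplus>\<^bsub>P\<^esub> \<iota> a) (g, coeff P f 0)" using g(3) by simp
      ultimately show "f \<in> (\<lambda>(g, a). X \<otimes>\<^bsub>P\<^esub> g \<oplus>\<^bsub>P\<^esub> \<iota> a) ` (S n \<times> carrier A)" by (rule rev_image_eqI)
    qed
    then have "|S (Suc n)| \<le>o |(\<lambda>(g, a). X \<otimes>\<^bsub>P\<^esub> g \<oplus>\<^bsub>P\<^esub> \<iota> a) ` (S n \<times> carrier A)|" by (rule card_of_mono1)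
    also have "|(\<lambda>(g, a). X \<otimes>\<^bsub>P\<^esub> g \<oplus>\<^bsub>P\<^esub> \<iota> a) ` (S n \<times> carrier A)| \<le>o |S n \<times> carrier A|" by (rule card_of_image)
    also have "|S n \<times> carrier A| \<le>o |carrier A \<times> carrier A|" by (rule card_of_Times_mono1[OF Suc])
    also have "|carrier A \<times> carrier A| =o |carrier A|" by (rule card_of_Times_same_infinite[OF infinite_carrier])
    finally show ?case .
  qed
  have "|UNIV :: nat set| \<le>o |carrier A|" using infinite_carrier by (simp add: infinite_iff_card_of_nat)
  then have "|\<Union>n. S n| \<le>o |carrier A|"
    by (rule card_of_UNION_ordLeq_infinite[OF infinite_carrier]) (use Sn in simp)
  moreover have "carrier P = (\<Union>n. S n)" using coeff_bound_ex by (auto simp: S_def)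
  ultimately have "|carrier P| \<le>o |carrier A|" by simp
  then show ?thesis unfolding lepoll_def card_of_ordLeq[symmetric] .
qed

text \<open>The ring wanted consists of the fractions f/x^n with \<open>n\<close> at most the order
  of \<open>f\<close> on every disc. It is realised as its image in A[T] under the substitution of
  one chosen disc \<open>p\<close>, which is injective; the same substitution serves as
  \<open>\<psi>\<close>.\<close>

lemma model_ex_P:
  assumes \<Delta>: "disc_family \<Delta>"
  shows "\<exists>C \<psi>. C \<subseteq> carrier P \<and> over_line A x (P\<lparr>carrier := C\<rparr>) \<psi> \<and>
    over_line.describes A x (P\<lparr>carrier := C\<rparr>) \<psi> \<Delta>"
proof -
  obtain p where p: "p \<in> \<Delta>" using \<Delta> unfolding disc_family_def by auto
  have closed: "fst q \<in> carrier A" if "q \<in> \<Delta>" for q using \<Delta> that unfolding disc_family_def by auto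
  \<comment> \<open>\<open>J n f\<close> says that f/x^n is an admissible fraction; \<open>C\<close>
    will collect the images of these fractions in the chart of \<open>p\<close>.\<close>
  define J where "J n f \<longleftrightarrow> f \<in> carrier P \<and> (\<forall>q\<in>\<Delta>. \<iota> x [^]\<^bsub>P\<^esub> n divides\<^bsub>P\<^esub> thd q f)" for n :: nat and f
  define C where "C = {g \<in> carrier P. \<exists>n f. J n f \<and> thd p f = \<iota> x [^]\<^bsub>P\<^esub> (n::nat) \<otimes>\<^bsub>P\<^esub> g}"
  have CI: "g \<in> C" if "g \<in> carrier P" "J n f" "thd p f = \<iota> x [^]\<^bsub>P\<^esub> n \<otimes>\<^bsub>P\<^esub> g" for g f and n :: nat
    using that unfolding C_def by blast
  have CE: "\<exists>n f. J n f \<and> thd p f = \<iota> x [^]\<^bsub>P\<^esub> n \<otimes>\<^bsub>P\<^esub> g" and CP: "g \<in> carrier P" if "g \<in> C" for g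
    using that unfolding C_def by simp_all
  note hp = theta_hom[OF closed[OF p], of "snd p"]
  have tx: "thd q (\<iota> x [^]\<^bsub>P\<^esub> n) = \<iota> x [^]\<^bsub>P\<^esub> n" if "q \<in> \<Delta>" for q and n :: nat
    by (simp only: P.ring_hom_nat_pow[OF P.is_cring theta_hom[OF closed[OF that]] \<iota>_x_closed]
        theta_const[OF closed[OF that] x_closed])
  have xn: "\<iota> x [^]\<^bsub>P\<^esub> n \<in> carrier P" for n :: nat by simp
  have J0: "J 0 f" if "f \<in> carrier P" for f
    unfolding J_def
  proof (intro conjI ballI that)
    fix q assume "q \<in> \<Delta>"
    then have "thd q f \<in> carrier P" using closed that by simp
    then show "\<iota> x [^]\<^bsub>P\<^esub> (0::nat) divides\<^bsub>P\<^esub> thd q f" by (intro dividesI[of "thd q f"]) simp_all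
  qed
  have Jmult: "J (n + m) (f \<otimes>\<^bsub>P\<^esub> g)" if f: "J n f" and g: "J m g" for f g n m
  proof -
    have c: "f \<in> carrier P" "g \<in> carrier P" using f g by (simp_all add: J_def)
    have "\<iota> x [^]\<^bsub>P\<^esub> (n + m) divides\<^bsub>P\<^esub> thd q (f \<otimes>\<^bsub>P\<^esub> g)" if q: "q \<in> \<Delta>" for q
      unfolding ring_hom_mult[OF theta_hom[OF closed[OF q]] c]
      by (rule P.pow_divides_mult) (use f g q c closed[OF q] in \<open>simp_all add: J_def\<close>)
    then show ?thesis using c by (simp add: J_def)
  qed
  have Jx: "J m (\<iota> x [^]\<^bsub>P\<^esub> m)" for m :: nat
  proof -
    have "\<iota> x [^]\<^bsub>P\<^esub> m divides\<^bsub>P\<^esub> thd q (\<iota> x [^]\<^bsub>P\<^esub> m)" if "q \<in> \<Delta>" for q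
      unfolding tx[OF that] by (rule dividesI[OF P.one_closed]) simp
    then show ?thesis by (simp add: J_def)
  qed
  have Jadd: "J n (f \<oplus>\<^bsub>P\<^esub> g)" if f: "J n f" and g: "J n g" for f g n
  proof -
    have c: "f \<in> carrier P" "g \<in> carrier P" using f g by (simp_all add: J_def)
    have "\<iota> x [^]\<^bsub>P\<^esub> n divides\<^bsub>P\<^esub> thd q (f \<oplus>\<^bsub>P\<^esub> g)" if q: "q \<in> \<Delta>" for q
      unfolding ring_hom_add[OF theta_hom[OF closed[OF q]] c]
      by (rule P.divides_add[OF xn]) (use f g q in \<open>simp_all add: J_def\<close>)
    then show ?thesis using c by (simp add: J_def)
  qed
  have C: "subring C P"
  proof (rule P.subringI)
    show "C \<subseteq> carrier P" unfolding C_def by blast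
    show "\<one>\<^bsub>P\<^esub> \<in> C" by (rule CI[OF _ J0[OF P.one_closed]]) (simp_all add: ring_hom_one[OF hp])
    fix g assume g: "g \<in> C"
    obtain n :: nat and f where f: "J n f" "thd p f = \<iota> x [^]\<^bsub>P\<^esub> n \<otimes>\<^bsub>P\<^esub> g" using CE[OF g] by metis
    have fc: "f \<in> carrier P" using f(1) by (simp add: J_def)
    have 1: "\<ominus>\<^bsub>P\<^esub> \<one>\<^bsub>P\<^esub> \<in> carrier P" by simp
    have "J (n + 0) (f \<otimes>\<^bsub>P\<^esub> (\<ominus>\<^bsub>P\<^esub> \<one>\<^bsub>P\<^esub>))" by (rule Jmult[OF f(1) J0[OF 1]])
    moreover have "f \<otimes>\<^bsub>P\<^esub> (\<ominus>\<^bsub>P\<^esub> \<one>\<^bsub>P\<^esub>) = \<ominus>\<^bsub>P\<^esub> f" using fc by algebra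
    ultimately have "J n (\<ominus>\<^bsub>P\<^esub> f)" by simp
    moreover have "thd p (\<ominus>\<^bsub>P\<^esub> f) = \<iota> x [^]\<^bsub>P\<^esub> n \<otimes>\<^bsub>P\<^esub> (\<ominus>\<^bsub>P\<^esub> g)"
    proof -
      have "thd p (\<zero>\<^bsub>P\<^esub> \<ominus>\<^bsub>P\<^esub> f) = thd p \<zero>\<^bsub>P\<^esub> \<ominus>\<^bsub>P\<^esub> thd p f"
        by (rule P.ring_hom_minus[OF P.is_cring hp P.zero_closed fc])
      moreover have "thd p \<zero>\<^bsub>P\<^esub> = \<zero>\<^bsub>P\<^esub>" by (rule P.ring_hom_zero'[OF P.is_cring hp])
      moreover have "thd p f \<in> carrier P" using fc closed[OF p] by simp
      ultimately have "thd p (\<ominus>\<^bsub>P\<^esub> f) = \<ominus>\<^bsub>P\<^esub> thd p f" using fc by (simp add: a_minus_def)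
      then show ?thesis unfolding f(2) using CP[OF g] by (simp add: P.r_minus)
    qed
    ultimately show "\<ominus>\<^bsub>P\<^esub> g \<in> C" using CP[OF g] by (intro CI) simp_all
    fix h assume h: "h \<in> C"
    obtain m :: nat and k where k: "J m k" "thd p k = \<iota> x [^]\<^bsub>P\<^esub> m \<otimes>\<^bsub>P\<^esub> h" using CE[OF h] by metis
    have kc: "k \<in> carrier P" using k(1) by (simp add: J_def)
    have "thd p (f \<otimes>\<^bsub>P\<^esub> k) = \<iota> x [^]\<^bsub>P\<^esub> (n + m) \<otimes>\<^bsub>P\<^esub> (g \<otimes>\<^bsub>P\<^esub> h)"
      unfolding ring_hom_mult[OF hp fc kc] f(2) k(2)
      using CP[OF g] CP[OF h] xn by (simp add: P.nat_pow_mult[symmetric] P.m_ac)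
    then show "g \<otimes>\<^bsub>P\<^esub> h \<in> C"
      by (rule CI[OF P.m_closed[OF CP[OF g] CP[OF h]] Jmult[OF f(1) k(1)]])
    have "thd p (\<iota> x [^]\<^bsub>P\<^esub> m \<otimes>\<^bsub>P\<^esub> f \<oplus>\<^bsub>P\<^esub> \<iota> x [^]\<^bsub>P\<^esub> n \<otimes>\<^bsub>P\<^esub> k) = \<iota> x [^]\<^bsub>P\<^esub> (n + m) \<otimes>\<^bsub>P\<^esub> (g \<oplus>\<^bsub>P\<^esub> h)"
      unfolding ring_hom_add[OF hp P.m_closed[OF xn fc] P.m_closed[OF xn kc]]
        ring_hom_mult[OF hp xn fc] ring_hom_mult[OF hp xn kc] f(2) k(2) tx[OF p]
      using CP[OF g] CP[OF h] xn by (simp add: P.nat_pow_mult[symmetric] P.r_distr P.l_distr P.m_ac)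
    moreover have "J (n + m) (\<iota> x [^]\<^bsub>P\<^esub> m \<otimes>\<^bsub>P\<^esub> f \<oplus>\<^bsub>P\<^esub> \<iota> x [^]\<^bsub>P\<^esub> n \<otimes>\<^bsub>P\<^esub> k)"
      using Jadd[OF Jmult[OF Jx f(1), of m, unfolded add.commute[of m n]] Jmult[OF Jx k(1), of n]] .
    ultimately show "g \<oplus>\<^bsub>P\<^esub> h \<in> C"
      using CI[OF P.a_closed[OF CP[OF g] CP[OF h]]] by metis
  qed
  let ?B = "P\<lparr>carrier := C\<rparr>"
  have dom: "domain ?B" by (rule P.subring_is_domain[OF C])
  have pow: "a [^]\<^bsub>?B\<^esub> n = a [^]\<^bsub>P\<^esub> n" for a and n :: nat by (simp add: P.nat_pow_consistent[symmetric])
  have thC: "thd p f \<in> C" if f: "f \<in> carrier P" for f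
  proof (rule CI[OF _ J0[OF f]])
    show "thd p f \<in> carrier P" using f closed[OF p] by simp
    then show "thd p f = \<iota> x [^]\<^bsub>P\<^esub> (0::nat) \<otimes>\<^bsub>P\<^esub> thd p f" by simp
  qed
  have px: "thd p (\<iota> x) = \<iota> x" by (rule theta_const[OF closed[OF p] x_closed])
  have L: "over_line A x ?B (thd p)"
  proof (intro over_line.intro over_line_axioms.intro base_ring_axioms dom)
    show "thd p \<in> ring_hom P ?B"
      using thC by (intro ring_hom_memI) (simp_all add: ring_hom_mult[OF hp] ring_hom_add[OF hp] ring_hom_one[OF hp])
    show "inj_on (thd p) (carrier P)" by (rule theta_inj[OF closed[OF p]])
    fix b assume "b \<in> carrier ?B"
    then have "b \<in> C" by simp
    then obtain n :: nat and f where f: "J n f" "thd p f = \<iota> x [^]\<^bsub>P\<^esub> n \<otimes>\<^bsub>P\<^esub> b" using CE by metis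
    show "\<exists>n::nat. \<exists>f\<in>carrier P. thd p (\<iota> x) [^]\<^bsub>?B\<^esub> n \<otimes>\<^bsub>?B\<^esub> b = thd p f"
      using f unfolding pow px J_def by (intro exI[of _ n] bexI[of _ f]) simp_all
  qed
  interpret L: over_line A x ?B "thd p" by (rule L)
  have "L.describes \<Delta>"
    unfolding L.describes_def
  proof (intro ballI allI)
    fix f and n :: nat assume f: "f \<in> carrier P"
    have "L.y [^]\<^bsub>?B\<^esub> n divides\<^bsub>?B\<^esub> thd p f \<longleftrightarrow> J n f"
    proof
      \<comment> \<open>If the quotient by x^n is the image of an admissible h/x^m, then x^m f = x^n
        h by injectivity of the chart, and cancelling x^m turns the orders of \<open>h\<close> into
        the claim on those of \<open>f\<close>.\<close>
      assume "L.y [^]\<^bsub>?B\<^esub> n divides\<^bsub>?B\<^esub> thd p f"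
      then obtain g where g: "g \<in> C" "thd p f = \<iota> x [^]\<^bsub>P\<^esub> n \<otimes>\<^bsub>P\<^esub> g" unfolding factor_def pow px by auto
      obtain m :: nat and h where h: "J m h" "thd p h = \<iota> x [^]\<^bsub>P\<^esub> m \<otimes>\<^bsub>P\<^esub> g" using CE[OF g(1)] by metis
      have hc: "h \<in> carrier P" using h(1) by (simp add: J_def)
      have "thd p (\<iota> x [^]\<^bsub>P\<^esub> m \<otimes>\<^bsub>P\<^esub> f) = thd p (\<iota> x [^]\<^bsub>P\<^esub> n \<otimes>\<^bsub>P\<^esub> h)"
        unfolding ring_hom_mult[OF hp xn f] ring_hom_mult[OF hp xn hc] tx[OF p] g(2) h(2)
        using CP[OF g(1)] xn by (simp add: P.m_lcomm)
      then have eq: "\<iota> x [^]\<^bsub>P\<^esub> m \<otimes>\<^bsub>P\<^esub> f = \<iota> x [^]\<^bsub>P\<^esub> n \<otimes>\<^bsub>P\<^esub> h"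
        by (rule inj_onD[OF theta_inj[OF closed[OF p]]]) (use f hc in simp_all)
      have "J (n + m) (\<iota> x [^]\<^bsub>P\<^esub> m \<otimes>\<^bsub>P\<^esub> f)" unfolding eq by (rule Jmult[OF Jx h(1)])
      then have d: "\<iota> x [^]\<^bsub>P\<^esub> (m + n) divides\<^bsub>P\<^esub> thd q (\<iota> x [^]\<^bsub>P\<^esub> m \<otimes>\<^bsub>P\<^esub> f)" if "q \<in> \<Delta>" for q
        using that unfolding J_def by (simp only: add.commute)
      have "\<iota> x [^]\<^bsub>P\<^esub> n divides\<^bsub>P\<^esub> thd q f" if q: "q \<in> \<Delta>" for q
        using d[OF q] unfolding ring_hom_mult[OF theta_hom[OF closed[OF q]] xn f] tx[OF q]
        by (rule iffD1[OF P.pow_divides_cancel[OF \<iota>_x_closed \<iota>_x_nonzero theta_closed[OF closed[OF q] f]]])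
      then show "J n f" using f by (simp add: J_def)
    next
      assume J: "J n f"
      then obtain g where g: "g \<in> carrier P" "thd p f = \<iota> x [^]\<^bsub>P\<^esub> n \<otimes>\<^bsub>P\<^esub> g"
        using p unfolding J_def factor_def by metis
      have "g \<in> C" by (rule CI[OF g(1) J g(2)])
      then show "L.y [^]\<^bsub>?B\<^esub> n divides\<^bsub>?B\<^esub> thd p f"
        unfolding pow px by (intro dividesI[of g]) (simp_all add: g(2))
    qed
    then show "L.y [^]\<^bsub>?B\<^esub> n divides\<^bsub>?B\<^esub> thd p f \<longleftrightarrow> (\<forall>(\<sigma>, m)\<in>\<Delta>. \<iota> x [^]\<^bsub>P\<^esub> n divides\<^bsub>P\<^esub> theta \<sigma> m f)"
      using f by (simp add: J_def case_prod_beta)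
  qed
  show ?thesis
  proof (intro exI conjI)
    show "C \<subseteq> carrier P" by (rule subringE(1)[OF C])
    show "over_line A x ?B (thd p)" by (rule L)
    show "L.describes \<Delta>" by fact
  qed
qed

lemma model_transport:
  assumes L: "over_line A x B \<psi>" and d: "over_line.describes A x B \<psi> \<Delta>" and e: "inj_on e (carrier B)"
  shows "over_line A x (image_ring e B) (e \<circ> \<psi>)" "over_line.describes A x (image_ring e B) (e \<circ> \<psi>) \<Delta>"
proof -
  interpret L: over_line A x B \<psi> by (rule L)
  let ?B = "image_ring e B"
  have iso: "e \<in> ring_iso B ?B" by (rule inj_imp_image_ring_iso[OF e])
  have hom: "e \<in> ring_hom B ?B" using iso by (simp add: ring_iso_def)
  have c: "carrier ?B = e ` carrier B" by (rule image_ring_carrier)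
  have dom: "domain ?B"
    by (rule L.B.inj_imp_image_ring_is_domain[OF e])
  interpret B': "domain" ?B by (rule dom)
  have pow: "e L.y [^]\<^bsub>?B\<^esub> n = e (L.y [^]\<^bsub>B\<^esub> n)" for n :: nat
    using L.B.ring_hom_nat_pow[OF B'.is_cring hom L.y_closed] by simp
  have yn: "L.y [^]\<^bsub>B\<^esub> n \<in> carrier B" for n :: nat by simp
  show L': "over_line A x ?B (e \<circ> \<psi>)"
  proof (intro over_line.intro over_line_axioms.intro base_ring_axioms dom)
    show "e \<circ> \<psi> \<in> ring_hom P ?B" by (rule ring_hom_trans[OF L.\<psi>_hom hom])
    have "\<psi> ` carrier P \<subseteq> carrier B" using L.\<psi>_closed by auto
    then show "inj_on (e \<circ> \<psi>) (carrier P)" by (rule comp_inj_on[OF L.\<psi>_inj inj_on_subset[OF e]])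
    fix b assume "b \<in> carrier ?B"
    then obtain b0 where b0: "b = e b0" "b0 \<in> carrier B" unfolding c by (rule imageE)
    obtain n :: nat and f where f: "f \<in> carrier P" "L.y [^]\<^bsub>B\<^esub> n \<otimes>\<^bsub>B\<^esub> b0 = \<psi> f" using L.denominators[OF b0(2)] by metis
    have "(e \<circ> \<psi>) (\<iota> x) [^]\<^bsub>?B\<^esub> n \<otimes>\<^bsub>?B\<^esub> b = (e \<circ> \<psi>) f"
      unfolding o_apply pow b0(1) f(2)[symmetric] by (rule ring_hom_mult[OF hom yn b0(2), symmetric])
    then show "\<exists>n::nat. \<exists>f\<in>carrier P. (e \<circ> \<psi>) (\<iota> x) [^]\<^bsub>?B\<^esub> n \<otimes>\<^bsub>?B\<^esub> b = (e \<circ> \<psi>) f" using f(1) by metis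
  qed
  interpret L': over_line A x ?B "e \<circ> \<psi>" by (rule L')
  have "(e \<circ> \<psi>) (\<iota> x) [^]\<^bsub>?B\<^esub> n divides\<^bsub>?B\<^esub> (e \<circ> \<psi>) f \<longleftrightarrow> L.y [^]\<^bsub>B\<^esub> n divides\<^bsub>B\<^esub> \<psi> f"
    if f: "f \<in> carrier P" for f and n :: nat
  proof
    assume "L.y [^]\<^bsub>B\<^esub> n divides\<^bsub>B\<^esub> \<psi> f"
    then show "(e \<circ> \<psi>) (\<iota> x) [^]\<^bsub>?B\<^esub> n divides\<^bsub>?B\<^esub> (e \<circ> \<psi>) f"
      unfolding o_apply pow by (rule L.B.hom_divides[OF hom yn])
  next
    assume "(e \<circ> \<psi>) (\<iota> x) [^]\<^bsub>?B\<^esub> n divides\<^bsub>?B\<^esub> (e \<circ> \<psi>) f"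
    then obtain b where b: "b \<in> e ` carrier B" "e (\<psi> f) = e (L.y [^]\<^bsub>B\<^esub> n) \<otimes>\<^bsub>?B\<^esub> b"
      unfolding o_apply pow factor_def c by metis
    from b(1) obtain b0 where b0: "b = e b0" "b0 \<in> carrier B" by (rule imageE)
    have "e (\<psi> f) = e (L.y [^]\<^bsub>B\<^esub> n \<otimes>\<^bsub>B\<^esub> b0)"
      using b(2) unfolding b0(1) ring_hom_mult[OF hom yn b0(2)] .
    then have "\<psi> f = L.y [^]\<^bsub>B\<^esub> n \<otimes>\<^bsub>B\<^esub> b0"
      by (rule inj_onD[OF e]) (rule L.\<psi>_closed[OF f] L.B.m_closed[OF yn b0(2)])+
    then show "L.y [^]\<^bsub>B\<^esub> n divides\<^bsub>B\<^esub> \<psi> f" by (rule dividesI[OF b0(2)])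
  qed
  then show "over_line.describes A x ?B (e \<circ> \<psi>) \<Delta>"
    using d unfolding L'.describes_def L.describes_def by simp
qed

text \<open>The carrier of the model lies in A[t], which is no larger than \<open>A\<close> and so
  embeds in \<open>'z\<close>; the structure is carried along.\<close>

lemma model_ex:
  assumes \<Delta>: "disc_family \<Delta>" and card: "carrier A \<lesssim> (UNIV :: 'z set)"
  shows "\<exists>(B :: 'z ring) \<psi>. over_line A x B \<psi> \<and> over_line.describes A x B \<psi> \<Delta>"
proof -
  obtain C \<psi> where B: "C \<subseteq> carrier P" "over_line A x (P\<lparr>carrier := C\<rparr>) \<psi>"
    "over_line.describes A x (P\<lparr>carrier := C\<rparr>) \<psi> \<Delta>"
    using model_ex_P[OF \<Delta>] by metis
  have "carrier P \<lesssim> (UNIV :: 'z set)" using polynomials_lepoll card by (rule lepoll_trans)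
  then obtain e :: "(nat \<Rightarrow> 'a) \<Rightarrow> 'z" where "inj_on e (carrier P)" unfolding lepoll_def by metis
  then have e: "inj_on e (carrier (P\<lparr>carrier := C\<rparr>))" by (rule inj_on_subset) (simp add: B(1))
  show ?thesis using model_transport[OF B(2,3) e] by metis
qed

section \<open>Morphisms of relative surfaces and inclusions of discs\<close>

definition refines :: "('a \<times> nat) set \<Rightarrow> ('a \<times> nat) set \<Rightarrow> bool" where
  "refines \<Delta>' \<Delta> \<longleftrightarrow> (\<forall>q\<in>\<Delta>'. \<exists>p\<in>\<Delta>. disc_within q p)"

text \<open>A homomorphism over A[t] is automatically injective, by clearing denominators. Each
  element of the target, times a power of the image of \<open>x\<close>, comes from A[t] and so lies
  in the image. By \<open>dfs_mor_iff\<close> birationality and the isomorphism over the punctured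
  base follow.\<close>

lemma dfs_hom_iff:
  fixes S S' :: "('a, 'z) rel_surface"
  assumes S: "rel_dfs A x S" and S': "rel_dfs A x S'"
  shows "\<phi> \<in> Hom (rel_dfs_cat A x) S' S \<longleftrightarrow> \<phi> \<in> extensional (carrier (coord_ring S)) \<and>
    \<phi> \<in> ring_hom (coord_ring S) (coord_ring S') \<and> (\<forall>f\<in>carrier P. \<phi> (comorphism S f) = comorphism S' f)"
proof -
  interpret L: over_line A x "coord_ring S" "comorphism S" by (rule rel_dfs_over_line(1)[OF S])
  interpret L': over_line A x "coord_ring S'" "comorphism S'" by (rule rel_dfs_over_line(1)[OF S'])
  let ?B = "coord_ring S" and ?B' = "coord_ring S'" and ?s = "str_map S" and ?s' = "str_map S'"
  note s\<psi> = rel_dfs_over_line(3)[OF S] and s\<psi>' = rel_dfs_over_line(3)[OF S']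
  have nz: "?s x \<noteq> \<zero>\<^bsub>?B\<^esub>" "?s' x \<noteq> \<zero>\<^bsub>?B'\<^esub>"
    using L.y_nonzero L'.y_nonzero s\<psi>[OF x_closed] s\<psi>'[OF x_closed] by simp_all
  note mor = dfs_mor_iff[OF L.B.domain_axioms L'.B.domain_axioms rel_dfs_over_line(2)[OF S] rel_dfs_over_line(2)[OF S'] nz]
  have sx': "?s' x = L'.y" using s\<psi>'[OF x_closed] by simp
  have "dfs_mor A x ?B' ?s' ?B ?s \<phi>"
    if \<phi>: "\<phi> \<in> ring_hom ?B ?B'" and c: "\<And>f. f \<in> carrier P \<Longrightarrow> \<phi> (comorphism S f) = comorphism S' f"
  proof (rule iffD2[OF mor], intro conjI ballI)
    show "\<phi> \<in> ring_hom ?B ?B'" by (rule \<phi>)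
    show "\<phi> (?s a) = ?s' a" if a: "a \<in> carrier A" for a
      using c[of "\<iota> a"] a by (simp add: s\<psi> s\<psi>')
    show "inj_on \<phi> (carrier ?B)"
    proof (rule inj_onI)
      fix b c' assume bc: "b \<in> carrier ?B" "c' \<in> carrier ?B" "\<phi> b = \<phi> c'"
      let ?d = "b \<ominus>\<^bsub>?B\<^esub> c'"
      have d: "?d \<in> carrier ?B" using bc by simp
      have \<phi>d: "\<phi> ?d = \<zero>\<^bsub>?B'\<^esub>"
        using L.B.ring_hom_minus[OF L'.B.is_cring \<phi> bc(1,2)] bc(3) ring_hom_closed[OF \<phi> bc(2)] by simp
      obtain n :: nat and f where f: "f \<in> carrier P" "L.y [^]\<^bsub>?B\<^esub> n \<otimes>\<^bsub>?B\<^esub> ?d = comorphism S f"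
        using L.denominators[OF d] by metis
      have yn: "L.y [^]\<^bsub>?B\<^esub> n \<in> carrier ?B" by simp
      have "comorphism S' f = \<phi> (L.y [^]\<^bsub>?B\<^esub> n) \<otimes>\<^bsub>?B'\<^esub> \<phi> ?d"
        by (simp only: c[OF f(1), symmetric] f(2)[symmetric] ring_hom_mult[OF \<phi> yn d])
      then have "comorphism S' f = \<zero>\<^bsub>?B'\<^esub>" using ring_hom_closed[OF \<phi> yn] by (simp add: \<phi>d)
      then have "f = \<zero>\<^bsub>P\<^esub>" using L'.\<psi>_zero_iff[OF f(1)] by simp
      then have "L.y [^]\<^bsub>?B\<^esub> n \<otimes>\<^bsub>?B\<^esub> ?d = \<zero>\<^bsub>?B\<^esub>" using f L.\<psi>_zero_iff[OF f(1)] by simp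
      then have "?d = \<zero>\<^bsub>?B\<^esub>"
        using L.B.integral[OF _ yn d] L.B.nat_pow_nonzero[OF L.y_closed L.y_nonzero, of n] by metis
      then show "b = c'" using bc by simp
    qed
    fix b' assume b': "b' \<in> carrier ?B'"
    obtain n :: nat and f where f: "f \<in> carrier P" "L'.y [^]\<^bsub>?B'\<^esub> n \<otimes>\<^bsub>?B'\<^esub> b' = comorphism S' f"
      using L'.denominators[OF b'] by metis
    show "\<exists>n::nat. \<exists>b\<in>carrier ?B. ?s' x [^]\<^bsub>?B'\<^esub> n \<otimes>\<^bsub>?B'\<^esub> b' = \<phi> b"
      unfolding sx' using f c[OF f(1)] L.\<psi>_closed[OF f(1)] by metis
  qed
  moreover have "\<phi> \<in> ring_hom ?B ?B'" if "dfs_mor A x ?B' ?s' ?B ?s \<phi>"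
    using that by (simp add: dfs_mor_def alg_hom_def)
  ultimately show ?thesis
    unfolding rel_dfs_cat_def by (simp del: One_nat_def) metis
qed

text \<open>Times a power of y an element comes from A[t], where the value is prescribed, and the
  power cancels in the target.\<close>

lemma dfs_hom_unique:
  fixes S S' :: "('a, 'z) rel_surface"
  assumes S: "rel_dfs A x S" and S': "rel_dfs A x S'"
    and \<phi>: "\<phi> \<in> Hom (rel_dfs_cat A x) S' S" "\<chi> \<in> Hom (rel_dfs_cat A x) S' S"
  shows "\<phi> = \<chi>"
proof -
  interpret L: over_line A x "coord_ring S" "comorphism S" by (rule rel_dfs_over_line(1)[OF S])
  interpret L': over_line A x "coord_ring S'" "comorphism S'" by (rule rel_dfs_over_line(1)[OF S'])
  let ?B = "coord_ring S" and ?B' = "coord_ring S'"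
  note h = \<phi>(1)[unfolded dfs_hom_iff[OF S S']] and k = \<phi>(2)[unfolded dfs_hom_iff[OF S S']]
  show ?thesis
  proof (rule extensionalityI[OF conjunct1[OF h] conjunct1[OF k]])
    fix b assume b: "b \<in> carrier ?B"
    obtain n :: nat and f where f: "f \<in> carrier P" "L.y [^]\<^bsub>?B\<^esub> n \<otimes>\<^bsub>?B\<^esub> b = comorphism S f"
      using L.denominators[OF b] by metis
    have yn: "L.y [^]\<^bsub>?B\<^esub> n \<in> carrier ?B" by simp
    have eq: "L'.y [^]\<^bsub>?B'\<^esub> n \<otimes>\<^bsub>?B'\<^esub> \<theta> b = comorphism S' f"
      if \<theta>: "\<theta> \<in> ring_hom ?B ?B'" "\<forall>f\<in>carrier P. \<theta> (comorphism S f) = comorphism S' f" for \<theta>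
    proof -
      have "\<theta> L.y = L'.y" using \<theta>(2) \<iota>_x_closed by blast
      then have "L'.y [^]\<^bsub>?B'\<^esub> n \<otimes>\<^bsub>?B'\<^esub> \<theta> b = \<theta> (L.y [^]\<^bsub>?B\<^esub> n \<otimes>\<^bsub>?B\<^esub> b)"
        by (simp only: ring_hom_mult[OF \<theta>(1) yn b] L.B.ring_hom_nat_pow[OF L'.B.is_cring \<theta>(1) L.y_closed])
      then show ?thesis using \<theta>(2) f by simp
    qed
    have "L'.y [^]\<^bsub>?B'\<^esub> n \<otimes>\<^bsub>?B'\<^esub> \<phi> b = L'.y [^]\<^bsub>?B'\<^esub> n \<otimes>\<^bsub>?B'\<^esub> \<chi> b"
      using eq[of \<phi>] eq[of \<chi>] h k by simp
    then show "\<phi> b = \<chi> b"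
      using L'.B.m_lcancel[OF L'.B.nat_pow_nonzero[OF L'.y_closed L'.y_nonzero, of n] _
          ring_hom_closed[OF _ b] ring_hom_closed[OF _ b], of \<phi> \<chi>] h k by simp
  qed
qed

lemma rel_dfs_discs:
  fixes S :: "('a, 'z) rel_surface"
  assumes S: "rel_dfs A x S"
  shows "\<exists>\<Delta>. disc_family \<Delta> \<and> over_line.describes A x (coord_ring S) (comorphism S) \<Delta>"
proof -
  interpret L: over_line A x "coord_ring S" "comorphism S" by (rule rel_dfs_over_line(1)[OF S])
  obtain n \<rho> where n: "n > 0" "L.fibre_charts n \<rho>" using rel_dfs_fibre_charts[OF S] by metis
  show ?thesis by (rule L.describes_ex[OF n(2,1)])
qed

text \<open>A homomorphism preserves divisibility by powers of the image of \<open>x\<close>, an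
  inequality of valuations that \<open>within_if_divides\<close> turns into inclusions of discs.
  Conversely, inclusions give the inequality by \<open>theta_within\<close>, and
  \<open>extend\<close> gives the homomorphism.\<close>

lemma dfs_hom_ex_iff:
  fixes S S' :: "('a, 'z) rel_surface"
  assumes S: "rel_dfs A x S" and S': "rel_dfs A x S'"
    and \<Delta>: "disc_family \<Delta>" "over_line.describes A x (coord_ring S) (comorphism S) \<Delta>"
    and \<Delta>': "disc_family \<Delta>'" "over_line.describes A x (coord_ring S') (comorphism S') \<Delta>'"
  shows "Hom (rel_dfs_cat A x) S' S \<noteq> {} \<longleftrightarrow> refines \<Delta>' \<Delta>"
proof -
  interpret L: over_line A x "coord_ring S" "comorphism S" by (rule rel_dfs_over_line(1)[OF S])
  interpret L': over_line A x "coord_ring S'" "comorphism S'" by (rule rel_dfs_over_line(1)[OF S'])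
  let ?B = "coord_ring S" and ?B' = "coord_ring S'" and ?\<psi> = "comorphism S" and ?\<psi>' = "comorphism S'"
  have closed: "fst p \<in> carrier A" if "p \<in> \<Delta>" for p using \<Delta>(1) that unfolding disc_family_def by auto
  have closed': "fst p \<in> carrier A" if "p \<in> \<Delta>'" for p using \<Delta>'(1) that unfolding disc_family_def by auto
  show ?thesis
  proof
    assume "Hom (rel_dfs_cat A x) S' S \<noteq> {}"
    then obtain \<phi> where "\<phi> \<in> Hom (rel_dfs_cat A x) S' S" by blast
    then have \<phi>: "\<phi> \<in> ring_hom ?B ?B'" "\<And>f. f \<in> carrier P \<Longrightarrow> \<phi> (?\<psi> f) = ?\<psi>' f"
      unfolding dfs_hom_iff[OF S S'] by simp_all
    have \<phi>y: "\<phi> (L.y [^]\<^bsub>?B\<^esub> n) = L'.y [^]\<^bsub>?B'\<^esub> n" for n :: nat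
      by (simp only: L.B.ring_hom_nat_pow[OF L'.B.is_cring \<phi>(1) L.y_closed] \<phi>(2)[OF \<iota>_x_closed])
    show "refines \<Delta>' \<Delta>"
      unfolding refines_def
    proof
      fix q assume q: "q \<in> \<Delta>'"
      show "\<exists>p\<in>\<Delta>. disc_within q p"
      proof (rule within_if_divides[OF \<Delta>(1) closed'[OF q]])
        fix f and n :: nat assume f: "f \<in> carrier P" and d: "\<And>p. p \<in> \<Delta> \<Longrightarrow> \<iota> x [^]\<^bsub>P\<^esub> n divides\<^bsub>P\<^esub> thd p f"
        have "L.y [^]\<^bsub>?B\<^esub> n divides\<^bsub>?B\<^esub> ?\<psi> f" using L.describes_iff[OF \<Delta> f] d by simp
        then have "\<phi> (L.y [^]\<^bsub>?B\<^esub> n) divides\<^bsub>?B'\<^esub> \<phi> (?\<psi> f)" by (rule L.B.hom_divides[OF \<phi>(1), rotated]) simp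
        then have "L'.y [^]\<^bsub>?B'\<^esub> n divides\<^bsub>?B'\<^esub> ?\<psi>' f" unfolding \<phi>y \<phi>(2)[OF f] .
        then show "\<iota> x [^]\<^bsub>P\<^esub> n divides\<^bsub>P\<^esub> thd q f" using L'.describes_iff[OF \<Delta>' f] q by simp
      qed
    qed
  next
    assume r: "refines \<Delta>' \<Delta>"
    have "\<exists>\<phi>\<in>ring_hom ?B ?B'. \<forall>f\<in>carrier P. \<phi> (?\<psi> f) = ?\<psi>' f"
    proof (rule L.extend[OF L'.B.domain_axioms L'.\<psi>_hom L'.y_nonzero])
      fix f and n :: nat assume f: "f \<in> carrier P" and d: "L.y [^]\<^bsub>?B\<^esub> n divides\<^bsub>?B\<^esub> ?\<psi> f"
      show "L'.y [^]\<^bsub>?B'\<^esub> n divides\<^bsub>?B'\<^esub> ?\<psi>' f"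
      proof (rule iffD2[OF L'.describes_iff[OF \<Delta>' f]], rule ballI)
        fix q assume q: "q \<in> \<Delta>'"
        then obtain p where p: "p \<in> \<Delta>" "disc_within q p" using r unfolding refines_def by metis
        have "\<iota> x [^]\<^bsub>P\<^esub> n divides\<^bsub>P\<^esub> thd p f" using L.describes_iff[OF \<Delta> f] d p(1) by simp
        then show "\<iota> x [^]\<^bsub>P\<^esub> n divides\<^bsub>P\<^esub> thd q f"
          by (rule theta_within[OF closed[OF p(1)] closed'[OF q] _ f, rotated]) (use p(2) in simp)
      qed
    qed
    then obtain \<phi> where \<phi>: "\<phi> \<in> ring_hom ?B ?B'" "\<And>f. f \<in> carrier P \<Longrightarrow> \<phi> (?\<psi> f) = ?\<psi>' f" by metis
    have "restrict \<phi> (carrier ?B) \<in> Hom (rel_dfs_cat A x) S' S"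
      unfolding dfs_hom_iff[OF S S']
    proof (intro conjI ballI)
      show "restrict \<phi> (carrier ?B) \<in> ring_hom ?B ?B'"
        using \<phi>(1) ring_hom_closed[OF \<phi>(1)]
        by (intro ring_hom_memI) (simp_all add: ring_hom_mult[OF \<phi>(1)] ring_hom_add[OF \<phi>(1)] ring_hom_one[OF \<phi>(1)])
    qed (use \<phi>(2) in simp_all)
    then show "Hom (rel_dfs_cat A x) S' S \<noteq> {}" by blast
  qed
qed

text \<open>Only closure under identities and composites needs work; the laws are equalities in
  hom-sets with at most one element.\<close>

lemma category_rel_dfs: "category (rel_dfs_cat A x :: (('a, 'z) rel_surface, 'z \<Rightarrow> 'z) cat)"
proof -
  let ?C = "rel_dfs_cat A x :: (('a, 'z) rel_surface, 'z \<Rightarrow> 'z) cat"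
  have O: "rel_dfs A x S \<longleftrightarrow> S \<in> Obj ?C" for S by (simp add: rel_dfs_cat_def)
  have I: "Idn ?C S = (\<lambda>b\<in>carrier (coord_ring S). b)" for S by (simp add: rel_dfs_cat_def)
  have Cm: "Comp ?C S'' S' S g f = compose (carrier (coord_ring S)) f g" for S'' S' S g f by (simp add: rel_dfs_cat_def)
  have ring: "ring (coord_ring S)" if "S \<in> Obj ?C" for S
  proof -
    interpret L: over_line A x "coord_ring S" "comorphism S" by (rule rel_dfs_over_line(1)[OF that[folded O]])
    show ?thesis by (rule L.B.ring_axioms)
  qed
  have idm: "Idn ?C S \<in> Hom ?C S S" if S: "S \<in> Obj ?C" for S
  proof -
    interpret L: over_line A x "coord_ring S" "comorphism S" by (rule rel_dfs_over_line(1)[OF S[folded O]])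
    show ?thesis
      unfolding dfs_hom_iff[OF S[folded O] S[folded O]] I
      by (intro conjI ring_hom_memI) simp_all
  qed
  have compm: "Comp ?C S'' S' S g f \<in> Hom ?C S'' S"
    if S: "S'' \<in> Obj ?C" "S' \<in> Obj ?C" "S \<in> Obj ?C" and f: "f \<in> Hom ?C S'' S'" and g: "g \<in> Hom ?C S' S" for S'' S' S f g
  proof -
    interpret L: over_line A x "coord_ring S" "comorphism S" by (rule rel_dfs_over_line(1)[OF S(3)[folded O]])
    have f': "f \<in> ring_hom (coord_ring S') (coord_ring S'')" "\<forall>p\<in>carrier P. f (comorphism S' p) = comorphism S'' p"
      using f unfolding dfs_hom_iff[OF S(2,1)[folded O]] by simp_all
    have g': "g \<in> ring_hom (coord_ring S) (coord_ring S')" "\<forall>p\<in>carrier P. g (comorphism S p) = comorphism S' p"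
      using g unfolding dfs_hom_iff[OF S(3,2)[folded O]] by simp_all
    show ?thesis
      unfolding dfs_hom_iff[OF S(3,1)[folded O]] Cm
    proof (intro conjI ballI)
      show "compose (carrier (coord_ring S)) f g \<in> ring_hom (coord_ring S) (coord_ring S'')"
        using ring_hom_closed[OF g'(1)] ring_hom_closed[OF f'(1)]
        by (intro ring_hom_memI)
           (simp_all add: compose_def ring_hom_mult[OF g'(1)] ring_hom_add[OF g'(1)] ring_hom_one[OF g'(1)]
             ring_hom_mult[OF f'(1)] ring_hom_add[OF f'(1)] ring_hom_one[OF f'(1)])
    qed (use f'(2) g'(2) in \<open>simp_all add: compose_def\<close>)
  qed
  show ?thesis
  proof
    fix X Y :: "('a, 'z) rel_surface" and f
    assume X: "X \<in> Obj ?C"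
    then show "Idn ?C X \<in> Hom ?C X X" by (rule idm)
    assume Y: "Y \<in> Obj ?C" and f: "f \<in> Hom ?C X Y"
    show "Comp ?C X X Y f (Idn ?C X) = f"
      by (rule dfs_hom_unique[OF Y[folded O] X[folded O] compm[OF X X Y idm[OF X] f] f])
    show "Comp ?C X Y Y (Idn ?C Y) f = f"
      by (rule dfs_hom_unique[OF Y[folded O] X[folded O] compm[OF X Y Y f idm[OF Y]] f])
  next
    fix X Y Z f g assume "X \<in> Obj ?C" "Y \<in> Obj ?C" "Z \<in> Obj ?C" "f \<in> Hom ?C X Y" "g \<in> Hom ?C Y Z"
    then show "Comp ?C X Y Z g f \<in> Hom ?C X Z" by (rule compm)
  next
    fix W X Y Z f g h
    assume o: "W \<in> Obj ?C" "X \<in> Obj ?C" "Y \<in> Obj ?C" "Z \<in> Obj ?C"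
      and m: "f \<in> Hom ?C W X" "g \<in> Hom ?C X Y" "h \<in> Hom ?C Y Z"
    show "Comp ?C W Y Z h (Comp ?C W X Y g f) = Comp ?C W X Z (Comp ?C X Y Z h g) f"
      by (rule dfs_hom_unique[OF o(4)[folded O] o(1)[folded O]])
         (rule compm[OF o(1,3,4) compm[OF o(1,2,3) m(1,2)] m(3)] compm[OF o(1,2,4) m(1) compm[OF o(2,3,4) m(2,3)]])+
  qed
qed

end

section \<open>Rooted trees and their disc families\<close>

locale rtree =
  fixes r :: "'v rel"
  assumes rooted_tree: "rooted_tree r"
begin

lemma finite_Field: "finite (Field r)"
  using rooted_tree unfolding rooted_tree_def by simp

lemma tree_refl: "e \<in> Field r \<Longrightarrow> (e, e) \<in> r"
  using rooted_tree unfolding rooted_tree_def partial_order_on_def preorder_on_def refl_on_def by simp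

lemma tree_trans: "(a, b) \<in> r \<Longrightarrow> (b, c) \<in> r \<Longrightarrow> (a, c) \<in> r"
  using rooted_tree unfolding rooted_tree_def partial_order_on_def preorder_on_def by (metis transD)

lemma tree_antisym: "(a, b) \<in> r \<Longrightarrow> (b, a) \<in> r \<Longrightarrow> a = b"
  using rooted_tree unfolding rooted_tree_def partial_order_on_def by (metis antisymD)

lemma FieldI: "(a, b) \<in> r \<Longrightarrow> a \<in> Field r" "(a, b) \<in> r \<Longrightarrow> b \<in> Field r"
  by (auto simp: Field_def)

lemma down_subset: "down r e \<subseteq> Field r"
  by (auto simp: down_def Field_def)

lemma finite_down: "finite (down r e)"
  using finite_subset[OF down_subset finite_Field] .

lemma down_chain: "e \<in> Field r \<Longrightarrow> down r e \<in> Chains r"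
  using rooted_tree unfolding rooted_tree_def by simp

lemma down_comparable: "(a, e) \<in> r \<Longrightarrow> (b, e) \<in> r \<Longrightarrow> (a, b) \<in> r \<or> (b, a) \<in> r"
  using down_chain[OF FieldI(2)] unfolding Chains_def down_def by blast

lemma down_self: "e \<in> Field r \<Longrightarrow> e \<in> down r e"
  using tree_refl by (simp add: down_def)

lemma card_down: "e \<in> Field r \<Longrightarrow> card (down r e) = Suc (level r e)"
  using down_self[of e] finite_down[of e] unfolding level_def
  by (metis One_nat_def Suc_pred card_gt_0_iff empty_iff)

lemma level_less:
  assumes "(a, b) \<in> r" "a \<noteq> b"
  shows "level r a < level r b"
proof -
  have "down r a \<subseteq> down r b" using assms tree_trans by (auto simp: down_def)
  moreover have "b \<in> down r b" using down_self FieldI(2)[OF assms(1)] .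
  moreover have "b \<notin> down r a" using assms tree_antisym by (auto simp: down_def)
  ultimately have "down r a \<subset> down r b" by blast
  then have "card (down r a) < card (down r b)" by (rule psubset_card_mono[OF finite_down])
  then show ?thesis using card_down FieldI[OF assms(1)] by simp
qed

lemma level_mono: "(a, b) \<in> r \<Longrightarrow> level r a \<le> level r b"
  using level_less[of a b] by (cases "a = b") auto

lemma down_le_iff: "(a, e) \<in> r \<Longrightarrow> (b, e) \<in> r \<Longrightarrow> (a, b) \<in> r \<longleftrightarrow> level r a \<le> level r b"
  using down_comparable[of a e b] level_mono[of a b] level_less[of b a] tree_refl[OF FieldI(1)] by fastforce

lemma down_level_inj: "(a, e) \<in> r \<Longrightarrow> (b, e) \<in> r \<Longrightarrow> level r a = level r b \<Longrightarrow> a = b"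
  using down_le_iff[of a e b] down_le_iff[of b e a] tree_antisym by auto

text \<open>Levels are pairwise different on the branch below \<open>e\<close>, and this branch has
  as many nodes as there are candidates for the level.\<close>

lemma level_image_down:
  assumes "e \<in> Field r"
  shows "level r ` down r e = {..level r e}"
proof (rule card_subset_eq)
  show "level r ` down r e \<subseteq> {..level r e}" using level_mono by (auto simp: down_def)
  have "inj_on (level r) (down r e)"
    using down_level_inj by (auto simp: inj_on_def down_def)
  then show "card (level r ` down r e) = card {..level r e}" using card_down[OF assms] by (simp add: card_image)
qed simp

text \<open>The node at level \<open>l\<close> on the branch from the root to \<open>e\<close>;
  branches are treated as functions of the level.\<close>

definition anc where "anc e l = (THE a. (a, e) \<in> r \<and> level r a = l)"

lemma anc_ex1:
  assumes "e \<in> Field r" "l \<le> level r e"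
  shows "\<exists>!a. (a, e) \<in> r \<and> level r a = l"
proof -
  have "l \<in> level r ` down r e" using level_image_down assms by simp
  then obtain a where "(a, e) \<in> r" "level r a = l" by (auto simp: down_def)
  then show ?thesis using down_level_inj by metis
qed

lemma anc:
  assumes "e \<in> Field r" "l \<le> level r e"
  shows "(anc e l, e) \<in> r" "level r (anc e l) = l"
  using theI'[OF anc_ex1[OF assms]] unfolding anc_def by simp_all

lemma anc_eqI: "(a, e) \<in> r \<Longrightarrow> level r a = l \<Longrightarrow> anc e l = a"
  using down_level_inj[of "anc e l" e a] anc[of e l] level_mono FieldI(2) by metis

lemma anc_level: "(a, e) \<in> r \<Longrightarrow> anc e (level r a) = a"
  by (rule anc_eqI) simp_all

lemma anc_self: "e \<in> Field r \<Longrightarrow> anc e (level r e) = e"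
  by (rule anc_level[OF tree_refl])

lemma anc_Field: "e \<in> Field r \<Longrightarrow> l \<le> level r e \<Longrightarrow> anc e l \<in> Field r"
  using anc(1) FieldI(1) by metis

lemma anc_mono:
  assumes "e \<in> Field r" "k \<le> l" "l \<le> level r e"
  shows "(anc e k, anc e l) \<in> r"
  using down_le_iff[OF anc(1)[of e k] anc(1)[of e l]] anc(2) assms by simp

lemma down_eq_anc:
  assumes "e \<in> Field r"
  shows "down r e = anc e ` {..level r e}"
proof (intro equalityI subsetI)
  fix a assume "a \<in> down r e"
  then have a: "(a, e) \<in> r" by (simp add: down_def)
  then show "a \<in> anc e ` {..level r e}" using anc_level[OF a] level_mono[OF a] by (metis atMost_iff rev_image_eqI)
qed (use anc(1)[OF assms] in \<open>auto simp: down_def\<close>)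

lemma leaves_Field: "e \<in> leaves r \<Longrightarrow> e \<in> Field r"
  by (simp add: leaves_def)

lemma leaf_max: "e \<in> leaves r \<Longrightarrow> (e, b) \<in> r \<Longrightarrow> b = e"
  using FieldI(2) unfolding leaves_def by blast

lemma leaf_above:
  assumes "v \<in> Field r"
  shows "\<exists>e\<in>leaves r. (v, e) \<in> r"
proof -
  let ?U = "up_set r v"
  have "?U \<subseteq> Field r" using FieldI(2) by (auto simp: up_set_def)
  then have U: "finite ?U" "v \<in> ?U"
    using finite_subset[OF _ finite_Field] tree_refl[OF assms] by (auto simp: up_set_def)
  define m where "m = Max (level r ` ?U)"
  have "m \<in> level r ` ?U" unfolding m_def using U by (intro Max_in) auto
  then obtain e where e: "(v, e) \<in> r" "level r e = m" by (auto simp: up_set_def)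
  have max: "level r b \<le> m" if "(v, b) \<in> r" for b
    unfolding m_def using U that by (intro Max_ge) (auto simp: up_set_def)
  have "b = e" if "(e, b) \<in> r" for b
    using level_less[OF that] max[OF tree_trans[OF e(1) that]] e(2) by (cases "b = e") auto
  then show ?thesis using e FieldI(2)[OF e(1)] unfolding leaves_def by blast
qed

text \<open>A finite nonempty chain lies below its element of highest level; maximality makes that
  element a leaf and the chain its whole branch.\<close>

lemma maximal_chain_iff: "maximal_chain r C \<longleftrightarrow> (\<exists>e\<in>leaves r. C = down r e)"
proof
  assume m: "maximal_chain r C"
  then have C: "C \<in> Chains r" and max: "\<And>C'. C' \<in> Chains r \<Longrightarrow> C \<subseteq> C' \<Longrightarrow> C' = C"
    unfolding maximal_chain_def by auto
  have sub: "C \<subseteq> Field r" using C unfolding Chains_def Field_def by blast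
  have fin: "finite C" using finite_subset[OF sub finite_Field] .
  have ne: "C \<noteq> {}"
  proof
    assume "C = {}"
    moreover obtain e where "e \<in> Field r" using rooted_tree unfolding rooted_tree_def by blast
    then have "{e} \<in> Chains r" using tree_refl by (simp add: Chains_def)
    ultimately show False using max[of "{e}"] by simp
  qed
  have "Max (level r ` C) \<in> level r ` C" using fin ne by (intro Max_in) auto
  then obtain e where e: "e \<in> C" "level r e = Max (level r ` C)" by auto
  have "C \<subseteq> down r e"
  proof
    fix a assume a: "a \<in> C"
    have "(a, e) \<in> r \<or> (e, a) \<in> r" using C a e(1) unfolding Chains_def by blast
    moreover have "level r a \<le> level r e" unfolding e(2) using fin a by (intro Max_ge) auto
    then have "(e, a) \<in> r \<Longrightarrow> a = e" using level_less[of e a] by (cases "a = e") auto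
    ultimately show "a \<in> down r e" using tree_refl sub e(1) by (auto simp: down_def)
  qed
  then have eq: "C = down r e" using max[OF down_chain] sub e(1) by blast
  have "b = e" if b: "(e, b) \<in> r" for b
  proof -
    have "C \<subseteq> down r b" unfolding eq using tree_trans[OF _ b] by (auto simp: down_def)
    then have "down r b = C" by (rule max[OF down_chain[OF FieldI(2)[OF b]]])
    then have "b \<in> down r e" using down_self[OF FieldI(2)[OF b]] eq by simp
    then show ?thesis using tree_antisym b by (simp add: down_def)
  qed
  then have "e \<in> leaves r" unfolding leaves_def using sub e(1) by blast
  then show "\<exists>e\<in>leaves r. C = down r e" using eq by blast
next
  assume "\<exists>e\<in>leaves r. C = down r e"
  then obtain e where e: "e \<in> leaves r" "C = down r e" by blast
  have "C' = C" if C': "C' \<in> Chains r" "C \<subseteq> C'" for C'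
  proof -
    have eC: "e \<in> C'" using C'(2) e down_self leaves_Field by blast
    have "c \<in> down r e" if c: "c \<in> C'" for c
    proof -
      have "(c, e) \<in> r \<or> (e, c) \<in> r" using C'(1) eC c unfolding Chains_def by blast
      then show ?thesis using leaf_max[OF e(1)] tree_refl[OF leaves_Field[OF e(1)]] by (auto simp: down_def)
    qed
    then show ?thesis using C'(2) e(2) by blast
  qed
  then show "maximal_chain r C"
    unfolding maximal_chain_def using down_chain[OF leaves_Field[OF e(1)]] e(2) by blast
qed

lemma anc_zero: 
  assumes "e \<in> Field r" "e' \<in> Field r"
  shows "anc e 0 = anc e' 0"
proof -
  have min: "anc b 0 \<in> Field r \<and> (\<forall>a\<in>Field r. (a, anc b 0) \<in> r \<longrightarrow> a = anc b 0)" if "b \<in> Field r" for b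
    using anc_Field[OF that, of 0] anc(2)[OF that, of 0] level_less by fastforce
  have "\<exists>!e. e \<in> Field r \<and> (\<forall>e'\<in>Field r. (e', e) \<in> r \<longrightarrow> e' = e)"
    using rooted_tree unfolding rooted_tree_def by simp
  then show ?thesis using min[OF assms(1)] min[OF assms(2)] by (elim ex1E) metis
qed

text \<open>For distinct leaves, removing the leaves from their branches does not change the
  intersection. The intersection is a chain closed downwards, so the branches agree exactly up to
  the level of its top element.\<close>

lemma first_common_ancestor:
  assumes e: "e \<in> leaves r" "e' \<in> leaves r" "e \<noteq> e'"
  defines "d \<equiv> level r (first_common_ancestor r e e')"
  shows "d < level r e" "d < level r e'"
    and "\<And>l. l \<le> level r e \<Longrightarrow> l \<le> level r e' \<Longrightarrow> anc e l = anc e' l \<longleftrightarrow> l \<le> d"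
proof -
  let ?C = "(down r e - {e}) \<inter> (down r e' - {e'})"
  have F: "e \<in> Field r" "e' \<in> Field r" using e leaves_Field by auto
  have C: "a \<in> ?C \<longleftrightarrow> (a, e) \<in> r \<and> (a, e') \<in> r" for a
    using leaf_max[OF e(1), of e'] leaf_max[OF e(2), of e] e(3) by (auto simp: down_def)
  have fin: "finite ?C" using finite_down by simp
  have "anc e 0 \<in> ?C" unfolding C using anc(1)[OF F(1), of 0] anc(1)[OF F(2), of 0] anc_zero[OF F] by simp
  then have "Max (level r ` ?C) \<in> level r ` ?C" using fin by (intro Max_in) auto
  then obtain a where a: "a \<in> ?C" "level r a = Max (level r ` ?C)" by (metis (no_types, lifting) imageE)
  have aC: "(b, a) \<in> r" if b: "b \<in> ?C" for b
  proof -
    have "level r b \<le> level r a" unfolding a(2) using fin b by (intro Max_ge) auto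
    then show ?thesis using down_le_iff[of b e a] a(1) b C by blast
  qed
  have "first_common_ancestor r e e' = a"
    unfolding first_common_ancestor_def Let_def
  proof (rule the_equality)
    show "a \<in> ?C \<and> (\<forall>b\<in>?C. (a, b) \<in> r \<longrightarrow> b = a)" using a(1) aC tree_antisym by blast
    fix c assume "c \<in> ?C \<and> (\<forall>b\<in>?C. (c, b) \<in> r \<longrightarrow> b = c)"
    then show "c = a" using aC a(1) by metis
  qed
  then have d: "d = level r a" by (simp add: d_def)
  show "d < level r e" "d < level r e'" unfolding d using a(1) by (auto intro!: level_less simp: down_def)
  fix l assume l: "l \<le> level r e" "l \<le> level r e'"
  show "anc e l = anc e' l \<longleftrightarrow> l \<le> d"
  proof
    assume eq: "anc e l = anc e' l"
    have "anc e l \<in> ?C" unfolding C using anc(1)[OF F(1) l(1)] anc(1)[OF F(2) l(2)] eq by simp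
    then have "level r (anc e l) \<le> d" unfolding d by (intro level_mono aC)
    then show "l \<le> d" using anc(2)[OF F(1) l(1)] by simp
  next
    assume ld: "l \<le> d"
    have aF: "a \<in> Field r" and ae: "(a, e) \<in> r" "(a, e') \<in> r" using a(1) C FieldI(1) by blast+
    have b: "(anc a l, a) \<in> r" "level r (anc a l) = l" using anc[OF aF] ld d by simp_all
    show "anc e l = anc e' l"
      using anc_eqI[OF tree_trans[OF b(1) ae(1)] b(2)] anc_eqI[OF tree_trans[OF b(1) ae(2)] b(2)] by simp
  qed
qed

end

text \<open>Along a branch a morphism keeps levels until it meets the image leaf and then stays
  there. Levels have no gaps because the image of a branch is a whole branch; and two consecutive
  nodes with the same image force the fibre to be a maximal subtree, which contains the leaf
  \<open>e'\<close>.\<close>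

lemma tree_mor_anc:
  assumes t: "rtree r'" "rtree r" and \<tau>: "tree_mor r' r \<tau>" and e': "e' \<in> leaves r'"
  shows "\<tau> e' \<in> leaves r" and "level r (\<tau> e') \<le> level r' e'"
    and "k \<le> level r' e' \<Longrightarrow> \<tau> (rtree.anc r' e' k) = rtree.anc r (\<tau> e') (min k (level r (\<tau> e')))"
proof -
  interpret R': rtree r' by (rule t(1))
  interpret R: rtree r by (rule t(2))
  have mono: "(\<tau> a, \<tau> b) \<in> r" if "(a, b) \<in> r'" for a b using \<tau> that unfolding tree_mor_def by auto
  have fib: "{f \<in> Field r'. \<tau> f = \<tau> v} = {v} \<or> maximal_subtree r' {f \<in> Field r'. \<tau> f = \<tau> v}"
    if "v \<in> Field r'" for v using \<tau> that unfolding tree_mor_def Let_def by auto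
  have F': "e' \<in> Field r'" by (rule R'.leaves_Field[OF e'])
  have "maximal_chain r' (down r' e')" unfolding R'.maximal_chain_iff using e' by blast
  then have "maximal_chain r (\<tau> ` down r' e')" using \<tau> unfolding tree_mor_def by blast
  then obtain e where e: "e \<in> leaves r" "\<tau> ` down r' e' = down r e" unfolding R.maximal_chain_iff by blast
  have F: "e \<in> Field r" by (rule R.leaves_Field[OF e(1)])
  have "e \<in> \<tau> ` down r' e'" using e(2) R.down_self[OF F] by simp
  then obtain v where v: "(v, e') \<in> r'" "e = \<tau> v" by (auto simp: down_def)
  have eq: "\<tau> e' = e" using R.leaf_max[OF e(1)] mono[OF v(1)] v(2) by simp
  show "\<tau> e' \<in> leaves r" using eq e(1) by simp
  have "card (down r e) \<le> card (down r' e')" using e(2) card_image_le[OF R'.finite_down] by metis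
  then show "level r (\<tau> e') \<le> level r' e'" using R.card_down[OF F] R'.card_down[OF F'] eq by simp
  let ?m = "level r e" and ?m' = "level r' e'"
  define h where "h k = level r (\<tau> (R'.anc e' k))" for k
  have \<tau>a: "(\<tau> (R'.anc e' k), e) \<in> r" if "k \<le> ?m'" for k
    using mono[OF R'.anc(1)[OF F' that]] eq by simp
  have hmono: "h k \<le> h l" if "k \<le> l" "l \<le> ?m'" for k l
    unfolding h_def using R.level_mono[OF mono[OF R'.anc_mono[OF F' that]]] .
  have him: "\<exists>k\<le>?m'. h k = l" if "l \<le> ?m" for l
  proof -
    have "R.anc e l \<in> \<tau> ` down r' e'" using R.anc(1)[OF F that] e(2) by (simp add: down_def)
    then obtain k where "k \<le> ?m'" "R.anc e l = \<tau> (R'.anc e' k)" unfolding R'.down_eq_anc[OF F'] by auto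
    then show ?thesis unfolding h_def using R.anc(2)[OF F that] by metis
  qed
  have hle: "h k \<le> ?m" if "k \<le> ?m'" for k unfolding h_def using R.level_mono[OF \<tau>a[OF that]] .
  \<comment> \<open>A fibre with two nodes of the branch is the set of all nodes above some
    \<open>c\<close>. Since \<open>c\<close> lies below \<open>e'\<close>, the common image is that
    of \<open>e'\<close>, whose level is \<open>?m\<close>.\<close>
  have stat: "h k = ?m" if k: "Suc k \<le> ?m'" "h k = h (Suc k)" for k
  proof -
    let ?v = "R'.anc e' k" and ?w = "R'.anc e' (Suc k)"
    have k': "k \<le> ?m'" using k by simp
    have vw: "?v \<noteq> ?w" using R'.anc(2)[OF F' k'] R'.anc(2)[OF F' k(1)] by auto
    have \<tau>vw: "\<tau> ?v = \<tau> ?w"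
      using R.down_level_inj[OF \<tau>a[OF k'] \<tau>a[OF k(1)]] k(2) unfolding h_def by simp
    have vF: "?v \<in> Field r'" "?w \<in> Field r'" using R'.anc_Field[OF F'] k k' by auto
    have w: "?w \<in> {f \<in> Field r'. \<tau> f = \<tau> ?v}" using vF(2) \<tau>vw by simp
    have "{f \<in> Field r'. \<tau> f = \<tau> ?v} \<noteq> {?v}"
    proof
      assume "{f \<in> Field r'. \<tau> f = \<tau> ?v} = {?v}"
      then have "?w \<in> {?v}" using w by (rule subst)
      then show False using vw by simp
    qed
    then have "maximal_subtree r' {f \<in> Field r'. \<tau> f = \<tau> ?v}" using fib[OF vF(1)] by blast
    then obtain c where c: "{f \<in> Field r'. \<tau> f = \<tau> ?v} = up_set r' c" unfolding maximal_subtree_def by auto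
    have "(c, ?v) \<in> r'" using c vF(1) by (auto simp: up_set_def)
    then have "(c, e') \<in> r'" using R'.tree_trans R'.anc(1)[OF F' k'] by blast
    then have "e' \<in> {f \<in> Field r'. \<tau> f = \<tau> ?v}" using c by (simp add: up_set_def)
    then show ?thesis unfolding h_def using eq by simp
  qed
  \<comment> \<open>Below \<open>?m\<close> the value must increase by \<open>stat\<close>, and it
    cannot jump: k + 1 is attained somewhere and \<open>h\<close> is monotone.\<close>
  have hk: "h k = min k ?m" if "k \<le> ?m'" for k
    using that
  proof (induction k)
    case 0
    obtain j where "j \<le> ?m'" "h j = 0" using him[of 0] by auto
    then show ?case using hmono[of 0 j] by simp
  next
    case (Suc k)
    then have IH: "h k = min k ?m" by simp
    show ?case
    proof (cases "k \<ge> ?m")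
      case True
      then show ?thesis using IH hmono[of k "Suc k"] hle[OF Suc.prems] Suc.prems by simp
    next
      case False
      then have hk: "h k = k" using IH by simp
      have "h k \<noteq> h (Suc k)" using stat[OF Suc.prems] hk False by auto
      then have gt: "h (Suc k) > k" using hmono[of k "Suc k"] Suc.prems hk by simp
      obtain j where j: "j \<le> ?m'" "h j = Suc k" using him[of "Suc k"] False by auto
      have "Suc k \<le> j"
      proof (rule ccontr)
        assume "\<not> Suc k \<le> j"
        then have "h j \<le> h k" using hmono[of j k] Suc.prems by simp
        then show False using j hk by simp
      qed
      then have "h (Suc k) \<le> Suc k" using hmono[OF _ j(1)] j(2) by metis
      then show ?thesis using gt False by simp
    qed
  qed
  show "\<tau> (R'.anc e' k) = R.anc (\<tau> e') (min k (level r (\<tau> e')))" if k: "k \<le> ?m'"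
    unfolding eq using R.anc_eqI[OF \<tau>a[OF k], of "min k ?m"] hk[OF k] unfolding h_def by simp
qed

section \<open>Labelled trees as families of discs\<close>

context base_ring
begin

definition tree_discs :: "'v rel \<times> ('v \<Rightarrow> 'a) \<Rightarrow> ('a \<times> nat) set" where
  "tree_discs \<gamma> = (\<lambda>e. (snd \<gamma> e, level (fst \<gamma>) e)) ` leaves (fst \<gamma>)"

lemma labelled_treeD:
  assumes "labelled_tree A x \<gamma>"
  shows "rtree (fst \<gamma>)" and "e \<in> leaves (fst \<gamma>) \<Longrightarrow> snd \<gamma> e \<in> carrier A"
    and "\<lbrakk>e \<in> leaves (fst \<gamma>); e' \<in> leaves (fst \<gamma>); e \<noteq> e'\<rbrakk> \<Longrightarrow>
      x [^] level (fst \<gamma>) (first_common_ancestor (fst \<gamma>) e e') divides (snd \<gamma> e' \<ominus> snd \<gamma> e)"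
    and "\<lbrakk>e \<in> leaves (fst \<gamma>); e' \<in> leaves (fst \<gamma>); e \<noteq> e'\<rbrakk> \<Longrightarrow>
      \<not> x [^] (Suc (level (fst \<gamma>) (first_common_ancestor (fst \<gamma>) e e'))) divides (snd \<gamma> e' \<ominus> snd \<gamma> e)"
proof -
  have P: "x [^] n \<in> carrier A" for n :: nat by simp
  show "rtree (fst \<gamma>)" using assms unfolding labelled_tree_def by (simp add: case_prod_beta rtree_def)
  show "e \<in> leaves (fst \<gamma>) \<Longrightarrow> snd \<gamma> e \<in> carrier A"
    using assms unfolding labelled_tree_def by (auto simp: case_prod_beta)
  assume "e \<in> leaves (fst \<gamma>)" "e' \<in> leaves (fst \<gamma>)" "e \<noteq> e'"
  then have "snd \<gamma> e' \<ominus> snd \<gamma> e \<in> PIdl (x [^] level (fst \<gamma>) (first_common_ancestor (fst \<gamma>) e e')) -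
      PIdl (x [^] (level (fst \<gamma>) (first_common_ancestor (fst \<gamma>) e e') + 1))"
    using assms unfolding labelled_tree_def Let_def by (simp add: case_prod_beta)
  then show "x [^] level (fst \<gamma>) (first_common_ancestor (fst \<gamma>) e e') divides (snd \<gamma> e' \<ominus> snd \<gamma> e)"
    and "\<not> x [^] (Suc (level (fst \<gamma>) (first_common_ancestor (fst \<gamma>) e e'))) divides (snd \<gamma> e' \<ominus> snd \<gamma> e)"
    unfolding Suc_eq_plus1 Diff_iff PIdl_iff[OF P] by blast+
qed

context
  fixes \<gamma> :: "'v rel \<times> ('v \<Rightarrow> 'a)"
  assumes \<gamma>: "labelled_tree A x \<gamma>"
begin

interpretation R: rtree "fst \<gamma>" by (rule labelled_treeD(1)[OF \<gamma>])

abbreviation "leaf_disc e \<equiv> (snd \<gamma> e, level (fst \<gamma>) e)"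

lemma label_closed: "e \<in> leaves (fst \<gamma>) \<Longrightarrow> snd \<gamma> e \<in> carrier A"
  by (rule labelled_treeD(2)[OF \<gamma>])

text \<open>By the condition on labels, x^l divides the difference exactly for \<open>l\<close> up
  to the level of the first common ancestor, and the branches agree up to the same level. So a node
  at level \<open>l\<close> is a congruence class of labels modulo x^l.\<close>

lemma anc_eq_iff_divides:
  assumes e: "e \<in> leaves (fst \<gamma>)" "e' \<in> leaves (fst \<gamma>)"
    and l: "l \<le> level (fst \<gamma>) e" "l \<le> level (fst \<gamma>) e'"
  shows "R.anc e l = R.anc e' l \<longleftrightarrow> x [^] l divides (snd \<gamma> e' \<ominus> snd \<gamma> e)"
proof (cases "e = e'")
  case True
  have "snd \<gamma> e \<ominus> snd \<gamma> e = \<zero>" using label_closed[OF e(1)] by simp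
  then show ?thesis unfolding True[symmetric] by (simp add: divides_zero)
next
  case False
  let ?d = "level (fst \<gamma>) (first_common_ancestor (fst \<gamma>) e e')" and ?\<delta> = "snd \<gamma> e' \<ominus> snd \<gamma> e"
  have \<delta>: "?\<delta> \<in> carrier A" using label_closed e by simp
  have "x [^] l divides ?\<delta> \<longleftrightarrow> l \<le> ?d"
  proof
    assume "l \<le> ?d"
    then show "x [^] l divides ?\<delta>" by (rule pow_divides_mono[OF x_closed \<delta> labelled_treeD(3)[OF \<gamma> e False]])
  next
    assume d: "x [^] l divides ?\<delta>"
    show "l \<le> ?d"
    proof (rule ccontr)
      assume "\<not> l \<le> ?d"
      then have "Suc ?d \<le> l" by simp
      then have "x [^] Suc ?d divides ?\<delta>" by (rule pow_divides_mono[OF x_closed \<delta> d])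
      then show False using labelled_treeD(4)[OF \<gamma> e False] by simp
    qed
  qed
  then show ?thesis using R.first_common_ancestor(3)[OF e False l] by simp
qed

lemma leaf_discs_separated:
  assumes e: "e \<in> leaves (fst \<gamma>)" "e' \<in> leaves (fst \<gamma>)" "e \<noteq> e'"
  shows "separated (leaf_disc e) (leaf_disc e')"
  unfolding separated_def fst_conv snd_conv
  using R.first_common_ancestor(1,2)[OF e] labelled_treeD(3,4)[OF \<gamma> e] by auto

text \<open>Two discs that contain a common disc are nested, whereas the discs of distinct leaves
  are separated. This makes the image of a leaf under a morphism unique.\<close>

lemma within_leaf_unique:
  assumes q: "fst q \<in> carrier A" and e: "e \<in> leaves (fst \<gamma>)" "e' \<in> leaves (fst \<gamma>)"
    and w: "disc_within q (leaf_disc e)" "disc_within q (leaf_disc e')"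
  shows "e = e'"
proof (rule ccontr)
  assume ne: "e \<noteq> e'"
  have c: "snd \<gamma> e \<in> carrier A" "snd \<gamma> e' \<in> carrier A" using label_closed e by auto
  have *: "disc_within p p'" if "disc_within q p" "disc_within q p'" "snd p' \<le> snd p"
    "fst p \<in> carrier A" "fst p' \<in> carrier A" for p p'
  proof -
    have "fst q \<ominus> fst p \<in> carrier A" using q that by simp
    then have "x [^] snd p' divides (fst q \<ominus> fst p)"
      using that pow_divides_mono[OF x_closed, of "fst q \<ominus> fst p" "snd p" "snd p'"] unfolding disc_within_def by simp
    then have a: "x [^] snd p' divides (fst p \<ominus> fst q)"
      by (rule minus_swap_divides[OF q that(4), rotated]) simp
    have b: "x [^] snd p' divides (fst q \<ominus> fst p')" using that unfolding disc_within_def by simp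
    have "fst p \<ominus> fst p' = (fst p \<ominus> fst q) \<oplus> (fst q \<ominus> fst p')" using q that(4,5) by algebra
    then show ?thesis using divides_add[OF _ a b] that(3) unfolding disc_within_def by simp
  qed
  have "disc_within (leaf_disc e) (leaf_disc e') \<or> disc_within (leaf_disc e') (leaf_disc e)"
    using *[OF w] *[OF w(2,1)] c by (cases "level (fst \<gamma>) e' \<le> level (fst \<gamma>) e") auto
  then show False
    using leaf_discs_separated[OF e ne] separated_iff_not_within[of "leaf_disc e" "leaf_disc e'"] c by simp
qed

lemma tree_discs_family: "disc_family (tree_discs \<gamma>)"
  unfolding disc_family_def
proof (intro conjI ballI impI)
  have "leaves (fst \<gamma>) \<subseteq> Field (fst \<gamma>)" by (auto simp: leaves_def)
  then show "finite (tree_discs \<gamma>)" unfolding tree_discs_def using finite_subset[OF _ R.finite_Field] by auto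
  obtain v where "v \<in> Field (fst \<gamma>)" using R.rooted_tree unfolding rooted_tree_def by blast
  then show "tree_discs \<gamma> \<noteq> {}" unfolding tree_discs_def using R.leaf_above by blast
  show "fst ` tree_discs \<gamma> \<subseteq> carrier A" unfolding tree_discs_def using label_closed by auto
  fix p q assume "p \<in> tree_discs \<gamma>" "q \<in> tree_discs \<gamma>" "p \<noteq> q"
  then show "separated p q" unfolding tree_discs_def using leaf_discs_separated by blast
qed

end

lemma disc_within_trans:
  assumes "fst p \<in> carrier A" "fst q \<in> carrier A" "fst s \<in> carrier A"
    and w: "disc_within p q" "disc_within q s"
  shows "disc_within p s"
proof -
  have "fst p \<ominus> fst q \<in> carrier A" using assms by simp
  then have a: "x [^] snd s divides (fst p \<ominus> fst q)"
    using w pow_divides_mono[OF x_closed, of "fst p \<ominus> fst q" "snd q" "snd s"] unfolding disc_within_def by simp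
  have b: "x [^] snd s divides (fst q \<ominus> fst s)" using w unfolding disc_within_def by simp
  have "fst p \<ominus> fst s = (fst p \<ominus> fst q) \<oplus> (fst q \<ominus> fst s)" using assms(1-3) by algebra
  then show ?thesis using divides_add[OF _ a b] w unfolding disc_within_def by simp
qed

lemma tree_hom_leaf:
  fixes \<gamma> \<gamma>' :: "'v rel \<times> ('v \<Rightarrow> 'a)"
  assumes \<gamma>: "labelled_tree A x \<gamma>" and \<gamma>': "labelled_tree A x \<gamma>'"
    and \<tau>: "labelled_tree_mor A x \<gamma>' \<gamma> \<tau>" and e': "e' \<in> leaves (fst \<gamma>')"
  shows "\<tau> e' \<in> leaves (fst \<gamma>)"
    and "disc_within (snd \<gamma>' e', level (fst \<gamma>') e') (snd \<gamma> (\<tau> e'), level (fst \<gamma>) (\<tau> e'))"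
    and "k \<le> level (fst \<gamma>') e' \<Longrightarrow> \<tau> (rtree.anc (fst \<gamma>') e' k) = rtree.anc (fst \<gamma>) (\<tau> e') (min k (level (fst \<gamma>) (\<tau> e')))"
proof -
  have tm: "tree_mor (fst \<gamma>') (fst \<gamma>) \<tau>" using \<tau> unfolding labelled_tree_mor_def by (simp add: case_prod_beta)
  note t = tree_mor_anc[OF labelled_treeD(1)[OF \<gamma>'] labelled_treeD(1)[OF \<gamma>] tm e']
  show "\<tau> e' \<in> leaves (fst \<gamma>)" by (rule t(1))
  then have "snd \<gamma>' e' \<ominus> snd \<gamma> (\<tau> e') \<in> PIdl (x [^] level (fst \<gamma>) (\<tau> e'))"
    using \<tau> e' unfolding labelled_tree_mor_def by (simp add: case_prod_beta)
  then have "x [^] level (fst \<gamma>) (\<tau> e') divides (snd \<gamma>' e' \<ominus> snd \<gamma> (\<tau> e'))"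
    using PIdl_iff[OF nat_pow_closed[OF x_closed]] by simp
  then show "disc_within (snd \<gamma>' e', level (fst \<gamma>') e') (snd \<gamma> (\<tau> e'), level (fst \<gamma>) (\<tau> e'))"
    using t(2) unfolding disc_within_def by simp
  show "k \<le> level (fst \<gamma>') e' \<Longrightarrow> \<tau> (rtree.anc (fst \<gamma>') e' k) = rtree.anc (fst \<gamma>) (\<tau> e') (min k (level (fst \<gamma>) (\<tau> e')))"
    by (rule t(3))
qed

text \<open>A choice of a containing disc for each leaf is extended by the formula that
  \<open>tree_mor_anc\<close> forces: levels on a branch are kept and cut off at the level of the
  image leaf. Independence of the leaf and the condition on fibres turn into congruences between
  labels.\<close>

lemma tree_hom_ex:
  fixes \<gamma> \<gamma>' :: "'v rel \<times> ('v \<Rightarrow> 'a)"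
  assumes \<gamma>: "labelled_tree A x \<gamma>" and \<gamma>': "labelled_tree A x \<gamma>'"
    and f: "\<And>e'. e' \<in> leaves (fst \<gamma>') \<Longrightarrow> f e' \<in> leaves (fst \<gamma>) \<and>
      disc_within (snd \<gamma>' e', level (fst \<gamma>') e') (snd \<gamma> (f e'), level (fst \<gamma>) (f e'))"
  shows "\<exists>\<tau> \<in> extensional (Field (fst \<gamma>')). labelled_tree_mor A x \<gamma>' \<gamma> \<tau> \<and>
    (\<forall>e'\<in>leaves (fst \<gamma>'). \<forall>k\<le>level (fst \<gamma>') e'.
       \<tau> (rtree.anc (fst \<gamma>') e' k) = rtree.anc (fst \<gamma>) (f e') (min k (level (fst \<gamma>) (f e'))))"
proof -
  interpret R: rtree "fst \<gamma>" by (rule labelled_treeD(1)[OF \<gamma>])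
  interpret R': rtree "fst \<gamma>'" by (rule labelled_treeD(1)[OF \<gamma>'])
  let ?L = "level (fst \<gamma>)" and ?L' = "level (fst \<gamma>')"
  have fl: "f e \<in> leaves (fst \<gamma>)" and fw: "disc_within (snd \<gamma>' e, ?L' e) (snd \<gamma> (f e), ?L (f e))"
    if "e \<in> leaves (fst \<gamma>')" for e using f[OF that] by auto
  have fF: "f e \<in> Field (fst \<gamma>)" if "e \<in> leaves (fst \<gamma>')" for e by (rule R.leaves_Field[OF fl[OF that]])
  have fle: "?L (f e) \<le> ?L' e" if "e \<in> leaves (fst \<gamma>')" for e using fw[OF that] by (simp add: disc_within_def)
  note lc = label_closed[OF \<gamma>] and lc' = label_closed[OF \<gamma>']
  define g where "g e k = R.anc (f e) (min k (?L (f e)))" for e k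
  \<comment> \<open>The disc of \<open>f e1\<close> then contains the disc of \<open>e2\<close> as
    well, and the containing leaf is unique.\<close>
  have same_leaf: "f e1 = f e2"
    if e: "e1 \<in> leaves (fst \<gamma>')" "e2 \<in> leaves (fst \<gamma>')"
      and d: "x [^] ?L (f e1) divides (snd \<gamma>' e2 \<ominus> snd \<gamma>' e1)" and le: "?L (f e1) \<le> ?L' e2" for e1 e2
  proof (rule within_leaf_unique[OF \<gamma> _ fl[OF e(1)] fl[OF e(2)] _ fw[OF e(2)]])
    have c: "snd \<gamma>' e1 \<in> carrier A" "snd \<gamma>' e2 \<in> carrier A" "snd \<gamma> (f e1) \<in> carrier A"
      using lc'[OF e(1)] lc'[OF e(2)] lc[OF fl[OF e(1)]] by auto
    then show "fst (snd \<gamma>' e2, ?L' e2) \<in> carrier A" by simp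
    have b: "x [^] ?L (f e1) divides (snd \<gamma>' e1 \<ominus> snd \<gamma> (f e1))" using fw[OF e(1)] by (simp add: disc_within_def)
    have "snd \<gamma>' e2 \<ominus> snd \<gamma> (f e1) = (snd \<gamma>' e2 \<ominus> snd \<gamma>' e1) \<oplus> (snd \<gamma>' e1 \<ominus> snd \<gamma> (f e1))" using c by algebra
    then show "disc_within (snd \<gamma>' e2, ?L' e2) (snd \<gamma> (f e1), ?L (f e1))"
      using divides_add[OF _ d b] le by (simp add: disc_within_def)
  qed
  \<comment> \<open>Independence of the leaf chosen above a node. If level \<open>k\<close> reaches
    one of the image leaves, both leaves lie in the same disc and the image leaves coincide;
    otherwise the labels of the image leaves agree modulo x^k through those of \<open>e1\<close> and
    \<open>e2\<close>.\<close>
  have well: "g e1 k = g e2 k"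
    if e: "e1 \<in> leaves (fst \<gamma>')" "e2 \<in> leaves (fst \<gamma>')" and k: "k \<le> ?L' e1" "k \<le> ?L' e2"
      and a: "R'.anc e1 k = R'.anc e2 k" for e1 e2 k
  proof -
    have c: "snd \<gamma>' e1 \<in> carrier A" "snd \<gamma>' e2 \<in> carrier A" "snd \<gamma> (f e1) \<in> carrier A" "snd \<gamma> (f e2) \<in> carrier A"
      using lc'[OF e(1)] lc'[OF e(2)] lc[OF fl[OF e(1)]] lc[OF fl[OF e(2)]] by auto
    have d: "x [^] k divides (snd \<gamma>' e2 \<ominus> snd \<gamma>' e1)"
      using anc_eq_iff_divides[OF \<gamma>' e k] a by simp
    have d': "x [^] k divides (snd \<gamma>' e1 \<ominus> snd \<gamma>' e2)" by (rule minus_swap_divides[OF c(2,1) _ d]) simp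
    consider "?L (f e1) \<le> k" | "?L (f e2) \<le> k" | "k < ?L (f e1)" "k < ?L (f e2)" by linarith
    then show ?thesis
    proof cases
      case 1
      have "x [^] ?L (f e1) divides (snd \<gamma>' e2 \<ominus> snd \<gamma>' e1)"
        by (rule pow_divides_mono[OF x_closed _ d 1]) (use c in simp)
      then have "f e1 = f e2" using same_leaf[OF e] 1 k by simp
      then show ?thesis by (simp add: g_def)
    next
      case 2
      have "x [^] ?L (f e2) divides (snd \<gamma>' e1 \<ominus> snd \<gamma>' e2)"
        by (rule pow_divides_mono[OF x_closed _ d' 2]) (use c in simp)
      then have "f e2 = f e1" using same_leaf[OF e(2,1)] 2 k by simp
      then show ?thesis by (simp add: g_def)
    next
      case 3
      have b: "x [^] k divides (snd \<gamma>' e \<ominus> snd \<gamma> (f e))" if "e \<in> leaves (fst \<gamma>')" "k < ?L (f e)" for e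
        by (rule pow_divides_mono[OF x_closed, of _ "?L (f e)"])
           (use fw[OF that(1)] that lc'[OF that(1)] lc[OF fl[OF that(1)]] in \<open>simp_all add: disc_within_def\<close>)
      have b1: "x [^] k divides (snd \<gamma> (f e1) \<ominus> snd \<gamma>' e1)"
        by (rule minus_swap_divides[OF c(1,3) _ b[OF e(1) 3(1)]]) simp
      have "snd \<gamma> (f e2) \<ominus> snd \<gamma> (f e1) = (snd \<gamma> (f e2) \<ominus> snd \<gamma>' e2) \<oplus> ((snd \<gamma>' e2 \<ominus> snd \<gamma>' e1) \<oplus> (snd \<gamma>' e1 \<ominus> snd \<gamma> (f e1)))"
        using c by algebra
      moreover have "x [^] k divides (snd \<gamma> (f e2) \<ominus> snd \<gamma>' e2)"
        by (rule minus_swap_divides[OF c(2,4) _ b[OF e(2) 3(2)]]) simp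
      ultimately have "x [^] k divides (snd \<gamma> (f e2) \<ominus> snd \<gamma> (f e1))"
        using divides_add[OF _ _ divides_add[OF _ d b[OF e(1) 3(1)]]] by simp
      then show ?thesis
        using anc_eq_iff_divides[OF \<gamma> fl[OF e(1)] fl[OF e(2)], of k] 3 by (simp add: g_def)
    qed
  qed
  \<comment> \<open>An arbitrary leaf above the node; \<open>well\<close> makes the choice
    immaterial.\<close>
  define lf where "lf v = (SOME e. e \<in> leaves (fst \<gamma>') \<and> (v, e) \<in> fst \<gamma>')" for v
  have lf: "lf v \<in> leaves (fst \<gamma>')" "(v, lf v) \<in> fst \<gamma>'" if "v \<in> Field (fst \<gamma>')" for v
    using someI_ex[of "\<lambda>e. e \<in> leaves (fst \<gamma>') \<and> (v, e) \<in> fst \<gamma>'"] R'.leaf_above[OF that] unfolding lf_def by blast+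
  define \<tau> where "\<tau> = (\<lambda>v\<in>Field (fst \<gamma>'). g (lf v) (?L' v))"
  have \<tau>g: "\<tau> v = g e (?L' v)" if e: "e \<in> leaves (fst \<gamma>')" and v: "(v, e) \<in> fst \<gamma>'" for v e
  proof -
    have vF: "v \<in> Field (fst \<gamma>')" by (rule R'.FieldI(1)[OF v])
    have "g (lf v) (?L' v) = g e (?L' v)"
      by (rule well[OF lf(1)[OF vF] e])
         (use R'.level_mono[OF lf(2)[OF vF]] R'.level_mono[OF v] R'.anc_level[OF lf(2)[OF vF]] R'.anc_level[OF v] in simp_all)
    then show ?thesis using vF by (simp add: \<tau>_def)
  qed
  have \<tau>a: "\<tau> (R'.anc e k) = g e k" if e: "e \<in> leaves (fst \<gamma>')" and k: "k \<le> ?L' e" for e k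
    using \<tau>g[OF e R'.anc(1)[OF R'.leaves_Field[OF e] k]] R'.anc(2)[OF R'.leaves_Field[OF e] k] by simp
  have gF: "(g e k, f e) \<in> fst \<gamma>" "?L (g e k) = min k (?L (f e))" if "e \<in> leaves (fst \<gamma>')" for e k
    unfolding g_def using R.anc[OF fF[OF that]] by simp_all
  have \<tau>leaf: "\<tau> e = f e" if e: "e \<in> leaves (fst \<gamma>')" for e
    using \<tau>a[OF e order_refl] R'.anc_self[OF R'.leaves_Field[OF e]] fle[OF e] R.anc_self[OF fF[OF e]]
    by (simp add: g_def)
  have mor: "tree_mor (fst \<gamma>') (fst \<gamma>) \<tau>"
    unfolding tree_mor_def Let_def
  proof (intro conjI)
    show "\<tau> \<in> Field (fst \<gamma>') \<rightarrow> Field (fst \<gamma>)"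
    proof
      fix v assume v: "v \<in> Field (fst \<gamma>')"
      show "\<tau> v \<in> Field (fst \<gamma>)" using \<tau>g[OF lf[OF v]] R.FieldI(1)[OF gF(1)[OF lf(1)[OF v]]] by simp
    qed
    show "\<forall>(v, w)\<in>fst \<gamma>'. (\<tau> v, \<tau> w) \<in> fst \<gamma>"
    proof (clarify)
      fix v w assume vw: "(v, w) \<in> fst \<gamma>'"
      have w: "w \<in> Field (fst \<gamma>')" by (rule R'.FieldI(2)[OF vw])
      let ?e = "lf w"
      note e = lf[OF w]
      have "min (?L' v) (?L (f ?e)) \<le> min (?L' w) (?L (f ?e))" using R'.level_mono[OF vw] by simp
      then have "(g ?e (?L' v), g ?e (?L' w)) \<in> fst \<gamma>" unfolding g_def by (rule R.anc_mono[OF fF[OF e(1)]]) simp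
      then show "(\<tau> v, \<tau> w) \<in> fst \<gamma>"
        using \<tau>g[OF e] \<tau>g[OF e(1) R'.tree_trans[OF vw e(2)]] by simp
    qed
    show "\<forall>C. maximal_chain (fst \<gamma>') C \<longrightarrow> maximal_chain (fst \<gamma>) (\<tau> ` C)"
    proof (intro allI impI)
      fix C assume "maximal_chain (fst \<gamma>') C"
      then obtain e where e: "e \<in> leaves (fst \<gamma>')" "C = down (fst \<gamma>') e" unfolding R'.maximal_chain_iff by blast
      have "\<tau> ` C = g e ` {..?L' e}"
        unfolding e(2) R'.down_eq_anc[OF R'.leaves_Field[OF e(1)]] image_image
        by (rule image_cong) (use \<tau>a[OF e(1)] in auto)
      also have "\<dots> = R.anc (f e) ` {..?L (f e)}"
      proof (intro equalityI subsetI)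
        fix v assume "v \<in> R.anc (f e) ` {..?L (f e)}"
        then obtain k where k: "k \<le> ?L (f e)" "v = R.anc (f e) k" by auto
        then have "v = g e k" by (simp add: g_def)
        then show "v \<in> g e ` {..?L' e}" using k(1) fle[OF e(1)] by auto
      qed (auto simp: g_def)
      also have "\<dots> = down (fst \<gamma>) (f e)" by (rule R.down_eq_anc[OF fF[OF e(1)], symmetric])
      finally show "maximal_chain (fst \<gamma>) (\<tau> ` C)" unfolding R.maximal_chain_iff using fl[OF e(1)] by blast
    qed
    show "\<forall>v\<in>Field (fst \<gamma>'). {w \<in> Field (fst \<gamma>'). \<tau> w = \<tau> v} = {v} \<or> maximal_subtree (fst \<gamma>') {w \<in> Field (fst \<gamma>'). \<tau> w = \<tau> v}"
    proof
      fix v assume v: "v \<in> Field (fst \<gamma>')"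
      let ?e = "lf v" and ?k = "?L' v"
      note e = lf[OF v]
      note ec = lc'[OF e(1)]
      have \<tau>v: "\<tau> v = g ?e ?k" by (rule \<tau>g[OF e])
      have kle: "?k \<le> ?L' ?e" by (rule R'.level_mono[OF e(2)])
      show "{w \<in> Field (fst \<gamma>'). \<tau> w = \<tau> v} = {v} \<or> maximal_subtree (fst \<gamma>') {w \<in> Field (fst \<gamma>'). \<tau> w = \<tau> v}"
      proof (cases "?k < ?L (f ?e)")
        case True
        \<comment> \<open>Below the image leaf levels are kept, so a node with the same image has
          the same level \<open>?k\<close>. The labels above both nodes agree modulo x^k through the
          labels of the image leaves, hence the nodes coincide.\<close>
        have "w = v" if w: "w \<in> Field (fst \<gamma>')" and eq: "\<tau> w = \<tau> v" for w
        proof -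
          note ew = lf[OF w]
          have gw: "g (lf w) (?L' w) = g ?e ?k" using eq \<tau>v \<tau>g[OF ew] by simp
          then have lev: "min (?L' w) (?L (f (lf w))) = ?k"
            using gF(2)[OF ew(1), of "?L' w"] gF(2)[OF e(1), of ?k] True by simp
          have lt: "?L' w < ?L (f (lf w))"
          proof (rule ccontr)
            assume "\<not> ?thesis"
            then have "g (lf w) (?L' w) = f (lf w)" using R.anc_self[OF fF[OF ew(1)]] by (simp add: g_def min_def)
            then have "g ?e ?k \<in> leaves (fst \<gamma>)" using gw fl[OF ew(1)] by simp
            then have "f ?e = g ?e ?k" by (rule R.leaf_max[OF _ gF(1)[OF e(1)]])
            then show False using gF(2)[OF e(1), of ?k] True by simp
          qed
          then have kw: "?L' w = ?k" using lev by simp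
          have cc: "snd \<gamma> (f ?e) \<in> carrier A" "snd \<gamma> (f (lf w)) \<in> carrier A" "snd \<gamma>' (lf w) \<in> carrier A"
            using lc[OF fl[OF e(1)]] lc[OF fl[OF ew(1)]] lc'[OF ew(1)] by auto
          have "R.anc (f ?e) ?k = R.anc (f (lf w)) ?k"
            using gw lt True kw unfolding g_def by simp
          then have d: "x [^] ?k divides (snd \<gamma> (f (lf w)) \<ominus> snd \<gamma> (f ?e))"
            using anc_eq_iff_divides[OF \<gamma> fl[OF e(1)] fl[OF ew(1)], of ?k] True lt kw by simp
          have b: "x [^] ?k divides (snd \<gamma>' u \<ominus> snd \<gamma> (f u))" if "u \<in> leaves (fst \<gamma>')" "?k < ?L (f u)" for u
            by (rule pow_divides_mono[OF x_closed, of _ "?L (f u)"])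
               (use fw[OF that(1)] that lc'[OF that(1)] lc[OF fl[OF that(1)]] in \<open>simp_all add: disc_within_def\<close>)
          have b1: "x [^] ?k divides (snd \<gamma>' (lf w) \<ominus> snd \<gamma> (f (lf w)))" using b[OF ew(1)] lt kw by simp
          have b2: "x [^] ?k divides (snd \<gamma> (f ?e) \<ominus> snd \<gamma>' ?e)"
            by (rule minus_swap_divides[OF ec cc(1) _ b[OF e(1) True]]) simp
          have "snd \<gamma>' (lf w) \<ominus> snd \<gamma>' ?e = (snd \<gamma>' (lf w) \<ominus> snd \<gamma> (f (lf w))) \<oplus>
              ((snd \<gamma> (f (lf w)) \<ominus> snd \<gamma> (f ?e)) \<oplus> (snd \<gamma> (f ?e) \<ominus> snd \<gamma>' ?e))"
            using cc ec by algebra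
          then have "x [^] ?k divides (snd \<gamma>' (lf w) \<ominus> snd \<gamma>' ?e)"
            using divides_add[OF _ b1 divides_add[OF _ d b2]] by simp
          then have "R'.anc ?e ?k = R'.anc (lf w) ?k"
            using anc_eq_iff_divides[OF \<gamma>' e(1) ew(1) kle] R'.level_mono[OF ew(2)] kw by simp
          then show "w = v" using R'.anc_level[OF e(2)] R'.anc_level[OF ew(2)] kw by simp
        qed
        then show ?thesis using v by blast
      next
        case False
        let ?l = "?L (f ?e)"
        let ?u = "R'.anc ?e ?l"
        have le: "?l \<le> ?L' ?e" by (rule fle[OF e(1)])
        have eF: "?e \<in> Field (fst \<gamma>')" by (rule R'.leaves_Field[OF e(1)])
        have u: "(?u, ?e) \<in> fst \<gamma>'" "?L' ?u = ?l" "?u \<in> Field (fst \<gamma>')"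
          using R'.anc[OF eF le] R'.anc_Field[OF eF le] by simp_all
        have \<tau>fe: "\<tau> v = f ?e" using \<tau>v False R.anc_self[OF fF[OF e(1)]] by (simp add: g_def min_def)
        \<comment> \<open>The image is the leaf \<open>f ?e\<close>, of level \<open>?l\<close>. Its
          fibre is the subtree above the node at level \<open>?l\<close> on the branch of
          \<open>?e\<close>: a node is in it exactly if a leaf above it has its disc within that of
          \<open>f ?e\<close> and its own level is at least \<open>?l\<close>.\<close>
        have "{w \<in> Field (fst \<gamma>'). \<tau> w = \<tau> v} = up_set (fst \<gamma>') ?u"
        proof (intro equalityI subsetI)
          fix w assume "w \<in> {w \<in> Field (fst \<gamma>'). \<tau> w = \<tau> v}"
          then have w: "w \<in> Field (fst \<gamma>')" "\<tau> w = f ?e" using \<tau>fe by auto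
          note ew = lf[OF w(1)]
          have gw: "g (lf w) (?L' w) = f ?e" using w(2) \<tau>g[OF ew] by simp
          then have few: "f (lf w) = f ?e" using R.leaf_max[OF fl[OF e(1)]] gF(1)[OF ew(1), of "?L' w"] by simp
          then have lw: "?l \<le> ?L' w" using gF(2)[OF ew(1), of "?L' w"] gw by simp
          have cc: "snd \<gamma> (f ?e) \<in> carrier A" "snd \<gamma>' (lf w) \<in> carrier A"
            using lc[OF fl[OF e(1)]] lc'[OF ew(1)] by auto
          have b1: "x [^] ?l divides (snd \<gamma>' (lf w) \<ominus> snd \<gamma> (f ?e))" using fw[OF ew(1)] few by (simp add: disc_within_def)
          have b2: "x [^] ?l divides (snd \<gamma> (f ?e) \<ominus> snd \<gamma>' ?e)"
            by (rule minus_swap_divides[OF ec cc(1)]) (use fw[OF e(1)] in \<open>simp_all add: disc_within_def\<close>)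
          have "snd \<gamma>' (lf w) \<ominus> snd \<gamma>' ?e = (snd \<gamma>' (lf w) \<ominus> snd \<gamma> (f ?e)) \<oplus> (snd \<gamma> (f ?e) \<ominus> snd \<gamma>' ?e)"
            using cc ec by algebra
          then have "x [^] ?l divides (snd \<gamma>' (lf w) \<ominus> snd \<gamma>' ?e)" using divides_add[OF _ b1 b2] by simp
          moreover have l': "?l \<le> ?L' (lf w)" using lw R'.level_mono[OF ew(2)] by simp
          ultimately have "?u = R'.anc (lf w) ?l" using anc_eq_iff_divides[OF \<gamma>' e(1) ew(1) le] by simp
          then have "(?u, lf w) \<in> fst \<gamma>'" using R'.anc(1)[OF R'.leaves_Field[OF ew(1)] l'] by simp
          then have "(?u, w) \<in> fst \<gamma>'" using R'.down_le_iff[OF _ ew(2)] u(2) lw by simp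
          then show "w \<in> up_set (fst \<gamma>') ?u" by (simp add: up_set_def)
        next
          fix w assume "w \<in> up_set (fst \<gamma>') ?u"
          then have uw: "(?u, w) \<in> fst \<gamma>'" by (simp add: up_set_def)
          have w: "w \<in> Field (fst \<gamma>')" by (rule R'.FieldI(2)[OF uw])
          note ew = lf[OF w]
          have uew: "(?u, lf w) \<in> fst \<gamma>'" by (rule R'.tree_trans[OF uw ew(2)])
          have l': "?l \<le> ?L' (lf w)" using R'.level_mono[OF uew] u(2) by simp
          have "?u = R'.anc (lf w) ?l" using R'.anc_eqI[OF uew u(2)] by simp
          then have "x [^] ?l divides (snd \<gamma>' (lf w) \<ominus> snd \<gamma>' ?e)"
            using anc_eq_iff_divides[OF \<gamma>' e(1) ew(1) le l'] by simp
          then have few: "f ?e = f (lf w)" using same_leaf[OF e(1) ew(1)] l' by simp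
          have "?l \<le> ?L' w" using R'.level_mono[OF uw] u(2) by simp
          then have "g (lf w) (?L' w) = f ?e" using R.anc_self[OF fF[OF e(1)]] few by (simp add: g_def min_def)
          then show "w \<in> {w \<in> Field (fst \<gamma>'). \<tau> w = \<tau> v}" using w \<tau>g[OF ew] \<tau>fe by simp
        qed
        then show ?thesis using u(3) unfolding maximal_subtree_def by blast
      qed
    qed
  qed
  have "labelled_tree_mor A x \<gamma>' \<gamma> \<tau>"
    unfolding labelled_tree_mor_def case_prod_beta
  proof (intro conjI ballI impI mor)
    fix e' e assume e': "e' \<in> leaves (fst \<gamma>')" and "\<tau> e' = e"
    then have e: "e = f e'" using \<tau>leaf by simp
    show "snd \<gamma>' e' \<ominus> snd \<gamma> e \<in> PIdl (x [^] ?L e)"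
      unfolding e PIdl_iff[OF nat_pow_closed[OF x_closed]] using fw[OF e'] by (simp add: disc_within_def)
  qed
  moreover have "\<tau> \<in> extensional (Field (fst \<gamma>'))" by (simp add: \<tau>_def)
  ultimately show ?thesis using \<tau>a unfolding g_def by (intro bexI[of _ \<tau>] conjI ballI allI impI) simp_all
qed

end

section \<open>The equivalence\<close>

text \<open>In thin categories all diagrams commute, and objects with maps both ways are isomorphic.
  Full faithfulness and essential surjectivity thus become statements about nonempty hom-sets; the
  inverse functor is obtained by choice.\<close>

lemma thin_equivalence:
  assumes C: "category C" and D: "category D"
    and thinC: "\<And>X Y f g. \<lbrakk>X \<in> Obj C; Y \<in> Obj C; f \<in> Hom C X Y; g \<in> Hom C X Y\<rbrakk> \<Longrightarrow> f = g"
    and thinD: "\<And>X Y f g. \<lbrakk>X \<in> Obj D; Y \<in> Obj D; f \<in> Hom D X Y; g \<in> Hom D X Y\<rbrakk> \<Longrightarrow> f = g"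
    and F: "\<And>X. X \<in> Obj C \<Longrightarrow> F X \<in> Obj D"
    and iff: "\<And>X Y. \<lbrakk>X \<in> Obj C; Y \<in> Obj C\<rbrakk> \<Longrightarrow> Hom C X Y \<noteq> {} \<longleftrightarrow> Hom D (F X) (F Y) \<noteq> {}"
    and surj: "\<And>Y. Y \<in> Obj D \<Longrightarrow> \<exists>X\<in>Obj C. Hom D (F X) Y \<noteq> {} \<and> Hom D Y (F X) \<noteq> {}"
  shows "equivalent_categories C D"
proof -
  interpret C: category C by (rule C)
  interpret D: category D by (rule D)
  define G where "G Y = (SOME X. X \<in> Obj C \<and> Hom D (F X) Y \<noteq> {} \<and> Hom D Y (F X) \<noteq> {})" for Y
  have G: "G Y \<in> Obj C" "Hom D (F (G Y)) Y \<noteq> {}" "Hom D Y (F (G Y)) \<noteq> {}" if "Y \<in> Obj D" for Y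
    using someI_ex[of "\<lambda>X. X \<in> Obj C \<and> Hom D (F X) Y \<noteq> {} \<and> Hom D Y (F X) \<noteq> {}"] surj[OF that]
    unfolding G_def by blast+
  define c where "c X Y = (SOME f. f \<in> Hom C X Y)" for X Y
  define d where "d X Y = (SOME f. f \<in> Hom D X Y)" for X Y
  have c: "c X Y \<in> Hom C X Y" if "Hom C X Y \<noteq> {}" for X Y unfolding c_def using that by (metis ex_in_conv someI_ex)
  have d: "d X Y \<in> Hom D X Y" if "Hom D X Y \<noteq> {}" for X Y unfolding d_def using that by (metis ex_in_conv someI_ex)
  have compD: "Hom D X Z \<noteq> {}" if "X \<in> Obj D" "Y \<in> Obj D" "Z \<in> Obj D" "Hom D X Y \<noteq> {}" "Hom D Y Z \<noteq> {}" for X Y Z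
    using D.Comp_closed[OF that(1-3) d[OF that(4)] d[OF that(5)]] by blast
  have Fne: "Hom D (F X) (F Y) \<noteq> {}" if "X \<in> Obj C" "Y \<in> Obj C" "f \<in> Hom C X Y" for X Y f
    using iff[OF that(1,2)] that(3) by blast
  have Gne: "Hom C (G X) (G Y) \<noteq> {}" if o: "X \<in> Obj D" "Y \<in> Obj D" and f: "f \<in> Hom D X Y" for X Y f
  proof -
    have "Hom D (F (G X)) Y \<noteq> {}" using compD[OF F[OF G(1)[OF o(1)]] o G(2)[OF o(1)]] f by blast
    then have "Hom D (F (G X)) (F (G Y)) \<noteq> {}"
      using compD[OF F[OF G(1)[OF o(1)]] o(2) F[OF G(1)[OF o(2)]] _ G(3)[OF o(2)]] by blast
    then show ?thesis using iff[OF G(1)[OF o(1)] G(1)[OF o(2)]] by blast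
  qed
  have funF: "is_functor C D F (\<lambda>X Y _. d (F X) (F Y))"
    unfolding is_functor_def
  proof (intro conjI ballI)
    fix X assume X: "X \<in> Obj C"
    show "F X \<in> Obj D" by (rule F[OF X])
    show "d (F X) (F X) = Idn D (F X)"
      by (rule thinD[OF F[OF X] F[OF X] d[OF Fne[OF X X C.Idn_closed[OF X]]] D.Idn_closed[OF F[OF X]]])
    fix Y f assume Y: "Y \<in> Obj C" and f: "f \<in> Hom C X Y"
    show "d (F X) (F Y) \<in> Hom D (F X) (F Y)" by (rule d[OF Fne[OF X Y f]])
  next
    fix X Y Z f g assume o: "X \<in> Obj C" "Y \<in> Obj C" "Z \<in> Obj C" and f: "f \<in> Hom C X Y" and g: "g \<in> Hom C Y Z"
    show "d (F X) (F Z) = Comp D (F X) (F Y) (F Z) (d (F Y) (F Z)) (d (F X) (F Y))"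
      by (rule thinD[OF F[OF o(1)] F[OF o(3)] d[OF Fne[OF o(1,3) C.Comp_closed[OF o f g]]]
            D.Comp_closed[OF F[OF o(1)] F[OF o(2)] F[OF o(3)] d[OF Fne[OF o(1,2) f]] d[OF Fne[OF o(2,3) g]]]])
  qed
  have funG: "is_functor D C G (\<lambda>X Y _. c (G X) (G Y))"
    unfolding is_functor_def
  proof (intro conjI ballI)
    fix X assume X: "X \<in> Obj D"
    show "G X \<in> Obj C" by (rule G(1)[OF X])
    show "c (G X) (G X) = Idn C (G X)"
      by (rule thinC[OF G(1)[OF X] G(1)[OF X] c[OF Gne[OF X X D.Idn_closed[OF X]]] C.Idn_closed[OF G(1)[OF X]]])
    fix Y f assume Y: "Y \<in> Obj D" and f: "f \<in> Hom D X Y"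
    show "c (G X) (G Y) \<in> Hom C (G X) (G Y)" by (rule c[OF Gne[OF X Y f]])
  next
    fix X Y Z f g assume o: "X \<in> Obj D" "Y \<in> Obj D" "Z \<in> Obj D" and f: "f \<in> Hom D X Y" and g: "g \<in> Hom D Y Z"
    show "c (G X) (G Z) = Comp C (G X) (G Y) (G Z) (c (G Y) (G Z)) (c (G X) (G Y))"
      by (rule thinC[OF G(1)[OF o(1)] G(1)[OF o(3)] c[OF Gne[OF o(1,3) D.Comp_closed[OF o f g]]]
            C.Comp_closed[OF G(1)[OF o(1)] G(1)[OF o(2)] G(1)[OF o(3)] c[OF Gne[OF o(1,2) f]] c[OF Gne[OF o(2,3) g]]]])
  qed
  have GF: "Hom C X (G (F X)) \<noteq> {}" "Hom C (G (F X)) X \<noteq> {}" if X: "X \<in> Obj C" for X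
    using iff[OF X G(1)[OF F[OF X]]] iff[OF G(1)[OF F[OF X]] X] G(2,3)[OF F[OF X]] by simp_all
  have nat\<eta>: "is_nat_iso C C (\<lambda>X. X) (\<lambda>X Y f. f) (G \<circ> F) (\<lambda>X Y f. c (G (F X)) (G (F Y))) (\<lambda>X. c X (G (F X)))"
    unfolding is_nat_iso_def is_iso_def o_apply
  proof (intro conjI ballI)
    fix X assume X: "X \<in> Obj C"
    note GX = G(1)[OF F[OF X]] and h = c[OF GF(1)[OF X]] and k = c[OF GF(2)[OF X]]
    show "c X (G (F X)) \<in> Hom C X (G (F X))" by (rule h)
    show "\<exists>g\<in>Hom C (G (F X)) X. Comp C X (G (F X)) X g (c X (G (F X))) = Idn C X \<and>
        Comp C (G (F X)) X (G (F X)) (c X (G (F X))) g = Idn C (G (F X))"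
      using thinC[OF X X C.Comp_closed[OF X GX X h k] C.Idn_closed[OF X]]
        thinC[OF GX GX C.Comp_closed[OF GX X GX k h] C.Idn_closed[OF GX]] k by blast
    fix Y f assume Y: "Y \<in> Obj C" and f: "f \<in> Hom C X Y"
    note GY = G(1)[OF F[OF Y]]
    have m: "c (G (F X)) (G (F Y)) \<in> Hom C (G (F X)) (G (F Y))"
      by (rule c[OF Gne[OF F[OF X] F[OF Y] d[OF Fne[OF X Y f]]]])
    show "Comp C X Y (G (F Y)) (c Y (G (F Y))) f = Comp C X (G (F X)) (G (F Y)) (c (G (F X)) (G (F Y))) (c X (G (F X)))"
      by (rule thinC[OF X GY C.Comp_closed[OF X Y GY f c[OF GF(1)[OF Y]]] C.Comp_closed[OF X GX GY h m]])
  qed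
  have nat\<epsilon>: "is_nat_iso D D (F \<circ> G) (\<lambda>X Y f. d (F (G X)) (F (G Y))) (\<lambda>X. X) (\<lambda>X Y f. f) (\<lambda>X. d (F (G X)) X)"
    unfolding is_nat_iso_def is_iso_def o_apply
  proof (intro conjI ballI)
    fix X assume X: "X \<in> Obj D"
    note FX = F[OF G(1)[OF X]] and h = d[OF G(2)[OF X]] and k = d[OF G(3)[OF X]]
    show "d (F (G X)) X \<in> Hom D (F (G X)) X" by (rule h)
    show "\<exists>g\<in>Hom D X (F (G X)). Comp D (F (G X)) X (F (G X)) g (d (F (G X)) X) = Idn D (F (G X)) \<and>
        Comp D X (F (G X)) X (d (F (G X)) X) g = Idn D X"
      using thinD[OF FX FX D.Comp_closed[OF FX X FX h k] D.Idn_closed[OF FX]]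
        thinD[OF X X D.Comp_closed[OF X FX X k h] D.Idn_closed[OF X]] k by blast
    fix Y f assume Y: "Y \<in> Obj D" and f: "f \<in> Hom D X Y"
    note FY = F[OF G(1)[OF Y]]
    have m: "d (F (G X)) (F (G Y)) \<in> Hom D (F (G X)) (F (G Y))"
      by (rule d[OF Fne[OF G(1)[OF X] G(1)[OF Y] c[OF Gne[OF X Y f]]]])
    show "Comp D (F (G X)) (F (G Y)) Y (d (F (G Y)) Y) (d (F (G X)) (F (G Y))) = Comp D (F (G X)) X Y f (d (F (G X)) X)"
      by (rule thinD[OF FX Y D.Comp_closed[OF FX FY Y m d[OF G(2)[OF Y]]] D.Comp_closed[OF FX X Y h f]])
  qed
  show ?thesis
    unfolding equivalent_categories_def
    using C D funF funG nat\<eta> nat\<epsilon> by blast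
qed

section \<open>The thin category of labelled trees, and trees built from discs\<close>

context base_ring
begin

text \<open>A leaf must go to the unique leaf whose disc contains its disc, and
  \<open>tree_mor_anc\<close> then fixes the image of every node below.\<close>

lemma tree_hom_unique:
  fixes \<gamma> \<gamma>' :: "'v rel \<times> ('v \<Rightarrow> 'a)"
  assumes \<gamma>: "labelled_tree A x \<gamma>" and \<gamma>': "labelled_tree A x \<gamma>'"
    and h: "\<tau>1 \<in> Hom (labelled_tree_cat A x) \<gamma>' \<gamma>" "\<tau>2 \<in> Hom (labelled_tree_cat A x) \<gamma>' \<gamma>"
  shows "\<tau>1 = \<tau>2"
proof -
  interpret R': rtree "fst \<gamma>'" by (rule labelled_treeD(1)[OF \<gamma>'])
  have 1: "\<tau>1 \<in> extensional (Field (fst \<gamma>'))" "labelled_tree_mor A x \<gamma>' \<gamma> \<tau>1"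
    and 2: "\<tau>2 \<in> extensional (Field (fst \<gamma>'))" "labelled_tree_mor A x \<gamma>' \<gamma> \<tau>2"
    using h by (simp_all add: labelled_tree_cat_def)
  note t1 = tree_hom_leaf[OF \<gamma> \<gamma>' 1(2)] and t2 = tree_hom_leaf[OF \<gamma> \<gamma>' 2(2)]
  show ?thesis
  proof (rule extensionalityI[OF 1(1) 2(1)])
    fix v assume "v \<in> Field (fst \<gamma>')"
    then obtain e where e: "e \<in> leaves (fst \<gamma>')" "(v, e) \<in> fst \<gamma>'" using R'.leaf_above by blast
    have "fst (snd \<gamma>' e, level (fst \<gamma>') e) \<in> carrier A" using label_closed[OF \<gamma>' e(1)] by simp
    then have eq: "\<tau>1 e = \<tau>2 e" by (rule within_leaf_unique[OF \<gamma> _ t1(1)[OF e(1)] t2(1)[OF e(1)] t1(2)[OF e(1)] t2(2)[OF e(1)]])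
    show "\<tau>1 v = \<tau>2 v"
      using t1(3)[OF e(1) R'.level_mono[OF e(2)]] t2(3)[OF e(1) R'.level_mono[OF e(2)]] eq
      unfolding R'.anc_level[OF e(2)] by simp
  qed
qed

lemma tree_hom_ex_iff:
  fixes \<gamma> \<gamma>' :: "'v rel \<times> ('v \<Rightarrow> 'a)"
  assumes \<gamma>: "labelled_tree A x \<gamma>" and \<gamma>': "labelled_tree A x \<gamma>'"
  shows "Hom (labelled_tree_cat A x) \<gamma>' \<gamma> \<noteq> {} \<longleftrightarrow> refines (tree_discs \<gamma>') (tree_discs \<gamma>)"
proof
  assume "Hom (labelled_tree_cat A x) \<gamma>' \<gamma> \<noteq> {}"
  then obtain \<tau> where \<tau>: "labelled_tree_mor A x \<gamma>' \<gamma> \<tau>" by (auto simp: labelled_tree_cat_def)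
  note t = tree_hom_leaf[OF \<gamma> \<gamma>' \<tau>]
  show "refines (tree_discs \<gamma>') (tree_discs \<gamma>)"
    unfolding refines_def tree_discs_def using t(1,2) by blast
next
  assume "refines (tree_discs \<gamma>') (tree_discs \<gamma>)"
  then have "\<forall>e'\<in>leaves (fst \<gamma>'). \<exists>e. e \<in> leaves (fst \<gamma>) \<and>
      disc_within (snd \<gamma>' e', level (fst \<gamma>') e') (snd \<gamma> e, level (fst \<gamma>) e)"
    unfolding refines_def tree_discs_def by blast
  then obtain f where "\<And>e'. e' \<in> leaves (fst \<gamma>') \<Longrightarrow> f e' \<in> leaves (fst \<gamma>) \<and>
      disc_within (snd \<gamma>' e', level (fst \<gamma>') e') (snd \<gamma> (f e'), level (fst \<gamma>) (f e'))" by metis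
  from tree_hom_ex[OF \<gamma> \<gamma>' this] show "Hom (labelled_tree_cat A x) \<gamma>' \<gamma> \<noteq> {}"
    by (auto simp: labelled_tree_cat_def)
qed

text \<open>The formula along branches determines \<open>\<tau>\<close>, and
  \<open>tree_hom_ex\<close> produces a morphism that satisfies it. Identities and composites are
  recognised as morphisms in this way, without a return to chains and fibres.\<close>

lemma tree_hom_eqI:
  fixes \<gamma> \<gamma>' :: "'v rel \<times> ('v \<Rightarrow> 'a)"
  assumes \<gamma>: "labelled_tree A x \<gamma>" and \<gamma>': "labelled_tree A x \<gamma>'"
    and ext: "\<tau> \<in> extensional (Field (fst \<gamma>'))"
    and w: "\<And>e. e \<in> leaves (fst \<gamma>') \<Longrightarrow> f e \<in> leaves (fst \<gamma>) \<and>
      disc_within (snd \<gamma>' e, level (fst \<gamma>') e) (snd \<gamma> (f e), level (fst \<gamma>) (f e))"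
    and a: "\<And>e k. e \<in> leaves (fst \<gamma>') \<Longrightarrow> k \<le> level (fst \<gamma>') e \<Longrightarrow>
      \<tau> (rtree.anc (fst \<gamma>') e k) = rtree.anc (fst \<gamma>) (f e) (min k (level (fst \<gamma>) (f e)))"
  shows "labelled_tree_mor A x \<gamma>' \<gamma> \<tau>"
proof -
  interpret R': rtree "fst \<gamma>'" by (rule labelled_treeD(1)[OF \<gamma>'])
  obtain \<tau>0 where \<tau>0: "\<tau>0 \<in> extensional (Field (fst \<gamma>'))" "labelled_tree_mor A x \<gamma>' \<gamma> \<tau>0"
    "\<And>e k. e \<in> leaves (fst \<gamma>') \<Longrightarrow> k \<le> level (fst \<gamma>') e \<Longrightarrow>
      \<tau>0 (R'.anc e k) = rtree.anc (fst \<gamma>) (f e) (min k (level (fst \<gamma>) (f e)))"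
    using tree_hom_ex[OF \<gamma> \<gamma>' w] by blast
  have "\<tau> = \<tau>0"
  proof (rule extensionalityI[OF ext \<tau>0(1)])
    fix v assume "v \<in> Field (fst \<gamma>')"
    then obtain e where e: "e \<in> leaves (fst \<gamma>')" "(v, e) \<in> fst \<gamma>'" using R'.leaf_above by blast
    show "\<tau> v = \<tau>0 v"
      using a[OF e(1) R'.level_mono[OF e(2)]] \<tau>0(3)[OF e(1) R'.level_mono[OF e(2)]]
      unfolding R'.anc_level[OF e(2)] by simp
  qed
  then show ?thesis using \<tau>0(2) by simp
qed

lemma category_labelled_tree: "category (labelled_tree_cat A x :: ('v rel \<times> ('v \<Rightarrow> 'a), 'v \<Rightarrow> 'v) cat)"
proof -
  let ?D = "labelled_tree_cat A x :: ('v rel \<times> ('v \<Rightarrow> 'a), 'v \<Rightarrow> 'v) cat"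
  have O: "labelled_tree A x \<gamma> \<longleftrightarrow> \<gamma> \<in> Obj ?D" for \<gamma> :: "'v rel \<times> ('v \<Rightarrow> 'a)" by (simp add: labelled_tree_cat_def)
  have HI: "\<tau> \<in> Hom ?D \<gamma>' \<gamma> \<longleftrightarrow> \<tau> \<in> extensional (Field (fst \<gamma>')) \<and> labelled_tree_mor A x \<gamma>' \<gamma> \<tau>" for \<tau> \<gamma>' \<gamma>
    by (simp add: labelled_tree_cat_def)
  have idm: "Idn ?D \<gamma> \<in> Hom ?D \<gamma> \<gamma>" if \<gamma>: "\<gamma> \<in> Obj ?D" for \<gamma>
    unfolding HI
  proof -
    have ext: "Idn ?D \<gamma> \<in> extensional (Field (fst \<gamma>))" by (simp add: labelled_tree_cat_def)
    show "Idn ?D \<gamma> \<in> extensional (Field (fst \<gamma>)) \<and> labelled_tree_mor A x \<gamma> \<gamma> (Idn ?D \<gamma>)"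
    proof (rule conjI[OF ext tree_hom_eqI[OF \<gamma>[folded O] \<gamma>[folded O] ext, where f = id]])
      interpret R: rtree "fst \<gamma>" by (rule labelled_treeD(1)[OF \<gamma>[folded O]])
      fix e assume e: "e \<in> leaves (fst \<gamma>)"
      have "snd \<gamma> e \<ominus> snd \<gamma> e = \<zero>" using label_closed[OF \<gamma>[folded O] e] by simp
      then show "id e \<in> leaves (fst \<gamma>) \<and> disc_within (snd \<gamma> e, level (fst \<gamma>) e) (snd \<gamma> (id e), level (fst \<gamma>) (id e))"
        using e by (simp add: disc_within_def divides_zero)
      fix k assume k: "k \<le> level (fst \<gamma>) e"
      show "Idn ?D \<gamma> (R.anc e k) = rtree.anc (fst \<gamma>) (id e) (min k (level (fst \<gamma>) (id e)))"
        using R.anc_Field[OF R.leaves_Field[OF e] k] k by (simp add: labelled_tree_cat_def)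
    qed
  qed
  have compm: "Comp ?D \<gamma>'' \<gamma>' \<gamma> \<tau> \<tau>' \<in> Hom ?D \<gamma>'' \<gamma>"
    if o: "\<gamma>'' \<in> Obj ?D" "\<gamma>' \<in> Obj ?D" "\<gamma> \<in> Obj ?D" and \<tau>': "\<tau>' \<in> Hom ?D \<gamma>'' \<gamma>'" and \<tau>: "\<tau> \<in> Hom ?D \<gamma>' \<gamma>" for \<gamma>'' \<gamma>' \<gamma> \<tau> \<tau>'
    unfolding HI
  proof -
    have ext: "Comp ?D \<gamma>'' \<gamma>' \<gamma> \<tau> \<tau>' \<in> extensional (Field (fst \<gamma>''))" by (simp add: labelled_tree_cat_def)
    show "Comp ?D \<gamma>'' \<gamma>' \<gamma> \<tau> \<tau>' \<in> extensional (Field (fst \<gamma>'')) \<and> labelled_tree_mor A x \<gamma>'' \<gamma> (Comp ?D \<gamma>'' \<gamma>' \<gamma> \<tau> \<tau>')"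
    proof (rule conjI[OF ext tree_hom_eqI[OF o(3)[folded O] o(1)[folded O] ext, where f = "\<tau> \<circ> \<tau>'"]])
      interpret R'': rtree "fst \<gamma>''" by (rule labelled_treeD(1)[OF o(1)[folded O]])
      note t' = tree_hom_leaf[OF o(2,1)[folded O] conjunct2[OF \<tau>'[unfolded HI]]]
        and t = tree_hom_leaf[OF o(3,2)[folded O] conjunct2[OF \<tau>[unfolded HI]]]
      fix e assume e: "e \<in> leaves (fst \<gamma>'')"
      note e' = t'(1)[OF e]
      have le: "level (fst \<gamma>') (\<tau>' e) \<le> level (fst \<gamma>'') e" "level (fst \<gamma>) (\<tau> (\<tau>' e)) \<le> level (fst \<gamma>') (\<tau>' e)"
        using t'(2)[OF e] t(2)[OF e'] by (simp_all add: disc_within_def)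
      show "(\<tau> \<circ> \<tau>') e \<in> leaves (fst \<gamma>) \<and>
          disc_within (snd \<gamma>'' e, level (fst \<gamma>'') e) (snd \<gamma> ((\<tau> \<circ> \<tau>') e), level (fst \<gamma>) ((\<tau> \<circ> \<tau>') e))"
        using t(1)[OF e'] disc_within_trans[OF _ _ _ t'(2)[OF e] t(2)[OF e']]
          label_closed[OF o(1)[folded O] e] label_closed[OF o(2)[folded O] e'] label_closed[OF o(3)[folded O] t(1)[OF e']]
        by simp
      fix k assume k: "k \<le> level (fst \<gamma>'') e"
      have "Comp ?D \<gamma>'' \<gamma>' \<gamma> \<tau> \<tau>' (R''.anc e k) = \<tau> (\<tau>' (R''.anc e k))"
        using R''.anc_Field[OF R''.leaves_Field[OF e] k] by (simp add: labelled_tree_cat_def compose_def)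
      also have "\<dots> = rtree.anc (fst \<gamma>) (\<tau> (\<tau>' e)) (min (min k (level (fst \<gamma>') (\<tau>' e))) (level (fst \<gamma>) (\<tau> (\<tau>' e))))"
        unfolding t'(3)[OF e k] by (rule t(3)[OF e']) simp
      also have "min (min k (level (fst \<gamma>') (\<tau>' e))) (level (fst \<gamma>) (\<tau> (\<tau>' e))) = min k (level (fst \<gamma>) (\<tau> (\<tau>' e)))"
        using le by simp
      finally show "Comp ?D \<gamma>'' \<gamma>' \<gamma> \<tau> \<tau>' (R''.anc e k) =
          rtree.anc (fst \<gamma>) ((\<tau> \<circ> \<tau>') e) (min k (level (fst \<gamma>) ((\<tau> \<circ> \<tau>') e)))" by simp
    qed
  qed
  show ?thesis
  proof
    fix X Y :: "'v rel \<times> ('v \<Rightarrow> 'a)" and f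
    assume X: "X \<in> Obj ?D"
    then show "Idn ?D X \<in> Hom ?D X X" by (rule idm)
    assume Y: "Y \<in> Obj ?D" and f: "f \<in> Hom ?D X Y"
    show "Comp ?D X X Y f (Idn ?D X) = f"
      by (rule tree_hom_unique[OF Y[folded O] X[folded O] compm[OF X X Y idm[OF X] f] f])
    show "Comp ?D X Y Y (Idn ?D Y) f = f"
      by (rule tree_hom_unique[OF Y[folded O] X[folded O] compm[OF X Y Y f idm[OF Y]] f])
  next
    fix X Y Z f g assume "X \<in> Obj ?D" "Y \<in> Obj ?D" "Z \<in> Obj ?D" "f \<in> Hom ?D X Y" "g \<in> Hom ?D Y Z"
    then show "Comp ?D X Y Z g f \<in> Hom ?D X Z" by (rule compm)
  next
    fix W X Y Z f g h
    assume o: "W \<in> Obj ?D" "X \<in> Obj ?D" "Y \<in> Obj ?D" "Z \<in> Obj ?D"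
      and m: "f \<in> Hom ?D W X" "g \<in> Hom ?D X Y" "h \<in> Hom ?D Y Z"
    show "Comp ?D W Y Z h (Comp ?D W X Y g f) = Comp ?D W X Z (Comp ?D X Y Z h g) f"
      by (rule tree_hom_unique[OF o(4)[folded O] o(1)[folded O]])
         (rule compm[OF o(1,3,4) compm[OF o(1,2,3) m(1,2)] m(3)] compm[OF o(1,2,4) m(1) compm[OF o(2,3,4) m(2,3)]])+
  qed
qed

text \<open>Nodes are the congruence classes modulo x^l of discs in the family, for each level
  \<open>l\<close> up to their exponents; a node lies below those of higher level contained in its
  class. Disjointness of the discs makes the last class of each of them a leaf.\<close>

lemma tree_of_discs:
  assumes \<Delta>: "disc_family \<Delta>" and inf: "infinite (UNIV :: 'v set)"
  shows "\<exists>\<gamma> :: 'v rel \<times> ('v \<Rightarrow> 'a). labelled_tree A x \<gamma> \<and> tree_discs \<gamma> = \<Delta>"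
proof -
  have fin: "finite \<Delta>" and ne: "\<Delta> \<noteq> {}" and sep: "\<And>p q. p \<in> \<Delta> \<Longrightarrow> q \<in> \<Delta> \<Longrightarrow> p \<noteq> q \<Longrightarrow> separated p q"
    and closed: "\<And>p. p \<in> \<Delta> \<Longrightarrow> fst p \<in> carrier A"
    using \<Delta> unfolding disc_family_def by auto
  define E where "E l p q \<longleftrightarrow> x [^] (l::nat) divides (fst q \<ominus> fst p)" for l and p q :: "'a \<times> nat"
  have Erefl: "E l p p" if "p \<in> \<Delta>" for l p
  proof -
    have "fst p \<ominus> fst p = \<zero>" using closed[OF that] by simp
    then show ?thesis by (simp add: E_def divides_zero)
  qed
  have Esym: "E l q p" if "p \<in> \<Delta>" "q \<in> \<Delta>" "E l p q" for l p q
    using minus_swap_divides[OF closed[OF that(2)] closed[OF that(1)]] that(3) by (simp add: E_def)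
  have Etrans: "E l p s" if o: "p \<in> \<Delta>" "q \<in> \<Delta>" "s \<in> \<Delta>" and e: "E l p q" "E l q s" for l p q s
  proof -
    have "fst s \<ominus> fst p = (fst s \<ominus> fst q) \<oplus> (fst q \<ominus> fst p)"
      using closed[OF o(1)] closed[OF o(2)] closed[OF o(3)] by algebra
    then show ?thesis using divides_add[of "x [^] l"] e by (simp add: E_def)
  qed
  have Emono: "E l p q" if "p \<in> \<Delta>" "q \<in> \<Delta>" "E k p q" "l \<le> k" for l k p q
    using that closed pow_divides_mono[OF x_closed, of "fst q \<ominus> fst p" k l] by (simp add: E_def)
  have E0: "E 0 p q" if "p \<in> \<Delta>" "q \<in> \<Delta>" for p q
    unfolding E_def using closed that by (intro dividesI[of "fst q \<ominus> fst p"]) simp_all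
  define cls where "cls l p = {q \<in> \<Delta>. l \<le> snd q \<and> E l p q}" for l p
  \<comment> \<open>The level is kept beside the class, since the same set of discs may occur at
    several levels where the tree does not branch. These pairs are finite in number, so an injection
    gives them names in \<open>'v\<close>.\<close>
  define N where "N = (\<lambda>(p, l). (cls l p, l)) ` (SIGMA p:\<Delta>. {..snd p})"
  have "finite N" unfolding N_def using fin by (intro finite_imageI finite_SigmaI) auto
  then have "N \<lesssim> (UNIV :: 'v set)" by (rule finite_lepoll_infinite[OF inf])
  then obtain g :: "('a \<times> nat) set \<times> nat \<Rightarrow> 'v" where g: "inj_on g N" unfolding lepoll_def by blast
  define nm where "nm p l = g (cls l p, l)" for p l
  have nm_eq: "nm p l = nm q k \<longleftrightarrow> l = k \<and> E l p q" if o: "p \<in> \<Delta>" "q \<in> \<Delta>" "l \<le> snd p" "k \<le> snd q" for p q l k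
  proof -
    have "(cls l p, l) \<in> N" unfolding N_def by (rule rev_image_eqI[of "(p, l)"]) (use o in auto)
    moreover have "(cls k q, k) \<in> N" unfolding N_def by (rule rev_image_eqI[of "(q, k)"]) (use o in auto)
    ultimately have "nm p l = nm q k \<longleftrightarrow> cls l p = cls k q \<and> l = k" unfolding nm_def using inj_on_eq_iff[OF g] by simp
    moreover have "cls l p = cls l q \<longleftrightarrow> E l p q" if l: "l \<le> snd q"
    proof
      assume "cls l p = cls l q"
      moreover have "q \<in> cls l q" using o l Erefl by (simp add: cls_def)
      ultimately have "q \<in> cls l p" by simp
      then show "E l p q" by (simp add: cls_def)
    next
      assume "E l p q"
      then show "cls l p = cls l q" unfolding cls_def using o Esym Etrans by blast
    qed
    ultimately show ?thesis using o(4) by metis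
  qed
  define r where "r = {(nm p l, nm p k) |p l k. p \<in> \<Delta> \<and> l \<le> k \<and> k \<le> snd p}"
  have rI: "(nm p l, nm p k) \<in> r" if "p \<in> \<Delta>" "l \<le> k" "k \<le> snd p" for p l k using that unfolding r_def by blast
  have r_iff: "(nm p l, nm q k) \<in> r \<longleftrightarrow> l \<le> k \<and> E l p q" if o: "p \<in> \<Delta>" "q \<in> \<Delta>" "l \<le> snd p" "k \<le> snd q" for p q l k
  proof
    assume "(nm p l, nm q k) \<in> r"
    then obtain s l' k' where s: "s \<in> \<Delta>" "l' \<le> k'" "k' \<le> snd s" "nm p l = nm s l'" "nm q k = nm s k'" unfolding r_def by blast
    then have "l = l'" "E l p s" "k = k'" "E k q s" using nm_eq[OF o(1) s(1) o(3)] nm_eq[OF o(2) s(1) o(4)] by auto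
    then show "l \<le> k \<and> E l p q" using s(1,2) o Emono Esym Etrans by blast
  next
    assume h: "l \<le> k \<and> E l p q"
    then have "nm p l = nm q l" using nm_eq[OF o(1,2,3), of l] o by simp
    then show "(nm p l, nm q k) \<in> r" using rI[OF o(2), of l k] h o by simp
  qed
  have Fr: "v \<in> Field r \<longleftrightarrow> (\<exists>p\<in>\<Delta>. \<exists>l\<le>snd p. v = nm p l)" for v
  proof
    assume "v \<in> Field r"
    then obtain p l k where "p \<in> \<Delta>" "l \<le> k" "k \<le> snd p" "v = nm p l \<or> v = nm p k" unfolding Field_def r_def by blast
    then show "\<exists>p\<in>\<Delta>. \<exists>l\<le>snd p. v = nm p l" using order_trans by blast
  next
    assume "\<exists>p\<in>\<Delta>. \<exists>l\<le>snd p. v = nm p l"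
    then show "v \<in> Field r" using rI unfolding Field_def by blast
  qed
  have finF: "finite (Field r)"
  proof -
    have "Field r = (\<lambda>(p, l). nm p l) ` (SIGMA p:\<Delta>. {..snd p})" using Fr by force
    then show ?thesis using fin by simp
  qed
  have down: "down r (nm p l) = nm p ` {..l}" if o: "p \<in> \<Delta>" "l \<le> snd p" for p l
  proof (intro equalityI subsetI)
    fix v assume "v \<in> down r (nm p l)"
    then have v: "(v, nm p l) \<in> r" by (simp add: down_def)
    then have "v \<in> Field r" unfolding Field_def by blast
    then obtain q k where q: "q \<in> \<Delta>" "k \<le> snd q" "v = nm q k" using Fr by blast
    then have "k \<le> l" "E k q p" using r_iff[OF q(1) o(1) q(2) o(2)] v by auto
    then have "v = nm p k" using nm_eq[OF q(1) o(1) q(2), of k] q(3) o(2) by simp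
    then show "v \<in> nm p ` {..l}" using \<open>k \<le> l\<close> by blast
  qed (use rI[OF o(1) _ o(2)] in \<open>auto simp: down_def\<close>)
  have tree: "rooted_tree r"
    unfolding rooted_tree_def partial_order_on_def preorder_on_def
  proof (intro conjI ballI)
    show "r \<subseteq> Field r \<times> Field r" by (auto simp: Field_def)
    show "refl_on (Field r) r"
    proof (rule refl_onI)
      fix v assume "v \<in> Field r"
      then obtain p l where "p \<in> \<Delta>" "l \<le> snd p" "v = nm p l" using Fr by blast
      then show "(v, v) \<in> r" using rI by simp
    qed
    show "trans r"
    proof (rule transI)
      fix u v w assume uv: "(u, v) \<in> r" and vw: "(v, w) \<in> r"
      have "u \<in> Field r" "v \<in> Field r" "w \<in> Field r" using uv vw unfolding Field_def by blast+
      then obtain p l q k s j where h: "p \<in> \<Delta>" "l \<le> snd p" "u = nm p l" "q \<in> \<Delta>" "k \<le> snd q" "v = nm q k"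
          "s \<in> \<Delta>" "j \<le> snd s" "w = nm s j" unfolding Fr by metis
      then have "l \<le> k" "E l p q" "k \<le> j" "E k q s"
        using uv vw r_iff[OF h(1,4,2,5)] r_iff[OF h(4,7,5,8)] by auto
      then have "l \<le> j \<and> E l p s" using h Emono Etrans order_trans by blast
      then show "(u, w) \<in> r" using r_iff[OF h(1,7,2,8)] h(3,9) by simp
    qed
    show "antisym r"
    proof (rule antisymI)
      fix u v assume uv: "(u, v) \<in> r" and vu: "(v, u) \<in> r"
      have "u \<in> Field r" "v \<in> Field r" using uv unfolding Field_def by blast+
      then obtain p l q k where h: "p \<in> \<Delta>" "l \<le> snd p" "u = nm p l" "q \<in> \<Delta>" "k \<le> snd q" "v = nm q k" unfolding Fr by metis
      then have "l = k" "E l p q" using uv vu r_iff[OF h(1,4,2,5)] r_iff[OF h(4,1,5,2)] by auto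
      then show "u = v" using nm_eq[OF h(1,4,2,5)] h(3,6) by simp
    qed
    obtain p0 where p0: "p0 \<in> \<Delta>" using ne by blast
    have root: "nm p0 0 \<in> Field r" "\<And>v. v \<in> Field r \<Longrightarrow> (nm p0 0, v) \<in> r"
      using Fr p0 r_iff[OF p0 _ le0] E0[OF p0] by auto
    show "Field r \<noteq> {}" using root by blast
    show "finite (Field r)" by (rule finF)
    show "\<exists>!e. e \<in> Field r \<and> (\<forall>e'\<in>Field r. (e', e) \<in> r \<longrightarrow> e' = e)"
    proof (rule ex1I[of _ "nm p0 0"])
      show "nm p0 0 \<in> Field r \<and> (\<forall>e'\<in>Field r. (e', nm p0 0) \<in> r \<longrightarrow> e' = nm p0 0)"
        using root \<open>antisym r\<close> by (auto dest: antisymD)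
      fix e assume "e \<in> Field r \<and> (\<forall>e'\<in>Field r. (e', e) \<in> r \<longrightarrow> e' = e)"
      then show "e = nm p0 0" using root by metis
    qed
    fix v assume "v \<in> Field r"
    then obtain p l where h: "p \<in> \<Delta>" "l \<le> snd p" "v = nm p l" using Fr by blast
    show "down r v \<in> Chains r"
      unfolding h(3) down[OF h(1,2)] Chains_def
    proof (clarify)
      fix i j assume "i \<le> l" "j \<le> l" "(nm p j, nm p i) \<notin> r"
      then show "(nm p i, nm p j) \<in> r" using rI[OF h(1)] h(2) by (metis le_trans linear)
    qed
  qed
  interpret R: rtree r by (rule rtree.intro[OF tree])
  have lev: "level r (nm p l) = l" if o: "p \<in> \<Delta>" "l \<le> snd p" for p l
  proof -
    have "inj_on (nm p) {..l}" using nm_eq[OF o(1) o(1)] o(2) by (auto simp: inj_on_def)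
    then have "card (down r (nm p l)) = Suc l" unfolding down[OF o] by (simp add: card_image)
    then show ?thesis by (simp add: level_def)
  qed
  \<comment> \<open>At its own exponent the class of \<open>p\<close> contains no other disc, since
    that one would lie within \<open>p\<close>. Hence the last node of a disc is a leaf and belongs
    to this disc alone.\<close>
  have same: "p = q" if o: "p \<in> \<Delta>" "q \<in> \<Delta>" and h: "snd p \<le> snd q" "E (snd p) p q" for p q
  proof (rule ccontr)
    assume ne: "p \<noteq> q"
    have "disc_within q p" using h by (simp add: disc_within_def E_def)
    then show False using sep[OF o ne] separated_iff_not_within[OF closed[OF o(1)] closed[OF o(2)]] by simp
  qed
  have lv: "v \<in> leaves r \<longleftrightarrow> (\<exists>p\<in>\<Delta>. v = nm p (snd p))" for v
  proof
    assume v: "v \<in> leaves r"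
    then obtain p l where h: "p \<in> \<Delta>" "l \<le> snd p" "v = nm p l" using R.leaves_Field Fr by blast
    have "(v, nm p (snd p)) \<in> r" unfolding h(3) by (rule rI[OF h(1,2)]) simp
    then have "nm p (snd p) = v" by (rule R.leaf_max[OF v])
    then show "\<exists>p\<in>\<Delta>. v = nm p (snd p)" using h(1) by metis
  next
    assume "\<exists>p\<in>\<Delta>. v = nm p (snd p)"
    then obtain p where p: "p \<in> \<Delta>" "v = nm p (snd p)" by blast
    have "w = v" if w: "w \<in> Field r" "(v, w) \<in> r" for w
    proof -
      obtain q k where q: "q \<in> \<Delta>" "k \<le> snd q" "w = nm q k" using w(1) Fr by blast
      have h: "snd p \<le> k" "E (snd p) p q" using w(2) r_iff[OF p(1) q(1) order_refl q(2)] p(2) q(3) by auto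
      then have "p = q" using same[OF p(1) q(1)] q(2) by simp
      then show ?thesis using h q p by simp
    qed
    then show "v \<in> leaves r" unfolding leaves_def using p Fr by blast
  qed
  define \<sigma> where "\<sigma> = (\<lambda>v\<in>leaves r. fst (THE p. p \<in> \<Delta> \<and> v = nm p (snd p)))"
  have inj: "p = q" if "p \<in> \<Delta>" "q \<in> \<Delta>" "nm p (snd p) = nm q (snd q)" for p q
    using same[OF that(1,2)] nm_eq[OF that(1,2) order_refl order_refl] that(3) by auto
  have \<sigma>: "\<sigma> (nm p (snd p)) = fst p" if p: "p \<in> \<Delta>" for p
  proof -
    have "(THE q. q \<in> \<Delta> \<and> nm p (snd p) = nm q (snd q)) = p"
      by (rule the_equality) (use p inj in auto)
    then show ?thesis using lv p by (auto simp: \<sigma>_def)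
  qed
  have ancnm: "R.anc (nm p (snd p)) l = nm p l" if "p \<in> \<Delta>" "l \<le> snd p" for p l
    by (rule R.anc_eqI[OF rI[OF that order_refl] lev[OF that]])
  have pw: "x [^] n \<in> carrier A" for n :: nat by simp
  have "labelled_tree A x (r, \<sigma>)"
    unfolding labelled_tree_def split Let_def
  proof (intro conjI ballI impI tree)
    show "\<sigma> \<in> leaves r \<rightarrow>\<^sub>E carrier A"
    proof (rule PiE_I)
      fix v assume "v \<in> leaves r"
      then show "\<sigma> v \<in> carrier A" using \<sigma> closed lv by auto
    qed (simp add: \<sigma>_def)
    fix e e' assume e: "e \<in> leaves r" "e' \<in> leaves r" "e \<noteq> e'"
    obtain p q where p: "p \<in> \<Delta>" "e = nm p (snd p)" and q: "q \<in> \<Delta>" "e' = nm q (snd q)" using e lv by blast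
    let ?d = "level r (first_common_ancestor r e e')"
    note f = R.first_common_ancestor[OF e]
    have le: "level r e = snd p" "level r e' = snd q" using lev p q by simp_all
    \<comment> \<open>Both sides say that the branches of the two leaves agree at level
      \<open>l\<close>; taken at \<open>?d\<close> and one above, this is the condition on
      labels.\<close>
    have iff: "E l p q \<longleftrightarrow> l \<le> ?d" if "l \<le> snd p" "l \<le> snd q" for l
      using f(3)[of l] that nm_eq[OF p(1) q(1) that] ancnm[OF p(1) that(1)] ancnm[OF q(1) that(2)] le
      by (simp add: p(2)[symmetric] q(2)[symmetric])
    have "E ?d p q" using iff[of ?d] f(1,2) le by simp
    moreover have "\<not> E (?d + 1) p q" using iff[of "?d + 1"] f(1,2) le by simp
    ultimately show "\<sigma> e' \<ominus> \<sigma> e \<in> PIdl (x [^] ?d) - PIdl (x [^] (?d + 1))"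
      unfolding Diff_iff PIdl_iff[OF pw] E_def p(2)[symmetric] q(2)[symmetric]
      using \<sigma>[OF p(1)] \<sigma>[OF q(1)] p(2) q(2) by simp
  qed
  moreover have "tree_discs (r, \<sigma>) = \<Delta>"
  proof -
    have "leaves r = (\<lambda>p. nm p (snd p)) ` \<Delta>" using lv by blast
    then have "tree_discs (r, \<sigma>) = (\<lambda>p. (fst p, snd p)) ` \<Delta>"
      unfolding tree_discs_def fst_conv snd_conv by (simp add: image_image \<sigma> lev cong: image_cong)
    then show ?thesis by simp
  qed
  ultimately show ?thesis by metis
qed

end

text \<open>In a discrete valuation ring \<open>x\<close> is nonzero because the zero ideal is
  maximal only in a field. In a polynomial ring, an ideal strictly above that of the variable
  contains a polynomial with nonzero constant term, hence this term, which is a unit.\<close>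

lemma base_pair_base_ring:
  fixes k :: "'k ring" and A :: "'a ring" and x :: 'a
  assumes k: "field k" and b: "base_pair k A x"
  shows "base_ring A x"
  using b unfolding base_pair_def
proof (elim disjE conjE)
  assume dvr: "discrete_valuation_ring A" and u: "uniformizer A x"
  have dom: "domain A" and nf: "\<not> field A"
    using dvr by (simp_all add: discrete_valuation_ring_def principal_domain_def)
  have x: "x \<in> carrier A" "maximalideal (PIdl\<^bsub>A\<^esub> x) A" using u by (simp_all add: uniformizer_def)
  interpret A: "domain" A by (rule dom)
  have "x \<noteq> \<zero>\<^bsub>A\<^esub>"
  proof
    assume "x = \<zero>\<^bsub>A\<^esub>"
    then have "PIdl\<^bsub>A\<^esub> x = {\<zero>\<^bsub>A\<^esub>}" by (auto simp: cgenideal_def intro: exI[of _ "\<zero>\<^bsub>A\<^esub>"])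
    then show False using x(2) nf A.zeromaximalideal_fieldI by simp
  qed
  then show ?thesis by (intro base_ring.intro base_ring_axioms.intro dom x)
next
  assume A: "cring A" and "\<exists>\<phi>\<in>ring_iso (UP k) A. \<phi> (monom (UP k) \<one>\<^bsub>k\<^esub> 1) = x"
  then obtain \<phi> where \<phi>: "\<phi> \<in> ring_iso (UP k) A" "\<phi> (pvar k) = x" by (auto simp: pvar_def)
  interpret k: field k by (rule k)
  interpret A: cring A by (rule A)
  interpret P: "domain" "UP k" by (rule k.domain_UP)
  have hom: "\<phi> \<in> ring_hom (UP k) A" and bij: "bij_betw \<phi> (carrier (UP k)) (carrier A)"
    using \<phi>(1) by (simp_all add: ring_iso_def)
  have \<phi>0: "\<phi> \<zero>\<^bsub>UP k\<^esub> = \<zero>\<^bsub>A\<^esub>" by (rule P.ring_hom_zero'[OF A hom])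
  have dom: "domain A" using P.ring_iso_imp_img_domain[OF \<phi>(1)] \<phi>0 by simp
  have x: "x \<in> carrier A" using ring_hom_closed[OF hom k.pvar_closed] \<phi>(2) by simp
  have ninv: "pvar k \<otimes>\<^bsub>UP k\<^esub> f \<noteq> \<one>\<^bsub>UP k\<^esub>" if f: "f \<in> carrier (UP k)" for f
  proof
    assume "pvar k \<otimes>\<^bsub>UP k\<^esub> f = \<one>\<^bsub>UP k\<^esub>"
    then have "pvar k \<otimes>\<^bsub>UP k\<^esub> f \<oplus>\<^bsub>UP k\<^esub> const_poly k \<zero>\<^bsub>k\<^esub> = pvar k \<otimes>\<^bsub>UP k\<^esub> \<zero>\<^bsub>UP k\<^esub> \<oplus>\<^bsub>UP k\<^esub> const_poly k \<one>\<^bsub>k\<^esub>"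
      using f ring_hom_one[OF k.const_poly_hom] by (simp add: k.const_poly_zero)
    then show False using k.horner_inject(2)[OF f k.zero_closed P.zero_closed k.one_closed] by simp
  qed
  have nz: "x \<noteq> \<zero>\<^bsub>A\<^esub>"
  proof
    assume "x = \<zero>\<^bsub>A\<^esub>"
    then have "\<phi> (pvar k) = \<phi> \<zero>\<^bsub>UP k\<^esub>" using \<phi>(2) \<phi>0 by simp
    then have "pvar k = \<zero>\<^bsub>UP k\<^esub>" by (rule inj_onD[OF bij_betw_imp_inj_on[OF bij]]) simp_all
    then have "pvar k \<otimes>\<^bsub>UP k\<^esub> \<one>\<^bsub>UP k\<^esub> \<oplus>\<^bsub>UP k\<^esub> const_poly k \<zero>\<^bsub>k\<^esub> = \<zero>\<^bsub>UP k\<^esub>" by (simp add: k.const_poly_zero)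
    then show False using k.horner_eq_zero(1)[OF P.one_closed k.zero_closed] by simp
  qed
  have "maximalideal (PIdl\<^bsub>A\<^esub> x) A"
  proof (rule maximalidealI[OF A.cgenideal_ideal[OF x]])
    show "carrier A \<noteq> PIdl\<^bsub>A\<^esub> x"
    proof
      assume "carrier A = PIdl\<^bsub>A\<^esub> x"
      then have "\<one>\<^bsub>A\<^esub> \<in> PIdl\<^bsub>A\<^esub> x" using A.one_closed by simp
      then obtain z where z: "z \<in> carrier A" "\<one>\<^bsub>A\<^esub> = z \<otimes>\<^bsub>A\<^esub> x" by (auto simp: cgenideal_def)
      then obtain f where f: "f \<in> carrier (UP k)" "z = \<phi> f" using bij_betw_imp_surj_on[OF bij] by blast
      have "\<phi> (pvar k \<otimes>\<^bsub>UP k\<^esub> f) = \<phi> \<one>\<^bsub>UP k\<^esub>"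
        using f z x by (simp add: ring_hom_mult[OF hom] ring_hom_one[OF hom] \<phi>(2) A.m_comm)
      then have "pvar k \<otimes>\<^bsub>UP k\<^esub> f = \<one>\<^bsub>UP k\<^esub>"
        by (rule inj_onD[OF bij_betw_imp_inj_on[OF bij]]) (use f in simp_all)
      then show False using ninv f by simp
    qed
    fix J assume J: "ideal J A" and sub: "PIdl\<^bsub>A\<^esub> x \<subseteq> J" and "J \<subseteq> carrier A"
    interpret J: ideal J A by (rule J)
    show "J = PIdl\<^bsub>A\<^esub> x \<or> J = carrier A"
    proof (cases "J \<subseteq> PIdl\<^bsub>A\<^esub> x")
      case True
      then show ?thesis using sub by blast
    next
      case False
      then obtain a where a: "a \<in> J" "a \<notin> PIdl\<^bsub>A\<^esub> x" by blast
      obtain f where f: "f \<in> carrier (UP k)" "a = \<phi> f"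
        using bij_betw_imp_surj_on[OF bij] J.Icarr[OF a(1)] by blast
      obtain n where "bound \<zero>\<^bsub>k\<^esub> n (coeff (UP k) f)" using k.coeff_bound_ex[OF f(1)] by blast
      from k.horner_decomp[OF f(1) this] obtain g where
        g: "g \<in> carrier (UP k)" "f = pvar k \<otimes>\<^bsub>UP k\<^esub> g \<oplus>\<^bsub>UP k\<^esub> const_poly k (coeff (UP k) f 0)" by blast
      define c where "c = coeff (UP k) f 0"
      interpret UP: UP_ring k "UP k" by unfold_locales
      have c: "c \<in> carrier k" unfolding c_def using f(1) by simp
      have \<phi>g: "\<phi> g \<in> carrier A" and \<phi>c: "\<phi> (const_poly k c) \<in> carrier A"
        using ring_hom_closed[OF hom] g(1) c by simp_all
      have aeq: "a = x \<otimes>\<^bsub>A\<^esub> \<phi> g \<oplus>\<^bsub>A\<^esub> \<phi> (const_poly k c)"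
        unfolding f(2) using g c by (simp add: c_def[symmetric] ring_hom_add[OF hom] ring_hom_mult[OF hom] \<phi>(2))
      have xg: "x \<otimes>\<^bsub>A\<^esub> \<phi> g \<in> PIdl\<^bsub>A\<^esub> x"
        unfolding A.m_comm[OF x \<phi>g] using \<phi>g by (auto simp: cgenideal_def)
      have "c \<noteq> \<zero>\<^bsub>k\<^esub>"
      proof
        assume "c = \<zero>\<^bsub>k\<^esub>"
        then have "a = x \<otimes>\<^bsub>A\<^esub> \<phi> g" using aeq \<phi>g x by (simp add: k.const_poly_zero \<phi>0)
        then show False using a(2) xg by simp
      qed
      then have cu: "c \<in> Units k" using c k.field_Units by simp
      have "\<phi> (const_poly k c) = a \<ominus>\<^bsub>A\<^esub> x \<otimes>\<^bsub>A\<^esub> \<phi> g" unfolding aeq using \<phi>g \<phi>c x by algebra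
      then have "\<phi> (const_poly k c) \<in> J" using a(1) sub xg by (simp add: J.a_subgroup A.minus_eq J.a_inv_closed subsetD)
      then have "\<phi> (const_poly k (inv\<^bsub>k\<^esub> c)) \<otimes>\<^bsub>A\<^esub> \<phi> (const_poly k c) \<in> J"
        by (rule J.I_l_closed) (use ring_hom_closed[OF hom] k.Units_inv_closed[OF cu] in simp)
      moreover have "\<phi> (const_poly k (inv\<^bsub>k\<^esub> c)) \<otimes>\<^bsub>A\<^esub> \<phi> (const_poly k c) = \<one>\<^bsub>A\<^esub>"
        using c k.Units_inv_closed[OF cu] ring_hom_mult[OF k.const_poly_hom, of "inv\<^bsub>k\<^esub> c" c, symmetric]
        by (simp add: ring_hom_mult[OF hom, symmetric] k.Units_l_inv[OF cu] ring_hom_one[OF k.const_poly_hom] ring_hom_one[OF hom])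
      ultimately show ?thesis using J.one_imp_carrier by simp
    qed
  qed
  then show ?thesis by (intro base_ring.intro base_ring_axioms.intro dom x nz)
qed

text \<open>The cardinality assumptions secure room in the fixed types: \<open>'b\<close> has to
  hold a coordinate ring for every disc family, \<open>'v\<close> the nodes of trees of any finite
  size.\<close>

theorem theorem3p2:
  fixes k :: "'k ring" and A :: "'a ring" and x :: 'a
  assumes "field k" and "char_zero k"
    and "base_pair k A x"
    and "carrier A \<lesssim> (UNIV :: 'b set)"
    and "infinite (UNIV :: 'v set)"
  shows "equivalent_categories
           (rel_dfs_cat A x :: (('a, 'b) rel_surface, 'b \<Rightarrow> 'b) cat)
           (labelled_tree_cat A x :: ('v rel \<times> ('v \<Rightarrow> 'a), 'v \<Rightarrow> 'v) cat)"
proof -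
  interpret base_ring A x by (rule base_pair_base_ring[OF assms(1,3)])
  let ?C = "rel_dfs_cat A x :: (('a, 'b) rel_surface, 'b \<Rightarrow> 'b) cat"
  let ?D = "labelled_tree_cat A x :: ('v rel \<times> ('v \<Rightarrow> 'a), 'v \<Rightarrow> 'v) cat"
  have C: "S \<in> Obj ?C \<longleftrightarrow> rel_dfs A x S" for S by (simp add: rel_dfs_cat_def)
  have D: "\<gamma> \<in> Obj ?D \<longleftrightarrow> labelled_tree A x \<gamma>" for \<gamma> by (simp add: labelled_tree_cat_def)
  \<comment> \<open>Centres matter only modulo powers of \<open>x\<close>, so a family has to be
    chosen for each surface; any two families of one surface refine each other.\<close>
  define discs where "discs S = (SOME \<Delta>. disc_family \<Delta> \<and> over_line.describes A x (coord_ring S) (comorphism S) \<Delta>)"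
    for S :: "('a, 'b) rel_surface"
  have discs: "disc_family (discs S)" "over_line.describes A x (coord_ring S) (comorphism S) (discs S)"
    if "rel_dfs A x S" for S
    using someI_ex[OF rel_dfs_discs[OF that]] unfolding discs_def by auto
  define F where "F S = (SOME \<gamma> :: 'v rel \<times> ('v \<Rightarrow> 'a). labelled_tree A x \<gamma> \<and> tree_discs \<gamma> = discs S)" for S
  have F: "labelled_tree A x (F S)" "tree_discs (F S) = discs S" if "rel_dfs A x S" for S
    using someI_ex[OF tree_of_discs[OF discs(1)[OF that] assms(5)]] unfolding F_def by auto
  show ?thesis
  proof (rule thin_equivalence[OF category_rel_dfs category_labelled_tree, of F])
    fix S S' :: "('a, 'b) rel_surface" and f g
    assume "S \<in> Obj ?C" "S' \<in> Obj ?C" "f \<in> Hom ?C S S'" "g \<in> Hom ?C S S'"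
    then show "f = g" unfolding C by (intro dfs_hom_unique[of S' S])
  next
    fix \<gamma> \<gamma>' :: "'v rel \<times> ('v \<Rightarrow> 'a)" and f g
    assume "\<gamma> \<in> Obj ?D" "\<gamma>' \<in> Obj ?D" "f \<in> Hom ?D \<gamma> \<gamma>'" "g \<in> Hom ?D \<gamma> \<gamma>'"
    then show "f = g" unfolding D by (intro tree_hom_unique[of \<gamma>' \<gamma>])
  next
    fix S assume "S \<in> Obj ?C"
    then show "F S \<in> Obj ?D" unfolding C D by (rule F(1))
  next
    fix S S' assume "S \<in> Obj ?C" "S' \<in> Obj ?C"
    then have S: "rel_dfs A x S" "rel_dfs A x S'" unfolding C .
    show "Hom ?C S S' \<noteq> {} \<longleftrightarrow> Hom ?D (F S) (F S') \<noteq> {}"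
      unfolding tree_hom_ex_iff[OF F(1)[OF S(2)] F(1)[OF S(1)]] F(2)[OF S(1)] F(2)[OF S(2)]
      by (rule dfs_hom_ex_iff[OF S(2,1) discs[OF S(2)] discs[OF S(1)]])
  next
    fix \<gamma> assume "\<gamma> \<in> Obj ?D"
    then have \<gamma>: "labelled_tree A x \<gamma>" unfolding D .
    note \<Delta> = tree_discs_family[OF \<gamma>]
    obtain B :: "'b ring" and \<psi> where B: "over_line A x B \<psi>" "over_line.describes A x B \<psi> (tree_discs \<gamma>)"
      using model_ex[OF \<Delta> assms(4)] by metis
    let ?S = "\<lparr>coord_ring = B, str_map = \<psi> \<circ> \<iota>, comorphism = \<psi>\<rparr>"
    have S: "rel_dfs A x ?S" by (rule rel_dfs_if_describes[OF B(1) \<Delta> B(2)])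
    have dS: "over_line.describes A x (coord_ring ?S) (comorphism ?S) (tree_discs \<gamma>)" using B(2) by simp
    interpret cat: category ?C by (rule category_rel_dfs)
    have ne: "Hom ?C ?S ?S \<noteq> {}" using cat.Idn_closed[of ?S] S C by blast
    \<comment> \<open>The family chosen for \<open>?S\<close> need not be that of
      \<open>\<gamma>\<close>, but both describe \<open>?S\<close>, so the identity of
      \<open>?S\<close> gives refinement in both directions.\<close>
    have "refines (discs ?S) (tree_discs \<gamma>)" "refines (tree_discs \<gamma>) (discs ?S)"
      using dfs_hom_ex_iff[OF S S \<Delta> dS discs[OF S]] dfs_hom_ex_iff[OF S S discs[OF S] \<Delta> dS] ne by blast+
    then have "Hom ?D (F ?S) \<gamma> \<noteq> {}" "Hom ?D \<gamma> (F ?S) \<noteq> {}"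
      unfolding tree_hom_ex_iff[OF \<gamma> F(1)[OF S]] tree_hom_ex_iff[OF F(1)[OF S] \<gamma>] F(2)[OF S] by blast+
    then show "\<exists>S\<in>Obj ?C. Hom ?D (F S) \<gamma> \<noteq> {} \<and> Hom ?D \<gamma> (F S) \<noteq> {}" using S C by blast
  qed
qed

end
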